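(* Let $(R,\mathfrak m,k)$ be an $F$-finite regular local ring of characteristic $p>0$, with $v$, $u$, $v^\perp$ and $\Delta_1$ as in the context. Let $f_1,\dots,f_m$ be a regular sequence in $\mathfrak m$, $I:=(f_1,\dots,f_m)$ and $f:=f_1\cdots f_m$. Define an $R$-module homomorphism $$\theta\colon v^\perp\to R,\qquad F_*a\mapsto u(F_*(\Delta_1(f^{p-1})a)),$$ and a sequence of ideals $\{I_s\}_{s>0}$ by $I_1:=(I^{[p]}:I)$ and $I_{s+1}:=\theta(F_*I_s\cap v^\perp)+I_1$. Then $$\operatorname{ht}(R/I)=\inf\{n\mid I_n\nsubseteq\mathfrak m^{[p]}\}.$$
   Context: Quasi-$F$-split height: for an $\mathbb F_p$-scheme $X$ and $n\ge1$, let $W_n\mathcal O_X$ be the sheaf of ($p$-typical) Witt vectors of length $n$, $F\colon W_n\mathcal O_X\to F_*W_n\mathcal O_X$ the Frobenius and $R^{n-1}\colon W_n\mathcal O_X\to\mathcal O_X$ the restriction. $X$ is $n$-quasi-$F$-split if there is a $W_n\mathcal O_X$-module homomorphism $\phi\colon F_*W_n\mathcal O_X\to\mathcal O_X$ with $\phi\circ F=R^{n-1}$. $\operatorname{ht}(X)$ is the infimum of such $n$ ($\inf\emptyset=\infty$); for a ring $B$, $\operatorname{ht}(B):=\operatorname{ht}(\operatorname{Spec}B)$. Notation: $F_*R$ is $R$ with $R$-action $a\cdot F_*b=F_*(a^pb)$; $I^{[p]}$ is the ideal generated by $p$-th powers of elements of $I$. Fix $x_1,\dots,x_N\in R$ such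 that $\{F_*(x_1^{i_1}\cdots x_N^{i_N})\mid0\le i_j\le p-1\}$ is a basis of $F_*R$ over $R$ (such elements exist); write $v_1,\dots,v_d$ for the elements $x_1^{i_1}\cdots x_N^{i_N}$ ($0\le i_j\le p-1$), with $v=v_d=(x_1\cdots x_N)^{p-1}$. Let $u\in\operatorname{Hom}_R(F_*R,R)$ be the dual basis element of $F_*v$, and $v^\perp:=\ker(u)\subset F_*R$. A $p$-monomial is an element of the form $b^pv_i$. For $a\in R$ choose a decomposition $a=a_1+\cdots+a_r$ into $p$-monomials; $\Delta_1(a)\in R/F(R)$, where $F(R)=\{b^p\mid b\in R\}$, is the class (independent of choices) of $$\sum_{\substack{0\le\alpha_1,\dots,\alpha_r\le p-1\\ \alpha_1+\cdots+\alpha_r=p}}\frac1p\binom{p}{\alpha_1,\dots,\alpha_r}a_1^{\alpha_1}\cdots a_r^{\alpha_r}.$$ For $F_*a\in v^\perp$ the element $u(F_*(\Delta_1(f^{p-1})a))$ is computed with any representative of $\Delta_1(f^{p-1})$ in $R$; it does not depend on the representative. *)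

theory Defs
  imports
    "HOL-Algebra.QuotRing"
    "HOL-Algebra.Ring_Divisibility"
    "HOL-Analysis.Abstract_Topology"
    "HOL-Computational_Algebra.Primes"
    "HOL-Library.Poly_Mapping"
    "HOL-Library.Extended_Nat"
begin

section \<open>Modules and commutative algebra\<close>

text \<open>
  \<open>restrict_scalars h B\<close> is \<open>B\<close> as a module over the source of the ring map \<open>h\<close>. For \<open>h\<close> the
  Frobenius of \<open>B\<close> it is the module \<open>F\<^sub>*B\<close>; the element \<open>F\<^sub>*b\<close> is represented by \<open>b\<close> itself.
\<close>

definition restrict_scalars :: "('a \<Rightarrow> 'b) \<Rightarrow> ('b, 'c) ring_scheme \<Rightarrow> ('a, 'b) module" where
  "restrict_scalars h B =
     \<lparr>carrier = carrier B, monoid.mult = monoid.mult B, one = one B, ring.zero = ring.zero B, ring.add = ring.add B,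
      smult = (\<lambda>a b. h a \<otimes>\<^bsub>B\<^esub> b)\<rparr>"

definition frob_pushforward :: "nat \<Rightarrow> ('a, 'c) ring_scheme \<Rightarrow> ('a, 'a) module" where
  "frob_pushforward p R = restrict_scalars (\<lambda>a. a [^]\<^bsub>R\<^esub> p) R"

definition module_homs ::
  "('a, 'c) ring_scheme \<Rightarrow> ('a, 'b, 'd) module_scheme \<Rightarrow> ('a, 'e, 'f) module_scheme \<Rightarrow> ('b \<Rightarrow> 'e) set"
where
  "module_homs A M N =
     {\<phi> \<in> carrier M \<rightarrow> carrier N.
        (\<forall>x\<in>carrier M. \<forall>y\<in>carrier M. \<phi> (x \<oplus>\<^bsub>M\<^esub> y) = \<phi> x \<oplus>\<^bsub>N\<^esub> \<phi> y) \<and>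
        (\<forall>a\<in>carrier A. \<forall>x\<in>carrier M. \<phi> (a \<odot>\<^bsub>M\<^esub> x) = a \<odot>\<^bsub>N\<^esub> \<phi> x)}"

definition finitely_generated_module ::
  "('a, 'c) ring_scheme \<Rightarrow> ('a, 'b, 'd) module_scheme \<Rightarrow> bool" where
  "finitely_generated_module A M \<longleftrightarrow>
     (\<exists>S. finite S \<and> S \<subseteq> carrier M \<and>
        (\<forall>y\<in>carrier M. \<exists>c\<in>S \<rightarrow> carrier A. y = (\<Oplus>\<^bsub>M\<^esub>s\<in>S. c s \<odot>\<^bsub>M\<^esub> s)))"

text \<open>A basis indexed by the finite set \<open>J\<close>, and the coordinate functions (the dual basis).\<close>

definition module_basis ::
  "('a, 'c) ring_scheme \<Rightarrow> ('a, 'b, 'd) module_scheme \<Rightarrow> 'j set \<Rightarrow> ('j \<Rightarrow> 'b) \<Rightarrow> bool" where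
  "module_basis A M J v \<longleftrightarrow>
     finite J \<and> v \<in> J \<rightarrow> carrier M \<and>
     (\<forall>y\<in>carrier M. \<exists>!c. c \<in> J \<rightarrow>\<^sub>E carrier A \<and> y = (\<Oplus>\<^bsub>M\<^esub>j\<in>J. c j \<odot>\<^bsub>M\<^esub> v j))"

definition dual_basis ::
  "('a, 'c) ring_scheme \<Rightarrow> ('a, 'b, 'd) module_scheme \<Rightarrow> 'j set \<Rightarrow> ('j \<Rightarrow> 'b) \<Rightarrow> 'j \<Rightarrow> 'b \<Rightarrow> 'a" where
  "dual_basis A M J v j y =
     (THE c. c \<in> J \<rightarrow>\<^sub>E carrier A \<and> y = (\<Oplus>\<^bsub>M\<^esub>i\<in>J. c i \<odot>\<^bsub>M\<^esub> v i)) j"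

definition krull_dim :: "('a, 'c) ring_scheme \<Rightarrow> enat" where
  "krull_dim R =
     Sup {enat n | n. \<exists>P :: nat \<Rightarrow> 'a set.
            (\<forall>i\<le>n. primeideal (P i) R) \<and> (\<forall>i<n. P i \<subset> P (Suc i))}"

definition local_ring :: "('a, 'c) ring_scheme \<Rightarrow> 'a set \<Rightarrow> bool" where
  "local_ring R \<mm> \<longleftrightarrow> cring R \<and> maximalideal \<mm> R \<and> (\<forall>J. maximalideal J R \<longrightarrow> J = \<mm>)"

definition regular_local_ring :: "('a, 'c) ring_scheme \<Rightarrow> 'a set \<Rightarrow> bool" where
  "regular_local_ring R \<mm> \<longleftrightarrow>
     local_ring R \<mm> \<and> noetherian_ring R \<and>
     (\<exists>S. finite S \<and> S \<subseteq> carrier R \<and> Idl\<^bsub>R\<^esub> S = \<mm> \<and> enat (card S) = krull_dim R)"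

definition F_finite :: "nat \<Rightarrow> ('a, 'c) ring_scheme \<Rightarrow> bool" where
  "F_finite p R \<longleftrightarrow> finitely_generated_module R (frob_pushforward p R)"

definition regular_sequence :: "('a, 'c) ring_scheme \<Rightarrow> nat \<Rightarrow> (nat \<Rightarrow> 'a) \<Rightarrow> bool" where
  "regular_sequence R m f \<longleftrightarrow>
     (\<forall>i<m. f i \<in> carrier R \<and>
        (\<forall>a\<in>carrier R. f i \<otimes>\<^bsub>R\<^esub> a \<in> Idl\<^bsub>R\<^esub> (f ` {..<i}) \<longrightarrow> a \<in> Idl\<^bsub>R\<^esub> (f ` {..<i}))) \<and>
     Idl\<^bsub>R\<^esub> (f ` {..<m}) \<noteq> carrier R"

definition ideal_colon :: "('a, 'c) ring_scheme \<Rightarrow> 'a set \<Rightarrow> 'a set \<Rightarrow> 'a set" where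
  "ideal_colon R J I = {a \<in> carrier R. \<forall>b\<in>I. a \<otimes>\<^bsub>R\<^esub> b \<in> J}"

definition frob_power :: "nat \<Rightarrow> ('a, 'c) ring_scheme \<Rightarrow> 'a set \<Rightarrow> 'a set" where
  "frob_power p R I = Idl\<^bsub>R\<^esub> ((\<lambda>a. a [^]\<^bsub>R\<^esub> p) ` I)"


section \<open>Witt vectors\<close>

text \<open>
  Integer polynomials in two sequences of variables, \<open>X\<^sub>i = X (Inl i)\<close> and \<open>Y\<^sub>i = X (Inr i)\<close>.
\<close>

type_synonym witt_poly = "(nat + nat \<Rightarrow>\<^sub>0 nat) \<Rightarrow>\<^sub>0 int"

definition witt_var :: "nat + nat \<Rightarrow> witt_poly" where
  "witt_var v = Poly_Mapping.single (Poly_Mapping.single v 1) 1"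

definition eval_poly :: "('a, 'c) ring_scheme \<Rightarrow> witt_poly \<Rightarrow> (nat + nat \<Rightarrow> 'a) \<Rightarrow> 'a" where
  "eval_poly A P r =
     (\<Oplus>\<^bsub>A\<^esub>e\<in>Poly_Mapping.keys P. add_pow A (Poly_Mapping.lookup P e) (\<Otimes>\<^bsub>A\<^esub>v\<in>Poly_Mapping.keys e. r v [^]\<^bsub>A\<^esub> Poly_Mapping.lookup e v))"

definition ghost :: "nat \<Rightarrow> (nat \<Rightarrow> 'b::comm_ring_1) \<Rightarrow> nat \<Rightarrow> 'b" where
  "ghost p a n = (\<Sum>i\<le>n. of_nat p ^ i * a i ^ (p ^ (n - i)))"

text \<open>
  For prime \<open>p\<close> there are unique sequences of integer polynomials with these ghost components.
\<close>

definition witt_add_poly :: "nat \<Rightarrow> nat \<Rightarrow> witt_poly" where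
  "witt_add_poly p =
     (THE S. \<forall>n. ghost p S n = ghost p (witt_var \<circ> Inl) n + ghost p (witt_var \<circ> Inr) n)"

definition witt_mult_poly :: "nat \<Rightarrow> nat \<Rightarrow> witt_poly" where
  "witt_mult_poly p =
     (THE S. \<forall>n. ghost p S n = ghost p (witt_var \<circ> Inl) n * ghost p (witt_var \<circ> Inr) n)"

text \<open>
  \<open>W\<^sub>n(A)\<close>. The \<open>i\<close>-th operation polynomial only involves variables of index at most \<open>i\<close>, so the
  values of a vector outside \<open>{..<n}\<close> are irrelevant.
\<close>

definition witt_ring :: "nat \<Rightarrow> nat \<Rightarrow> ('a, 'c) ring_scheme \<Rightarrow> (nat \<Rightarrow> 'a) ring" where
  "witt_ring p n A =
     \<lparr>carrier = {..<n} \<rightarrow>\<^sub>E carrier A,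
      monoid.mult = (\<lambda>a b. \<lambda>i\<in>{..<n}. eval_poly A (witt_mult_poly p i) (case_sum a b)),
      one = (\<lambda>i\<in>{..<n}. if i = 0 then \<one>\<^bsub>A\<^esub> else \<zero>\<^bsub>A\<^esub>),
      ring.zero = (\<lambda>i\<in>{..<n}. \<zero>\<^bsub>A\<^esub>),
      ring.add = (\<lambda>a b. \<lambda>i\<in>{..<n}. eval_poly A (witt_add_poly p i) (case_sum a b))\<rparr>"

text \<open>The Witt vector Frobenius, for \<open>A\<close> of characteristic \<open>p\<close> only, where it is \<open>W\<^sub>n\<close> of Frobenius.\<close>

definition witt_frob :: "nat \<Rightarrow> nat \<Rightarrow> ('a, 'c) ring_scheme \<Rightarrow> (nat \<Rightarrow> 'a) \<Rightarrow> nat \<Rightarrow> 'a" where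
  "witt_frob p n A w = (\<lambda>i\<in>{..<n}. w i [^]\<^bsub>A\<^esub> p)"

text \<open>\<open>R\<^sup>n\<^sup>-\<^sup>1\<close> from \<open>W\<^sub>n(A)\<close> to \<open>A\<close>, for \<open>n \<ge> 1\<close>.\<close>

definition witt_res :: "(nat \<Rightarrow> 'a) \<Rightarrow> 'a" where
  "witt_res w = w 0"


section \<open>Ringed spaces and affine schemes\<close>

record ('x, 'b) ringed_space =
  top_of :: "'x topology"
  sections :: "'x set \<Rightarrow> 'b ring"
  restr :: "'x set \<Rightarrow> 'x set \<Rightarrow> 'b \<Rightarrow> 'b"

text \<open>
  \<open>fraction B S a s\<close> is \<open>a/s\<close> in \<open>S\<^sup>-\<^sup>1B\<close>, as a class of pairs.
\<close>

definition fraction_rel :: "('b, 'c) ring_scheme \<Rightarrow> 'b set \<Rightarrow> (('b \<times> 'b) \<times> ('b \<times> 'b)) set" where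
  "fraction_rel B S =
     {((a, s), (b, t)). a \<in> carrier B \<and> s \<in> S \<and> b \<in> carrier B \<and> t \<in> S \<and>
        (\<exists>w\<in>S. w \<otimes>\<^bsub>B\<^esub> (a \<otimes>\<^bsub>B\<^esub> t) = w \<otimes>\<^bsub>B\<^esub> (b \<otimes>\<^bsub>B\<^esub> s))}"

definition fraction :: "('b, 'c) ring_scheme \<Rightarrow> 'b set \<Rightarrow> 'b \<Rightarrow> 'b \<Rightarrow> ('b \<times> 'b) set" where
  "fraction B S a s = fraction_rel B S `` {(a, s)}"

definition localization :: "('b, 'c) ring_scheme \<Rightarrow> 'b set \<Rightarrow> ('b \<times> 'b) set ring" where
  "localization B S =
     \<lparr>carrier = (carrier B \<times> S) // fraction_rel B S,
      monoid.mult = (\<lambda>X Y. \<Union>(a, s)\<in>X. \<Union>(b, t)\<in>Y. fraction B S (a \<otimes>\<^bsub>B\<^esub> b) (s \<otimes>\<^bsub>B\<^esub> t)),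
      one = fraction B S \<one>\<^bsub>B\<^esub> \<one>\<^bsub>B\<^esub>,
      ring.zero = fraction B S \<zero>\<^bsub>B\<^esub> \<one>\<^bsub>B\<^esub>,
      ring.add = (\<lambda>X Y. \<Union>(a, s)\<in>X. \<Union>(b, t)\<in>Y.
               fraction B S (a \<otimes>\<^bsub>B\<^esub> t \<oplus>\<^bsub>B\<^esub> b \<otimes>\<^bsub>B\<^esub> s) (s \<otimes>\<^bsub>B\<^esub> t))\<rparr>"

abbreviation localization_at :: "('b, 'c) ring_scheme \<Rightarrow> 'b set \<Rightarrow> ('b \<times> 'b) set ring" where
  "localization_at B P \<equiv> localization B (carrier B - P)"

definition zariski_open :: "('b, 'c) ring_scheme \<Rightarrow> 'b set set \<Rightarrow> bool" where
  "zariski_open B U \<longleftrightarrow> (\<exists>E\<subseteq>carrier B. U = {P. primeideal P B \<and> \<not> E \<subseteq> P})"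

definition zariski :: "('b, 'c) ring_scheme \<Rightarrow> 'b set topology" where
  "zariski B = topology (zariski_open B)"

lemma istopology_zariski_open: "istopology (zariski_open B)"
  unfolding istopology_def
proof (intro conjI allI impI)
  fix U V assume "zariski_open B U" "zariski_open B V"
  then obtain E F where E: "E \<subseteq> carrier B" "U = {P. primeideal P B \<and> \<not> E \<subseteq> P}"
    and F: "F \<subseteq> carrier B" "V = {P. primeideal P B \<and> \<not> F \<subseteq> P}"
    unfolding zariski_open_def by blast
  define G where "G = {e \<otimes>\<^bsub>B\<^esub> f | e f. e \<in> E \<and> f \<in> F} \<inter> carrier B"
  have "G \<subseteq> P \<longleftrightarrow> E \<subseteq> P \<or> F \<subseteq> P" if P: "primeideal P B" for P
  proof -
    interpret primeideal P B by (rule P)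
    have "e \<in> P \<or> f \<in> P" if "G \<subseteq> P" "e \<in> E" "f \<in> F" for e f
      using that I_prime[of e f] E(1) F(1) unfolding G_def by blast
    moreover have "e \<otimes>\<^bsub>B\<^esub> f \<in> P" if "e \<in> E" "f \<in> F" "E \<subseteq> P \<or> F \<subseteq> P" for e f
      using that E(1) F(1) I_l_closed I_r_closed by blast
    ultimately show ?thesis unfolding G_def by blast
  qed
  then have "U \<inter> V = {P. primeideal P B \<and> \<not> G \<subseteq> P}"
    unfolding E F by auto
  moreover have "G \<subseteq> carrier B" by (auto simp: G_def)
  ultimately show "zariski_open B (U \<inter> V)" unfolding zariski_open_def by blast
next
  fix K assume "\<forall>U\<in>K. zariski_open B U"
  then obtain E where E: "\<And>U. U \<in> K \<Longrightarrow> E U \<subseteq> carrier B \<and> U = {P. primeideal P B \<and> \<not> E U \<subseteq> P}"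
    unfolding zariski_open_def by metis
  have "\<Union>K = {P. primeideal P B \<and> \<not> (\<Union>U\<in>K. E U) \<subseteq> P}"
    using E by blast
  moreover have "(\<Union>U\<in>K. E U) \<subseteq> carrier B" using E by blast
  ultimately show "zariski_open B (\<Union>K)" unfolding zariski_open_def by blast
qed

lemma openin_zariski: "openin (zariski B) U \<longleftrightarrow> zariski_open B U"
  by (simp add: zariski_def topology_inverse' istopology_zariski_open)

text \<open>
  Sections over \<open>U\<close> are the families of germs in the stalks \<open>B\<^sub>P\<close> that are locally given by a
  single fraction.
\<close>

definition spec_sections :: "('b, 'c) ring_scheme \<Rightarrow> 'b set set \<Rightarrow> ('b set \<Rightarrow> ('b \<times> 'b) set) ring" where
  "spec_sections B U =
     \<lparr>carrier = {s \<in> (\<Pi>\<^sub>E P\<in>U. carrier (localization_at B P)).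
        \<forall>P\<in>U. \<exists>V a b. openin (zariski B) V \<and> P \<in> V \<and> V \<subseteq> U \<and> a \<in> carrier B \<and> b \<in> carrier B \<and>
          (\<forall>Q\<in>V. b \<notin> Q \<and> s Q = fraction B (carrier B - Q) a b)},
      monoid.mult = (\<lambda>s t. \<lambda>P\<in>U. s P \<otimes>\<^bsub>localization_at B P\<^esub> t P),
      one = (\<lambda>P\<in>U. \<one>\<^bsub>localization_at B P\<^esub>),
      ring.zero = (\<lambda>P\<in>U. \<zero>\<^bsub>localization_at B P\<^esub>),
      ring.add = (\<lambda>s t. \<lambda>P\<in>U. s P \<oplus>\<^bsub>localization_at B P\<^esub> t P)\<rparr>"

definition Spec :: "('b, 'c) ring_scheme \<Rightarrow> ('b set, 'b set \<Rightarrow> ('b \<times> 'b) set) ringed_space" where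
  "Spec B = \<lparr>top_of = zariski B, sections = spec_sections B, restr = (\<lambda>U V s. restrict s V)\<rparr>"


section \<open>Quasi-F-split height\<close>

text \<open>
  \<open>W\<^sub>n\<O>\<^sub>X\<close> is the sheaf with sections \<open>W\<^sub>n(\<O>\<^sub>X(U))\<close> over \<open>U\<close> and componentwise restriction. The
  target \<open>\<O>\<^sub>X\<close> is a \<open>W\<^sub>n\<O>\<^sub>X\<close>-module through \<open>R\<^sup>n\<^sup>-\<^sup>1\<close>. A homomorphism of sheaves is a family \<open>\<phi> U\<close>
  of module homomorphisms on sections, compatible with restriction.
\<close>

definition quasi_F_split :: "nat \<Rightarrow> nat \<Rightarrow> ('x, 'b) ringed_space \<Rightarrow> bool" where
  "quasi_F_split p n X \<longleftrightarrow>
     (\<exists>\<phi> :: 'x set \<Rightarrow> (nat \<Rightarrow> 'b) \<Rightarrow> 'b.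
        (\<forall>U. openin (top_of X) U \<longrightarrow>
           \<phi> U \<in> module_homs (witt_ring p n (sections X U))
                    (restrict_scalars (witt_frob p n (sections X U)) (witt_ring p n (sections X U)))
                    (restrict_scalars witt_res (sections X U))) \<and>
        (\<forall>U V. openin (top_of X) U \<longrightarrow> openin (top_of X) V \<longrightarrow> V \<subseteq> U \<longrightarrow>
           (\<forall>w\<in>carrier (witt_ring p n (sections X U)).
              \<phi> V (\<lambda>i\<in>{..<n}. restr X U V (w i)) = restr X U V (\<phi> U w))) \<and>
        (\<forall>U. openin (top_of X) U \<longrightarrow>
           (\<forall>w\<in>carrier (witt_ring p n (sections X U)).
              \<phi> U (witt_frob p n (sections X U) w) = witt_res w)))"

definition scheme_height :: "nat \<Rightarrow> ('x, 'b) ringed_space \<Rightarrow> enat" where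
  "scheme_height p X = Inf {enat n | n. 1 \<le> n \<and> quasi_F_split p n X}"

definition ring_height :: "nat \<Rightarrow> ('b, 'c) ring_scheme \<Rightarrow> enat" where
  "ring_height p B = scheme_height p (Spec B)"


section \<open>The maps u, Delta and theta\<close>

text \<open>
  Throughout, \<open>x 0, \<dots>, x (N - 1)\<close> are the chosen elements, and the monomials \<open>v\<^sub>1, \<dots>, v\<^sub>d\<close> are
  indexed by their exponent vectors.
\<close>

definition exponents :: "nat \<Rightarrow> nat \<Rightarrow> (nat \<Rightarrow> nat) set" where
  "exponents p N = {..<N} \<rightarrow>\<^sub>E {0..p - 1}"

definition x_monom :: "('a, 'c) ring_scheme \<Rightarrow> nat \<Rightarrow> (nat \<Rightarrow> 'a) \<Rightarrow> (nat \<Rightarrow> nat) \<Rightarrow> 'a" where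
  "x_monom R N x e = (\<Otimes>\<^bsub>R\<^esub>j\<in>{..<N}. x j [^]\<^bsub>R\<^esub> e j)"

definition frob_basis :: "('a, 'c) ring_scheme \<Rightarrow> nat \<Rightarrow> nat \<Rightarrow> (nat \<Rightarrow> 'a) \<Rightarrow> bool" where
  "frob_basis R p N x \<longleftrightarrow>
     (\<forall>j<N. x j \<in> carrier R) \<and>
     module_basis R (frob_pushforward p R) (exponents p N) (x_monom R N x)"

definition u_map :: "('a, 'c) ring_scheme \<Rightarrow> nat \<Rightarrow> nat \<Rightarrow> (nat \<Rightarrow> 'a) \<Rightarrow> 'a \<Rightarrow> 'a" where
  "u_map R p N x =
     dual_basis R (frob_pushforward p R) (exponents p N) (x_monom R N x) (\<lambda>j\<in>{..<N}. p - 1)"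

definition v_perp :: "('a, 'c) ring_scheme \<Rightarrow> nat \<Rightarrow> nat \<Rightarrow> (nat \<Rightarrow> 'a) \<Rightarrow> 'a set" where
  "v_perp R p N x = {a \<in> carrier (frob_pushforward p R). u_map R p N x a = \<zero>\<^bsub>R\<^esub>}"

definition p_monomials :: "('a, 'c) ring_scheme \<Rightarrow> nat \<Rightarrow> nat \<Rightarrow> (nat \<Rightarrow> 'a) \<Rightarrow> 'a set" where
  "p_monomials R p N x =
     {b [^]\<^bsub>R\<^esub> p \<otimes>\<^bsub>R\<^esub> x_monom R N x e | b e. b \<in> carrier R \<and> e \<in> exponents p N}"

definition p_decomposition ::
  "('a, 'c) ring_scheme \<Rightarrow> nat \<Rightarrow> nat \<Rightarrow> (nat \<Rightarrow> 'a) \<Rightarrow> 'a \<Rightarrow> 'a list \<Rightarrow> bool" where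
  "p_decomposition R p N x a as \<longleftrightarrow>
     set as \<subseteq> p_monomials R p N x \<and> a = (\<Oplus>\<^bsub>R\<^esub>i\<in>{..<length as}. as ! i)"

text \<open>
  The natural number divisions are exact: \<open>fact p div (\<Prod>i. fact (\<alpha> i))\<close> is the multinomial
  coefficient, and it is divisible by the prime \<open>p\<close> because all \<open>\<alpha> i\<close> are less than \<open>p\<close>.
\<close>

definition delta_sum :: "('a, 'c) ring_scheme \<Rightarrow> nat \<Rightarrow> 'a list \<Rightarrow> 'a" where
  "delta_sum R p as =
     (\<Oplus>\<^bsub>R\<^esub>\<alpha>\<in>{\<alpha> \<in> {..<length as} \<rightarrow>\<^sub>E {0..p - 1}. (\<Sum>i<length as. \<alpha> i) = p}.
        add_pow R ((fact p div (\<Prod>i<length as. fact (\<alpha> i))) div p :: nat)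
          (\<Otimes>\<^bsub>R\<^esub>i\<in>{..<length as}. (as ! i) [^]\<^bsub>R\<^esub> \<alpha> i))"

definition frob_image :: "('a, 'c) ring_scheme \<Rightarrow> nat \<Rightarrow> 'a set" where
  "frob_image R p = {b [^]\<^bsub>R\<^esub> p | b. b \<in> carrier R}"

text \<open>
  The class in \<open>R/F(R)\<close>, formed from an arbitrary choice of decomposition; \<open>theta\<close> similarly
  uses an arbitrary representative of this class.
\<close>

definition Delta1 :: "('a, 'c) ring_scheme \<Rightarrow> nat \<Rightarrow> nat \<Rightarrow> (nat \<Rightarrow> 'a) \<Rightarrow> 'a \<Rightarrow> 'a set" where
  "Delta1 R p N x a =
     frob_image R p +>\<^bsub>R\<^esub> delta_sum R p (SOME as. p_decomposition R p N x a as)"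

definition theta :: "('a, 'c) ring_scheme \<Rightarrow> nat \<Rightarrow> nat \<Rightarrow> (nat \<Rightarrow> 'a) \<Rightarrow> 'a \<Rightarrow> 'a \<Rightarrow> 'a" where
  "theta R p N x f a =
     u_map R p N x ((SOME d. d \<in> Delta1 R p N x (f [^]\<^bsub>R\<^esub> (p - 1))) \<otimes>\<^bsub>R\<^esub> a)"

text \<open>The ideals \<open>I\<^sub>s\<close>, for \<open>s \<ge> 1\<close> only.\<close>

definition fedder_ideal ::
  "('a, 'c) ring_scheme \<Rightarrow> nat \<Rightarrow> nat \<Rightarrow> (nat \<Rightarrow> 'a) \<Rightarrow> 'a \<Rightarrow> 'a set \<Rightarrow> nat \<Rightarrow> 'a set" where
  "fedder_ideal R p N x f I s =
     (let I1 = ideal_colon R (frob_power p R I) I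
      in ((\<lambda>J. theta R p N x f ` (J \<inter> v_perp R p N x) <+>\<^bsub>R\<^esub> I1) ^^ (s - 1)) I1)"

end

theory Submission
  imports Defs "HOL-Library.Function_Algebras"
begin

text \<open>
  A quasi-\<open>F\<close>-splitting of the spectrum of a local ring is determined by its action on global sections,
  so only the ring \<open>W\<^sub>n(R/I)\<close> matters. All computations in it are done in characteristic 0: \<open>W\<^sub>n(R)\<close> is
  a quotient of the ring of sequences \<open>g\<close> over the polynomial ring \<open>\<int>[X\<^sub>a | a \<in> R]\<close> such that
  \<open>p\<^sup>n\<^sup>+\<^sup>1\<close> divides \<open>g (n + 1) - \<phi> (g n)\<close>, for the Frobenius lift \<open>\<phi> X\<^sub>a = X\<^sub>a\<^sup>p\<close>. For
  \<open>a = \<Sum>\<^sub>e c\<^sub>e\<^sup>p x\<^sup>e\<close> put \<open>\<sigma> a = \<Sum>\<^sub>e [c\<^sub>e\<^sup>p x\<^sup>e]\<close>. Modulo \<open>p\<close>, every element of \<open>W\<^sub>n(R)\<close> is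
  \<open>\<Sum>\<^sub>k V\<^sup>k (\<sigma> a\<^sub>k)\<close>, where \<open>a\<^sub>0\<close> is unique and the other \<open>a\<^sub>k\<close> are unique up to \<open>p\<close>-th powers, and
  \<open>[a] = \<sigma> a + \<Sum>\<^sub>k\<^sub>>\<^sub>0 V\<^sup>k (\<sigma> (a\<^sup>q\<^sup>-\<^sup>p \<Delta>\<^sub>1(a)))\<close> with \<open>q = p\<^sup>k\<close>.

  Pulled back to \<open>W\<^sub>n(R)\<close>, a splitting therefore has the form \<open>\<Sum>\<^sub>k V\<^sup>k (\<sigma> a\<^sub>k) \<mapsto> \<Sum>\<^sub>k u\<^sup>k\<^sup>+\<^sup>1 (h\<^sub>k a\<^sub>k)\<close>. It
  factors through \<open>W\<^sub>n(R/I)\<close> iff it maps all \<open>V\<^sup>k [f\<^sub>i r]\<close> into \<open>I\<close>. Let \<open>q = p\<^sup>k\<^sup>+\<^sup>1\<close>. Since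
  \<open>(I\<^sup>[\<^sup>q\<^sup>] : I) = f\<^sup>q\<^sup>-\<^sup>1 R + I\<^sup>[\<^sup>q\<^sup>]\<close>, descending induction on \<open>k\<close> gives \<open>h\<^sub>k = f\<^sup>q\<^sup>-\<^sup>p b\<^sub>k\<close> modulo
  \<open>I\<^sup>[\<^sup>q\<^sup>]\<close> with \<open>u b\<^sub>k = 0\<close> for \<open>k > 0\<close> and \<open>b\<^sub>k \<in> \<theta> b\<^sub>k\<^sub>+\<^sub>1 + I\<^sub>1\<close>: such a chain is what it means for
  \<open>h\<^sub>0\<close> to be in \<open>I\<^sub>n\<close>, and the map can be scaled to a splitting iff \<open>u (r h\<^sub>0)\<close> is a unit for some \<open>r\<close>.
\<close>

section \<open>Integer polynomials\<close>

text \<open>The operation polynomials of Witt vectors are given only by a definite description, so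
  identities between them cannot be computed. In ghost coordinates all operations are pointwise, and
  integer polynomial rings have no torsion, so one may divide by \<open>p\<close>. Working modulo
  \<open>p\<close> loses nothing: \<open>p\<close> is the Frobenius of \<open>V 1\<close>, whose
  first component is 0, so a splitting kills every multiple of \<open>p\<close>. The Teichmueller
  map is not additive in general, even modulo \<open>p\<close>. The map \<sigma> is: its summands
  are F[c] [x^e], and modulo \<open>p\<close> the Frobenius sees only the first component. The price
  is that [a] has \<sigma>-coordinates in all degrees, which is where \<Delta>_1 enters. Since
  \<open>u\<close> generates Hom(F_* R, R), a linear map on each coordinate is one ring element. The
  exponents have a single origin: in degree k a coefficient matters only modulo the q-th powers of
  the f_i, where q = p^(k+1), and a factor f^(q-p) makes all but the first two coordinates of
  [f_i r] disappear.\<close>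

type_synonym 'v zpoly = "('v \<Rightarrow>\<^sub>0 nat) \<Rightarrow>\<^sub>0 int"

definition zvar :: "'v \<Rightarrow> 'v zpoly" where
  "zvar v = Poly_Mapping.single (Poly_Mapping.single v 1) 1"

definition zmon :: "('a, 'c) ring_scheme \<Rightarrow> ('v \<Rightarrow> 'a) \<Rightarrow> ('v \<Rightarrow>\<^sub>0 nat) \<Rightarrow> 'a" where
  "zmon A r e = (\<Otimes>\<^bsub>A\<^esub>v\<in>Poly_Mapping.keys e. r v [^]\<^bsub>A\<^esub> Poly_Mapping.lookup e v)"

definition zeval :: "('a, 'c) ring_scheme \<Rightarrow> ('v \<Rightarrow> 'a) \<Rightarrow> 'v zpoly \<Rightarrow> 'a" where
  "zeval A r P = (\<Oplus>\<^bsub>A\<^esub>e\<in>Poly_Mapping.keys P. add_pow A (Poly_Mapping.lookup P e) (zmon A r e))"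

lemma eval_poly_eq_zeval: "eval_poly A P r = zeval A r P"
  by (simp add: eval_poly_def zeval_def zmon_def)

lemma witt_var_eq_zvar: "witt_var = zvar"
  by (simp add: fun_eq_iff witt_var_def zvar_def)

lemma zpoly_induct [case_names zero single add]:
  fixes P :: "'v zpoly"
  assumes "Q 0" and "\<And>e c. Q (Poly_Mapping.single e c)" and "\<And>P P'. Q P \<Longrightarrow> Q P' \<Longrightarrow> Q (P + P')"
  shows "Q P"
proof (induction P rule: Poly_Mapping.update_induct)
  case const then show ?case by (rule assms)
next
  case (update P e c)
  have "Poly_Mapping.update e c P = P + Poly_Mapping.single e c"
    by (rule poly_mapping_eqI)
      (use update in \<open>auto simp: Poly_Mapping.lookup_update lookup_add lookup_single in_keys_iff when_def\<close>)
  then show ?case using assms update by simp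
qed

text \<open>The characteristic 0 side lives in type classes, while the rings of the theorem are
  records with a carrier; a \<open>class_hom\<close> is a ring homomorphism across this gap.\<close>

locale class_hom = cring A for A :: "('a, 'c) ring_scheme" +
  fixes \<epsilon> :: "'u::comm_ring_1 \<Rightarrow> 'a"
  assumes hom_closed [simp, intro]: "\<epsilon> x \<in> carrier A"
    and hom_add: "\<epsilon> (x + y) = \<epsilon> x \<oplus>\<^bsub>A\<^esub> \<epsilon> y"
    and hom_mult: "\<epsilon> (x * y) = \<epsilon> x \<otimes>\<^bsub>A\<^esub> \<epsilon> y"
    and hom_one: "\<epsilon> 1 = \<one>\<^bsub>A\<^esub>"
begin

lemma hom_zero: "\<epsilon> 0 = \<zero>\<^bsub>A\<^esub>"
  using hom_add[of 0 0] by (metis add.right_neutral hom_closed add.l_cancel_one)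

lemma hom_minus: "\<epsilon> (- x) = \<ominus>\<^bsub>A\<^esub> \<epsilon> x"
  using hom_add[of "- x" x] hom_zero by (metis hom_closed minus_equality add.left_inverse)

lemma hom_diff: "\<epsilon> (x - y) = \<epsilon> x \<ominus>\<^bsub>A\<^esub> \<epsilon> y"
  using hom_add[of x "- y"] hom_minus by (simp add: a_minus_def)

lemma hom_power: "\<epsilon> (x ^ n) = \<epsilon> x [^]\<^bsub>A\<^esub> n"
  by (induction n) (auto simp: hom_one hom_mult m_comm)

lemma hom_sum: "\<epsilon> (sum g S) = (\<Oplus>\<^bsub>A\<^esub>s\<in>S. \<epsilon> (g s))"
proof (cases "finite S")
  case True then show ?thesis
    by (induction S) (auto simp: hom_zero hom_add)
qed (simp add: hom_zero)

lemma hom_prod: "\<epsilon> (prod g S) = (\<Otimes>\<^bsub>A\<^esub>s\<in>S. \<epsilon> (g s))"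
proof (cases "finite S")
  case True then show ?thesis
    by (induction S) (auto simp: hom_one hom_mult)
qed (simp add: hom_one)

lemma hom_of_nat_mult: "\<epsilon> (of_nat n * x) = add_pow A n (\<epsilon> x)"
  by (induction n) (auto simp: hom_zero hom_add ring_distribs a_comm)

end

section \<open>Evaluation of integer polynomials\<close>

lemma zmon_superset:
  assumes "cring A" "\<And>v. r v \<in> carrier A" "finite S" "Poly_Mapping.keys e \<subseteq> S"
  shows "zmon A r e = (\<Otimes>\<^bsub>A\<^esub>v\<in>S. r v [^]\<^bsub>A\<^esub> Poly_Mapping.lookup e v)"
proof -
  interpret cring A by fact
  show ?thesis unfolding zmon_def
    by (rule finprod_mono_neutral_cong_left) (use assms in \<open>auto simp: in_keys_iff\<close>)
qed

lemma zmon_closed: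
  assumes "cring A" "\<And>v. r v \<in> carrier A"
  shows "zmon A r e \<in> carrier A"
proof -
  interpret cring A by fact
  show ?thesis unfolding zmon_def by (rule finprod_closed) (use assms in auto)
qed

lemma zmon_add:
  assumes "cring A" "\<And>v. r v \<in> carrier A"
  shows "zmon A r (e + e') = zmon A r e \<otimes>\<^bsub>A\<^esub> zmon A r e'"
proof -
  interpret cring A by fact
  define S where "S = Poly_Mapping.keys e \<union> Poly_Mapping.keys e'"
  have S: "finite S" "Poly_Mapping.keys e \<subseteq> S" "Poly_Mapping.keys e' \<subseteq> S" "Poly_Mapping.keys (e + e') \<subseteq> S"
    unfolding S_def using keys_add[of e e'] by auto
  show ?thesis
    unfolding S(2)[THEN zmon_superset[of A r S, OF assms S(1)]] S(3)[THEN zmon_superset[of A r S, OF assms S(1)]]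
      S(4)[THEN zmon_superset[of A r S, OF assms S(1)]]
    by (subst finprod_multf[symmetric]) (use assms in \<open>auto simp: lookup_add nat_pow_mult intro!: finprod_cong'\<close>)
qed

lemma zeval_superset:
  assumes "cring A" "\<And>v. r v \<in> carrier A" "finite S" "Poly_Mapping.keys P \<subseteq> S"
  shows "zeval A r P = (\<Oplus>\<^bsub>A\<^esub>e\<in>S. add_pow A (Poly_Mapping.lookup P e) (zmon A r e))"
proof -
  interpret cring A by fact
  show ?thesis unfolding zeval_def
    by (rule add.finprod_mono_neutral_cong_left) (use assms zmon_closed[of A r, OF assms(1,2)] add.int_pow_closed in \<open>auto simp: in_keys_iff add_pow_int_ge\<close>)
qed

lemma zeval_closed:
  assumes "cring A" "\<And>v. r v \<in> carrier A"
  shows "zeval A r P \<in> carrier A"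
proof -
  interpret cring A by fact
  show ?thesis unfolding zeval_def by (rule finsum_closed) (use assms zmon_closed[of A r, OF assms(1,2)] add.int_pow_closed in auto)
qed

lemma zeval_add:
  assumes "cring A" "\<And>v. r v \<in> carrier A"
  shows "zeval A r (P + Q) = zeval A r P \<oplus>\<^bsub>A\<^esub> zeval A r Q"
proof -
  interpret cring A by fact
  define S where "S = Poly_Mapping.keys P \<union> Poly_Mapping.keys Q"
  have S: "finite S" "Poly_Mapping.keys P \<subseteq> S" "Poly_Mapping.keys Q \<subseteq> S" "Poly_Mapping.keys (P + Q) \<subseteq> S"
    unfolding S_def using keys_add[of P Q] by auto
  show ?thesis
    unfolding S(2)[THEN zeval_superset[of A r S, OF assms S(1)]] S(3)[THEN zeval_superset[of A r S, OF assms S(1)]]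
      S(4)[THEN zeval_superset[of A r S, OF assms S(1)]]
    by (subst finsum_addf[symmetric])
      (use assms zmon_closed[of A r, OF assms(1,2)] add.int_pow_closed in \<open>auto simp: lookup_add add.int_pow_mult intro!: add.finprod_cong'\<close>)
qed

lemma zeval_single:
  assumes "cring A" "\<And>v. r v \<in> carrier A"
  shows "zeval A r (Poly_Mapping.single e c) = add_pow A c (zmon A r e)"
proof -
  interpret cring A by fact
  show ?thesis
    by (subst zeval_superset[of A r "{e}", OF assms]) (use zmon_closed[of A r, OF assms] in \<open>auto simp: finsum_insert\<close>)
qed

lemma zeval_zero:
  assumes "cring A" "\<And>v. r v \<in> carrier A"
  shows "zeval A r 0 = \<zero>\<^bsub>A\<^esub>"
proof -
  interpret cring A by fact
  show ?thesis by (simp add: zeval_def)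
qed

lemma zeval_mult:
  assumes "cring A" "\<And>v. r v \<in> carrier A"
  shows "zeval A r (P * Q) = zeval A r P \<otimes>\<^bsub>A\<^esub> zeval A r Q"
proof -
  interpret cring A by fact
  note c [simp] = zmon_closed[of A r, OF assms] zeval_closed[of A r, OF assms]
  show ?thesis
  proof (induction P rule: zpoly_induct)
    case zero show ?case by (simp add: zeval_zero[of A r, OF assms])
  next
    case (add P P')
    then show ?case by (simp add: ring_distribs zeval_add[of A r, OF assms] l_distr)
  next
    case (single e d)
    show ?case
    proof (induction Q rule: zpoly_induct)
      case zero show ?case by (simp add: zeval_zero[of A r, OF assms])
    next
      case (add P P')
      then show ?case by (simp add: ring_distribs zeval_add[of A r, OF assms] r_distr)
    next
      case (single e' d')
      show ?case
        by (simp add: mult_single zeval_single[of A r, OF assms] zmon_add[of A r, OF assms] add_pow_ldistr_int add_pow_rdistr_int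
             add.int_pow_pow mult.commute m_comm)
    qed
  qed
qed

lemma zeval_class_hom:
  assumes "cring A" "\<And>v. r v \<in> carrier A"
  shows "class_hom A (zeval A r)"
proof -
  interpret cring A by fact
  have "zeval A r 1 = \<one>\<^bsub>A\<^esub>"
    using zeval_single[of A r 0 1, OF assms] by (simp add: zmon_def)
  then show ?thesis
    by unfold_locales (use assms zeval_closed[of A r] zeval_add[of A r] zeval_mult[of A r] in auto)
qed

lemma zeval_zvar:
  assumes "cring A" "\<And>v. r v \<in> carrier A"
  shows "zeval A r (zvar v) = r v"
proof -
  interpret cring A by fact
  have "zmon A r (Poly_Mapping.single v 1) = r v"
    using zmon_superset[of A r "{v}", OF assms] assms by (simp add: finprod_insert)
  then show ?thesis unfolding zvar_def by (subst zeval_single[of A r, OF assms]) (use assms in simp)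
qed

text \<open>Integers come from 1 by sums and negation, and monomials from variables by products, so
  closure under the ring operations is enough. It serves statements that propagate along these
  operations, such as the Frobenius congruence of \<open>zphi\<close>.\<close>

lemma zpoly_ring_induct [case_names one var add minus mult]:
  fixes P :: "'v zpoly"
  assumes "Q 1" and "\<And>v. Q (zvar v)" and "\<And>P P'. Q P \<Longrightarrow> Q P' \<Longrightarrow> Q (P + P')"
    and "\<And>P. Q P \<Longrightarrow> Q (- P)" and "\<And>P P'. Q P \<Longrightarrow> Q P' \<Longrightarrow> Q (P * P')"
  shows "Q P"
proof -
  have Q0: "Q 0" using assms(3)[of 1 "- 1"] assms(1) assms(4)[of 1] by simp
  have nat: "Q (of_nat n)" for n by (induction n) (simp_all add: Q0 assms(1,3))
  have int: "Q (of_int c)" for c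
  proof (cases "c \<ge> 0")
    case True then show ?thesis using nat[of "nat c"] by simp
  next
    case False then show ?thesis using assms(4)[OF nat[of "nat (- c)"]] by simp
  qed
  have mon: "Q (Poly_Mapping.single e 1)" for e :: "'v \<Rightarrow>\<^sub>0 nat"
  proof (induction e rule: Poly_Mapping.update_induct)
    case const then show ?case using assms(1) by simp
  next
    case (update e v n)
    have e: "Poly_Mapping.update v n e = e + Poly_Mapping.single v n"
      by (rule poly_mapping_eqI)
        (use update in \<open>auto simp: Poly_Mapping.lookup_update lookup_add lookup_single in_keys_iff when_def\<close>)
    have "Q (Poly_Mapping.single (Poly_Mapping.single v k) 1)" for k
    proof (induction k)
      case 0 then show ?case using assms(1) by simp
    next
      case (Suc k)
      have *: "Poly_Mapping.single (Poly_Mapping.single v (Suc k)) 1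
              = zvar v * Poly_Mapping.single (Poly_Mapping.single v k) (1::int)"
        by (simp add: zvar_def mult_single single_add[symmetric])
      show ?case unfolding * by (intro assms(5) assms(2) Suc)
    qed
    then have "Q (Poly_Mapping.single e 1 * Poly_Mapping.single (Poly_Mapping.single v n) 1)" using update by (intro assms(5))
    then show ?case unfolding e by (simp add: mult_single)
  qed
  show ?thesis
  proof (induction P rule: zpoly_induct)
    case zero then show ?case by (rule Q0)
  next
    case (single e c)
    have "Poly_Mapping.single e c = of_int c * Poly_Mapping.single e 1"
      by (simp only: single_of_int[symmetric] mult_single of_int_eq_id id_apply) simp
    show ?case unfolding \<open>Poly_Mapping.single e c = _\<close> by (intro assms(5) int mon)
  next
    case (add P P') then show ?case by (rule assms)
  qed
qed

lemma class_hom_unique: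
  fixes \<epsilon> \<epsilon>' :: "'v zpoly \<Rightarrow> 'a"
  assumes "class_hom A \<epsilon>" "class_hom A \<epsilon>'" "\<And>v. \<epsilon> (zvar v) = \<epsilon>' (zvar v)"
  shows "\<epsilon> P = \<epsilon>' P"
proof -
  interpret e: class_hom A \<epsilon> by fact
  interpret e': class_hom A \<epsilon>' by fact
  show ?thesis
    by (induction P rule: zpoly_ring_induct)
      (auto simp: e.hom_one e'.hom_one assms e.hom_add e'.hom_add e.hom_minus e'.hom_minus e.hom_mult e'.hom_mult)
qed

text \<open>The record form of a type-class ring lets \<open>zeval\<close> substitute polynomials
  for the variables of a polynomial.\<close>

definition class_ring :: "'u::comm_ring_1 ring" where
  "class_ring = \<lparr>carrier = UNIV, monoid.mult = (*), one = 1, ring.zero = 0, ring.add = (+)\<rparr>"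

lemma class_ring_simps [simp]:
  "carrier class_ring = UNIV" "x \<otimes>\<^bsub>class_ring\<^esub> y = x * y" "\<one>\<^bsub>class_ring\<^esub> = 1"
  "\<zero>\<^bsub>class_ring\<^esub> = 0" "x \<oplus>\<^bsub>class_ring\<^esub> y = x + y"
  by (simp_all add: class_ring_def)

lemma cring_class_ring: "cring class_ring"
proof -
  have "\<exists>y. y + x = 0 \<and> x + y = 0" for x :: 'a by (intro exI[of _ "- x"]) auto
  then show ?thesis by unfold_locales (auto simp: algebra_simps Units_def)
qed

text \<open>Coefficients are integers, so this can be read off coefficientwise. It supplies the
  \<open>torsion\<close> axiom of the Frobenius lift.\<close>

lemma zpoly_of_nat_mult_cancel:
  fixes x :: "'v zpoly"
  assumes "of_nat n * x = 0" "n \<noteq> 0"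
  shows "x = 0"
proof -
  have "Poly_Mapping.lookup (of_nat n * y) e = int n * Poly_Mapping.lookup y e" for y :: "'v zpoly" and e
    by (induction n) (auto simp: ring_distribs lookup_add)
  with assms show ?thesis by (intro poly_mapping_eqI) (metis lookup_zero mult_eq_0_iff of_nat_eq_0_iff)
qed

section \<open>Witt vectors in ghost coordinates\<close>

lemma power_fun_apply: "((f :: 'i \<Rightarrow> 'u::comm_ring_1) ^ n) i = f i ^ n"
  by (induction n) (auto simp: zero_fun_def one_fun_def plus_fun_def times_fun_def)

lemma sum_fun_apply: "(\<Sum>a\<in>S. (f a :: 'i \<Rightarrow> 'u::comm_ring_1)) i = (\<Sum>a\<in>S. f a i)"
  by (induction S rule: infinite_finite_induct) (auto simp: zero_fun_def one_fun_def plus_fun_def times_fun_def)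

lemma prod_fun_apply: "(\<Prod>a\<in>S. (f a :: 'i \<Rightarrow> 'u::comm_ring_1)) i = (\<Prod>a\<in>S. f a i)"
  by (induction S rule: infinite_finite_induct) (auto simp: zero_fun_def one_fun_def plus_fun_def times_fun_def)

lemma minus_fun_apply: "((f :: 'i \<Rightarrow> 'u::comm_ring_1) - g) i = f i - g i" "(- f) i = - f i"
  by (simp_all add: fun_diff_def fun_Compl_def)

lemmas fun_apply = plus_fun_apply zero_fun_apply times_fun_apply one_fun_apply of_nat_fun_apply
  power_fun_apply sum_fun_apply prod_fun_apply minus_fun_apply

declare plus_fun_apply [simp del] zero_fun_apply [simp del] times_fun_apply [simp del] one_fun_apply [simp del]
  Function_Algebras.of_nat_fun_apply [simp del] numeral_fun_apply [simp del]

lemma dvd_diff_swap: "(d :: 'u::comm_ring_1) dvd a - b \<longleftrightarrow> d dvd b - a"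
  by (metis dvd_minus_iff minus_diff_eq)

text \<open>The setting of Dwork's lemma. \<open>torsion\<close> concerns only \<open>p\<close>, the
  one integer that is cancelled in ghost components.\<close>

locale frob_lift =
  fixes p :: nat and \<phi> :: "'u::comm_ring_1 \<Rightarrow> 'u"
  assumes prime_p: "Factorial_Ring.prime p"
    and phi_add: "\<phi> (x + y) = \<phi> x + \<phi> y"
    and phi_mult: "\<phi> (x * y) = \<phi> x * \<phi> y"
    and phi_one: "\<phi> 1 = 1"
    and phi_frob: "of_nat p dvd \<phi> x - x ^ p"
    and torsion: "of_nat p * x = 0 \<Longrightarrow> x = 0"
begin

abbreviation P :: 'u where "P \<equiv> of_nat p"

lemma p_gt_1: "p > 1" using prime_p prime_gt_1_nat by simp

lemma phi_zero: "\<phi> 0 = 0" using phi_add[of 0 0] by simp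
lemma phi_minus: "\<phi> (- x) = - \<phi> x" using phi_add[of x "- x"] phi_zero by (simp add: eq_neg_iff_add_eq_0 add.commute)
lemma phi_power: "\<phi> (x ^ n) = \<phi> x ^ n" by (induction n) (auto simp: phi_one phi_mult)
lemma phi_of_nat: "\<phi> (of_nat n) = of_nat n" by (induction n) (auto simp: phi_one phi_add phi_zero)
lemma torsion_power: "P ^ k * x = 0 \<Longrightarrow> x = 0"
  by (induction k) (auto simp: mult.assoc dest: torsion)

lemma P_cancel: "P * x = P * y \<Longrightarrow> x = y"
  using torsion[of "x - y"] by (simp add: algebra_simps)

text \<open>Factor a^p - b^p as (a - b) times \<Sum> a^i b^(p-1-i). As a and b agree modulo
  \<open>p\<close>, the second factor is p b^(p-1) modulo \<open>p\<close>, hence divisible by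
  \<open>p\<close>, which gains one power.\<close>

lemma dvd_power_p_diff:
  assumes "P ^ Suc k dvd a - b"
  shows "P ^ Suc (Suc k) dvd a ^ p - b ^ p"
proof -
  have ab: "P dvd a - b" using assms dvd_mult_left by (metis power_Suc)
  have pw: "P dvd a ^ i - b ^ i" for i
    using ab by (metis dvd_trans dvd_triv_left power_diff_sumr2)
  obtain m where m: "p = Suc m" using p_gt_1 by (cases p) auto
  have "P dvd (\<Sum>i<p. a ^ i * b ^ (m - i))"
  proof -
    have "(\<Sum>i<p. a ^ i * b ^ (m - i)) = (\<Sum>i<p. (a ^ i - b ^ i) * b ^ (m - i)) + (\<Sum>i<p. b ^ i * b ^ (m - i))"
      by (simp add: sum.distrib[symmetric] algebra_simps)
    also have "(\<Sum>i<p. b ^ i * b ^ (m - i)) = P * b ^ m"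
      using m by (subst sum.cong[of _ "{..<p}" _ "\<lambda>_. b ^ m"]) (auto simp: power_add[symmetric])
    finally show ?thesis using pw by (auto intro!: dvd_add dvd_sum)
  qed
  then have "P ^ Suc k * P dvd (a - b) * (\<Sum>i<p. a ^ i * b ^ (m - i))"
    using assms by (rule mult_dvd_mono[rotated])
  also have "(a - b) * (\<Sum>i<p. a ^ i * b ^ (m - i)) = a ^ p - b ^ p"
    unfolding m using diff_power_eq_sum[of a m b] by simp
  finally show ?thesis by (simp add: mult.commute)
qed

lemma dvd_power_pp_diff:
  assumes "P dvd a - b"
  shows "P ^ Suc k dvd a ^ (p ^ k) - b ^ (p ^ k)"
proof (induction k)
  case (Suc k)
  then show ?case using dvd_power_p_diff[of k "a ^ (p ^ k)" "b ^ (p ^ k)"] by (simp add: power_mult[symmetric] mult.commute)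
qed (use assms in simp)

lemma phi_power_pp: "P ^ Suc k dvd x ^ (p ^ Suc k) - \<phi> x ^ (p ^ k)"
  using dvd_power_pp_diff[of "x ^ p" "\<phi> x" k] phi_frob[of x]
  by (simp only: power_mult[symmetric] power_Suc[of p] dvd_diff_swap[of _ "\<phi> x"])

text \<open>
  By Dwork's lemma these are the ghost vectors. \<open>V\<close>, \<open>F\<close> and \<open>T\<close> are the Verschiebung, the Frobenius
  and the Teichmueller map in ghost components.
\<close>

definition dwork :: "(nat \<Rightarrow> 'u) \<Rightarrow> bool" where
  "dwork g \<longleftrightarrow> (\<forall>n. P ^ Suc n dvd g (Suc n) - \<phi> (g n))"

lemma dworkD: "dwork g \<Longrightarrow> P ^ Suc n dvd g (Suc n) - \<phi> (g n)" by (simp add: dwork_def)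

lemma dwork_add [intro, simp]: "dwork g \<Longrightarrow> dwork h \<Longrightarrow> dwork (g + h)"
  unfolding dwork_def fun_apply phi_add add_diff_add by (blast intro: dvd_add)

lemma dwork_minus [intro, simp]: "dwork g \<Longrightarrow> dwork (- g)"
  unfolding dwork_def fun_apply phi_minus by (metis minus_diff_minus dvd_minus_iff)

lemma dwork_diff [intro, simp]: "dwork g \<Longrightarrow> dwork h \<Longrightarrow> dwork (g - h)"
  using dwork_add[of g "- h"] dwork_minus by simp

lemma dwork_mult [intro, simp]:
  assumes "dwork g" "dwork h" shows "dwork (g * h)"
  unfolding dwork_def
proof
  fix n
  have "(g * h) (Suc n) - \<phi> ((g * h) n) = (g (Suc n) - \<phi> (g n)) * h (Suc n) + \<phi> (g n) * (h (Suc n) - \<phi> (h n))"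
    by (simp add: phi_mult algebra_simps fun_apply)
  then show "P ^ Suc n dvd (g * h) (Suc n) - \<phi> ((g * h) n)"
    using assms[THEN dworkD] by (metis dvd_add dvd_mult dvd_mult2)
qed

lemma dwork_zero [intro, simp]: "dwork 0" by (simp add: dwork_def phi_zero fun_apply)
lemma dwork_one [intro, simp]: "dwork 1" by (simp add: dwork_def phi_one fun_apply)
lemma dwork_of_nat [intro, simp]: "dwork (of_nat n)"
proof (induction n)
  case (Suc n)
  then show ?case unfolding of_nat_Suc by (intro dwork_add dwork_one)
qed simp
lemma dwork_sum [intro, simp]: "(\<And>s. s \<in> S \<Longrightarrow> dwork (f s)) \<Longrightarrow> dwork (sum f S)"
  by (induction S rule: infinite_finite_induct) auto
lemma dwork_power [intro, simp]: "dwork g \<Longrightarrow> dwork (g ^ n)" by (induction n) auto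
lemma dwork_prod [intro, simp]: "(\<And>s. s \<in> S \<Longrightarrow> dwork (f s)) \<Longrightarrow> dwork (prod f S)"
  by (induction S rule: infinite_finite_induct) auto

definition V :: "(nat \<Rightarrow> 'u) \<Rightarrow> nat \<Rightarrow> 'u" where "V g n = (case n of 0 \<Rightarrow> 0 | Suc m \<Rightarrow> P * g m)"
definition F :: "(nat \<Rightarrow> 'u) \<Rightarrow> nat \<Rightarrow> 'u" where "F g n = g (Suc n)"
definition T :: "'u \<Rightarrow> nat \<Rightarrow> 'u" where "T a n = a ^ (p ^ n)"

lemma V_0 [simp]: "V g 0 = 0" and V_Suc [simp]: "V g (Suc n) = P * g n" by (simp_all add: V_def)
lemma T_0 [simp]: "T a 0 = a" by (simp add: T_def)

lemma dwork_V [intro, simp]: "dwork g \<Longrightarrow> dwork (V g)"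
  unfolding dwork_def
proof
  fix n assume g: "\<forall>n. P ^ Suc n dvd g (Suc n) - \<phi> (g n)"
  show "P ^ Suc n dvd V g (Suc n) - \<phi> (V g n)"
  proof (cases n)
    case (Suc m)
    have "V g (Suc n) - \<phi> (V g n) = P * (g (Suc m) - \<phi> (g m))"
      using Suc by (simp add: phi_mult phi_of_nat algebra_simps)
    then show ?thesis using g Suc by (metis dvd_refl mult_dvd_mono power_Suc)
  qed (simp add: phi_zero)
qed

text \<open>The shift raises the index by one, so the congruence that is available holds even modulo
  one more power of \<open>p\<close>.\<close>

lemma dwork_F [intro, simp]: "dwork g \<Longrightarrow> dwork (F g)"
  unfolding dwork_def F_def by (metis dvd_mult_right power_Suc)

lemma dwork_T [intro, simp]: "dwork (T a)"
  unfolding dwork_def T_def using phi_power_pp phi_power by metis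

section \<open>Identities between Verschiebung, Frobenius and Teichmueller elements\<close>

lemma F_V: "F (V g) = of_nat p * g" by (simp add: fun_apply fun_eq_iff F_def)
lemma V_F_mult: "V (F g * h) = g * V h"
  by (rule ext) (simp add: fun_apply V_def F_def split: nat.split)
lemma V_add: "V (g + h) = V g + V h" by (rule ext) (simp add: fun_apply V_def algebra_simps split: nat.split)
lemma V_diff: "V (g - h) = V g - V h" by (rule ext) (simp add: fun_apply V_def algebra_simps split: nat.split)
lemma V_zero: "V 0 = 0" by (rule ext) (simp add: fun_apply V_def split: nat.split)
lemma V_sum: "V (sum f S) = (\<Sum>s\<in>S. V (f s))"
  by (induction S rule: infinite_finite_induct) (auto simp: V_zero V_add)
lemma V_of_nat: "V (of_nat n * g) = of_nat n * V g" by (rule ext) (simp add: fun_apply V_def algebra_simps split: nat.split)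
lemma V_V_mult: "V g * V h = of_nat p * V (g * h)"
  by (rule ext) (simp add: fun_apply V_def algebra_simps split: nat.split)
lemma F_add: "F (g + h) = F g + F h" by (simp add: fun_apply fun_eq_iff F_def)
lemma F_diff: "F (g - h) = F g - F h" by (simp add: fun_apply fun_eq_iff F_def)
lemma F_one: "F 1 = 1" by (simp add: fun_apply fun_eq_iff F_def)
lemma F_power: "F (g ^ n) = F g ^ n" by (simp add: fun_apply fun_eq_iff F_def)
lemma F_sum: "F (sum f S) = (\<Sum>s\<in>S. F (f s))" by (simp add: fun_apply fun_eq_iff F_def)
lemma T_mult: "T (a * b) = T a * T b" by (simp add: fun_apply fun_eq_iff T_def power_mult_distrib)
lemma T_one: "T 1 = 1" by (simp add: fun_apply fun_eq_iff T_def)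
lemma T_zero: "T 0 = 0" using p_gt_1 by (simp add: fun_apply fun_eq_iff T_def power_0_left)
lemma T_power: "T (a ^ n) = T a ^ n" by (simp add: fun_apply fun_eq_iff T_def power_mult[symmetric] mult.commute)
lemma T_prod: "T (prod f S) = (\<Prod>s\<in>S. T (f s))"
  by (induction S rule: infinite_finite_induct) (auto simp: T_one T_mult)
lemma F_T: "F (T a) = T (a ^ p)" by (simp add: fun_apply fun_eq_iff F_def T_def power_mult[symmetric])

text \<open>The congruences carry divisibility by \<open>p\<close> from g 0 = 0 to all later
  components. Dividing by \<open>p\<close> costs one power of \<open>p\<close> in each congruence,
  but the index drops by one as well, so the quotient is again a ghost vector.\<close>

lemma V_surj:
  assumes "dwork g" "g 0 = 0"
  shows "\<exists>h. dwork h \<and> g = V h"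
proof -
  have dv: "P dvd g (Suc n)" for n
  proof (induction n)
    case 0 then show ?case using dworkD[OF assms(1), of 0] assms(2) by (simp add: phi_zero)
  next
    case (Suc n)
    then obtain y where "g (Suc n) = P * y" by blast
    then have "P dvd \<phi> (g (Suc n))" by (simp add: phi_mult phi_of_nat)
    moreover have "P dvd g (Suc (Suc n)) - \<phi> (g (Suc n))" using dworkD[OF assms(1), of "Suc n"] dvd_mult_left by (metis power_Suc)
    ultimately show ?case by (metis diff_add_cancel dvd_add)
  qed
  define h where "h n = (SOME y. g (Suc n) = P * y)" for n
  have h: "g (Suc n) = P * h n" for n
    unfolding h_def by (rule someI_ex[of "\<lambda>y. g (Suc n) = P * y"]) (use dv[of n] in \<open>simp add: dvd_def\<close>)
  have g: "g = V h" using h assms(2) by (auto simp: fun_apply fun_eq_iff V_def split: nat.split)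
  have "dwork h" unfolding dwork_def
  proof
    fix n
    have "P ^ Suc (Suc n) dvd P * (h (Suc n) - \<phi> (h n))"
      using dworkD[OF assms(1), of "Suc n"] h by (simp add: phi_mult phi_of_nat algebra_simps)
    then obtain y where "P * (h (Suc n) - \<phi> (h n)) = P * (P ^ Suc n * y)" by (metis dvdE mult.assoc power_Suc)
    then show "P ^ Suc n dvd h (Suc n) - \<phi> (h n)" by (metis P_cancel dvd_triv_left)
  qed
  with g show ?thesis by blast
qed

section \<open>Dwork's lemma and Witt coordinates\<close>

lemma V_inj: "V g = V h \<Longrightarrow> g = h"
  by (metis P_cancel V_Suc ext)

text \<open>The recursive form of the ghost map: a Witt vector is the Teichmueller element of its
  first coordinate plus the Verschiebung of its tail. Both halves of Dwork's lemma below are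
  inductions along this equation.\<close>

lemma ghost_shift: "ghost p (x :: nat \<Rightarrow> 'u) = T (x 0) + V (ghost p (\<lambda>i. x (Suc i)))"
proof (rule ext)
  fix n
  show "ghost p x n = (T (x 0) + V (ghost p (\<lambda>i. x (Suc i)))) n"
  proof (cases n)
    case (Suc m)
    have "ghost p x n = x 0 ^ (p ^ n) + (\<Sum>i\<le>m. P ^ Suc i * x (Suc i) ^ (p ^ (m - i)))"
      unfolding ghost_def Suc by (subst sum.atMost_Suc_shift) simp
    then show ?thesis using Suc by (simp add: fun_apply T_def ghost_def sum_distrib_left mult.assoc)
  qed (simp add: ghost_def fun_apply)
qed

lemma dwork_tail:
  assumes "dwork g"
  obtains g' where "dwork g'" "g = T (g 0) + V g'"
proof -
  have "dwork (g - T (g 0))" "(g - T (g 0)) 0 = 0" using assms by (auto simp: fun_apply)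
  from V_surj[OF this] show ?thesis using that by (metis add.commute diff_add_cancel)
qed

text \<open>Splitting off the first coordinate leaves a Teichmueller part, which satisfies the
  congruence by \<open>phi_power_pp\<close>, and \<open>p\<close> times the congruence of the tail
  at the previous index.\<close>

lemma dwork_ghost [intro, simp]: "dwork (ghost p x)"
proof -
  have "P ^ Suc n dvd ghost p x (Suc n) - \<phi> (ghost p x n)" for n and x :: "nat \<Rightarrow> 'u"
  proof (induction n arbitrary: x)
    case 0 
    have "ghost p x (Suc 0) - \<phi> (ghost p x 0) = x 0 ^ p - \<phi> (x 0) + P * x 1" by (simp add: ghost_def)
    then show ?case using phi_frob[of "x 0"] by (simp add: dvd_add dvd_diff_swap[of P "x 0 ^ p"])
  next
    case (Suc n)
    let ?y = "\<lambda>i. x (Suc i)"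
    have "ghost p x (Suc (Suc n)) - \<phi> (ghost p x (Suc n)) 
      = (T (x 0) (Suc (Suc n)) - \<phi> (T (x 0) (Suc n))) + P * (ghost p ?y (Suc n) - \<phi> (ghost p ?y n))"
      by (subst (1 2) ghost_shift) (simp add: fun_apply phi_add phi_mult phi_of_nat algebra_simps)
    also have "P ^ Suc (Suc n) dvd \<dots>"
      using dworkD[OF dwork_T[of "x 0"], of "Suc n"] Suc[of ?y] 
      by (metis dvd_add dvd_refl mult_dvd_mono power_Suc)
    finally show ?case .
  qed
  then show ?thesis by (simp add: dwork_def)
qed

lemma ghost_inj: "ghost p (x :: nat \<Rightarrow> 'u) = ghost p y \<Longrightarrow> x = y"
proof
  fix n assume "ghost p x = ghost p y"
  then show "x n = y n"
  proof (induction n arbitrary: x y)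
    case 0 then have "ghost p x 0 = ghost p y 0" by simp
    then show ?case by (simp add: ghost_def)
  next
    case (Suc n)
    from Suc(2) have "ghost p x 0 = ghost p y 0" by simp
    then have "x 0 = y 0" by (simp add: ghost_def)
    then have "V (ghost p (\<lambda>i. x (Suc i))) = V (ghost p (\<lambda>i. y (Suc i)))"
      using Suc(2) by (subst (asm) (1 2) ghost_shift) simp
    then show ?case using Suc(1) V_inj by blast
  qed
qed

text \<open>The converse half of Dwork's lemma. Subtracting the Teichmueller element of the first
  component leaves a Verschiebung; when this tail operation \<open>t\<close> is iterated, the n-th
  coordinate is the first component of the n-th tail.\<close>

lemma ex_ghost: "dwork g \<Longrightarrow> \<exists>x. ghost p x = g"
proof -
  assume g: "dwork g"
  define t where "t g = (SOME g'. dwork g' \<and> g = T (g 0) + V g')" for g :: "nat \<Rightarrow> 'u"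
  have t: "dwork (t g) \<and> g = T (g 0) + V (t g)" if "dwork g" for g
    unfolding t_def by (rule someI_ex[of "\<lambda>g'. dwork g' \<and> g = T (g 0) + V g'"]) (use dwork_tail[OF that] in blast)
  have "ghost p (\<lambda>n. (t ^^ n) g 0) n = g n" if "dwork g" for n and g :: "nat \<Rightarrow> 'u"
    using that
  proof (induction n arbitrary: g)
    case 0 then show ?case by (simp add: ghost_def)
  next
    case (Suc n)
    have "ghost p (\<lambda>n. (t ^^ n) g 0) (Suc n) = T (g 0) (Suc n) + P * ghost p (\<lambda>n. (t ^^ n) (t g) 0) n"
      by (subst ghost_shift) (simp add: funpow_swap1 fun_apply)
    also have "\<dots> = T (g 0) (Suc n) + V (t g) (Suc n)" using Suc t by simp
    also have "\<dots> = g (Suc n)" using t[OF Suc(2)] by (metis plus_fun_apply)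
    finally show ?case .
  qed
  then show ?thesis using g by blast
qed

definition coords :: "(nat \<Rightarrow> 'u) \<Rightarrow> nat \<Rightarrow> 'u" where "coords g = (THE x. ghost p x = g)"

lemma coords_ghost [simp]: "coords (ghost p x) = x"
  unfolding coords_def using ghost_inj by (auto intro!: the_equality)

lemma ghost_coords [simp]: "dwork g \<Longrightarrow> ghost p (coords g) = g"
  using ex_ghost coords_ghost by metis

lemma coords_0: "dwork g \<Longrightarrow> coords g 0 = g 0"
proof -
  assume "dwork g"
  then have "ghost p (coords g) 0 = g 0" by simp
  then show ?thesis by (simp add: ghost_def)
qed

lemma coords_V: "dwork g \<Longrightarrow> coords (V g) = case_nat 0 (coords g)"
proof -
  assume "dwork g"
  then have "V g = ghost p (case_nat 0 (coords g))" by (subst ghost_shift) (simp add: T_zero)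
  then show ?thesis by simp
qed

lemma coords_T_V: "dwork g \<Longrightarrow> coords (T a + V g) = case_nat a (coords g)"
proof -
  assume "dwork g"
  then have "T a + V g = ghost p (case_nat a (coords g))" by (subst ghost_shift) simp
  then show ?thesis by simp
qed

lemma coords_T: "coords (T a) = case_nat a (\<lambda>_. 0)"
proof -
  have "ghost p (\<lambda>_. 0) = 0" using p_gt_1 by (auto simp: fun_apply fun_eq_iff ghost_def power_0_left)
  then have "T a = ghost p (case_nat a (\<lambda>_. 0))" by (subst ghost_shift) (simp add: \<open>ghost p (\<lambda>_. 0) = 0\<close> V_zero)
  then show ?thesis by simp
qed

lemma coords_T_mult: "dwork g \<Longrightarrow> coords (T a * g) = (\<lambda>i. a ^ (p ^ i) * coords g i)"
proof -
  assume g: "dwork g"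
  have "ghost p (\<lambda>i. a ^ (p ^ i) * x i) n = T a n * ghost p x n" for x n
    unfolding ghost_def T_def sum_distrib_left
    by (intro sum.cong) (auto simp: power_mult_distrib power_mult[symmetric] power_add[symmetric] algebra_simps)
  then have "ghost p (\<lambda>i. a ^ (p ^ i) * coords g i) = T a * g" using g by (auto simp: fun_apply fun_eq_iff)
  then show ?thesis by (metis coords_ghost)
qed

text \<open>Strong induction, comparing component n of the ghost vector \<open>F g\<close> with
  component n+1 of \<open>g\<close>. If y_i is x_i^p modulo \<open>p\<close> for i < n, raising to
  the power p^(n-i) makes the i-th terms agree modulo p^(n+1), and cancelling p^n leaves the claim
  for n.\<close>

lemma coords_F: "dwork g \<Longrightarrow> P dvd coords (F g) n - coords g n ^ p"
proof -
  assume g: "dwork g"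
  define x y where "x = coords g" and "y = coords (F g)"
  have eq: "ghost p y n = ghost p x (Suc n)" for n using g by (simp add: x_def y_def F_def)
  show ?thesis unfolding x_def[symmetric] y_def[symmetric]
  proof (induction n rule: less_induct)
    case (less n)
    have d: "P ^ Suc n dvd P ^ i * (y i ^ (p ^ (n - i)) - x i ^ (p ^ (Suc n - i)))" if "i < n" for i
    proof -
      have "P ^ Suc (n - i) dvd y i ^ (p ^ (n - i)) - (x i ^ p) ^ (p ^ (n - i))"
        by (rule dvd_power_pp_diff) (use less that in simp)
      moreover have "(x i ^ p) ^ (p ^ (n - i)) = x i ^ (p ^ (Suc n - i))"
        using that by (simp add: power_mult[symmetric] Suc_diff_le)
      ultimately have "P ^ i * P ^ Suc (n - i) dvd P ^ i * (y i ^ (p ^ (n - i)) - x i ^ (p ^ (Suc n - i)))"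
        by (simp add: mult_dvd_mono)
      moreover have "P ^ i * P ^ Suc (n - i) = P ^ Suc n" using that by (simp only: power_add[symmetric]) simp
      ultimately show ?thesis by simp
    qed
    have "(\<Sum>i<n. P ^ i * y i ^ (p ^ (n - i))) + P ^ n * y n
        = (\<Sum>i<n. P ^ i * x i ^ (p ^ (Suc n - i))) + P ^ n * x n ^ p + P ^ Suc n * x (Suc n)"
      using eq[of n] by (simp add: ghost_def lessThan_Suc_atMost[symmetric])
    then have "P ^ n * (y n - x n ^ p)
       = P ^ Suc n * x (Suc n) - (\<Sum>i<n. P ^ i * (y i ^ (p ^ (n - i)) - x i ^ (p ^ (Suc n - i))))"
      by (simp add: algebra_simps sum_subtractf)
    also have "P ^ Suc n dvd \<dots>" by (intro dvd_diff dvd_sum d) auto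
    finally obtain z where "P ^ n * (y n - x n ^ p) = P ^ n * (P * z)" by (metis dvdE mult.assoc power_Suc2)
    then have "y n - x n ^ p = P * z" using torsion_power[of n "(y n - x n ^ p) - P * z"] by (simp add: algebra_simps)
    then show ?case by simp
  qed
qed

end

lemma freshman_dvd:
  fixes x y :: "'u::comm_ring_1"
  assumes "Factorial_Ring.prime p"
  shows "of_nat p dvd (x + y) ^ p - (x ^ p + y ^ p)"
proof -
  have p: "p > 0" using assms prime_gt_0_nat by blast
  have "(x + y) ^ p = (\<Sum>k\<le>p. of_nat (p choose k) * x ^ k * y ^ (p - k))" by (rule binomial_ring)
  also have "{..p} = insert 0 (insert p {1..<p})" using p by auto
  finally have "(x + y) ^ p - (x ^ p + y ^ p) = (\<Sum>k\<in>{1..<p}. of_nat (p choose k) * x ^ k * y ^ (p - k))"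
    using p by simp
  also have "of_nat p dvd \<dots>"
  proof (intro dvd_sum)
    fix k assume "k \<in> {1..<p}"
    then have "p dvd (p choose k)" using assms by (intro dvd_choose_prime) auto
    then have "(of_nat p :: 'u) dvd of_nat (p choose k)" by (metis dvd_def of_nat_mult)
    then show "(of_nat p :: 'u) dvd of_nat (p choose k) * x ^ k * y ^ (p - k)" by (simp add: mult.assoc)
  qed
  finally show ?thesis .
qed

section \<open>The Frobenius lift on integer polynomials\<close>

definition zphi :: "nat \<Rightarrow> 'v zpoly \<Rightarrow> 'v zpoly" where
  "zphi p = zeval class_ring (\<lambda>v. zvar v ^ p)"

lemma class_hom_zeval_class: "class_hom class_ring (zeval class_ring r)"
  by (rule zeval_class_hom) (auto simp: cring_class_ring)

lemma frob_lift_zphi: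
  assumes "Factorial_Ring.prime p"
  shows "frob_lift p (zphi p :: 'v zpoly \<Rightarrow> _)"
proof
  have p: "p > 0" using assms prime_gt_0_nat by blast
  interpret class_hom class_ring "zphi p :: 'v zpoly \<Rightarrow> _" unfolding zphi_def by (rule class_hom_zeval_class)
  show "zphi p (x + y) = zphi p x + zphi p y" for x y :: "'v zpoly" using hom_add by simp
  show "zphi p (x * y) = zphi p x * zphi p y" for x y :: "'v zpoly" using hom_mult by simp
  show "zphi p (1 :: 'v zpoly) = 1" using hom_one by simp
  show "x = 0" if "of_nat p * x = 0" for x :: "'v zpoly" using zpoly_of_nat_mult_cancel that p by blast
  show "of_nat p dvd zphi p x - x ^ p" for x :: "'v zpoly"
  proof (induction x rule: zpoly_ring_induct)
    case one then show ?case using hom_one by simp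
  next
    case (var v)
    have "zphi p (zvar v :: 'v zpoly) = zvar v ^ p" unfolding zphi_def by (rule zeval_zvar) (auto simp: cring_class_ring)
    then show ?case by simp
  next
    case (add P P')
    have "zphi p (P + P') - (P + P') ^ p = (zphi p P - P ^ p) + (zphi p P' - P' ^ p) - ((P + P') ^ p - (P ^ p + P' ^ p))"
      using hom_add by simp
    then show ?case using add freshman_dvd[OF assms] by (metis dvd_add dvd_diff)
  next
    case (minus P)
    have "zphi p (- P) = - zphi p P" using hom_add[of P "- P"] hom_add[of 0 0] by (simp add: eq_neg_iff_add_eq_0 add.commute)
    then have *: "zphi p (- P) - (- P) ^ p = ((P + - P) ^ p - (P ^ p + (- P) ^ p)) - (zphi p P - P ^ p)"
      using p by (simp add: power_0_left)
    show ?case unfolding * by (intro dvd_diff freshman_dvd[OF assms] minus)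
  next
    case (mult P P')
    have "zphi p (P * P') - (P * P') ^ p = (zphi p P - P ^ p) * zphi p P' + P ^ p * (zphi p P' - P' ^ p)"
      using hom_mult by (simp add: algebra_simps power_mult_distrib)
    then show ?case using mult by (metis dvd_add dvd_mult dvd_mult2)
  qed
qed (rule assms)

section \<open>The operation polynomials of Witt vectors\<close>

lemma class_hom_classD:
  assumes "class_hom class_ring h"
  shows "h (x + y) = h x + h y" "h (x * y) = h x * h y"
  using class_hom.hom_add[OF assms, of x y] class_hom.hom_mult[OF assms, of x y] by simp_all

lemma class_hom_ghost:
  assumes "class_hom class_ring h"
  shows "h (ghost p x n) = ghost p (h \<circ> x) n"
proof -
  interpret class_hom class_ring h by fact
  have add: "h (x + y) = h x + h y" and mult: "h (x * y) = h x * h y" and one: "h 1 = 1" for x y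
    using hom_add hom_mult hom_one by simp_all
  have zero: "h 0 = 0" using hom_zero by simp
  have pow: "h (x ^ k) = h x ^ k" for x k by (induction k) (auto simp: one mult)
  have nat: "h (of_nat k) = of_nat k" for k by (induction k) (auto simp: zero one add)
  have sum: "h (sum f S) = (\<Sum>s\<in>S. h (f s))" for f and S :: "nat set"
    by (induction S rule: infinite_finite_induct) (auto simp: zero add)
  show ?thesis by (simp add: ghost_def sum mult pow nat)
qed

text \<open>The truncated form of \<open>ghost_inj\<close>, for substitutions that preserve ghost
  components only up to some degree.\<close>

lemma (in frob_lift) ghost_inj_upto:
  assumes "\<And>n. n \<le> m \<Longrightarrow> ghost p (x :: nat \<Rightarrow> 'u) n = ghost p y n" "n \<le> m"
  shows "x n = y n"
  using assms(2)
proof (induction n rule: less_induct)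
  case (less n)
  have "(\<Sum>i<n. P ^ i * x i ^ (p ^ (n - i))) + P ^ n * x n = (\<Sum>i<n. P ^ i * y i ^ (p ^ (n - i))) + P ^ n * y n"
    using assms(1)[OF less.prems] by (simp add: ghost_def lessThan_Suc_atMost[symmetric])
  moreover have "(\<Sum>i<n. P ^ i * x i ^ (p ^ (n - i))) = (\<Sum>i<n. P ^ i * y i ^ (p ^ (n - i)))"
    using less by (intro sum.cong) auto
  ultimately have "P ^ n * (x n - y n) = 0" by (simp add: algebra_simps)
  then show ?case using torsion_power by (metis eq_iff_diff_eq_0)
qed

text \<open>The definite descriptions denote something: the sum and the product of two ghost vectors
  satisfy Dwork's congruences, and the ghost map is injective.\<close>

lemma
  assumes "Factorial_Ring.prime p"
  shows ghost_witt_add_poly: "ghost p (witt_add_poly p) n = ghost p (zvar \<circ> Inl) n + ghost p (zvar \<circ> Inr) n"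
    and ghost_witt_mult_poly: "ghost p (witt_mult_poly p) n = ghost p (zvar \<circ> Inl) n * ghost p (zvar \<circ> Inr) n"
proof -
  interpret frob_lift p "zphi p :: witt_poly \<Rightarrow> _" by (rule frob_lift_zphi) fact
  have ex1: "\<exists>!S. \<forall>n. ghost p S n = g n" if "dwork g" for g
  proof -
    have "\<exists>!S. ghost p S = g" using ex_ghost[OF that] ghost_inj by blast
    then show ?thesis by (simp add: fun_eq_iff)
  qed
  have "dwork (ghost p (zvar \<circ> Inl) + ghost p (zvar \<circ> Inr))" "dwork (ghost p (zvar \<circ> Inl) * ghost p (zvar \<circ> Inr))"
    by auto
  note ex = this[THEN ex1]
  show "ghost p (witt_add_poly p) n = ghost p (zvar \<circ> Inl) n + ghost p (zvar \<circ> Inr) n"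
    using theI'[OF ex(1)] unfolding witt_add_poly_def witt_var_eq_zvar fun_apply by blast
  show "ghost p (witt_mult_poly p) n = ghost p (zvar \<circ> Inl) n * ghost p (zvar \<circ> Inr) n"
    using theI'[OF ex(2)] unfolding witt_mult_poly_def witt_var_eq_zvar fun_apply by blast
qed

definition zvars :: "'v zpoly \<Rightarrow> 'v set" where
  "zvars P = (\<Union>e\<in>Poly_Mapping.keys P. Poly_Mapping.keys e)"

lemma zvars_add: "zvars (P + Q) \<subseteq> zvars P \<union> zvars Q"
  unfolding zvars_def using keys_add[of P Q] by blast

lemma zvars_minus: "zvars (- P) = zvars P"
  by (auto simp: zvars_def in_keys_iff)

lemma keys_add_nat: "Poly_Mapping.keys (e + e' :: 'v \<Rightarrow>\<^sub>0 nat) = Poly_Mapping.keys e \<union> Poly_Mapping.keys e'"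
  by (auto simp: in_keys_iff lookup_add)

lemma zvars_mult: "zvars (P * Q) \<subseteq> zvars P \<union> zvars Q"
proof
  fix v assume "v \<in> zvars (P * Q)"
  then obtain e where e: "e \<in> Poly_Mapping.keys (P * Q)" "v \<in> Poly_Mapping.keys e" by (auto simp: zvars_def)
  then obtain a b where "e = a + b" "a \<in> Poly_Mapping.keys P" "b \<in> Poly_Mapping.keys Q"
    using keys_mult[of P Q] by (auto simp: subset_iff)
  then show "v \<in> zvars P \<union> zvars Q" using e(2) by (auto simp: keys_add_nat zvars_def)
qed

lemma zvars_simps: "zvars (1 :: 'v zpoly) = {}" "zvars (0 :: 'v zpoly) = {}" "zvars (zvar v) = {v}"
  by (auto simp: zvars_def zvar_def)

lemma zvars_zeval:
  assumes "\<And>v. zvars (r v) \<subseteq> T"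
  shows "zvars (zeval class_ring r P) \<subseteq> T"
proof -
  interpret class_hom class_ring "zeval class_ring r" by (rule class_hom_zeval_class)
  show ?thesis
  proof (induction P rule: zpoly_ring_induct)
    case one then show ?case using hom_one by (simp add: zvars_simps)
  next
    case (var v) then show ?case using assms by (simp add: zeval_zvar cring_class_ring)
  next
    case (add P P') then show ?case using hom_add zvars_add by fastforce
  next
    case (minus P)
    have "zeval class_ring r P + zeval class_ring r (- P) = 0" using hom_add[of P "- P"] hom_zero by simp
    then have "zeval class_ring r (- P) = - zeval class_ring r P" by (simp add: eq_neg_iff_add_eq_0 add.commute)
    then show ?case using minus zvars_minus by metis
  next
    case (mult P P') then show ?case using hom_mult zvars_mult by fastforce
  qed
qed

abbreviation windex :: "nat + nat \<Rightarrow> nat" where "windex \<equiv> case_sum id id"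

text \<open>Set all variables of index above i to 0. This leaves the ghost components up to i of
  both arguments alone, hence those of \<open>S\<close>, hence the coordinate \<open>S i\<close>,
  which therefore equals a polynomial without these variables. The operation \<open>c\<close> is
  kept abstract to serve sum and product.\<close>

lemma witt_poly_vars:
  assumes "Factorial_Ring.prime p"
    and c: "\<And>n. ghost p S n = c (ghost p (zvar \<circ> Inl) n) (ghost p (zvar \<circ> Inr) n)"
    and hom: "\<And>h x y. class_hom class_ring h \<Longrightarrow> h (c x y) = c (h x) (h y)"
  shows "zvars (S i :: witt_poly) \<subseteq> {v. windex v \<le> i}"
proof -
  interpret frob_lift p "zphi p :: witt_poly \<Rightarrow> _" by (rule frob_lift_zphi) fact
  define r :: "nat + nat \<Rightarrow> witt_poly" where "r v = (if windex v \<le> i then zvar v else 0)" for v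
  let ?k = "zeval class_ring r"
  have k: "class_hom class_ring ?k" by (rule class_hom_zeval_class)
  have kv: "?k (zvar v) = r v" for v by (simp add: zeval_zvar cring_class_ring)
  have gh: "ghost p x n = ghost p y n" if "n \<le> i" "\<And>j. j \<le> n \<Longrightarrow> x j = y j" for n and x y :: "nat \<Rightarrow> witt_poly"
    unfolding ghost_def using that by (intro sum.cong) auto
  have "ghost p (?k \<circ> S) n = ghost p S n" if "n \<le> i" for n
  proof -
    have "ghost p (?k \<circ> S) n = ?k (ghost p S n)" using class_hom_ghost[OF k] by metis
    also have "\<dots> = c (ghost p (?k \<circ> (zvar \<circ> Inl)) n) (ghost p (?k \<circ> (zvar \<circ> Inr)) n)"
      by (simp only: c hom[OF k] class_hom_ghost[OF k])
    also have "ghost p (?k \<circ> (zvar \<circ> Inl)) n = ghost p (zvar \<circ> Inl) n"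
      by (rule gh[OF that]) (use that in \<open>auto simp: kv r_def\<close>)
    also have "ghost p (?k \<circ> (zvar \<circ> Inr)) n = ghost p (zvar \<circ> Inr) n"
      by (rule gh[OF that]) (use that in \<open>auto simp: kv r_def\<close>)
    finally show ?thesis unfolding c[of n] .
  qed
  then have "(?k \<circ> S) i = S i" by (rule ghost_inj_upto) auto
  moreover have "zvars (?k (S i)) \<subseteq> {v. windex v \<le> i}"
    by (rule zvars_zeval) (auto simp: r_def zvars_simps)
  ultimately show ?thesis by simp
qed

lemma
  assumes "Factorial_Ring.prime p"
  shows witt_add_poly_vars: "zvars (witt_add_poly p i) \<subseteq> {v. windex v \<le> i}"
    and witt_mult_poly_vars: "zvars (witt_mult_poly p i) \<subseteq> {v. windex v \<le> i}"
proof -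
  show "zvars (witt_add_poly p i) \<subseteq> {v. windex v \<le> i}"
    by (rule witt_poly_vars[where c = "(+)"]) (use assms ghost_witt_add_poly class_hom_classD in \<open>auto\<close>)
  show "zvars (witt_mult_poly p i) \<subseteq> {v. windex v \<le> i}"
    by (rule witt_poly_vars[where c = "(*)"]) (use assms ghost_witt_mult_poly class_hom_classD in \<open>auto\<close>)
qed

lemma zeval_cong:
  assumes "cring A" "\<And>v. r' v \<in> carrier A" "\<And>v. v \<in> zvars P \<Longrightarrow> r v = r' v"
  shows "zeval A r P = zeval A r' P"
proof -
  interpret cring A by fact
  have "zmon A r e = zmon A r' e" if "e \<in> Poly_Mapping.keys P" for e
    unfolding zmon_def using that assms(2,3) by (intro finprod_cong') (auto simp: zvars_def, metis assms(3) UN_I zvars_def)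
  then show ?thesis
    unfolding zeval_def using zmon_closed[of A r', OF assms(1,2)] by (intro add.finprod_cong') auto
qed

section \<open>Witt rings as quotients of rings of ghost vectors\<close>

locale witt_hom = frob_lift p \<phi> + class_hom A \<epsilon>
  for p and \<phi> :: "'u::comm_ring_1 \<Rightarrow> 'u" and A :: "('a, 'c) ring_scheme" and \<epsilon> :: "'u \<Rightarrow> 'a"
begin

text \<open>Substituting the coordinates of \<open>g\<close> and \<open>h\<close> into the
  polynomials \<open>S\<close> gives a vector with ghost components \<open>k\<close>, hence the
  coordinates of \<open>k\<close>. Applying \<epsilon> afterwards is evaluation in \<open>A\<close>,
  because homomorphisms out of an integer polynomial ring are determined by the variables.\<close>

lemma eps_coords:
  assumes S: "\<And>n. ghost p S n = c (ghost p (zvar \<circ> Inl) n) (ghost p (zvar \<circ> Inr) n)"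
    and hom: "\<And>h :: witt_poly \<Rightarrow> 'u. class_hom class_ring h \<Longrightarrow> (\<And>x y. h (c x y) = d (h x) (h y))"
    and "dwork g" "dwork h" "\<And>n. k n = d (g n) (h n)"
  shows "\<epsilon> (coords k i) = zeval A (case_sum (\<lambda>j. \<epsilon> (coords g j)) (\<lambda>j. \<epsilon> (coords h j))) (S i)"
proof -
  let ?r = "case_sum (coords g) (coords h)"
  let ?t = "zeval class_ring ?r"
  have t: "class_hom class_ring ?t" by (rule class_hom_zeval_class)
  have tv: "?t (zvar v) = ?r v" for v by (simp add: zeval_zvar cring_class_ring)
  have "ghost p (?t \<circ> S) = k"
  proof
    fix n
    have l: "?t \<circ> (zvar \<circ> Inl) = coords g" "?t \<circ> (zvar \<circ> Inr) = coords h" by (auto simp: tv)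
    have "ghost p (?t \<circ> S) n = ?t (ghost p S n)" using class_hom_ghost[OF t] by metis
    also have "\<dots> = d (ghost p (?t \<circ> (zvar \<circ> Inl)) n) (ghost p (?t \<circ> (zvar \<circ> Inr)) n)"
      by (simp only: S hom[OF t] class_hom_ghost[OF t])
    also have "\<dots> = k n" using assms unfolding l by simp
    finally show "ghost p (?t \<circ> S) n = k n" .
  qed
  then have "coords k = ?t \<circ> S" using coords_ghost by metis
  moreover have "\<epsilon> (?t (S i)) = zeval A (case_sum (\<lambda>j. \<epsilon> (coords g j)) (\<lambda>j. \<epsilon> (coords h j))) (S i)"
  proof (rule class_hom_unique[where \<epsilon> = "\<lambda>P. \<epsilon> (?t P)" and A = A])
    interpret t: class_hom class_ring ?t by (rule t)
    show "class_hom A (\<lambda>P. \<epsilon> (?t P))"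
      by unfold_locales (use t.hom_add t.hom_mult t.hom_one hom_add hom_mult hom_one in auto)
    show "class_hom A (zeval A (case_sum (\<lambda>j. \<epsilon> (coords g j)) (\<lambda>j. \<epsilon> (coords h j))))"
      by (rule zeval_class_hom) (auto simp: is_cring split: sum.split)
    show "\<epsilon> (?t (zvar v)) = zeval A (case_sum (\<lambda>j. \<epsilon> (coords g j)) (\<lambda>j. \<epsilon> (coords h j))) (zvar v)" for v
      unfolding tv by (subst zeval_zvar) (auto simp: is_cring split: sum.split)
  qed
  ultimately show ?thesis by simp
qed

text \<open>The map that presents W_n(A) as a quotient: upstairs the operations are pointwise on
  ghost vectors, and \<open>wproj_add\<close> and \<open>wproj_mult\<close> carry them to those of
  \<open>witt_ring\<close>.\<close>

definition wproj :: "nat \<Rightarrow> (nat \<Rightarrow> 'u) \<Rightarrow> nat \<Rightarrow> 'a" where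
  "wproj n g = (\<lambda>i\<in>{..<n}. \<epsilon> (coords g i))"

lemma wproj_closed [simp, intro]: "wproj n g \<in> carrier (witt_ring p n A)"
  by (auto simp: wproj_def witt_ring_def)

text \<open>\<open>wproj\<close> is \<open>undefined\<close> from index n on, which does no harm
  because the i-th operation polynomial has no variables of index above i.\<close>

lemma zeval_wproj:
  assumes "zvars Q \<subseteq> {v. windex v \<le> i}" "i < n"
  shows "zeval A (case_sum (wproj n g) (wproj n h)) Q
    = zeval A (case_sum (\<lambda>j. \<epsilon> (coords g j)) (\<lambda>j. \<epsilon> (coords h j))) Q"
  by (rule zeval_cong) (use assms is_cring in \<open>auto simp: wproj_def split: sum.splits\<close>)

lemma wproj_add:
  assumes "dwork g" "dwork h"
  shows "wproj n (g + h) = wproj n g \<oplus>\<^bsub>witt_ring p n A\<^esub> wproj n h"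
proof -
  have "\<epsilon> (coords (g + h) i) = zeval A (case_sum (\<lambda>j. \<epsilon> (coords g j)) (\<lambda>j. \<epsilon> (coords h j))) (witt_add_poly p i)" for i
    by (rule eps_coords[where c = "(+)" and d = "(+)"])
      (use assms ghost_witt_add_poly[OF prime_p] class_hom_classD in \<open>auto simp: fun_apply\<close>)
  then show ?thesis using zeval_wproj[OF witt_add_poly_vars[OF prime_p]]
    by (auto simp: witt_ring_def wproj_def[of n "g + h"] eval_poly_eq_zeval fun_eq_iff restrict_def)
qed

lemma wproj_mult:
  assumes "dwork g" "dwork h"
  shows "wproj n (g * h) = wproj n g \<otimes>\<^bsub>witt_ring p n A\<^esub> wproj n h"
proof -
  have "\<epsilon> (coords (g * h) i) = zeval A (case_sum (\<lambda>j. \<epsilon> (coords g j)) (\<lambda>j. \<epsilon> (coords h j))) (witt_mult_poly p i)" for i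
    by (rule eps_coords[where c = "(*)" and d = "(*)"])
      (use assms ghost_witt_mult_poly[OF prime_p] class_hom_classD in \<open>auto simp: fun_apply\<close>)
  then show ?thesis using zeval_wproj[OF witt_mult_poly_vars[OF prime_p]]
    by (auto simp: witt_ring_def wproj_def[of n "g * h"] eval_poly_eq_zeval fun_eq_iff restrict_def)
qed

lemma wproj_T: "wproj n (T a) = (\<lambda>i\<in>{..<n}. if i = 0 then \<epsilon> a else \<zero>\<^bsub>A\<^esub>)"
  by (auto simp: wproj_def coords_T fun_eq_iff hom_zero split: nat.split)

lemma wproj_one: "wproj n 1 = \<one>\<^bsub>witt_ring p n A\<^esub>"
  using wproj_T[of n 1] by (auto simp: T_one witt_ring_def hom_one fun_eq_iff restrict_def)

lemma wproj_zero: "wproj n 0 = \<zero>\<^bsub>witt_ring p n A\<^esub>"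
  using wproj_T[of n 0] by (auto simp add: T_zero witt_ring_def hom_zero fun_eq_iff restrict_def)

lemma wproj_T_mult:
  assumes "dwork g"
  shows "wproj n (T a * g) = (\<lambda>i\<in>{..<n}. \<epsilon> a [^]\<^bsub>A\<^esub> (p ^ i) \<otimes>\<^bsub>A\<^esub> wproj n g i)"
  using assms by (auto simp: wproj_def coords_T_mult hom_mult hom_power fun_eq_iff)

lemma wproj_surj:
  assumes "\<epsilon> ` UNIV = carrier A" "w \<in> carrier (witt_ring p n A)"
  obtains g where "dwork g" "wproj n g = w"
proof -
  define s where "s = inv_into UNIV \<epsilon>"
  have s: "\<epsilon> (s a) = a" if "a \<in> carrier A" for a
    unfolding s_def using that assms(1) by (intro f_inv_into_f) simp
  have "wproj n (ghost p (\<lambda>i. s (w i))) = w"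
    using assms(2) s by (auto simp: wproj_def witt_ring_def fun_eq_iff PiE_def extensional_def Pi_def)
  then show ?thesis using that dwork_ghost by blast
qed

end

text \<open>There is one variable for each element of the type; those outside the carrier are sent
  to 0, so that evaluation is a homomorphism on all polynomials.\<close>

lemma exists_witt_hom:
  fixes A :: "('a, 'c) ring_scheme"
  assumes "Factorial_Ring.prime p" "cring A"
  obtains \<epsilon> :: "'a zpoly \<Rightarrow> 'a" where "witt_hom p (zphi p) A \<epsilon>" "\<epsilon> ` UNIV = carrier A"
    "\<forall>a\<in>carrier A. \<epsilon> (zvar a) = a"
proof -
  interpret cring A by fact
  let ?r = "\<lambda>a. if a \<in> carrier A then a else \<zero>\<^bsub>A\<^esub>"
  interpret class_hom A "zeval A ?r" by (rule zeval_class_hom) (use assms in auto)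
  interpret frob_lift p "zphi p :: 'a zpoly \<Rightarrow> _" by (rule frob_lift_zphi) fact
  have 1: "zeval A ?r (zvar a) = a" if "a \<in> carrier A" for a
    using zeval_zvar[OF assms(2), of ?r a] that by simp
  have "witt_hom p (zphi p) A (zeval A ?r)" by unfold_locales
  moreover have "zeval A ?r ` UNIV = carrier A"
  proof (intro equalityI subsetI)
    fix a assume "a \<in> carrier A"
    then show "a \<in> zeval A ?r ` UNIV" by (intro image_eqI[where x = "zvar a"] 1[symmetric] UNIV_I)
  qed blast
  ultimately show ?thesis using 1 by (intro that) auto
qed

text \<open>The ring axioms hold pointwise for ghost vectors and descend along the surjection
  \<open>wproj\<close>, so no identity between operation polynomials has to be checked.\<close>

lemma cring_witt_ring:
  assumes "Factorial_Ring.prime p" "cring A"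
  shows "cring (witt_ring p n A)"
proof -
  obtain \<epsilon> :: "'a zpoly \<Rightarrow> 'a" where e: "witt_hom p (zphi p) A \<epsilon>" "\<epsilon> ` UNIV = carrier A"
    by (rule exists_witt_hom[OF assms])
  interpret witt_hom p "zphi p" A \<epsilon> by (rule e)
  let ?W = "witt_ring p n A"
  have C: "carrier ?W = wproj n ` {g. dwork g}"
    using wproj_surj[OF e(2)] wproj_closed by blast
  note s = wproj_add[symmetric] wproj_mult[symmetric] wproj_one[symmetric] wproj_zero[symmetric]
  show ?thesis
  proof (intro cringI abelian_groupI comm_monoidI)
    fix x assume "x \<in> carrier ?W"
    then obtain g where "dwork g" "x = wproj n g" using C by auto
    then show "\<exists>y\<in>carrier ?W. y \<oplus>\<^bsub>?W\<^esub> x = \<zero>\<^bsub>?W\<^esub>"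
      by (intro bexI[of _ "wproj n (- g)"]) (auto simp: s)
  qed (auto simp: C s algebra_simps)
qed

section \<open>Functoriality, Teichmueller elements and Frobenius on Witt rings\<close>

definition witt_map :: "nat \<Rightarrow> ('a \<Rightarrow> 'b) \<Rightarrow> (nat \<Rightarrow> 'a) \<Rightarrow> nat \<Rightarrow> 'b" where
  "witt_map n h w = (\<lambda>i\<in>{..<n}. h (w i))"

definition witt_teich :: "nat \<Rightarrow> ('a, 'c) ring_scheme \<Rightarrow> 'a \<Rightarrow> nat \<Rightarrow> 'a" where
  "witt_teich n A a = (\<lambda>i\<in>{..<n}. if i = 0 then a else \<zero>\<^bsub>A\<^esub>)"

lemma witt_carrier: "w \<in> carrier (witt_ring p n A) \<longleftrightarrow> w \<in> {..<n} \<rightarrow>\<^sub>E carrier A"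
  by (simp add: witt_ring_def)

lemma ring_hom_pow:
  assumes "h \<in> ring_hom A A'" "cring A" "cring A'" "a \<in> carrier A"
  shows "h (a [^]\<^bsub>A\<^esub> (k::nat)) = h a [^]\<^bsub>A'\<^esub> k"
proof -
  interpret A: cring A by fact
  interpret A': cring A' by fact
  interpret ring_hom_ring A A' h by (rule ring_hom_ringI2) (use assms A.ring_axioms A'.ring_axioms in auto)
  show ?thesis by (rule hom_nat_pow) fact
qed

lemma ring_hom_zero':
  assumes "h \<in> ring_hom A A'" "cring A" "cring A'"
  shows "h \<zero>\<^bsub>A\<^esub> = \<zero>\<^bsub>A'\<^esub>"
proof -
  interpret A: cring A by fact
  interpret A': cring A' by fact
  interpret ring_hom_ring A A' h by (rule ring_hom_ringI2) (use assms A.ring_axioms A'.ring_axioms in auto)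
  show ?thesis by (rule hom_zero)
qed

lemma witt_map_closed:
  assumes "h \<in> ring_hom A A'" "w \<in> carrier (witt_ring p n A)"
  shows "witt_map n h w \<in> carrier (witt_ring p n A')"
  using assms by (auto simp: witt_carrier witt_map_def PiE_def Pi_def dest: ring_hom_closed)

text \<open>A presentation of W_n(A) followed by \<open>h\<close> is a \<open>witt_hom\<close> for
  \<open>A'\<close> on the same ghost vectors, so both projections are additive and multiplicative
  and \<open>witt_map\<close> intertwines them.\<close>

lemma witt_map_hom:
  fixes A :: "('a, 'c) ring_scheme" and A' :: "('b, 'd) ring_scheme"
  assumes "Factorial_Ring.prime p" "cring A" "cring A'" and h: "h \<in> ring_hom A A'"
  shows "witt_map n h \<in> ring_hom (witt_ring p n A) (witt_ring p n A')"
proof -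
  obtain \<epsilon> :: "'a zpoly \<Rightarrow> 'a" where e: "witt_hom p (zphi p) A \<epsilon>" "\<epsilon> ` UNIV = carrier A"
    by (rule exists_witt_hom[OF assms(1,2)])
  interpret witt_hom p "zphi p" A \<epsilon> by (rule e)
  interpret A': cring A' by fact
  interpret w': witt_hom p "zphi p" A' "\<lambda>x. h (\<epsilon> x)"
    by unfold_locales
      (use h in \<open>auto simp: hom_add hom_mult hom_one ring_hom_add ring_hom_mult ring_hom_one ring_hom_closed\<close>)
  have m: "witt_map n h (wproj n g) = w'.wproj n g" for g
    by (auto simp: witt_map_def wproj_def w'.wproj_def)
  show ?thesis
  proof (rule ring_hom_memI)
    fix x y assume xy: "x \<in> carrier (witt_ring p n A)" "y \<in> carrier (witt_ring p n A)"
    obtain g where g: "dwork g" "x = wproj n g" using wproj_surj[OF e(2) xy(1)] by metis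
    obtain k where k: "dwork k" "y = wproj n k" using wproj_surj[OF e(2) xy(2)] by metis
    show "witt_map n h (x \<otimes>\<^bsub>witt_ring p n A\<^esub> y) = witt_map n h x \<otimes>\<^bsub>witt_ring p n A'\<^esub> witt_map n h y"
      using g k by (simp add: wproj_mult[symmetric] m w'.wproj_mult)
    show "witt_map n h (x \<oplus>\<^bsub>witt_ring p n A\<^esub> y) = witt_map n h x \<oplus>\<^bsub>witt_ring p n A'\<^esub> witt_map n h y"
      using g k by (simp add: wproj_add[symmetric] m w'.wproj_add)
  next
    show "witt_map n h \<one>\<^bsub>witt_ring p n A\<^esub> = \<one>\<^bsub>witt_ring p n A'\<^esub>"
      by (simp add: wproj_one[symmetric] m w'.wproj_one)
  qed (rule witt_map_closed[OF h])
qed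

lemma witt_teich_closed: "cring A \<Longrightarrow> a \<in> carrier A \<Longrightarrow> witt_teich n A a \<in> carrier (witt_ring p n A)"
  using cring.cring_simprules(2) by (fastforce simp: witt_carrier witt_teich_def)

lemma witt_teich_mult:
  fixes A :: "('a, 'c) ring_scheme"
  assumes "Factorial_Ring.prime p" "cring A" "a \<in> carrier A" "w \<in> carrier (witt_ring p n A)"
  shows "witt_teich n A a \<otimes>\<^bsub>witt_ring p n A\<^esub> w = (\<lambda>i\<in>{..<n}. a [^]\<^bsub>A\<^esub> (p ^ i) \<otimes>\<^bsub>A\<^esub> w i)"
proof -
  obtain \<epsilon> :: "'a zpoly \<Rightarrow> 'a" where e: "witt_hom p (zphi p) A \<epsilon>" "\<epsilon> ` UNIV = carrier A"
    "\<forall>a\<in>carrier A. \<epsilon> (zvar a) = a"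
    by (rule exists_witt_hom[OF assms(1,2)])
  interpret witt_hom p "zphi p" A \<epsilon> by (rule e)
  obtain g where g: "dwork g" "w = wproj n g" using wproj_surj[OF e(2) assms(4)] by metis
  have "witt_teich n A a = wproj n (T (zvar a))"
    using bspec[OF e(3) assms(3)] by (simp add: wproj_T witt_teich_def fun_eq_iff restrict_def)
  then show ?thesis using g wproj_T_mult[OF g(1), of n "zvar a"] bspec[OF e(3) assms(3)]
    by (simp add: wproj_mult)
qed

text \<open>By \<open>coords_F\<close> the coordinates of \<open>F g\<close> are p-th powers modulo
  \<open>p\<close>, and \<epsilon> kills multiples of \<open>p\<close>. This identifies the shift of
  ghost components with \<open>witt_frob\<close>.\<close>

lemma (in witt_hom) wproj_F:
  assumes "add_pow A p \<one>\<^bsub>A\<^esub> = \<zero>\<^bsub>A\<^esub>" "dwork g"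
  shows "wproj n (F g) = witt_frob p n A (wproj n g)"
proof -
  have e0: "\<epsilon> (of_nat p * x) = \<zero>\<^bsub>A\<^esub>" for x
    using assms(1) hom_of_nat_mult[of p 1] by (simp add: hom_mult hom_one)
  have "\<epsilon> (coords (F g) i) = \<epsilon> (coords g i) [^]\<^bsub>A\<^esub> p" for i
  proof -
    obtain y where "coords (F g) i = coords g i ^ p + of_nat p * y"
      using coords_F[OF assms(2), of i] by (metis dvdE diff_add_cancel add.commute)
    then show ?thesis by (simp add: hom_add hom_power e0)
  qed
  then show ?thesis by (auto simp: wproj_def witt_frob_def)
qed

section \<open>Localizations\<close>

locale mult_set = cring B for B :: "('b, 'c) ring_scheme" (structure) +
  fixes S :: "'b set"
  assumes S_one: "\<one> \<in> S" and S_mult: "s \<in> S \<Longrightarrow> t \<in> S \<Longrightarrow> s \<otimes> t \<in> S" and S_sub: "S \<subseteq> carrier B"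
begin

lemma S_car [simp, intro]: "s \<in> S \<Longrightarrow> s \<in> carrier B" using S_sub by blast

lemma equiv_fraction_rel: "equiv (carrier B \<times> S) (fraction_rel B S)"
proof (rule equivI)
  show "refl_on (carrier B \<times> S) (fraction_rel B S)"
    by (auto simp: refl_on_def fraction_rel_def intro!: S_one bexI[of _ \<one>])
  show "fraction_rel B S \<subseteq> (carrier B \<times> S) \<times> (carrier B \<times> S)" by (auto simp: fraction_rel_def)
  show "sym (fraction_rel B S)" unfolding sym_def fraction_rel_def by auto (metis)
  show "trans (fraction_rel B S)"
  proof (rule transI)
    fix x y z assume "(x, y) \<in> fraction_rel B S" "(y, z) \<in> fraction_rel B S"
    then obtain a s b t c u w w' where xyz: "x = (a, s)" "y = (b, t)" "z = (c, u)"
      and car: "a \<in> carrier B" "b \<in> carrier B" "c \<in> carrier B" "s \<in> S" "t \<in> S" "u \<in> S" "w \<in> S" "w' \<in> S"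
      and eq: "w \<otimes> (a \<otimes> t) = w \<otimes> (b \<otimes> s)" "w' \<otimes> (b \<otimes> u) = w' \<otimes> (c \<otimes> t)"
      unfolding fraction_rel_def by auto
    \<comment> \<open>The middle denominator t belongs to the witness, since it is the factor
      through which the two given equations are compared.\<close>
    have "(w \<otimes> w' \<otimes> t) \<otimes> (a \<otimes> u) = (w \<otimes> (a \<otimes> t)) \<otimes> (w' \<otimes> u)" using car by (simp add: m_ac)
    also have "\<dots> = (w' \<otimes> (b \<otimes> u)) \<otimes> (w \<otimes> s)" unfolding eq(1) using car by (simp add: m_ac)
    also have "\<dots> = (w \<otimes> w' \<otimes> t) \<otimes> (c \<otimes> s)" unfolding eq(2) using car by (simp add: m_ac)
    finally show "(x, z) \<in> fraction_rel B S"
      unfolding xyz fraction_rel_def using car S_mult by blast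
  qed
qed

lemma fraction_eq_iff:
  assumes "a \<in> carrier B" "s \<in> S" "b \<in> carrier B" "t \<in> S"
  shows "fraction B S a s = fraction B S b t \<longleftrightarrow> (\<exists>w\<in>S. w \<otimes> (a \<otimes> t) = w \<otimes> (b \<otimes> s))"
  unfolding fraction_def
  by (subst eq_equiv_class_iff[OF equiv_fraction_rel]) (use assms in \<open>auto simp: fraction_rel_def\<close>)

lemma fraction_self: "a \<in> carrier B \<Longrightarrow> s \<in> S \<Longrightarrow> (a, s) \<in> fraction B S a s"
  by (auto simp: fraction_def fraction_rel_def intro: S_one)

lemma fraction_mem:
  assumes "(b, t) \<in> fraction B S a s"
  shows "b \<in> carrier B \<and> t \<in> S \<and> fraction B S b t = fraction B S a s"
  using assms equiv_class_eq[OF equiv_fraction_rel, of "(a, s)" "(b, t)"]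
  by (auto simp: fraction_def fraction_rel_def)

lemma carrier_loc: "carrier (localization B S) = {fraction B S a s | a s. a \<in> carrier B \<and> s \<in> S}"
  by (auto simp: localization_def quotient_def fraction_def)

lemma fraction_closed [simp, intro]: "a \<in> carrier B \<Longrightarrow> s \<in> S \<Longrightarrow> fraction B S a s \<in> carrier (localization B S)"
  by (auto simp: carrier_loc)

text \<open>The operations of \<open>localization\<close> are unions over all representatives; when
  \<open>G\<close> takes the same value on all of them, the union collapses to that value.\<close>

lemma fraction_UN:
  assumes "a \<in> carrier B" "s \<in> S" "b \<in> carrier B" "t \<in> S"
    and "\<And>a' s' b' t'. (a', s') \<in> fraction B S a s \<Longrightarrow> (b', t') \<in> fraction B S b t \<Longrightarrow> G a' s' b' t' = G a s b t"
  shows "(\<Union>(a', s')\<in>fraction B S a s. \<Union>(b', t')\<in>fraction B S b t. G a' s' b' t') = G a s b t"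
proof -
  have "(\<Union>(a', s')\<in>fraction B S a s. \<Union>(b', t')\<in>fraction B S b t. G a' s' b' t')
    = (\<Union>x\<in>fraction B S a s. \<Union>y\<in>fraction B S b t. G a s b t)"
    by (intro SUP_cong refl) (auto simp: assms(5) split: prod.split)
  then show ?thesis using fraction_self[OF assms(1,2)] fraction_self[OF assms(3,4)] by auto
qed

lemma fraction_mult:
  assumes "a \<in> carrier B" "s \<in> S" "b \<in> carrier B" "t \<in> S"
  shows "fraction B S a s \<otimes>\<^bsub>localization B S\<^esub> fraction B S b t = fraction B S (a \<otimes> b) (s \<otimes> t)"
  unfolding localization_def monoid.simps
proof (rule fraction_UN[OF assms])
  fix a' s' b' t' assume "(a', s') \<in> fraction B S a s" "(b', t') \<in> fraction B S b t"
  from this[THEN fraction_mem] obtain w w' where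
    car: "a' \<in> carrier B" "s' \<in> S" "b' \<in> carrier B" "t' \<in> S" "w \<in> S" "w' \<in> S"
    and eq: "w \<otimes> (a' \<otimes> s) = w \<otimes> (a \<otimes> s')" "w' \<otimes> (b' \<otimes> t) = w' \<otimes> (b \<otimes> t')"
    using fraction_eq_iff assms by metis
  have "(w \<otimes> w') \<otimes> ((a' \<otimes> b') \<otimes> (s \<otimes> t)) = (w \<otimes> (a' \<otimes> s)) \<otimes> (w' \<otimes> (b' \<otimes> t))"
    using car assms by (simp add: m_ac)
  also have "\<dots> = (w \<otimes> w') \<otimes> ((a \<otimes> b) \<otimes> (s' \<otimes> t'))"
    unfolding eq using car assms by (simp add: m_ac)
  finally show "fraction B S (a' \<otimes> b') (s' \<otimes> t') = fraction B S (a \<otimes> b) (s \<otimes> t)"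
    using car assms S_mult by (subst fraction_eq_iff) auto
qed

lemma fraction_add:
  assumes "a \<in> carrier B" "s \<in> S" "b \<in> carrier B" "t \<in> S"
  shows "fraction B S a s \<oplus>\<^bsub>localization B S\<^esub> fraction B S b t = fraction B S (a \<otimes> t \<oplus> b \<otimes> s) (s \<otimes> t)"
  unfolding localization_def ring.simps
proof (rule fraction_UN[OF assms])
  fix a' s' b' t' assume "(a', s') \<in> fraction B S a s" "(b', t') \<in> fraction B S b t"
  from this[THEN fraction_mem] obtain w w' where
    car: "a' \<in> carrier B" "s' \<in> S" "b' \<in> carrier B" "t' \<in> S" "w \<in> S" "w' \<in> S"
    and eq: "w \<otimes> (a' \<otimes> s) = w \<otimes> (a \<otimes> s')" "w' \<otimes> (b' \<otimes> t) = w' \<otimes> (b \<otimes> t')"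
    using fraction_eq_iff assms by metis
  have "(w \<otimes> w') \<otimes> ((a' \<otimes> t' \<oplus> b' \<otimes> s') \<otimes> (s \<otimes> t))
      = (w \<otimes> (a' \<otimes> s)) \<otimes> (w' \<otimes> t' \<otimes> t) \<oplus> (w' \<otimes> (b' \<otimes> t)) \<otimes> (w \<otimes> s' \<otimes> s)"
    using car assms by (simp add: m_ac r_distr l_distr)
  also have "\<dots> = (w \<otimes> w') \<otimes> ((a \<otimes> t \<oplus> b \<otimes> s) \<otimes> (s' \<otimes> t'))"
    unfolding eq using car assms by (simp add: m_ac r_distr l_distr)
  finally show "fraction B S (a' \<otimes> t' \<oplus> b' \<otimes> s') (s' \<otimes> t') = fraction B S (a \<otimes> t \<oplus> b \<otimes> s) (s \<otimes> t)"
    using car assms S_mult by (subst fraction_eq_iff) auto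
qed

lemma fraction_zero: "\<zero>\<^bsub>localization B S\<^esub> = fraction B S \<zero> \<one>"
  and fraction_one: "\<one>\<^bsub>localization B S\<^esub> = fraction B S \<one> \<one>"
  by (simp_all add: localization_def)

lemma fraction_eqI:
  assumes "a \<in> carrier B" "s \<in> S" "b \<in> carrier B" "t \<in> S" "a \<otimes> t = b \<otimes> s"
  shows "fraction B S a s = fraction B S b t"
  using assms fraction_eq_iff[OF assms(1-4)] S_one by metis

lemma cring_localization: "cring (localization B S)"
proof -
  let ?L = "localization B S"
  note s = fraction_add fraction_mult fraction_zero fraction_one S_mult S_one
  have ax: "(x \<oplus>\<^bsub>?L\<^esub> y) \<oplus>\<^bsub>?L\<^esub> z = x \<oplus>\<^bsub>?L\<^esub> (y \<oplus>\<^bsub>?L\<^esub> z) \<and> x \<oplus>\<^bsub>?L\<^esub> y = y \<oplus>\<^bsub>?L\<^esub> x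
      \<and> (x \<otimes>\<^bsub>?L\<^esub> y) \<otimes>\<^bsub>?L\<^esub> z = x \<otimes>\<^bsub>?L\<^esub> (y \<otimes>\<^bsub>?L\<^esub> z) \<and> x \<otimes>\<^bsub>?L\<^esub> y = y \<otimes>\<^bsub>?L\<^esub> x
      \<and> (x \<oplus>\<^bsub>?L\<^esub> y) \<otimes>\<^bsub>?L\<^esub> z = x \<otimes>\<^bsub>?L\<^esub> z \<oplus>\<^bsub>?L\<^esub> y \<otimes>\<^bsub>?L\<^esub> z"
    if xyz: "x \<in> carrier ?L" "y \<in> carrier ?L" "z \<in> carrier ?L" for x y z
  proof -
    obtain a s b t c u where e: "x = fraction B S a s" "y = fraction B S b t" "z = fraction B S c u"
      and c: "a \<in> carrier B" "s \<in> S" "b \<in> carrier B" "t \<in> S" "c \<in> carrier B" "u \<in> S"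
      using xyz unfolding carrier_loc by blast
    show ?thesis unfolding e using c
      by (simp add: s, intro conjI) (rule fraction_eqI; simp add: s l_distr r_distr m_ac a_ac)+
  qed
  show ?thesis
  proof (intro cringI abelian_groupI comm_monoidI)
    fix x assume "x \<in> carrier ?L"
    then obtain a s where x: "x = fraction B S a s" "a \<in> carrier B" "s \<in> S" by (auto simp: carrier_loc)
    have "fraction B S (\<ominus> a) s \<oplus>\<^bsub>?L\<^esub> x = \<zero>\<^bsub>?L\<^esub>"
      using x by (simp add: s) (rule fraction_eqI; simp add: s l_minus l_neg)
    then show "\<exists>y\<in>carrier ?L. y \<oplus>\<^bsub>?L\<^esub> x = \<zero>\<^bsub>?L\<^esub>" using x by blast
    show "\<zero>\<^bsub>?L\<^esub> \<oplus>\<^bsub>?L\<^esub> x = x" "\<one>\<^bsub>?L\<^esub> \<otimes>\<^bsub>?L\<^esub> x = x"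
      using x by (simp_all add: s)
  next
    fix x y assume "x \<in> carrier ?L" "y \<in> carrier ?L"
    then obtain a s b t where e: "x = fraction B S a s" "y = fraction B S b t"
      and c: "a \<in> carrier B" "s \<in> S" "b \<in> carrier B" "t \<in> S"
      unfolding carrier_loc by blast
    show "x \<oplus>\<^bsub>?L\<^esub> y \<in> carrier ?L" "x \<otimes>\<^bsub>?L\<^esub> y \<in> carrier ?L"
      unfolding e using c by (simp_all add: s fraction_closed)
  next
    show "\<zero>\<^bsub>?L\<^esub> \<in> carrier ?L" "\<one>\<^bsub>?L\<^esub> \<in> carrier ?L" by (simp_all add: s fraction_closed)
  qed (use ax in blast)+
qed

end

section \<open>Quasi-F-splittings of local affine schemes\<close>

text \<open>A splitting on the Witt ring of a single ring, with the two module structures of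
  \<open>quasi_F_split\<close> written out.\<close>

definition qfs_map :: "nat \<Rightarrow> nat \<Rightarrow> ('b, 'c) ring_scheme \<Rightarrow> ((nat \<Rightarrow> 'b) \<Rightarrow> 'b) \<Rightarrow> bool" where
  "qfs_map p n B \<psi> \<longleftrightarrow>
     \<psi> \<in> carrier (witt_ring p n B) \<rightarrow> carrier B \<and>
     (\<forall>x\<in>carrier (witt_ring p n B). \<forall>y\<in>carrier (witt_ring p n B).
        \<psi> (x \<oplus>\<^bsub>witt_ring p n B\<^esub> y) = \<psi> x \<oplus>\<^bsub>B\<^esub> \<psi> y) \<and>
     (\<forall>a\<in>carrier (witt_ring p n B). \<forall>x\<in>carrier (witt_ring p n B).
        \<psi> (witt_frob p n B a \<otimes>\<^bsub>witt_ring p n B\<^esub> x) = a 0 \<otimes>\<^bsub>B\<^esub> \<psi> x) \<and>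
     (\<forall>w\<in>carrier (witt_ring p n B). \<psi> (witt_frob p n B w) = w 0)"

lemma qfs_map_eq:
  "qfs_map p n B \<psi> \<longleftrightarrow>
     \<psi> \<in> module_homs (witt_ring p n B) (restrict_scalars (witt_frob p n B) (witt_ring p n B)) (restrict_scalars witt_res B) \<and>
     (\<forall>w\<in>carrier (witt_ring p n B). \<psi> (witt_frob p n B w) = witt_res w)"
  unfolding qfs_map_def module_homs_def restrict_scalars_def witt_res_def by auto

lemma quasi_F_split_iff:
  "quasi_F_split p n X \<longleftrightarrow>
     (\<exists>\<phi>. (\<forall>U. openin (top_of X) U \<longrightarrow> qfs_map p n (sections X U) (\<phi> U)) \<and>
        (\<forall>U V. openin (top_of X) U \<longrightarrow> openin (top_of X) V \<longrightarrow> V \<subseteq> U \<longrightarrow>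
           (\<forall>w\<in>carrier (witt_ring p n (sections X U)).
              \<phi> V (witt_map n (restr X U V) w) = restr X U V (\<phi> U w))))"
  unfolding quasi_F_split_def qfs_map_eq witt_map_def imp_conjR all_conj_distrib by (simp only: conj_ac)

section \<open>Stalks and sections of the structure sheaf\<close>

context cring
begin

lemma prime_mult_set:
  assumes "primeideal P R" shows "mult_set R (carrier R - P)"
proof -
  interpret primeideal P R by fact
  have "\<one> \<notin> P" using I_notcarr one_imp_carrier by blast
  then show ?thesis by unfold_locales (use I_prime in auto)
qed

lemma open_prime: "openin (zariski R) U \<Longrightarrow> P \<in> U \<Longrightarrow> primeideal P R"
  unfolding openin_zariski zariski_open_def by auto

lemma cring_loc: "primeideal P R \<Longrightarrow> cring (localization_at R P)"
  by (rule mult_set.cring_localization[OF prime_mult_set])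

definition to_loc :: "'a set \<Rightarrow> 'a \<Rightarrow> ('a \<times> 'a) set" where
  "to_loc P a = fraction R (carrier R - P) a \<one>"

lemma to_loc_hom:
  assumes "primeideal P R" shows "to_loc P \<in> ring_hom R (localization_at R P)"
proof -
  interpret mult_set R "carrier R - P" by (rule prime_mult_set) fact
  show ?thesis
    by (rule ring_hom_memI) (use S_one in \<open>auto simp: to_loc_def fraction_mult fraction_add fraction_one\<close>)
qed

lemma to_loc_eq_iff:
  assumes "primeideal P R" "a \<in> carrier R" "b \<in> carrier R"
  shows "to_loc P a = to_loc P b \<longleftrightarrow> (\<exists>w\<in>carrier R - P. w \<otimes> a = w \<otimes> b)"
proof -
  interpret mult_set R "carrier R - P" by (rule prime_mult_set) fact
  show ?thesis unfolding to_loc_def using S_one assms by (subst fraction_eq_iff) auto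
qed

lemma to_loc_mult_fraction:
  assumes "primeideal P R" "a \<in> carrier R" "s \<in> carrier R - P"
  shows "to_loc P s \<otimes>\<^bsub>localization_at R P\<^esub> fraction R (carrier R - P) a s = to_loc P a"
proof -
  interpret mult_set R "carrier R - P" by (rule prime_mult_set) fact
  have "fraction R (carrier R - P) (s \<otimes> a) (\<one> \<otimes> s) = fraction R (carrier R - P) a \<one>"
    by (rule fraction_eqI) (use assms S_one in \<open>auto simp: m_ac\<close>)
  then show ?thesis unfolding to_loc_def using assms S_one by (simp add: fraction_mult)
qed

text \<open>The image of \<open>s\<close> is a unit in the stalk, so it can be divided out. Values
  in stalks are recognised this way.\<close>

lemma fraction_unique:
  assumes "primeideal P R" "a \<in> carrier R" "s \<in> carrier R - P" "y \<in> carrier (localization_at R P)"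
    and "to_loc P s \<otimes>\<^bsub>localization_at R P\<^esub> y = to_loc P a"
  shows "y = fraction R (carrier R - P) a s"
proof -
  interpret mult_set R "carrier R - P" by (rule prime_mult_set) fact
  obtain b t where y: "y = fraction R (carrier R - P) b t" "b \<in> carrier R" "t \<in> carrier R - P"
    using assms(4) unfolding carrier_loc by blast
  have "fraction R (carrier R - P) (s \<otimes> b) (\<one> \<otimes> t) = fraction R (carrier R - P) a \<one>"
    using assms(5) y assms S_one by (simp add: to_loc_def fraction_mult)
  then obtain w where w: "w \<in> carrier R - P" "w \<otimes> ((s \<otimes> b) \<otimes> \<one>) = w \<otimes> (a \<otimes> (\<one> \<otimes> t))"
    using y assms S_one S_mult by (subst (asm) fraction_eq_iff) auto
  then have "w \<otimes> (b \<otimes> s) = w \<otimes> (a \<otimes> t)" using y assms by (simp add: m_ac)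
  then show ?thesis unfolding y(1) using w y assms by (subst fraction_eq_iff) auto
qed

lemma sections_mem:
  "s \<in> carrier (spec_sections R U) \<longleftrightarrow> s \<in> (\<Pi>\<^sub>E P\<in>U. carrier (localization_at R P)) \<and>
     (\<forall>P\<in>U. \<exists>V a b. openin (zariski R) V \<and> P \<in> V \<and> V \<subseteq> U \<and> a \<in> carrier R \<and> b \<in> carrier R \<and>
          (\<forall>Q\<in>V. b \<notin> Q \<and> s Q = fraction R (carrier R - Q) a b))"
  by (simp add: spec_sections_def)

lemma sections_ops:
  "\<zero>\<^bsub>spec_sections R U\<^esub> = (\<lambda>P\<in>U. \<zero>\<^bsub>localization_at R P\<^esub>)"
  "\<one>\<^bsub>spec_sections R U\<^esub> = (\<lambda>P\<in>U. \<one>\<^bsub>localization_at R P\<^esub>)"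
  "s \<oplus>\<^bsub>spec_sections R U\<^esub> t = (\<lambda>P\<in>U. s P \<oplus>\<^bsub>localization_at R P\<^esub> t P)"
  "s \<otimes>\<^bsub>spec_sections R U\<^esub> t = (\<lambda>P\<in>U. s P \<otimes>\<^bsub>localization_at R P\<^esub> t P)"
  by (simp_all add: spec_sections_def)

lemma sections_closed_eqI:
  assumes "s \<in> carrier (spec_sections R U)" "t \<in> carrier (spec_sections R U)" "\<And>P. P \<in> U \<Longrightarrow> s P = t P"
  shows "s = t"
  using assms unfolding sections_mem by (auto intro: PiE_ext)

lemma sectionsI:
  assumes U: "openin (zariski R) U" and ext: "s \<in> extensional U"
    and loc: "\<And>P. P \<in> U \<Longrightarrow> \<exists>V a b. openin (zariski R) V \<and> P \<in> V \<and> V \<subseteq> U \<and> a \<in> carrier R \<and> b \<in> carrier R \<and>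
          (\<forall>Q\<in>V. b \<notin> Q \<and> s Q = fraction R (carrier R - Q) a b)"
  shows "s \<in> carrier (spec_sections R U)"
proof -
  have "s P \<in> carrier (localization_at R P)" if P: "P \<in> U" for P
  proof -
    interpret mult_set R "carrier R - P" by (rule prime_mult_set) (rule open_prime[OF U P])
    from loc[OF P] obtain a b where "a \<in> carrier R" "b \<in> carrier R" "b \<notin> P" "s P = fraction R (carrier R - P) a b"
      by blast
    then show ?thesis by (simp add: fraction_closed)
  qed
  then show ?thesis unfolding sections_mem using ext loc by (auto simp: PiE_def)
qed

lemma sections_local:
  assumes "s \<in> carrier (spec_sections R U)" "P \<in> U"
  obtains V a b where "openin (zariski R) V" "P \<in> V" "V \<subseteq> U" "a \<in> carrier R" "b \<in> carrier R"
    "\<forall>Q\<in>V. b \<notin> Q \<and> s Q = fraction R (carrier R - Q) a b"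
  using assms unfolding sections_mem by meson

lemma const_section:
  assumes U: "openin (zariski R) U" and a: "a \<in> carrier R"
  shows "(\<lambda>P\<in>U. to_loc P a) \<in> carrier (spec_sections R U)"
proof (rule sectionsI[OF U])
  fix P assume P: "P \<in> U"
  have "\<forall>Q\<in>U. \<one> \<notin> Q \<and> (\<lambda>P\<in>U. to_loc P a) Q = fraction R (carrier R - Q) a \<one>"
    using mult_set.S_one[OF prime_mult_set[OF open_prime[OF U]]] by (auto simp: to_loc_def)
  then show "\<exists>V c b. openin (zariski R) V \<and> P \<in> V \<and> V \<subseteq> U \<and> c \<in> carrier R \<and> b \<in> carrier R \<and>
      (\<forall>Q\<in>V. b \<notin> Q \<and> (\<lambda>P\<in>U. to_loc P a) Q = fraction R (carrier R - Q) c b)"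
    using U P a by blast
qed simp

lemma
  assumes U: "openin (zariski R) U"
    and s: "s \<in> carrier (spec_sections R U)" and t: "t \<in> carrier (spec_sections R U)"
  shows sections_add_closed: "s \<oplus>\<^bsub>spec_sections R U\<^esub> t \<in> carrier (spec_sections R U)"
    and sections_mult_closed: "s \<otimes>\<^bsub>spec_sections R U\<^esub> t \<in> carrier (spec_sections R U)"
proof -
  have *: "\<exists>V a b c d. openin (zariski R) V \<and> P \<in> V \<and> V \<subseteq> U \<and> a \<in> carrier R \<and> b \<in> carrier R \<and>
      c \<in> carrier R \<and> d \<in> carrier R \<and> (\<forall>Q\<in>V. b \<otimes> d \<notin> Q \<and>
        s Q \<oplus>\<^bsub>localization_at R Q\<^esub> t Q = fraction R (carrier R - Q) (a \<otimes> d \<oplus> c \<otimes> b) (b \<otimes> d) \<and>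
        s Q \<otimes>\<^bsub>localization_at R Q\<^esub> t Q = fraction R (carrier R - Q) (a \<otimes> c) (b \<otimes> d))" if P: "P \<in> U" for P
  proof -
    obtain V a b where V: "openin (zariski R) V" "P \<in> V" "V \<subseteq> U" "a \<in> carrier R" "b \<in> carrier R"
      "\<forall>Q\<in>V. b \<notin> Q \<and> s Q = fraction R (carrier R - Q) a b" by (rule sections_local[OF s P])
    obtain W c d where W: "openin (zariski R) W" "P \<in> W" "W \<subseteq> U" "c \<in> carrier R" "d \<in> carrier R"
      "\<forall>Q\<in>W. d \<notin> Q \<and> t Q = fraction R (carrier R - Q) c d" by (rule sections_local[OF t P])
    have "b \<otimes> d \<notin> Q \<and>
        s Q \<oplus>\<^bsub>localization_at R Q\<^esub> t Q = fraction R (carrier R - Q) (a \<otimes> d \<oplus> c \<otimes> b) (b \<otimes> d) \<and>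
        s Q \<otimes>\<^bsub>localization_at R Q\<^esub> t Q = fraction R (carrier R - Q) (a \<otimes> c) (b \<otimes> d)" if Q: "Q \<in> V \<inter> W" for Q
    proof -
      interpret mult_set R "carrier R - Q" by (rule prime_mult_set) (use open_prime[OF V(1)] Q in blast)
      show ?thesis using V W Q S_mult[of b d] by (auto simp: fraction_add fraction_mult)
    qed
    note A = this
    have "openin (zariski R) (V \<inter> W)" "P \<in> V \<inter> W" "V \<inter> W \<subseteq> U" using V(1-3) W(1-3) by auto
    then show ?thesis
      by (intro exI[of _ "V \<inter> W"] exI[of _ a] exI[of _ b] exI[of _ c] exI[of _ d])
        (intro conjI ballI A[THEN conjunct1] A[THEN conjunct2, THEN conjunct1] A[THEN conjunct2, THEN conjunct2] V(4,5) W(4,5))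
  qed
  show "s \<oplus>\<^bsub>spec_sections R U\<^esub> t \<in> carrier (spec_sections R U)"
  proof (rule sectionsI[OF U])
    fix P assume P: "P \<in> U"
    obtain V a b c d where V: "openin (zariski R) V" "P \<in> V" "V \<subseteq> U" and c: "a \<in> carrier R" "b \<in> carrier R"
      "c \<in> carrier R" "d \<in> carrier R" and f: "\<forall>Q\<in>V. b \<otimes> d \<notin> Q \<and>
        s Q \<oplus>\<^bsub>localization_at R Q\<^esub> t Q = fraction R (carrier R - Q) (a \<otimes> d \<oplus> c \<otimes> b) (b \<otimes> d) \<and>
        s Q \<otimes>\<^bsub>localization_at R Q\<^esub> t Q = fraction R (carrier R - Q) (a \<otimes> c) (b \<otimes> d)"
      using *[OF P] by blast
    have "\<forall>Q\<in>V. b \<otimes> d \<notin> Q \<and> (s \<oplus>\<^bsub>spec_sections R U\<^esub> t) Q = fraction R (carrier R - Q) (a \<otimes> d \<oplus> c \<otimes> b) (b \<otimes> d)"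
      using f V(3) by (simp add: sections_ops subset_iff)
    then show "\<exists>V a b. openin (zariski R) V \<and> P \<in> V \<and> V \<subseteq> U \<and> a \<in> carrier R \<and> b \<in> carrier R \<and>
          (\<forall>Q\<in>V. b \<notin> Q \<and> (s \<oplus>\<^bsub>spec_sections R U\<^esub> t) Q = fraction R (carrier R - Q) a b)"
      by (intro exI[of _ V] exI[of _ "a \<otimes> d \<oplus> c \<otimes> b"] exI[of _ "b \<otimes> d"] conjI V) (use c in simp_all)
  qed (simp add: sections_ops)
  show "s \<otimes>\<^bsub>spec_sections R U\<^esub> t \<in> carrier (spec_sections R U)"
  proof (rule sectionsI[OF U])
    fix P assume P: "P \<in> U"
    obtain V a b c d where V: "openin (zariski R) V" "P \<in> V" "V \<subseteq> U" and c: "a \<in> carrier R" "b \<in> carrier R"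
      "c \<in> carrier R" "d \<in> carrier R" and f: "\<forall>Q\<in>V. b \<otimes> d \<notin> Q \<and>
        s Q \<oplus>\<^bsub>localization_at R Q\<^esub> t Q = fraction R (carrier R - Q) (a \<otimes> d \<oplus> c \<otimes> b) (b \<otimes> d) \<and>
        s Q \<otimes>\<^bsub>localization_at R Q\<^esub> t Q = fraction R (carrier R - Q) (a \<otimes> c) (b \<otimes> d)"
      using *[OF P] by blast
    have "\<forall>Q\<in>V. b \<otimes> d \<notin> Q \<and> (s \<otimes>\<^bsub>spec_sections R U\<^esub> t) Q = fraction R (carrier R - Q) (a \<otimes> c) (b \<otimes> d)"
      using f V(3) by (simp add: sections_ops subset_iff)
    then show "\<exists>V a b. openin (zariski R) V \<and> P \<in> V \<and> V \<subseteq> U \<and> a \<in> carrier R \<and> b \<in> carrier R \<and>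
          (\<forall>Q\<in>V. b \<notin> Q \<and> (s \<otimes>\<^bsub>spec_sections R U\<^esub> t) Q = fraction R (carrier R - Q) a b)"
      by (intro exI[of _ V] exI[of _ "a \<otimes> c"] exI[of _ "b \<otimes> d"] conjI V) (use c in simp_all)
  qed (simp add: sections_ops)
qed

lemma section_stalk: "s \<in> carrier (spec_sections R U) \<Longrightarrow> P \<in> U \<Longrightarrow> s P \<in> carrier (localization_at R P)"
  unfolding sections_mem by blast

lemma cring_sections:
  assumes U: "openin (zariski R) U"
  shows "cring (spec_sections R U)"
proof -
  let ?O = "spec_sections R U"
  note cl = sections_add_closed[OF U] sections_mult_closed[OF U]
  have L: "cring (localization_at R P)" if "P \<in> U" for P using cring_loc[OF open_prime[OF U that]] .
  have const: "\<zero>\<^bsub>?O\<^esub> = (\<lambda>P\<in>U. to_loc P \<zero>)" "\<one>\<^bsub>?O\<^esub> = (\<lambda>P\<in>U. to_loc P \<one>)"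
    using L ring_hom_zero'[OF to_loc_hom is_cring] ring_hom_one[OF to_loc_hom] open_prime[OF U]
    by (auto simp: sections_ops intro!: restrict_ext)
  have 01: "\<zero>\<^bsub>?O\<^esub> \<in> carrier ?O" "\<one>\<^bsub>?O\<^esub> \<in> carrier ?O" unfolding const by (auto intro: const_section[OF U])
  have ax: "(x \<oplus>\<^bsub>?O\<^esub> y) \<oplus>\<^bsub>?O\<^esub> z = x \<oplus>\<^bsub>?O\<^esub> (y \<oplus>\<^bsub>?O\<^esub> z) \<and> x \<oplus>\<^bsub>?O\<^esub> y = y \<oplus>\<^bsub>?O\<^esub> x
      \<and> (x \<otimes>\<^bsub>?O\<^esub> y) \<otimes>\<^bsub>?O\<^esub> z = x \<otimes>\<^bsub>?O\<^esub> (y \<otimes>\<^bsub>?O\<^esub> z) \<and> x \<otimes>\<^bsub>?O\<^esub> y = y \<otimes>\<^bsub>?O\<^esub> x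
      \<and> (x \<oplus>\<^bsub>?O\<^esub> y) \<otimes>\<^bsub>?O\<^esub> z = x \<otimes>\<^bsub>?O\<^esub> z \<oplus>\<^bsub>?O\<^esub> y \<otimes>\<^bsub>?O\<^esub> z"
    if xyz: "x \<in> carrier ?O" "y \<in> carrier ?O" "z \<in> carrier ?O" for x y z
    unfolding sections_ops
    by (intro conjI restrict_ext)
      (use xyz[THEN section_stalk] L in \<open>auto simp: cring.cring_simprules\<close>)
  show ?thesis
  proof (intro cringI abelian_groupI comm_monoidI)
    fix x assume x: "x \<in> carrier ?O"
    show "\<zero>\<^bsub>?O\<^esub> \<oplus>\<^bsub>?O\<^esub> x = x"
      by (rule sections_closed_eqI[where U = U]) (intro cl x 01, rule x, simp add: sections_ops cring.cring_simprules(8)[OF L] monoid.l_one[OF ring.is_monoid[OF cring.axioms(1)[OF L]]] section_stalk[OF x])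
    show "\<one>\<^bsub>?O\<^esub> \<otimes>\<^bsub>?O\<^esub> x = x"
      by (rule sections_closed_eqI[where U = U]) (intro cl x 01, rule x, simp add: sections_ops cring.cring_simprules(8)[OF L] monoid.l_one[OF ring.is_monoid[OF cring.axioms(1)[OF L]]] section_stalk[OF x])
    \<comment> \<open>The negative of \<open>x\<close> is its product with the constant section -1,
      which is known to be a section; this avoids a separate local argument for negatives.\<close>
    let ?m = "(\<lambda>P\<in>U. to_loc P (\<ominus> \<one>)) \<otimes>\<^bsub>?O\<^esub> x"
    have m: "?m \<in> carrier ?O" by (intro cl const_section[OF U] x) auto
    have "?m \<oplus>\<^bsub>?O\<^esub> x = \<zero>\<^bsub>?O\<^esub>"
    proof (intro sections_closed_eqI[OF cl(1)[OF m x] 01(1)])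
      fix P assume P: "P \<in> U"
      interpret L: cring "localization_at R P" by (rule L[OF P])
      note h = to_loc_hom[OF open_prime[OF U P]]
      have "to_loc P (\<ominus> \<one>) \<oplus>\<^bsub>localization_at R P\<^esub> \<one>\<^bsub>localization_at R P\<^esub> = \<zero>\<^bsub>localization_at R P\<^esub>"
        using ring_hom_add[OF h, of "\<ominus> \<one>" \<one>] ring_hom_zero'[OF h is_cring L.is_cring] ring_hom_one[OF h]
        by (simp add: l_neg)
      then have "(to_loc P (\<ominus> \<one>) \<oplus>\<^bsub>localization_at R P\<^esub> \<one>\<^bsub>localization_at R P\<^esub>) \<otimes>\<^bsub>localization_at R P\<^esub> x P = \<zero>\<^bsub>localization_at R P\<^esub>"
        using section_stalk[OF x P] by simp
      then show "(?m \<oplus>\<^bsub>?O\<^esub> x) P = \<zero>\<^bsub>?O\<^esub> P"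
        using section_stalk[OF x P] P ring_hom_closed[OF h, of "\<ominus> \<one>"] by (simp add: sections_ops L.l_distr)
    qed
    then show "\<exists>y\<in>carrier ?O. y \<oplus>\<^bsub>?O\<^esub> x = \<zero>\<^bsub>?O\<^esub>" using m by blast
  qed ((rule cl 01; assumption?) | (use ax in blast))+
qed

lemma stalk_hom:
  assumes "openin (zariski R) U" "P \<in> U"
  shows "(\<lambda>s. s P) \<in> ring_hom (spec_sections R U) (localization_at R P)"
  by (rule ring_hom_memI) (use assms section_stalk in \<open>auto simp: sections_ops\<close>)

lemma const_hom:
  assumes "openin (zariski R) U"
  shows "(\<lambda>a. \<lambda>P\<in>U. to_loc P a) \<in> ring_hom R (spec_sections R U)"
proof -
  note h = to_loc_hom[OF open_prime[OF assms]]
  show ?thesis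
    by (rule ring_hom_memI)
      (use assms const_section in
        \<open>simp_all add: sections_ops ring_hom_add[OF h] ring_hom_mult[OF h] ring_hom_one[OF h] cong: restrict_cong\<close>)
qed

end

lemma witt_frob_teich:
  assumes "cring A" "a \<in> carrier A" "p > 0"
  shows "witt_frob p n A (witt_teich n A a) = witt_teich n A (a [^]\<^bsub>A\<^esub> p)"
proof -
  interpret cring A by fact
  show ?thesis using assms by (auto simp: witt_frob_def witt_teich_def fun_eq_iff nat_pow_zero)
qed

lemma witt_frob_closed: "cring A \<Longrightarrow> w \<in> carrier (witt_ring p n A) \<Longrightarrow> witt_frob p n A w \<in> carrier (witt_ring p n A)"
  using monoid.nat_pow_closed[OF ring.is_monoid[OF cring.axioms(1)]]
  by (fastforce simp: witt_carrier witt_frob_def)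

lemma witt_frob_map:
  assumes "h \<in> ring_hom A A'" "cring A" "cring A'" "w \<in> carrier (witt_ring p n A)"
  shows "witt_map n h (witt_frob p n A w) = witt_frob p n A' (witt_map n h w)"
  using assms(4) ring_hom_pow[OF assms(1-3)]
  by (auto simp: witt_map_def witt_frob_def fun_eq_iff witt_carrier PiE_iff)

lemma witt_teich_map:
  assumes "h \<in> ring_hom A A'" "cring A" "cring A'"
  shows "witt_map n h (witt_teich n A a) = witt_teich n A' (h a)"
  using ring_hom_zero'[OF assms] by (auto simp: witt_map_def witt_teich_def)

lemma witt_teich_mult_teich:
  assumes "Factorial_Ring.prime p" "cring A" "a \<in> carrier A" "b \<in> carrier A"
  shows "witt_teich n A a \<otimes>\<^bsub>witt_ring p n A\<^esub> witt_teich n A b = witt_teich n A (a \<otimes>\<^bsub>A\<^esub> b)"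
proof -
  interpret cring A by fact
  show ?thesis using assms(3,4)
    unfolding witt_teich_mult[OF assms(1-3) witt_teich_closed[OF assms(2,4)]]
    by (auto simp: witt_teich_def fun_eq_iff)
qed

lemma witt_frob_teich_mult:
  assumes "Factorial_Ring.prime p" "cring A" "a \<in> carrier A" "w \<in> carrier (witt_ring p n A)"
  shows "witt_frob p n A (witt_teich n A a \<otimes>\<^bsub>witt_ring p n A\<^esub> w)
    = witt_teich n A (a [^]\<^bsub>A\<^esub> p) \<otimes>\<^bsub>witt_ring p n A\<^esub> witt_frob p n A w"
proof -
  interpret cring A by fact
  have w: "i < n \<Longrightarrow> w i \<in> carrier A" for i using assms(4) by (auto simp: witt_carrier)
  have "(a [^]\<^bsub>A\<^esub> (p ^ i)) [^]\<^bsub>A\<^esub> p = (a [^]\<^bsub>A\<^esub> p) [^]\<^bsub>A\<^esub> (p ^ i)" for i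
    using assms(3) by (simp add: nat_pow_pow mult.commute)
  then show ?thesis
    unfolding witt_teich_mult[OF assms] witt_teich_mult[OF assms(1,2) nat_pow_closed[OF assms(3)] witt_frob_closed[OF assms(2,4)]]
    using assms(3) w by (auto simp: witt_frob_def fun_eq_iff nat_pow_distrib)
qed

lemma
  assumes "qfs_map p n B \<psi>"
  shows qfs_closed: "x \<in> carrier (witt_ring p n B) \<Longrightarrow> \<psi> x \<in> carrier B"
    and qfs_add: "x \<in> carrier (witt_ring p n B) \<Longrightarrow> y \<in> carrier (witt_ring p n B) \<Longrightarrow>
      \<psi> (x \<oplus>\<^bsub>witt_ring p n B\<^esub> y) = \<psi> x \<oplus>\<^bsub>B\<^esub> \<psi> y"
    and qfs_frob_mult: "a \<in> carrier (witt_ring p n B) \<Longrightarrow> x \<in> carrier (witt_ring p n B) \<Longrightarrow>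
      \<psi> (witt_frob p n B a \<otimes>\<^bsub>witt_ring p n B\<^esub> x) = a 0 \<otimes>\<^bsub>B\<^esub> \<psi> x"
    and qfs_frob: "x \<in> carrier (witt_ring p n B) \<Longrightarrow> \<psi> (witt_frob p n B x) = x 0"
  using assms unfolding qfs_map_def by auto

text \<open>[a^p] is the Frobenius of [a], whose first component is a because n > 0, so Frobenius
  linearity of \<psi> applies.\<close>

lemma qfs_teich:
  assumes "qfs_map p n B \<psi>" "Factorial_Ring.prime p" "n > 0" "cring B" "a \<in> carrier B" "x \<in> carrier (witt_ring p n B)"
  shows "\<psi> (witt_teich n B (a [^]\<^bsub>B\<^esub> p) \<otimes>\<^bsub>witt_ring p n B\<^esub> x) = a \<otimes>\<^bsub>B\<^esub> \<psi> x"
  using qfs_frob_mult[OF assms(1) witt_teich_closed[OF assms(4,5)] assms(6)] assms(2,3)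
  by (simp add: witt_frob_teich[OF assms(4,5)] prime_gt_0_nat) (simp add: witt_teich_def)

section \<open>Extension of a splitting from global sections to the sheaf\<close>

locale split_spec = cring B for B :: "('b, 'c) ring_scheme" (structure) +
  fixes p n :: nat and \<psi> :: "(nat \<Rightarrow> 'b) \<Rightarrow> 'b"
  assumes prime_p: "Factorial_Ring.prime p" and n_pos: "n > 0" and psi: "qfs_map p n B \<psi>"
begin

abbreviation "W \<equiv> witt_ring p n B"
abbreviation "L P \<equiv> localization_at B P"
abbreviation "WL P \<equiv> witt_ring p n (localization_at B P)"

lemma p_pos: "p > 0" using prime_p prime_gt_0_nat by blast

lemma cring_W: "cring W" by (rule cring_witt_ring) (use prime_p is_cring in auto)
lemma cring_WL: "primeideal P B \<Longrightarrow> cring (WL P)" by (rule cring_witt_ring) (use prime_p cring_loc in auto)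

text \<open>\<open>germ_rep P w t x\<close>: the Teichmueller element of \<open>t\<^sup>p\<close> clears the denominators of \<open>w\<close>, and the
  product comes from \<open>x\<close>. Linearity then forces the value \<open>\<psi> x / t\<close> at \<open>w\<close>.\<close>

definition germ_rep where
  "germ_rep P w t x \<longleftrightarrow> t \<in> carrier B - P \<and> x \<in> carrier W \<and>
     witt_map n (to_loc P) x = witt_teich n (L P) (to_loc P t [^]\<^bsub>L P\<^esub> p) \<otimes>\<^bsub>WL P\<^esub> w"

context
  fixes P assumes P: "primeideal P B"
begin

interpretation M: mult_set B "carrier B - P" by (rule prime_mult_set[OF P])
interpretation LP: cring "L P" by (rule cring_loc[OF P])
interpretation WP: cring "WL P" by (rule cring_WL[OF P])
interpretation W: cring W by (rule cring_W)

lemmas h = to_loc_hom[OF P]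
lemmas hW = witt_map_hom[OF prime_p is_cring LP.is_cring h, of n]

lemma to_loc_closed': "t \<in> carrier B \<Longrightarrow> to_loc P t \<in> carrier (L P)"
  using ring_hom_closed[OF h] .

lemma germ_rep_comp:
  assumes "germ_rep P w t x" "w \<in> carrier (WL P)" "i < n"
  shows "to_loc P (x i) = to_loc P t [^]\<^bsub>L P\<^esub> (p ^ Suc i) \<otimes>\<^bsub>L P\<^esub> w i"
proof -
  have t: "to_loc P t \<in> carrier (L P)" using assms(1) to_loc_closed' unfolding germ_rep_def by blast
  have "witt_map n (to_loc P) x i = (to_loc P t [^]\<^bsub>L P\<^esub> p) [^]\<^bsub>L P\<^esub> (p ^ i) \<otimes>\<^bsub>L P\<^esub> w i"
    using assms t unfolding germ_rep_def by (simp add: witt_teich_mult[OF prime_p LP.is_cring])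
  then show ?thesis using assms(3) t by (simp add: witt_map_def LP.nat_pow_pow)
qed

text \<open>Each equality of germs is witnessed by one element outside the prime; a vector has only
  n components, so the product of the witnesses serves all of them.\<close>

lemma common_annihilator:
  assumes "\<And>i. i < n \<Longrightarrow> a i \<in> carrier B" "\<And>i. i < n \<Longrightarrow> b i \<in> carrier B"
    "\<And>i. i < n \<Longrightarrow> to_loc P (a i) = to_loc P (b i)"
  shows "\<exists>s\<in>carrier B - P. \<forall>i<n. s \<otimes> a i = s \<otimes> b i"
proof -
  have "\<exists>s\<in>carrier B - P. \<forall>i<k. s \<otimes> a i = s \<otimes> b i" if "k \<le> n" for k
    using that
  proof (induction k)
    case 0 then show ?case using M.S_one by auto
  next
    case (Suc k)
    then obtain s where s: "s \<in> carrier B - P" "\<forall>i<k. s \<otimes> a i = s \<otimes> b i" by auto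
    obtain t where t: "t \<in> carrier B - P" "t \<otimes> a k = t \<otimes> b k"
      using assms[of k] Suc(2) to_loc_eq_iff[OF P] by (metis Suc_le_lessD)
    have "(t \<otimes> s) \<otimes> a i = (t \<otimes> s) \<otimes> b i" if i: "i < Suc k" for i
    proof (cases "i = k")
      case True
      have "s \<otimes> (t \<otimes> a k) = s \<otimes> (t \<otimes> b k)" using t by simp
      then show ?thesis using True s t assms[of k] Suc(2) by (simp add: m_ac)
    next
      case False
      then have "t \<otimes> (s \<otimes> a i) = t \<otimes> (s \<otimes> b i)" using i s by simp
      then show ?thesis using s t assms[of i] Suc(2) i by (simp add: m_assoc)
    qed
    then show ?case using M.S_mult[OF t(1) s(1)] by blast
  qed
  then show ?thesis by blast
qed

text \<open>In the stalk both x and x' are multiples of \<open>w\<close>, so after crosswise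
  multiplication by [t'^p] and [t^p] they agree there, and some \<open>s\<close> outside the prime
  annihilates the differences of all components. Inserting \<open>s\<close> as [s^p] gives an
  equality in W_n(B), which linearity of \<psi> turns into the equality of fractions.\<close>

lemma germ_rep_unique:
  assumes w: "w \<in> carrier (WL P)" and r: "germ_rep P w t x" "germ_rep P w t' x'"
  shows "fraction B (carrier B - P) (\<psi> x) t = fraction B (carrier B - P) (\<psi> x') t'"
proof -
  have t: "t \<in> carrier B - P" "t' \<in> carrier B - P" and x: "x \<in> carrier W" "x' \<in> carrier W"
    using r unfolding germ_rep_def by auto
  have xi: "i < n \<Longrightarrow> x i \<in> carrier B" "i < n \<Longrightarrow> x' i \<in> carrier B" for i
    using x by (auto simp: witt_carrier)
  let ?a = "\<lambda>i. t' [^] (p ^ Suc i) \<otimes> x i" and ?b = "\<lambda>i. t [^] (p ^ Suc i) \<otimes> x' i"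
  have "\<exists>s\<in>carrier B - P. \<forall>i<n. s \<otimes> ?a i = s \<otimes> ?b i"
  proof (rule common_annihilator)
    fix i assume i: "i < n"
    show "?a i \<in> carrier B" "?b i \<in> carrier B" using t xi[OF i] by auto
    have tw: "to_loc P t \<in> carrier (L P)" "to_loc P t' \<in> carrier (L P)" "w i \<in> carrier (L P)"
      using t w i to_loc_closed' by (auto simp: witt_carrier)
    show "to_loc P (?a i) = to_loc P (?b i)"
      using t xi[OF i] tw germ_rep_comp[OF r(1) w i] germ_rep_comp[OF r(2) w i]
      by (simp add: ring_hom_mult[OF h] ring_hom_pow[OF h is_cring LP.is_cring] LP.m_ac del: power_Suc)
  qed
  then obtain s where s: "s \<in> carrier B - P" "\<And>i. i < n \<Longrightarrow> s \<otimes> ?a i = s \<otimes> ?b i" by blast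
  have "witt_teich n B ((s \<otimes> t') [^] p) \<otimes>\<^bsub>W\<^esub> x = witt_teich n B ((s \<otimes> t) [^] p) \<otimes>\<^bsub>W\<^esub> x'"
  proof -
    have "((s \<otimes> t') [^] p) [^] (p ^ i) \<otimes> x i = ((s \<otimes> t) [^] p) [^] (p ^ i) \<otimes> x' i" if i: "i < n" for i
    proof -
      \<comment> \<open>In degree i the Teichmueller element of s^p contributes s^(p^(i+1)); one
        factor is spent on the annihilator equation and the other k are carried along.\<close>
      obtain k where k: "p ^ Suc i = Suc k" using p_pos by (metis gr0_conv_Suc zero_less_power)
      have "((s \<otimes> r) [^] p) [^] (p ^ i) \<otimes> y = s [^] k \<otimes> (s \<otimes> (r [^] (p ^ Suc i) \<otimes> y))"
        if "r \<in> carrier B" "y \<in> carrier B" for r y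
      proof -
        have "((s \<otimes> r) [^] p) [^] (p ^ i) = (s \<otimes> r) [^] Suc k"
          using that s(1) k by (simp only: nat_pow_pow m_closed DiffD1 power_Suc)
        also have "\<dots> = (s [^] k \<otimes> s) \<otimes> r [^] Suc k"
          using that s(1) by (subst nat_pow_distrib) auto
        finally show ?thesis using that s(1) unfolding k by (simp only: m_assoc m_closed nat_pow_closed DiffD1)
      qed
      then show ?thesis using t xi[OF i] s(2)[OF i] by simp
    qed
    then show ?thesis using t s x by (simp add: witt_teich_mult[OF prime_p is_cring] cong: restrict_cong)
  qed
  then have "\<psi> (witt_teich n B ((s \<otimes> t') [^] p) \<otimes>\<^bsub>W\<^esub> x) = \<psi> (witt_teich n B ((s \<otimes> t) [^] p) \<otimes>\<^bsub>W\<^esub> x')"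
    by simp
  then have "(s \<otimes> t') \<otimes> \<psi> x = (s \<otimes> t) \<otimes> \<psi> x'"
    using t s x by (simp add: qfs_teich[OF psi prime_p n_pos is_cring])
  then have "s \<otimes> (\<psi> x \<otimes> t') = s \<otimes> (\<psi> x' \<otimes> t)"
    using t s x qfs_closed[OF psi] by (simp add: m_ac)
  then show ?thesis using t s x qfs_closed[OF psi] by (subst M.fraction_eq_iff) auto
qed

definition germ_val :: "(nat \<Rightarrow> ('b \<times> 'b) set) \<Rightarrow> ('b \<times> 'b) set" where
  "germ_val w = (THE y. \<exists>t x. germ_rep P w t x \<and> y = fraction B (carrier B - P) (\<psi> x) t)"

lemma germ_val_eq:
  assumes "w \<in> carrier (WL P)" "germ_rep P w t x"
  shows "germ_val w = fraction B (carrier B - P) (\<psi> x) t"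
  unfolding germ_val_def
  by (rule the_equality) (use assms germ_rep_unique in blast)+

lemma teich_p_mult:
  assumes "s \<in> carrier B" "t \<in> carrier B"
  shows "witt_teich n (L P) (to_loc P (s \<otimes> t) [^]\<^bsub>L P\<^esub> p)
    = witt_teich n (L P) (to_loc P s [^]\<^bsub>L P\<^esub> p) \<otimes>\<^bsub>WL P\<^esub> witt_teich n (L P) (to_loc P t [^]\<^bsub>L P\<^esub> p)"
  using assms to_loc_closed'
  by (simp add: witt_teich_mult_teich[OF prime_p LP.is_cring] ring_hom_mult[OF h] LP.nat_pow_distrib)

lemma teich_p_closed:
  "t \<in> carrier B \<Longrightarrow> witt_teich n (L P) (to_loc P t [^]\<^bsub>L P\<^esub> p) \<in> carrier (WL P)"
  using to_loc_closed' by (auto intro!: witt_teich_closed LP.is_cring)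

lemma germ_val_add:
  assumes w: "w \<in> carrier (WL P)" "germ_rep P w t x" and w': "w' \<in> carrier (WL P)" "germ_rep P w' t' x'"
  shows "germ_val (w \<oplus>\<^bsub>WL P\<^esub> w') = germ_val w \<oplus>\<^bsub>L P\<^esub> germ_val w'"
proof -
  have t: "t \<in> carrier B - P" "t' \<in> carrier B - P" and x: "x \<in> carrier W" "x' \<in> carrier W"
    and e: "witt_map n (to_loc P) x = witt_teich n (L P) (to_loc P t [^]\<^bsub>L P\<^esub> p) \<otimes>\<^bsub>WL P\<^esub> w"
      "witt_map n (to_loc P) x' = witt_teich n (L P) (to_loc P t' [^]\<^bsub>L P\<^esub> p) \<otimes>\<^bsub>WL P\<^esub> w'"
    using w w' unfolding germ_rep_def by auto
  have tc: "t \<in> carrier B" "t' \<in> carrier B" using t by auto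
  let ?x = "witt_teich n B (t' [^] p) \<otimes>\<^bsub>W\<^esub> x" and ?x' = "witt_teich n B (t [^] p) \<otimes>\<^bsub>W\<^esub> x'"
  have xc: "?x \<in> carrier W" "?x' \<in> carrier W"
    using tc x witt_teich_closed[OF is_cring] by (auto intro!: W.m_closed)
  have m: "witt_map n (to_loc P) (witt_teich n B (s [^] p) \<otimes>\<^bsub>W\<^esub> y)
      = witt_teich n (L P) (to_loc P s [^]\<^bsub>L P\<^esub> p) \<otimes>\<^bsub>WL P\<^esub> witt_map n (to_loc P) y"
    if "s \<in> carrier B" "y \<in> carrier W" for s y
    using that by (simp add: ring_hom_mult[OF hW] witt_teich_closed[OF is_cring]
        witt_teich_map[OF h is_cring LP.is_cring] ring_hom_pow[OF h is_cring LP.is_cring])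
  have "germ_rep P (w \<oplus>\<^bsub>WL P\<^esub> w') (t \<otimes> t') (?x \<oplus>\<^bsub>W\<^esub> ?x')"
    unfolding germ_rep_def
  proof (intro conjI)
    show "t \<otimes> t' \<in> carrier B - P" using M.S_mult t by blast
    show "?x \<oplus>\<^bsub>W\<^esub> ?x' \<in> carrier W" using xc by auto
    show "witt_map n (to_loc P) (?x \<oplus>\<^bsub>W\<^esub> ?x')
      = witt_teich n (L P) (to_loc P (t \<otimes> t') [^]\<^bsub>L P\<^esub> p) \<otimes>\<^bsub>WL P\<^esub> (w \<oplus>\<^bsub>WL P\<^esub> w')"
      unfolding ring_hom_add[OF hW xc] m[OF tc(2) x(1)] m[OF tc(1) x(2)] e teich_p_mult[OF tc]
      using teich_p_closed[OF tc(1)] teich_p_closed[OF tc(2)] w w'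
      by (simp add: WP.m_ac WP.r_distr WP.l_distr)
  qed
  then have "germ_val (w \<oplus>\<^bsub>WL P\<^esub> w') = fraction B (carrier B - P) (\<psi> (?x \<oplus>\<^bsub>W\<^esub> ?x')) (t \<otimes> t')"
    by (intro germ_val_eq) (use w w' in auto)
  also have "\<psi> (?x \<oplus>\<^bsub>W\<^esub> ?x') = \<psi> x \<otimes> t' \<oplus> \<psi> x' \<otimes> t"
    using tc x qfs_closed[OF psi]
    by (simp add: qfs_add[OF psi xc] qfs_teich[OF psi prime_p n_pos is_cring] m_comm)
  also have "fraction B (carrier B - P) \<dots> (t \<otimes> t') = germ_val w \<oplus>\<^bsub>L P\<^esub> germ_val w'"
    using w w' t x qfs_closed[OF psi] by (simp add: germ_val_eq M.fraction_add)
  finally show ?thesis .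
qed

text \<open>Applying Frobenius to [t^p] w = x gives [(t^p)^p] F w = F x, so the denominator becomes
  t^p. The degree 0 equation t^p w_0 = x_0 identifies the value that a splitting must take.\<close>

lemma germ_rep_frob:
  assumes w: "w \<in> carrier (WL P)" "germ_rep P w t x"
  shows "germ_rep P (witt_frob p n (L P) w) (t [^] p) (witt_frob p n B x)"
    and "fraction B (carrier B - P) (x 0) (t [^] p) = w 0"
proof -
  have t: "t \<in> carrier B - P" and x: "x \<in> carrier W"
    and e: "witt_map n (to_loc P) x = witt_teich n (L P) (to_loc P t [^]\<^bsub>L P\<^esub> p) \<otimes>\<^bsub>WL P\<^esub> w"
    using w unfolding germ_rep_def by auto
  have tp: "t [^] k \<in> carrier B - P" for k :: nat
    by (induction k) (use M.S_one M.S_mult t in auto)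
  have tl: "to_loc P t [^]\<^bsub>L P\<^esub> p \<in> carrier (L P)" using t to_loc_closed' by auto
  show "germ_rep P (witt_frob p n (L P) w) (t [^] p) (witt_frob p n B x)"
    unfolding germ_rep_def
    using tp t x witt_frob_closed[OF is_cring x] tl w
    by (auto simp: witt_frob_map[OF h is_cring LP.is_cring x] e witt_frob_teich_mult[OF prime_p LP.is_cring]
        ring_hom_pow[OF h is_cring LP.is_cring])
  have x0: "x 0 \<in> carrier B" "w 0 \<in> carrier (L P)" using x w n_pos by (auto simp: witt_carrier)
  have "to_loc P (t [^] p) \<otimes>\<^bsub>L P\<^esub> w 0 = to_loc P (x 0)"
    using germ_rep_comp[OF w(2,1) n_pos] t by (simp add: ring_hom_pow[OF h is_cring LP.is_cring])
  then show "fraction B (carrier B - P) (x 0) (t [^] p) = w 0"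
    using fraction_unique[OF P x0(1) tp x0(2)] by simp
qed

lemma germ_val_frob:
  assumes w: "w \<in> carrier (WL P)" "germ_rep P w t x"
  shows "germ_val (witt_frob p n (L P) w) = w 0"
  using germ_val_eq[OF witt_frob_closed[OF LP.is_cring w(1)] germ_rep_frob(1)[OF w]] germ_rep_frob(2)[OF w] w
  by (simp add: qfs_frob[OF psi] germ_rep_def)

lemma germ_val_frob_mult:
  assumes a: "a \<in> carrier (WL P)" "germ_rep P a s y" and w: "w \<in> carrier (WL P)" "germ_rep P w t x"
  shows "germ_val (witt_frob p n (L P) a \<otimes>\<^bsub>WL P\<^esub> w) = a 0 \<otimes>\<^bsub>L P\<^esub> germ_val w"
proof -
  note Fa = germ_rep_frob[OF a]
  have t: "t \<in> carrier B - P" and x: "x \<in> carrier W"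
    and e: "witt_map n (to_loc P) x = witt_teich n (L P) (to_loc P t [^]\<^bsub>L P\<^esub> p) \<otimes>\<^bsub>WL P\<^esub> w"
    using w unfolding germ_rep_def by auto
  have y: "y \<in> carrier W" using a unfolding germ_rep_def by auto
  have sp: "s [^] p \<in> carrier B - P" and Fy: "witt_frob p n B y \<in> carrier W"
    and eF: "witt_map n (to_loc P) (witt_frob p n B y)
      = witt_teich n (L P) (to_loc P (s [^] p) [^]\<^bsub>L P\<^esub> p) \<otimes>\<^bsub>WL P\<^esub> witt_frob p n (L P) a"
    using Fa(1) unfolding germ_rep_def by auto
  have FA: "witt_frob p n (L P) a \<in> carrier (WL P)" by (rule witt_frob_closed[OF LP.is_cring a(1)])
  have "germ_rep P (witt_frob p n (L P) a \<otimes>\<^bsub>WL P\<^esub> w) (s [^] p \<otimes> t) (witt_frob p n B y \<otimes>\<^bsub>W\<^esub> x)"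
    unfolding germ_rep_def
  proof (intro conjI)
    show "s [^] p \<otimes> t \<in> carrier B - P" using M.S_mult t sp by blast
    show "witt_frob p n B y \<otimes>\<^bsub>W\<^esub> x \<in> carrier W" using Fy x by auto
    have tc: "s [^] p \<in> carrier B" "t \<in> carrier B" using t sp by auto
    show "witt_map n (to_loc P) (witt_frob p n B y \<otimes>\<^bsub>W\<^esub> x)
      = witt_teich n (L P) (to_loc P (s [^] p \<otimes> t) [^]\<^bsub>L P\<^esub> p) \<otimes>\<^bsub>WL P\<^esub> (witt_frob p n (L P) a \<otimes>\<^bsub>WL P\<^esub> w)"
      unfolding ring_hom_mult[OF hW Fy x] e eF teich_p_mult[OF tc]
      using teich_p_closed[OF tc(1)] teich_p_closed[OF tc(2)] w FA by (simp add: WP.m_ac)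
  qed
  then have "germ_val (witt_frob p n (L P) a \<otimes>\<^bsub>WL P\<^esub> w)
      = fraction B (carrier B - P) (\<psi> (witt_frob p n B y \<otimes>\<^bsub>W\<^esub> x)) (s [^] p \<otimes> t)"
    by (intro germ_val_eq) (use w FA in auto)
  also have "\<dots> = fraction B (carrier B - P) (y 0) (s [^] p) \<otimes>\<^bsub>L P\<^esub> fraction B (carrier B - P) (\<psi> x) t"
    using y n_pos x t sp qfs_closed[OF psi x]
    by (subst M.fraction_mult) (auto simp: qfs_frob_mult[OF psi y x] witt_carrier)
  finally show ?thesis using Fa(2) germ_val_eq[OF w] by simp
qed

end

text \<open>\<open>sheaf_map\<close> has to be given by a single fraction near \<open>P\<close>.
  Intersecting finitely many neighbourhoods gives one denominator for all components, hence one
  representation that is valid at every point of a neighbourhood.\<close>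

lemma common_germ_rep:
  assumes U: "openin (zariski B) U" and P: "P \<in> U" and w: "w \<in> carrier (witt_ring p n (spec_sections B U))"
  obtains V t x where "openin (zariski B) V" "P \<in> V" "V \<subseteq> U" "t \<in> carrier B" "x \<in> carrier W"
    "\<forall>Q\<in>V. germ_rep Q (witt_map n (\<lambda>s. s Q) w) t x"
proof -
  have wi: "w i \<in> carrier (spec_sections B U)" if "i < n" for i using w that by (auto simp: witt_carrier)
  have "\<exists>V t c. openin (zariski B) V \<and> P \<in> V \<and> V \<subseteq> U \<and> t \<in> carrier B \<and> (\<forall>i<k. c i \<in> carrier B) \<and>
      (\<forall>Q\<in>V. t \<notin> Q \<and> (\<forall>i<k. to_loc Q (c i) = to_loc Q t \<otimes>\<^bsub>L Q\<^esub> w i Q))" if "k \<le> n" for k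
    using that
  proof (induction k)
    case 0
    have "\<forall>Q\<in>U. \<one> \<notin> Q" using mult_set.S_one[OF prime_mult_set[OF open_prime[OF U]]] by blast
    then show ?case using U P by blast
  next
    case (Suc k)
    then obtain V t c where V: "openin (zariski B) V" "P \<in> V" "V \<subseteq> U" and t: "t \<in> carrier B"
      and c: "\<forall>i<k. c i \<in> carrier B"
      and e: "\<forall>Q\<in>V. t \<notin> Q \<and> (\<forall>i<k. to_loc Q (c i) = to_loc Q t \<otimes>\<^bsub>L Q\<^esub> w i Q)" by auto
    have k: "k < n" using Suc by auto
    obtain V' a b where V': "openin (zariski B) V'" "P \<in> V'" "V' \<subseteq> U" and ab: "a \<in> carrier B" "b \<in> carrier B"
      and f: "\<forall>Q\<in>V'. b \<notin> Q \<and> w k Q = fraction B (carrier B - Q) a b"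
      by (rule sections_local[OF wi[OF k] P])
    define c' where "c' i = (if i = k then t \<otimes> a else b \<otimes> c i)" for i
    have VV: "openin (zariski B) (V \<inter> V')" "P \<in> V \<inter> V'" "V \<inter> V' \<subseteq> U" using V V' by auto
    have c': "\<forall>i<Suc k. c' i \<in> carrier B" using c t ab by (auto simp: c'_def less_Suc_eq)
    have "t \<otimes> b \<notin> Q \<and> (\<forall>i<Suc k. to_loc Q (c' i) = to_loc Q (t \<otimes> b) \<otimes>\<^bsub>L Q\<^esub> w i Q)" if Q: "Q \<in> V \<inter> V'" for Q
    proof -
      have pQ: "primeideal Q B" using open_prime[OF VV(1) Q] .
      interpret LQ: cring "L Q" by (rule cring_loc[OF pQ])
      interpret M: mult_set B "carrier B - Q" by (rule prime_mult_set[OF pQ])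
      note h = to_loc_hom[OF pQ]
      have "Q \<in> V" "Q \<in> V'" "Q \<in> U" using Q V by auto
      have tb: "t \<in> carrier B - Q" "b \<in> carrier B - Q" using t ab \<open>Q \<in> V\<close> \<open>Q \<in> V'\<close> e f by auto
      have wk: "w i Q \<in> carrier (L Q)" if "i < n" for i using section_stalk[OF wi[OF that] \<open>Q \<in> U\<close>] .
      have cl: "to_loc Q y \<in> carrier (L Q)" if "y \<in> carrier B" for y using ring_hom_closed[OF h that] .
      have "to_loc Q a = to_loc Q b \<otimes>\<^bsub>L Q\<^esub> w k Q"
        using to_loc_mult_fraction[OF pQ ab(1) tb(2)] f \<open>Q \<in> V'\<close> by simp
      moreover have "\<forall>i<k. to_loc Q (c i) = to_loc Q t \<otimes>\<^bsub>L Q\<^esub> w i Q" using e \<open>Q \<in> V\<close> by blast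
      ultimately have "to_loc Q (c' i) = to_loc Q (t \<otimes> b) \<otimes>\<^bsub>L Q\<^esub> w i Q" if "i < Suc k" for i
        using that c t ab k wk[of i] cl[of t] cl[of b]
        by (auto simp: c'_def ring_hom_mult[OF h] less_Suc_eq LQ.m_ac)
      then show ?thesis using M.S_mult[OF tb] by blast
    qed
    then show ?case using VV c' t ab by (intro exI[of _ "V \<inter> V'"] exI[of _ "t \<otimes> b"] exI[of _ c'] conjI ballI) blast+
  qed
  from this[OF order_refl] obtain V t c where V: "openin (zariski B) V" "P \<in> V" "V \<subseteq> U" and t: "t \<in> carrier B"
    and c: "\<forall>i<n. c i \<in> carrier B"
    and e: "\<forall>Q\<in>V. t \<notin> Q \<and> (\<forall>i<n. to_loc Q (c i) = to_loc Q t \<otimes>\<^bsub>L Q\<^esub> w i Q)" by blast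
  \<comment> \<open>In degree i the Teichmueller element of t^p multiplies by t^(p^(i+1)). As w_i =
    c_i / t, one factor t is absorbed by the denominator.\<close>
  define x where "x = (\<lambda>i\<in>{..<n}. t [^] (p ^ Suc i - 1) \<otimes> c i)"
  have x: "x \<in> carrier W" using c t by (auto simp: x_def witt_carrier)
  have "germ_rep Q (witt_map n (\<lambda>s. s Q) w) t x" if Q: "Q \<in> V" for Q
  proof -
    have pQ: "primeideal Q B" using open_prime[OF V(1) Q] .
    interpret LQ: cring "L Q" by (rule cring_loc[OF pQ])
    note h = to_loc_hom[OF pQ]
    have QU: "Q \<in> U" using Q V by auto
    have tl: "to_loc Q t \<in> carrier (L Q)" using ring_hom_closed[OF h t] .
    have wk: "w i Q \<in> carrier (L Q)" if "i < n" for i using section_stalk[OF wi[OF that] QU] .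
    have wQ: "witt_map n (\<lambda>s. s Q) w \<in> carrier (WL Q)" by (rule witt_map_closed[OF stalk_hom[OF U QU] w])
    have "to_loc Q (x i) = (to_loc Q t [^]\<^bsub>L Q\<^esub> p) [^]\<^bsub>L Q\<^esub> (p ^ i) \<otimes>\<^bsub>L Q\<^esub> w i Q" if i: "i < n" for i
    proof -
      obtain k where k: "p ^ Suc i = Suc k" using p_pos by (metis gr0_conv_Suc zero_less_power)
      have "(to_loc Q t [^]\<^bsub>L Q\<^esub> p) [^]\<^bsub>L Q\<^esub> (p ^ i) = to_loc Q t [^]\<^bsub>L Q\<^esub> Suc k"
        using tl k by (simp only: LQ.nat_pow_pow power_Suc)
      moreover have "to_loc Q (x i) = to_loc Q t [^]\<^bsub>L Q\<^esub> k \<otimes>\<^bsub>L Q\<^esub> (to_loc Q t \<otimes>\<^bsub>L Q\<^esub> w i Q)"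
        using i c t e Q k by (simp add: x_def ring_hom_mult[OF h] ring_hom_pow[OF h is_cring LQ.is_cring])
      ultimately show ?thesis using tl wk[OF i] by (simp add: LQ.m_assoc)
    qed
    then have "witt_map n (to_loc Q) x = witt_teich n (L Q) (to_loc Q t [^]\<^bsub>L Q\<^esub> p) \<otimes>\<^bsub>WL Q\<^esub> witt_map n (\<lambda>s. s Q) w"
      unfolding witt_teich_mult[OF prime_p LQ.is_cring LQ.nat_pow_closed[OF tl] wQ]
      by (auto simp: witt_map_def intro!: restrict_ext)
    then show ?thesis unfolding germ_rep_def using x t e Q by blast
  qed
  then show ?thesis using that V t x by blast
qed

definition sheaf_map where
  "sheaf_map U w = (\<lambda>P\<in>U. germ_val P (witt_map n (\<lambda>s. s P) w))"

lemma
  assumes U: "openin (zariski B) U" and P: "P \<in> U" and w: "w \<in> carrier (witt_ring p n (spec_sections B U))"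
  shows germ_rep_exists: "\<exists>t x. germ_rep P (witt_map n (\<lambda>s. s P) w) t x"
    and stalk_W: "witt_map n (\<lambda>s. s P) w \<in> carrier (WL P)"
  using common_germ_rep[OF U P w] witt_map_closed[OF stalk_hom[OF U P] w] by metis+

lemma sheaf_map_closed:
  assumes U: "openin (zariski B) U" and w: "w \<in> carrier (witt_ring p n (spec_sections B U))"
  shows "sheaf_map U w \<in> carrier (spec_sections B U)"
proof (rule sectionsI[OF U])
  fix P assume P: "P \<in> U"
  obtain V t x where V: "openin (zariski B) V" "P \<in> V" "V \<subseteq> U" and t: "t \<in> carrier B" and x: "x \<in> carrier W"
    and g: "\<forall>Q\<in>V. germ_rep Q (witt_map n (\<lambda>s. s Q) w) t x" by (rule common_germ_rep[OF U P w])
  have "t \<notin> Q \<and> sheaf_map U w Q = fraction B (carrier B - Q) (\<psi> x) t" if Q: "Q \<in> V" for Q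
  proof -
    have QU: "Q \<in> U" using Q V by auto
    have r: "germ_rep Q (witt_map n (\<lambda>s. s Q) w) t x" using g Q by blast
    then show ?thesis
      using germ_val_eq[OF open_prime[OF U QU] stalk_W[OF U QU w] r] QU by (simp add: sheaf_map_def germ_rep_def)
  qed
  then show "\<exists>V a b. openin (zariski B) V \<and> P \<in> V \<and> V \<subseteq> U \<and> a \<in> carrier B \<and> b \<in> carrier B \<and>
          (\<forall>Q\<in>V. b \<notin> Q \<and> sheaf_map U w Q = fraction B (carrier B - Q) a b)"
    using V t qfs_closed[OF psi x] by blast
qed (simp add: sheaf_map_def)

lemma sheaf_map_qfs:
  assumes U: "openin (zariski B) U"
  shows "qfs_map p n (spec_sections B U) (sheaf_map U)"
proof -
  let ?O = "spec_sections B U"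
  let ?WO = "witt_ring p n ?O"
  interpret O: cring ?O by (rule cring_sections[OF U])
  interpret WO: cring ?WO by (rule cring_witt_ring[OF prime_p O.is_cring])
  have st: "witt_map n (\<lambda>s. s P) \<in> ring_hom ?WO (WL P)" if "P \<in> U" for P
    by (rule witt_map_hom[OF prime_p O.is_cring cring_loc[OF open_prime[OF U that]] stalk_hom[OF U that]])
  have fr: "witt_map n (\<lambda>s. s P) (witt_frob p n ?O w) = witt_frob p n (L P) (witt_map n (\<lambda>s. s P) w)"
    if "P \<in> U" "w \<in> carrier ?WO" for P w
    by (rule witt_frob_map[OF stalk_hom[OF U that(1)] O.is_cring cring_loc[OF open_prime[OF U that(1)]] that(2)])
  have w0: "witt_map n (\<lambda>s. s P) w 0 = w 0 P" for P w using n_pos by (simp add: witt_map_def)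
  show ?thesis unfolding qfs_map_def
  proof (intro conjI ballI funcsetI)
    fix w assume "w \<in> carrier ?WO"
    then show "sheaf_map U w \<in> carrier ?O" by (rule sheaf_map_closed[OF U])
  next
    fix x y assume xy: "x \<in> carrier ?WO" "y \<in> carrier ?WO"
    show "sheaf_map U (x \<oplus>\<^bsub>?WO\<^esub> y) = sheaf_map U x \<oplus>\<^bsub>?O\<^esub> sheaf_map U y"
      unfolding sections_ops sheaf_map_def
    proof (rule restrict_ext)
      fix P assume P: "P \<in> U"
      obtain t a where r: "germ_rep P (witt_map n (\<lambda>s. s P) x) t a" using germ_rep_exists[OF U P xy(1)] by blast
      obtain t' a' where r': "germ_rep P (witt_map n (\<lambda>s. s P) y) t' a'" using germ_rep_exists[OF U P xy(2)] by blast
      show "germ_val P (witt_map n (\<lambda>s. s P) (x \<oplus>\<^bsub>?WO\<^esub> y))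
        = (\<lambda>P\<in>U. germ_val P (witt_map n (\<lambda>s. s P) x)) P \<oplus>\<^bsub>L P\<^esub> (\<lambda>P\<in>U. germ_val P (witt_map n (\<lambda>s. s P) y)) P"
        using germ_val_add[OF open_prime[OF U P] stalk_W[OF U P xy(1)] r stalk_W[OF U P xy(2)] r'] P
        by (simp add: ring_hom_add[OF st[OF P] xy])
    qed
    show "sheaf_map U (witt_frob p n ?O x \<otimes>\<^bsub>?WO\<^esub> y) = x 0 \<otimes>\<^bsub>?O\<^esub> sheaf_map U y"
      unfolding sections_ops sheaf_map_def
    proof (rule restrict_ext)
      fix P assume P: "P \<in> U"
      obtain t a where r: "germ_rep P (witt_map n (\<lambda>s. s P) x) t a" using germ_rep_exists[OF U P xy(1)] by blast
      obtain t' a' where r': "germ_rep P (witt_map n (\<lambda>s. s P) y) t' a'" using germ_rep_exists[OF U P xy(2)] by blast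
      show "germ_val P (witt_map n (\<lambda>s. s P) (witt_frob p n ?O x \<otimes>\<^bsub>?WO\<^esub> y))
        = x 0 P \<otimes>\<^bsub>L P\<^esub> (\<lambda>P\<in>U. germ_val P (witt_map n (\<lambda>s. s P) y)) P"
        using germ_val_frob_mult[OF open_prime[OF U P] stalk_W[OF U P xy(1)] r stalk_W[OF U P xy(2)] r'] P
        by (simp add: ring_hom_mult[OF st[OF P] witt_frob_closed[OF O.is_cring xy(1)] xy(2)] fr[OF P xy(1)] w0)
    qed
  next
    fix w assume w: "w \<in> carrier ?WO"
    have w0c: "w 0 \<in> carrier ?O" using w n_pos by (auto simp: witt_carrier)
    show "sheaf_map U (witt_frob p n ?O w) = w 0"
    proof (rule sections_closed_eqI[OF sheaf_map_closed[OF U witt_frob_closed[OF O.is_cring w]] w0c])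
      fix P assume P: "P \<in> U"
      obtain t a where r: "germ_rep P (witt_map n (\<lambda>s. s P) w) t a" using germ_rep_exists[OF U P w] by blast
      show "sheaf_map U (witt_frob p n ?O w) P = w 0 P"
        using germ_val_frob[OF open_prime[OF U P] stalk_W[OF U P w] r] P
        by (simp add: sheaf_map_def fr[OF P w] w0)
    qed
  qed
qed

lemma quasi_F_split_Spec_if: "quasi_F_split p n (Spec B)"
  unfolding quasi_F_split_iff Spec_def ringed_space.simps
proof (intro exI[of _ sheaf_map] conjI allI impI ballI)
  fix U V and w :: "nat \<Rightarrow> 'b set \<Rightarrow> ('b \<times> 'b) set" assume U: "openin (zariski B) U" and V: "openin (zariski B) V" and VU: "V \<subseteq> U"
  have "witt_map n (\<lambda>s. s P) (witt_map n (\<lambda>s. restrict s V) w) = witt_map n (\<lambda>s. s P) w" if "P \<in> V" for P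
    using that by (auto simp: witt_map_def intro!: restrict_ext)
  then show "sheaf_map V (witt_map n (\<lambda>s. restrict s V) w) = restrict (sheaf_map U w) V"
    using subsetD[OF VU] by (simp add: sheaf_map_def cong: restrict_cong)
qed (rule sheaf_map_qfs)

end

text \<open>Elements outside \<open>M\<close> are units, so B -> B_M is bijective. A sheaf splitting
  is applied to Witt vectors of constant global sections and its value is read off in the stalk at
  the closed point \<open>M\<close>, which replaces a computation of the ring of global sections.
  The converse is the construction of \<open>split_spec\<close>.\<close>

lemma quasi_F_split_Spec:
  fixes B :: "('b, 'c) ring_scheme"
  assumes p: "Factorial_Ring.prime p" and n: "n > 0" and B: "cring B"
    and M: "primeideal M B" "carrier B - M \<subseteq> Units B"
  shows "quasi_F_split p n (Spec B) \<longleftrightarrow> (\<exists>\<psi>. qfs_map p n B \<psi>)"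
proof
  assume "\<exists>\<psi>. qfs_map p n B \<psi>"
  then obtain \<psi> where "qfs_map p n B \<psi>" by blast
  with assms have "split_spec B p n \<psi>" by (simp add: split_spec_def split_spec_axioms_def)
  then show "quasi_F_split p n (Spec B)" by (rule split_spec.quasi_F_split_Spec_if)
next
  assume "quasi_F_split p n (Spec B)"
  then obtain \<phi> where phi: "openin (zariski B) U \<Longrightarrow> qfs_map p n (spec_sections B U) (\<phi> U)" for U
    unfolding quasi_F_split_iff Spec_def by auto
  interpret cring B by fact
  define U where "U = {P. primeideal P B}"
  have U: "openin (zariski B) U"
    unfolding openin_zariski zariski_open_def U_def
    using mult_set.S_one[OF prime_mult_set] by (intro exI[of _ "{\<one>\<^bsub>B\<^esub>}"]) auto
  have MU: "M \<in> U" using M by (simp add: U_def)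
  let ?L = "localization_at B M" and ?O = "spec_sections B U"
  interpret mult_set B "carrier B - M" by (rule prime_mult_set[OF M(1)])
  interpret L: cring ?L by (rule cring_localization)
  interpret O: cring ?O by (rule cring_sections[OF U])
  note t = to_loc_hom[OF M(1)]
  have inj: "inj_on (to_loc M) (carrier B)"
  proof (rule inj_onI)
    fix a b assume ab: "a \<in> carrier B" "b \<in> carrier B" "to_loc M a = to_loc M b"
    then obtain w where "w \<in> carrier B - M" "w \<otimes>\<^bsub>B\<^esub> a = w \<otimes>\<^bsub>B\<^esub> b" using to_loc_eq_iff[OF M(1)] by blast
    then show "a = b" using ab M(2) Units_l_cancel by blast
  qed
  have surj: "\<exists>b\<in>carrier B. to_loc M b = y" if "y \<in> carrier ?L" for y
  proof -
    obtain a s where y: "y = fraction B (carrier B - M) a s" "a \<in> carrier B" "s \<in> carrier B - M"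
      using \<open>y \<in> carrier ?L\<close> unfolding carrier_loc by blast
    have s: "s \<in> Units B" using y M(2) by blast
    have "(a \<otimes>\<^bsub>B\<^esub> inv\<^bsub>B\<^esub> s) \<otimes>\<^bsub>B\<^esub> s = a \<otimes>\<^bsub>B\<^esub> \<one>\<^bsub>B\<^esub>" using s y(2) by (simp add: m_assoc Units_closed)
    then have "to_loc M (a \<otimes>\<^bsub>B\<^esub> inv\<^bsub>B\<^esub> s) = y"
      unfolding y(1) to_loc_def using y s S_one by (intro fraction_eqI) auto
    then show ?thesis using y s by blast
  qed
  define c where "c a = (\<lambda>P\<in>U. to_loc P a)" for a
  have ch: "c \<in> ring_hom B ?O" unfolding c_def by (rule const_hom[OF U])
  note W = witt_map_hom[OF p B O.is_cring ch, of n]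
  note ph = phi[OF U]
  define \<psi> where "\<psi> w = inv_into (carrier B) (to_loc M) (\<phi> U (witt_map n c w) M)" for w
  have Wc: "witt_map n c w \<in> carrier (witt_ring p n ?O)" if "w \<in> carrier (witt_ring p n B)" for w
    by (rule witt_map_closed[OF ch that])
  have im: "\<phi> U (witt_map n c w) M \<in> to_loc M ` carrier B" if "w \<in> carrier (witt_ring p n B)" for w
    using surj[OF section_stalk[OF qfs_closed[OF ph Wc[OF that]] MU]] by auto
  have psi: "\<psi> w \<in> carrier B" "to_loc M (\<psi> w) = \<phi> U (witt_map n c w) M" if "w \<in> carrier (witt_ring p n B)" for w
    unfolding \<psi>_def using inv_into_into[OF im[OF that]] f_inv_into_f[OF im[OF that]] by simp_all
  interpret WB: cring "witt_ring p n B" by (rule cring_witt_ring[OF p B])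
  have "qfs_map p n B \<psi>" unfolding qfs_map_def
  proof (intro conjI ballI funcsetI)
    fix x assume "x \<in> carrier (witt_ring p n B)" then show "\<psi> x \<in> carrier B" by (rule psi)
  next
    fix x y assume xy: "x \<in> carrier (witt_ring p n B)" "y \<in> carrier (witt_ring p n B)"
    have cM: "c b M = to_loc M b" for b using MU by (simp add: c_def)
    show "\<psi> (x \<oplus>\<^bsub>witt_ring p n B\<^esub> y) = \<psi> x \<oplus>\<^bsub>B\<^esub> \<psi> y"
    proof (rule inj_onD[OF inj])
      show "to_loc M (\<psi> (x \<oplus>\<^bsub>witt_ring p n B\<^esub> y)) = to_loc M (\<psi> x \<oplus>\<^bsub>B\<^esub> \<psi> y)"
        using xy psi MU by (simp add: ring_hom_add[OF W] qfs_add[OF ph] Wc ring_hom_add[OF t] sections_ops)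
    qed (use xy psi in auto)
    have x0: "x 0 \<in> carrier B" "witt_map n c x 0 = c (x 0)" using xy n by (auto simp: witt_carrier witt_map_def)
    have Fx: "witt_frob p n B x \<in> carrier (witt_ring p n B)" by (rule witt_frob_closed[OF B xy(1)])
    show "\<psi> (witt_frob p n B x \<otimes>\<^bsub>witt_ring p n B\<^esub> y) = x 0 \<otimes>\<^bsub>B\<^esub> \<psi> y"
    proof (rule inj_onD[OF inj])
      show "to_loc M (\<psi> (witt_frob p n B x \<otimes>\<^bsub>witt_ring p n B\<^esub> y)) = to_loc M (x 0 \<otimes>\<^bsub>B\<^esub> \<psi> y)"
        using xy Fx x0 psi MU
        by (simp add: ring_hom_mult[OF W] witt_frob_map[OF ch B O.is_cring] qfs_frob_mult[OF ph] Wc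
            ring_hom_mult[OF t] sections_ops cM)
    qed (use xy Fx x0 psi in auto)
    show "\<psi> (witt_frob p n B x) = x 0"
    proof (rule inj_onD[OF inj])
      show "to_loc M (\<psi> (witt_frob p n B x)) = to_loc M (x 0)"
        using xy Fx x0 psi by (simp add: witt_frob_map[OF ch B O.is_cring] qfs_frob[OF ph] Wc cM)
    qed (use xy Fx x0 psi in auto)
  qed
  then show "\<exists>\<psi>. qfs_map p n B \<psi>" by blast
qed

section \<open>Colon ideals of regular sequences\<close>

text \<open>The ideal generated by the powers f_i^(a_i) for i < m, see \<open>pow_ideal_Idl\<close>.
  The recursion lets inductions over the sequence peel off the last generator, and the exponents
  vary with i because colon ideals lower them one at a time.\<close>

primrec pow_ideal :: "('a, 'c) ring_scheme \<Rightarrow> (nat \<Rightarrow> 'a) \<Rightarrow> (nat \<Rightarrow> nat) \<Rightarrow> nat \<Rightarrow> 'a set" where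
  "pow_ideal R f a 0 = {\<zero>\<^bsub>R\<^esub>}"
| "pow_ideal R f a (Suc m) =
     {l \<oplus>\<^bsub>R\<^esub> f m [^]\<^bsub>R\<^esub> a m \<otimes>\<^bsub>R\<^esub> r | l r. l \<in> pow_ideal R f a m \<and> r \<in> carrier R}"

context cring
begin

lemma pow_ideal_cong: "(\<And>i. i < m \<Longrightarrow> a i = b i) \<Longrightarrow> pow_ideal R f a m = pow_ideal R f b m"
  by (induction m) auto

lemma pow_ideal_sub: "(\<And>i. i < m \<Longrightarrow> f i \<in> carrier R) \<Longrightarrow> x \<in> pow_ideal R f a m \<Longrightarrow> x \<in> carrier R"
proof (induction m arbitrary: x)
  case (Suc m)
  then obtain l r where "x = l \<oplus> f m [^] a m \<otimes> r" "l \<in> pow_ideal R f a m" "r \<in> carrier R" by auto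
  with Suc show ?case by simp
qed simp

lemma pow_ideal_SucI:
  "x = l \<oplus> f m [^] a m \<otimes> r \<Longrightarrow> l \<in> pow_ideal R f a m \<Longrightarrow> r \<in> carrier R \<Longrightarrow> x \<in> pow_ideal R f a (Suc m)"
  by auto

lemma pow_ideal_add:
  assumes "\<And>i. i < m \<Longrightarrow> f i \<in> carrier R"
  shows "x \<in> pow_ideal R f a m \<Longrightarrow> y \<in> pow_ideal R f a m \<Longrightarrow> x \<oplus> y \<in> pow_ideal R f a m"
  using assms
proof (induction m arbitrary: x y)
  case (Suc m)
  obtain l r where x: "x = l \<oplus> f m [^] a m \<otimes> r" "l \<in> pow_ideal R f a m" "r \<in> carrier R" using Suc by auto
  obtain l' r' where y: "y = l' \<oplus> f m [^] a m \<otimes> r'" "l' \<in> pow_ideal R f a m" "r' \<in> carrier R" using Suc by auto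
  have l: "l \<in> carrier R" "l' \<in> carrier R" using x y pow_ideal_sub[of m f _ a] Suc.prems by auto
  have f: "f m [^] a m \<in> carrier R" using Suc.prems by simp
  have "x \<oplus> y = (l \<oplus> l') \<oplus> f m [^] a m \<otimes> (r \<oplus> r')"
    using x y l f by (simp add: r_distr a_ac)
  moreover have "l \<oplus> l' \<in> pow_ideal R f a m" using Suc x y by auto
  ultimately show ?case using x y by auto
qed simp

lemma pow_ideal_zero:
  assumes "\<And>i. i < m \<Longrightarrow> f i \<in> carrier R"
  shows "\<zero> \<in> pow_ideal R f a m"
  using assms
proof (induction m)
  case (Suc m)
  then have "\<zero> = \<zero> \<oplus> f m [^] a m \<otimes> \<zero>" by simp
  then show ?case by (rule pow_ideal_SucI) (use Suc in auto)
qed simp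

lemma pow_ideal_mult:
  assumes "\<And>i. i < m \<Longrightarrow> f i \<in> carrier R"
  shows "x \<in> pow_ideal R f a m \<Longrightarrow> y \<in> carrier R \<Longrightarrow> y \<otimes> x \<in> pow_ideal R f a m"
  using assms
proof (induction m arbitrary: x)
  case (Suc m)
  obtain l r where x: "x = l \<oplus> f m [^] a m \<otimes> r" "l \<in> pow_ideal R f a m" "r \<in> carrier R" using Suc by auto
  have l: "l \<in> carrier R" using x pow_ideal_sub[of m f _ a] Suc.prems by auto
  have f: "f m [^] a m \<in> carrier R" using Suc.prems by simp
  have "y \<otimes> x = y \<otimes> l \<oplus> f m [^] a m \<otimes> (y \<otimes> r)"
    using x l f Suc.prems by (simp add: r_distr m_lcomm)
  moreover have "y \<otimes> l \<in> pow_ideal R f a m" using Suc x by auto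
  ultimately show ?case using x Suc.prems by auto
qed simp

lemma pow_ideal_ideal:
  assumes "\<And>i. i < m \<Longrightarrow> f i \<in> carrier R"
  shows "ideal (pow_ideal R f a m) R"
proof (rule idealI)
  show "subgroup (pow_ideal R f a m) (add_monoid R)"
  proof
    show "pow_ideal R f a m \<subseteq> carrier (add_monoid R)" using pow_ideal_sub assms by auto
    show "inv\<^bsub>add_monoid R\<^esub> x \<in> pow_ideal R f a m" if "x \<in> pow_ideal R f a m" for x
    proof -
      have "(\<ominus> \<one>) \<otimes> x = \<ominus> x" using that pow_ideal_sub[of m f, OF assms that] by (simp add: l_minus)
      then have "\<ominus> x \<in> pow_ideal R f a m" using pow_ideal_mult[OF assms that, of "\<ominus> \<one>"] by simp
      then show ?thesis by (simp add: a_inv_def)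
    qed
  qed (use pow_ideal_add pow_ideal_zero assms in auto)
  fix x y assume xy: "x \<in> pow_ideal R f a m" "y \<in> carrier R"
  show "y \<otimes> x \<in> pow_ideal R f a m" by (rule pow_ideal_mult[OF assms xy])
  then show "x \<otimes> y \<in> pow_ideal R f a m" using m_comm[OF pow_ideal_sub[of m f, OF assms xy(1)] xy(2)] by simp
qed (rule ring_axioms)

lemma pow_ideal_gen:
  assumes "\<And>i. i < m \<Longrightarrow> f i \<in> carrier R"
  shows "i < m \<Longrightarrow> f i [^] a i \<in> pow_ideal R f a m"
  using assms
proof (induction m)
  case (Suc m)
  show ?case
  proof (cases "i = m")
    case True
    then have "f i [^] a i = \<zero> \<oplus> f m [^] a m \<otimes> \<one>" using Suc.prems by simp
    then show ?thesis by (rule pow_ideal_SucI) (use pow_ideal_zero[of m f a] Suc.prems in auto)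
  next
    case False
    then have "f i [^] a i \<in> pow_ideal R f a m" using Suc by auto
    moreover have "f i [^] a i = f i [^] a i \<oplus> f m [^] a m \<otimes> \<zero>" using Suc.prems by simp
    ultimately show ?thesis by (intro pow_ideal_SucI[of _ _ _ _ _ \<zero>]) auto
  qed
qed simp

lemma pow_ideal_least:
  assumes "ideal J R" "\<And>i. i < m \<Longrightarrow> f i [^] a i \<in> J" "\<And>i. i < m \<Longrightarrow> f i \<in> carrier R"
  shows "pow_ideal R f a m \<subseteq> J"
proof -
  interpret J: ideal J R by fact
  show ?thesis using assms(2,3)
  proof (induction m)
    case (Suc m)
    then show ?case by (auto intro!: J.a_closed J.I_r_closed)
  qed simp
qed

lemma pow_ideal_Idl:
  assumes "\<And>i. i < m \<Longrightarrow> f i \<in> carrier R"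
  shows "pow_ideal R f a m = Idl ((\<lambda>i. f i [^] a i) ` {..<m})"
proof
  have s: "(\<lambda>i. f i [^] a i) ` {..<m} \<subseteq> carrier R" using assms by auto
  show "pow_ideal R f a m \<subseteq> Idl ((\<lambda>i. f i [^] a i) ` {..<m})"
    by (rule pow_ideal_least) (use genideal_ideal[OF s] genideal_self[OF s] assms in auto)
  show "Idl ((\<lambda>i. f i [^] a i) ` {..<m}) \<subseteq> pow_ideal R f a m"
    by (rule genideal_minimal[OF pow_ideal_ideal]) (use pow_ideal_gen[OF assms] assms in auto)
qed

lemma pow_ideal_mono:
  assumes "\<And>i. i < m \<Longrightarrow> f i \<in> carrier R" "\<And>i. i < m \<Longrightarrow> b i \<le> a i"
  shows "pow_ideal R f a m \<subseteq> pow_ideal R f b m"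
proof (rule pow_ideal_least[OF pow_ideal_ideal])
  fix i assume i: "i < m"
  interpret J: ideal "pow_ideal R f b m" R by (rule pow_ideal_ideal) (use assms in auto)
  have "f i [^] a i = f i [^] b i \<otimes> f i [^] (a i - b i)" using assms i by (simp add: nat_pow_mult)
  then show "f i [^] a i \<in> pow_ideal R f b m" using pow_ideal_gen[of m f i b, OF assms(1) i] assms(1)[OF i] J.I_r_closed by simp
qed (use assms in auto)

text \<open>The remainder \<open>l\<close> involves only the generators other than that of index j;
  this is expressed by its membership for every exponent \<open>e\<close> in place j.\<close>

lemma pow_ideal_split:
  assumes "\<And>i. i < m \<Longrightarrow> f i \<in> carrier R" "j < m" "x \<in> pow_ideal R f a m"
  shows "\<exists>l w. x = l \<oplus> f j [^] a j \<otimes> w \<and> w \<in> carrier R \<and> (\<forall>e. l \<in> pow_ideal R f (a(j := e)) m)"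
  using assms
proof (induction m arbitrary: x)
  case (Suc m)
  obtain l r where x: "x = l \<oplus> f m [^] a m \<otimes> r" "l \<in> pow_ideal R f a m" "r \<in> carrier R" using Suc by auto
  have lc: "l \<in> carrier R" using x pow_ideal_sub[of m f _ a] Suc.prems by auto
  show ?case
  proof (cases "j = m")
    case True
    have "l \<in> pow_ideal R f (a(j := e)) (Suc m)" for e
    proof -
      have "l \<in> pow_ideal R f (a(j := e)) m" using x pow_ideal_cong[of m a "a(j := e)" f] True by auto
      moreover have "l = l \<oplus> f m [^] (a(j := e)) m \<otimes> \<zero>" using Suc.prems(1)[of m] lc by simp
      ultimately show ?thesis by (intro pow_ideal_SucI[of _ _ _ _ _ \<zero>]) auto
    qed
    then show ?thesis using x True by blast
  next
    case False
    then obtain l' w where l: "l = l' \<oplus> f j [^] a j \<otimes> w" "w \<in> carrier R" "\<forall>e. l' \<in> pow_ideal R f (a(j := e)) m"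
      using Suc x by (metis less_Suc_eq)
    have lc': "l' \<in> carrier R" using l(3) pow_ideal_sub[of m f] Suc.prems by auto
    have fc: "f m [^] a m \<in> carrier R" "f j [^] a j \<in> carrier R" using Suc.prems by auto
    have "x = (l' \<oplus> f m [^] a m \<otimes> r) \<oplus> f j [^] a j \<otimes> w"
      using x l lc' fc by (simp add: a_ac)
    moreover have "l' \<oplus> f m [^] a m \<otimes> r \<in> pow_ideal R f (a(j := e)) (Suc m)" for e
      using l x False by auto
    ultimately show ?thesis using l by blast
  qed
qed simp

lemma sub_mem_ideal:
  assumes "ideal J R" "x \<oplus> y \<in> J" "y \<in> J" "x \<in> carrier R"
  shows "x \<in> J"
proof -
  interpret J: ideal J R by fact
  have "(x \<oplus> y) \<ominus> y \<in> J" using assms J.a_inv_closed J.a_closed by (simp add: a_minus_def)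
  moreover have "(x \<oplus> y) \<ominus> y = x" using assms J.Icarr[OF assms(3)] by (simp add: a_minus_def a_assoc r_neg)
  ultimately show ?thesis by simp
qed

text \<open>Induction on the sum of the exponents. If a_j is at least 2, lowering it by 1 gives y =
  l + f_j^(a_j-1) w. Then f_j^(a_j-1) g w lies in the ideal, the colon property leaves g w in the
  ideal with exponent 1 at j, and the induction hypothesis for w puts f_j^(a_j-1) w into the
  original ideal. The colon property is a hypothesis so that the lemma is available inside the
  induction that proves it.\<close>

lemma nonzerodivisor_step:
  assumes car: "\<And>i. i < m \<Longrightarrow> f i \<in> carrier R" "g \<in> carrier R"
    and reg: "\<And>x. x \<in> carrier R \<Longrightarrow> g \<otimes> x \<in> pow_ideal R f (\<lambda>_. 1) m \<Longrightarrow> x \<in> pow_ideal R f (\<lambda>_. 1) m"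
    and colon: "\<And>a j c y. j < m \<Longrightarrow> c < a j \<Longrightarrow> y \<in> carrier R \<Longrightarrow> (\<And>i. i < m \<Longrightarrow> 1 \<le> a i) \<Longrightarrow>
      f j [^] c \<otimes> y \<in> pow_ideal R f a m \<Longrightarrow> y \<in> pow_ideal R f (a(j := a j - c)) m"
    and a: "\<And>i. i < m \<Longrightarrow> 1 \<le> a i"
    and y: "y \<in> carrier R" "g \<otimes> y \<in> pow_ideal R f a m"
  shows "y \<in> pow_ideal R f a m"
  using a y
proof (induction "\<Sum>i<m. a i" arbitrary: a y rule: less_induct)
  case less
  show ?case
  proof (cases "\<forall>i<m. a i = 1")
    case True
    then have "pow_ideal R f a m = pow_ideal R f (\<lambda>_. 1) m" by (intro pow_ideal_cong) auto
    then show ?thesis using reg less.prems by simp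
  next
    case False
    then obtain j where j: "j < m" "2 \<le> a j" using less.prems(1) by (metis One_nat_def Suc_1 Suc_leI le_neq_implies_less)
    have sm: "(\<Sum>i<m. (a(j := b)) i) < (\<Sum>i<m. a i)" if "b < a j" for b
      by (rule sum_strict_mono_ex1) (use that j in auto)
    have I: "ideal (pow_ideal R f b m) R" for b by (rule pow_ideal_ideal) (use car in auto)
    have sub: "pow_ideal R f a m \<subseteq> pow_ideal R f (a(j := b)) m" if "b \<le> a j" for b
      by (rule pow_ideal_mono) (use car that in auto)
    have "y \<in> pow_ideal R f (a(j := a j - 1)) m"
    proof (rule less.hyps)
      show "(\<Sum>i<m. (a(j := a j - 1)) i) < (\<Sum>i<m. a i)" by (rule sm) (use j in simp)
      show "1 \<le> (a(j := a j - 1)) i" if "i < m" for i using less.prems(1)[OF that] j by auto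
      show "y \<in> carrier R" by (rule less.prems)
      show "g \<otimes> y \<in> pow_ideal R f (a(j := a j - 1)) m" using sub[of "a j - 1"] less.prems(3) by auto
    qed
    from pow_ideal_split[of m f j, OF car(1) j(1) this] obtain l w where
      lw: "y = l \<oplus> f j [^] (a j - 1) \<otimes> w" "w \<in> carrier R" "\<forall>e. l \<in> pow_ideal R f (a(j := e)) m"
      by auto
    have l: "l \<in> pow_ideal R f a m" using lw(3)[rule_format, of "a j"] by simp
    have lc: "l \<in> carrier R" using pow_ideal_sub[of m f, OF car(1) l] by simp
    have fj: "f j \<in> carrier R" using car j by simp
    have "f j [^] (a j - 1) \<otimes> (g \<otimes> w) \<oplus> g \<otimes> l = g \<otimes> y"
      using lw(1,2) lc fj car(2) by (simp add: r_distr m_ac a_ac)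
    then have "f j [^] (a j - 1) \<otimes> (g \<otimes> w) \<in> pow_ideal R f a m"
      using sub_mem_ideal[OF I, of "f j [^] (a j - 1) \<otimes> (g \<otimes> w)" "g \<otimes> l" a] less.prems(3)
        pow_ideal_mult[OF car(1) l car(2)] lw fj car(2) by simp
    note fgw = this
    have "g \<otimes> w \<in> pow_ideal R f (a(j := a j - (a j - 1))) m"
    proof (rule colon[OF j(1) _ _ _ fgw])
      show "a j - 1 < a j" using j by simp
      show "g \<otimes> w \<in> carrier R" using lw car by simp
    qed (rule less.prems(1))
    then have gw: "g \<otimes> w \<in> pow_ideal R f (a(j := 1)) m" using j by simp
    have "w \<in> pow_ideal R f (a(j := 1)) m"
    proof (rule less.hyps[OF _ _ _ gw])
      show "(\<Sum>i<m. (a(j := 1)) i) < (\<Sum>i<m. a i)" by (rule sm) (use j in simp)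
      show "1 \<le> (a(j := 1)) i" if "i < m" for i using less.prems(1)[OF that] by simp
    qed (rule lw(2))
    from pow_ideal_split[of m f j, OF car(1) j(1) this] obtain l' w' where
      lw': "w = l' \<oplus> f j [^] (1::nat) \<otimes> w'" "w' \<in> carrier R" "\<forall>e. l' \<in> pow_ideal R f (a(j := e)) m"
      by auto
    have l': "l' \<in> pow_ideal R f a m" using lw'(3)[rule_format, of "a j"] by simp
    have lc': "l' \<in> carrier R" using pow_ideal_sub[of m f, OF car(1) l'] by simp
    interpret J: ideal "pow_ideal R f a m" R by (rule I)
    have p: "f j [^] a j = f j [^] (a j - 1) \<otimes> f j" using j fj nat_pow_Suc[of "f j" "a j - 1"] by simp
    have "f j [^] (a j - 1) \<otimes> w = f j [^] (a j - 1) \<otimes> l' \<oplus> f j [^] a j \<otimes> w'"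
      using lw'(1,2) lc' fj by (simp add: p r_distr m_assoc)
    also have "\<dots> \<in> pow_ideal R f a m"
      using fj by (intro J.a_closed J.I_l_closed[OF l'] J.I_r_closed[OF pow_ideal_gen[of m f j a, OF car(1) j(1)] lw'(2)]) auto
    finally show ?thesis using lw(1) l J.a_closed by simp
  qed
qed

lemma nonzerodivisor_power:
  assumes "\<And>x. x \<in> carrier R \<Longrightarrow> g \<otimes> x \<in> J \<Longrightarrow> x \<in> J" "g \<in> carrier R" "y \<in> carrier R" "g [^] (k::nat) \<otimes> y \<in> J"
  shows "y \<in> J"
  using assms(3,4)
proof (induction k arbitrary: y)
  case (Suc k)
  have "g [^] Suc k \<otimes> y = g [^] k \<otimes> (g \<otimes> y)" using assms(2) Suc by (simp add: m_assoc)
  then have "g \<otimes> y \<in> J" using Suc.IH[of "g \<otimes> y"] Suc.prems assms(2) by simp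
  then show ?case by (rule assms(1)[OF Suc.prems(1)])
qed (use assms in simp)

definition weak_regular :: "(nat \<Rightarrow> 'a) \<Rightarrow> nat \<Rightarrow> bool" where
  "weak_regular f m \<longleftrightarrow> (\<forall>i<m. f i \<in> carrier R \<and>
     (\<forall>x\<in>carrier R. f i \<otimes> x \<in> pow_ideal R f (\<lambda>_. 1) i \<longrightarrow> x \<in> pow_ideal R f (\<lambda>_. 1) i))"

text \<open>Write f_j^c y = l + f_m^(a_m) w with m the last index. If j = m, subtracting f_m^(a_m-c)
  w from y reduces to \<open>f m\<close> being a nonzerodivisor modulo the powers of the earlier
  elements. If j < m, reduction modulo f_j^c shows that w is f_j^c w' up to powers of the other
  earlier elements, and y - f_m^(a_m) w' falls under the induction hypothesis.\<close>

lemma colon_power: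
  assumes "weak_regular f m" "j < m" "c < a j" "y \<in> carrier R" "\<And>i. i < m \<Longrightarrow> 1 \<le> a i"
    and "f j [^] c \<otimes> y \<in> pow_ideal R f a m"
  shows "y \<in> pow_ideal R f (a(j := a j - c)) m"
  using assms
proof (induction m arbitrary: a j c y)
  case (Suc m)
  have wr: "weak_regular f m" using Suc.prems(1) by (simp add: weak_regular_def)
  have car: "f i \<in> carrier R" if "i < Suc m" for i using Suc.prems(1) that by (simp add: weak_regular_def)
  have car': "f i \<in> carrier R" if "i < m" for i using car that by simp
  have fm: "f m \<in> carrier R" using car by simp
  have fj: "f j \<in> carrier R" using car Suc.prems(2) by simp
  note colon = Suc.IH[OF wr]
  have nzd: "x \<in> pow_ideal R f b m" if "\<And>i. i < m \<Longrightarrow> 1 \<le> b i" "x \<in> carrier R" "f m [^] (k::nat) \<otimes> x \<in> pow_ideal R f b m" for b x k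
  proof (rule nonzerodivisor_power[OF _ fm that(2,3)])
    fix z assume z: "z \<in> carrier R" "f m \<otimes> z \<in> pow_ideal R f b m"
    show "z \<in> pow_ideal R f b m"
    proof (rule nonzerodivisor_step[OF car' fm])
      show "x \<in> pow_ideal R f (\<lambda>_. 1) m" if "x \<in> carrier R" "f m \<otimes> x \<in> pow_ideal R f (\<lambda>_. 1) m" for x
        using Suc.prems(1) that by (simp add: weak_regular_def)
      show "y \<in> pow_ideal R f (a(j := a j - c)) m" if "j < m" "c < a j" "y \<in> carrier R"
        "\<And>i. i < m \<Longrightarrow> 1 \<le> a i" "f j [^] c \<otimes> y \<in> pow_ideal R f a m" for a j c y
        by (rule colon[OF that])
    qed (use that z in auto)
  qed
  have I: "ideal (pow_ideal R f b m) R" for b by (rule pow_ideal_ideal) (use car in auto)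
  obtain l w where e: "f j [^] c \<otimes> y = l \<oplus> f m [^] a m \<otimes> w" "l \<in> pow_ideal R f a m" "w \<in> carrier R"
    using Suc.prems(6) by auto
  have lc: "l \<in> carrier R" using pow_ideal_sub[of m f, OF car' e(2)] by simp
  show ?case
  proof (cases "j = m")
    case True
    have am: "a m = c + (a m - c)" using Suc.prems True by simp
    have p: "f m [^] a m = f m [^] c \<otimes> f m [^] (a m - c)"
      using fm by (subst am) (simp add: nat_pow_mult)
    let ?z = "y \<ominus> f m [^] (a m - c) \<otimes> w"
    have zc: "?z \<in> carrier R" using Suc.prems e fm by simp
    have "f m [^] c \<otimes> ?z = f m [^] c \<otimes> y \<ominus> f m [^] a m \<otimes> w"
      unfolding p using Suc.prems e fm by (simp add: a_minus_def r_distr r_minus m_assoc)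
    also have "\<dots> = l" unfolding e(1)[unfolded True] using lc e fm by (simp add: a_minus_def a_assoc r_neg)
    finally have "?z \<in> pow_ideal R f a m" using nzd[of a ?z c] Suc.prems(5) zc e(2) by simp
    then have z1: "?z \<in> pow_ideal R f (a(j := a j - c)) m" using pow_ideal_cong[of m a "a(j := a j - c)" f] True by simp
    have z2: "y = ?z \<oplus> f m [^] (a(j := a j - c)) m \<otimes> w"
      using True Suc.prems e fm by (simp add: a_minus_def a_assoc l_neg)
    show ?thesis by (rule pow_ideal_SucI[OF z2 z1 e(3)])
  next
    case False
    then have j: "j < m" using Suc.prems by simp
    show ?thesis
    \<comment> \<open>In the auxiliary ideal with exponents \<open>?b\<close> the exponent at j is
      c, and the nonzerodivisor argument asks for exponents of at least 1.\<close>
    proof (cases "c = 0")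
      case True then show ?thesis using Suc.prems by simp
    next
      case c: False
      let ?b = "a(j := c)"
      interpret Jb: ideal "pow_ideal R f ?b m" R by (rule I)
      have "l \<in> pow_ideal R f ?b m" by (rule subsetD[OF pow_ideal_mono e(2)]) (use car' Suc.prems(3) in auto)
      moreover have "f j [^] c \<otimes> y \<in> pow_ideal R f ?b m"
        using pow_ideal_gen[of m f j ?b, OF car' j] Suc.prems(4) by (auto intro!: Jb.I_r_closed)
      moreover have "f m [^] a m \<otimes> w \<oplus> l = f j [^] c \<otimes> y" using e lc fm by (simp add: a_comm)
      ultimately have fw: "f m [^] a m \<otimes> w \<in> pow_ideal R f ?b m"
        using sub_mem_ideal[OF I, of "f m [^] a m \<otimes> w" l ?b] fm e by simp
      have "w \<in> pow_ideal R f ?b m" by (rule nzd[OF _ _ fw]) (use c e Suc.prems in auto)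
      from pow_ideal_split[of m f j, OF car' j this] obtain l' w' where
        w: "w = l' \<oplus> f j [^] c \<otimes> w'" "w' \<in> carrier R" "\<forall>e. l' \<in> pow_ideal R f (a(j := e)) m" by auto
      have l': "l' \<in> pow_ideal R f a m" using w(3)[rule_format, of "a j"] by simp
      have lc': "l' \<in> carrier R" using pow_ideal_sub[of m f, OF car' l'] by simp
      let ?z = "y \<ominus> f m [^] a m \<otimes> w'"
      have zc: "?z \<in> carrier R" using Suc.prems w fm by simp
      interpret J: ideal "pow_ideal R f a m" R by (rule I)
      have "f j [^] c \<otimes> ?z = f j [^] c \<otimes> y \<ominus> f m [^] a m \<otimes> (f j [^] c \<otimes> w')"
        using Suc.prems w fm fj by (simp add: a_minus_def r_distr r_minus m_lcomm)
      also have "\<dots> = l \<oplus> f m [^] a m \<otimes> l'"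
        unfolding e(1) w(1) using lc lc' w(2) fm fj by (simp add: a_minus_def r_distr a_assoc r_neg)
      finally have fz: "f j [^] c \<otimes> ?z \<in> pow_ideal R f a m"
        using e(2) l' fm by (simp add: J.a_closed J.I_l_closed)
      have z1: "?z \<in> pow_ideal R f (a(j := a j - c)) m"
        by (rule colon[OF j _ zc _ fz]) (use Suc.prems in auto)
      have z2: "y = ?z \<oplus> f m [^] (a(j := a j - c)) m \<otimes> w'"
        using False Suc.prems w fm by (simp add: a_minus_def a_assoc l_neg)
      show ?thesis by (rule pow_ideal_SucI[OF z2 z1 w(2)])
    qed
  qed
qed simp

lemma weak_regular_car: "weak_regular f m \<Longrightarrow> i < m \<Longrightarrow> f i \<in> carrier R"
  by (simp add: weak_regular_def)

section \<open>Colon ideals and the product of the sequence\<close>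

definition fprod :: "(nat \<Rightarrow> 'a) \<Rightarrow> nat \<Rightarrow> 'a" where
  "fprod f s = (\<Otimes>i\<in>{..<s}. f i)"

lemma fprod_closed: "(\<And>i. i < s \<Longrightarrow> f i \<in> carrier R) \<Longrightarrow> fprod f s \<in> carrier R"
  unfolding fprod_def by (rule finprod_closed) auto

lemma fprod_Suc: "(\<And>i. i < Suc s \<Longrightarrow> f i \<in> carrier R) \<Longrightarrow> fprod f (Suc s) = fprod f s \<otimes> f s"
  unfolding fprod_def lessThan_Suc by (subst finprod_insert) (auto simp: m_comm Pi_def)

lemma fprod_0: "fprod f 0 = \<one>" by (simp add: fprod_def)

lemma colon_fprod:
  assumes wr: "weak_regular f m" and "s \<le> m" "\<And>i. i < m \<Longrightarrow> 1 \<le> a i" "\<And>i. i < s \<Longrightarrow> c < a i" "y \<in> carrier R"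
    and "fprod f s [^] c \<otimes> y \<in> pow_ideal R f a m"
  shows "y \<in> pow_ideal R f (\<lambda>i. if i < s then a i - c else a i) m"
  using assms(2-)
proof (induction s arbitrary: y)
  case 0 then show ?case by (simp add: fprod_0)
next
  case (Suc s)
  have car: "f i \<in> carrier R" if "i < m" for i using weak_regular_car[OF wr that] .
  have fs: "fprod f s \<in> carrier R" "f s \<in> carrier R" using Suc.prems(1) car by (auto intro!: fprod_closed)
  have "fprod f (Suc s) [^] c \<otimes> y = fprod f s [^] c \<otimes> (f s [^] c \<otimes> y)"
    using fs Suc.prems car by (subst fprod_Suc) (auto simp: nat_pow_distrib m_assoc)
  then have "f s [^] c \<otimes> y \<in> pow_ideal R f (\<lambda>i. if i < s then a i - c else a i) m"
    by (intro Suc.IH) (use Suc.prems fs in auto)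
  then have "y \<in> pow_ideal R f ((\<lambda>i. if i < s then a i - c else a i)(s := a s - c)) m"
    using colon_power[OF wr, of s c "\<lambda>i. if i < s then a i - c else a i" y] Suc.prems
    by (auto simp: Suc_le_eq)
  also have "(\<lambda>i. if i < s then a i - c else a i)(s := a s - c) = (\<lambda>i. if i < Suc s then a i - c else a i)"
    by (auto simp: fun_eq_iff)
  finally show ?case .
qed

lemma fprod_split:
  assumes "\<And>i. i < s \<Longrightarrow> f i \<in> carrier R" "j < s"
  shows "\<exists>g\<in>carrier R. fprod f s = f j \<otimes> g"
  using assms
proof (induction s)
  case (Suc s)
  have fs: "fprod f s \<in> carrier R" "f s \<in> carrier R" using Suc.prems by (auto intro!: fprod_closed)
  show ?case
  proof (cases "j = s")
    case True
    then have "fprod f (Suc s) = f j \<otimes> fprod f s" using fprod_Suc[of s f] Suc.prems fs by (simp add: m_comm)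
    then show ?thesis using fs by blast
  next
    case False
    then obtain g where g: "g \<in> carrier R" "fprod f s = f j \<otimes> g" using Suc by auto
    then have "fprod f (Suc s) = f j \<otimes> (g \<otimes> f s)" using fprod_Suc[of s f] Suc.prems by (simp add: m_assoc)
    then show ?thesis using g fs by blast
  qed
qed simp

lemma ideal_mult_preimage:
  assumes "ideal J R" "g \<in> carrier R"
  shows "ideal {x \<in> carrier R. g \<otimes> x \<in> J} R"
proof -
  interpret J: ideal J R by fact
  show ?thesis
  proof (rule idealI)
    show "subgroup {x \<in> carrier R. g \<otimes> x \<in> J} (add_monoid R)"
    proof
      fix x assume x: "x \<in> {x \<in> carrier R. g \<otimes> x \<in> J}"
      then have "g \<otimes> (\<ominus> x) \<in> J" using J.a_inv_closed[of "g \<otimes> x"] assms(2) by (simp add: r_minus)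
      then show "inv\<^bsub>add_monoid R\<^esub> x \<in> {x \<in> carrier R. g \<otimes> x \<in> J}"
        using x by (simp add: a_inv_def[symmetric])
    qed (use assms(2) in \<open>auto simp: r_distr\<close>)
    fix x y assume xy: "x \<in> {x \<in> carrier R. g \<otimes> x \<in> J}" "y \<in> carrier R"
    have "g \<otimes> (y \<otimes> x) = y \<otimes> (g \<otimes> x)" "g \<otimes> (x \<otimes> y) = (g \<otimes> x) \<otimes> y"
      using xy assms(2) by (auto simp: m_ac)
    then show "y \<otimes> x \<in> {x \<in> carrier R. g \<otimes> x \<in> J}" "x \<otimes> y \<in> {x \<in> carrier R. g \<otimes> x \<in> J}"
      using xy J.I_l_closed J.I_r_closed by auto
  qed (rule ring_axioms)
qed

lemma fprod_mult_pow_ideal: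
  assumes car: "\<And>i. i < m \<Longrightarrow> f i \<in> carrier R" and "s \<le> m" and "x \<in> pow_ideal R f b m"
  shows "fprod f s [^] c \<otimes> x \<in> pow_ideal R f (\<lambda>i. if i < s then b i + c else b i) m" (is "_ \<in> ?J")
proof -
  interpret J: ideal ?J R by (rule pow_ideal_ideal) (use car in auto)
  have fs: "fprod f s \<in> carrier R" using assms by (auto intro!: fprod_closed)
  have sub: "pow_ideal R f b m \<subseteq> {x \<in> carrier R. fprod f s [^] c \<otimes> x \<in> ?J}"
  proof (rule pow_ideal_least)
    show "ideal {x \<in> carrier R. fprod f s [^] c \<otimes> x \<in> ?J} R"
      by (rule ideal_mult_preimage) (use fs J.ideal_axioms in auto)
    fix i assume i: "i < m"
    have "f i [^] b i \<otimes> fprod f s [^] c \<in> ?J"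
    proof (cases "i < s")
      case True
      then obtain g where g: "g \<in> carrier R" "fprod f s = f i \<otimes> g" using fprod_split[of s f i] car assms(2) by auto
      have "f i [^] b i \<otimes> fprod f s [^] c = f i [^] (b i + c) \<otimes> g [^] c"
        using g car[OF i] by (simp add: nat_pow_distrib nat_pow_mult[symmetric] m_assoc)
      then show ?thesis using pow_ideal_gen[of m f i "\<lambda>i. if i < s then b i + c else b i", OF car i] True g
        by (simp add: J.I_r_closed)
    next
      case False
      then show ?thesis using pow_ideal_gen[of m f i "\<lambda>i. if i < s then b i + c else b i", OF car i] fs
        by (simp add: J.I_r_closed)
    qed
    then show "f i [^] b i \<in> {x \<in> carrier R. fprod f s [^] c \<otimes> x \<in> ?J}" using car[OF i] fs by (simp add: m_comm)
  qed (use car in auto)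
  show ?thesis using subsetD[OF sub assms(3)] by simp
qed

text \<open>Absorb one element at a time. Let y be the (q-1)-st power of the product of the f_i with
  i < s, times z, modulo q-th powers. As f_s y lies in the ideal, the exponent at s drops to q-1;
  dividing by the power of the product lowers the exponents before s to 1. So z is a multiple of
  f_s^(q-1) up to terms that the power of the product sends back into the ideal.\<close>

lemma colon_pow_ideal:
  assumes wr: "weak_regular f m" and q: "2 \<le> q" and y: "y \<in> carrier R"
    and "\<And>j. j < m \<Longrightarrow> f j \<otimes> y \<in> pow_ideal R f (\<lambda>_. q) m"
  shows "\<exists>z\<in>carrier R. \<exists>l\<in>pow_ideal R f (\<lambda>_. q) m. y = fprod f m [^] (q - 1) \<otimes> z \<oplus> l"
proof -
  have car: "f i \<in> carrier R" if "i < m" for i using weak_regular_car[OF wr that] .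
  have I: "ideal (pow_ideal R f b m) R" for b by (rule pow_ideal_ideal) (use car in auto)
  interpret J: ideal "pow_ideal R f (\<lambda>_. q) m" R by (rule I)
  have "\<exists>z\<in>carrier R. \<exists>l\<in>pow_ideal R f (\<lambda>_. q) m. y = fprod f s [^] (q - 1) \<otimes> z \<oplus> l" if "s \<le> m" for s
    using that
  proof (induction s)
    case 0
    then show ?case using y J.zero_closed by (intro bexI[of _ y] bexI[of _ \<zero>]) (auto simp: fprod_0)
  next
    case (Suc s)
    then obtain z l where z: "z \<in> carrier R" "l \<in> pow_ideal R f (\<lambda>_. q) m" "y = fprod f s [^] (q - 1) \<otimes> z \<oplus> l"
      by auto
    have s: "s < m" using Suc by simp
    have fs: "fprod f s \<in> carrier R" "f s \<in> carrier R" using s car by (auto intro!: fprod_closed)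
    have lc: "l \<in> carrier R" using z J.Icarr by blast
    let ?b = "(\<lambda>_. q)(s := q - 1)"
    have "y \<in> pow_ideal R f ?b m"
      using colon_power[OF wr s, of 1 "\<lambda>_. q" y] assms(4)[OF s] q y fs by simp
    moreover have "l \<in> pow_ideal R f ?b m" by (rule subsetD[OF pow_ideal_mono z(2)]) (use car in auto)
    ultimately have "fprod f s [^] (q - 1) \<otimes> z \<in> pow_ideal R f ?b m"
      using sub_mem_ideal[OF I, of "fprod f s [^] (q - 1) \<otimes> z" l ?b] z fs by simp
    then have "z \<in> pow_ideal R f (\<lambda>i. if i < s then ?b i - (q - 1) else ?b i) m"
      by (rule colon_fprod[OF wr _ _ _ z(1), rotated 3]) (use s q in auto)
    from pow_ideal_split[of m f s, OF car s this] obtain l' w where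
      w: "z = l' \<oplus> f s [^] (q - 1) \<otimes> w" "w \<in> carrier R"
         "\<forall>e. l' \<in> pow_ideal R f ((\<lambda>i. if i < s then ?b i - (q - 1) else ?b i)(s := e)) m" by auto
    have "l' \<in> pow_ideal R f (\<lambda>i. if i < s then 1 else q) m"
      using w(3)[rule_format, of q] pow_ideal_cong[of m "(\<lambda>i. if i < s then ?b i - (q - 1) else ?b i)(s := q)" "\<lambda>i. if i < s then 1 else q" f] q
      by (auto simp: fun_eq_iff)
    then have m1: "fprod f s [^] (q - 1) \<otimes> l' \<in> pow_ideal R f (\<lambda>_. q) m"
      using fprod_mult_pow_ideal[of m f s l' "\<lambda>i. if i < s then 1 else q" "q - 1", OF car] s q
        pow_ideal_cong[of m "\<lambda>i. if i < s then (if i < s then 1 else q) + (q - 1) else (if i < s then 1 else q)" "\<lambda>_. q" f]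
      by auto
    have lc': "l' \<in> carrier R" using w(3) pow_ideal_sub[of m f, OF car] by blast
    have "fprod f (Suc s) [^] (q - 1) = fprod f s [^] (q - 1) \<otimes> f s [^] (q - 1)"
      using fs s car by (subst fprod_Suc) (auto simp: nat_pow_distrib)
    then have "y = fprod f (Suc s) [^] (q - 1) \<otimes> w \<oplus> (fprod f s [^] (q - 1) \<otimes> l' \<oplus> l)"
      unfolding z(3) w(1) using w(2) lc lc' fs by (simp add: r_distr m_assoc a_ac)
    then show ?case using w(2) J.a_closed[OF m1 z(2)] by blast
  qed
  then show ?thesis by blast
qed

end

section \<open>Frobenius bases\<close>

text \<open>The binomial congruence in the polynomial ring with variables indexed by ring elements
  is mapped to \<open>R\<close>, where \<open>p\<close> vanishes.\<close>

lemma (in cring) freshman: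
  fixes p :: nat
  assumes "Factorial_Ring.prime p" "add_pow R p \<one> = \<zero>" "a \<in> carrier R" "b \<in> carrier R"
  shows "(a \<oplus> b) [^] p = a [^] p \<oplus> b [^] p"
proof -
  obtain \<epsilon> :: "'a zpoly \<Rightarrow> 'a" where e: "witt_hom p (zphi p) R \<epsilon>" "\<epsilon> ` UNIV = carrier R"
    "\<forall>a\<in>carrier R. \<epsilon> (zvar a) = a"
    by (rule exists_witt_hom[OF assms(1) is_cring])
  interpret witt_hom p "zphi p" R \<epsilon> by (rule e)
  obtain z where "(zvar a + zvar b) ^ p - (zvar a ^ p + zvar b ^ p) = of_nat p * z"
    using freshman_dvd[OF assms(1)] by blast
  then have z: "(zvar a + zvar b) ^ p = (zvar a ^ p + zvar b ^ p) + of_nat p * z" by (simp add: algebra_simps)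
  have "\<epsilon> (of_nat p * z) = add_pow R p \<one> \<otimes> \<epsilon> z"
    using hom_of_nat_mult[of p 1] by (simp add: hom_mult hom_one)
  then have "\<epsilon> ((zvar a + zvar b) ^ p) = \<epsilon> (zvar a ^ p + zvar b ^ p)"
    unfolding z using assms(2) by (simp add: hom_add)
  then show ?thesis using e(3) assms by (simp add: hom_power hom_add)
qed

lemma (in cring) finsum_ideal:
  assumes "ideal J R" "\<And>s. s \<in> S \<Longrightarrow> g s \<in> J"
  shows "(\<Oplus>s\<in>S. g s) \<in> J"
proof -
  interpret J: ideal J R by fact
  show ?thesis using assms(2)
    by (induction S rule: infinite_finite_induct) (auto simp: Pi_def J.Icarr)
qed

locale p_basis = cring R for R :: "('a, 'c) ring_scheme" (structure) +
  fixes p N :: nat and x :: "nat \<Rightarrow> 'a"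
  assumes prime_p: "Factorial_Ring.prime p" and char_p: "add_pow R p \<one> = \<zero>" and basis: "frob_basis R p N x"
begin

abbreviation "E \<equiv> exponents p N"
abbreviation "xm \<equiv> x_monom R N x"
abbreviation "u \<equiv> u_map R p N x"

definition crd :: "'a \<Rightarrow> (nat \<Rightarrow> nat) \<Rightarrow> 'a" where
  "crd a = (THE c. c \<in> E \<rightarrow>\<^sub>E carrier R \<and> a = (\<Oplus>e\<in>E. c e [^] p \<otimes> xm e))"

lemma p_gt_1: "p > 1" and p_pos: "p > 0" using prime_p prime_gt_1_nat by (simp_all add: prime_gt_0_nat)

lemma finite_E: "finite E" by (simp add: exponents_def finite_PiE)

lemma x_closed: "j < N \<Longrightarrow> x j \<in> carrier R" using basis by (simp add: frob_basis_def)

lemma xm_closed [simp, intro]: "xm e \<in> carrier R"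
  unfolding x_monom_def using x_closed by (intro finprod_closed) auto

lemma finsum_pushforward: "finsum (frob_pushforward p R) = finsum R"
  by (simp add: fun_eq_iff finsum_def finprod_def frob_pushforward_def restrict_scalars_def)

lemma ex1_crd: "a \<in> carrier R \<Longrightarrow> \<exists>!c. c \<in> E \<rightarrow>\<^sub>E carrier R \<and> a = (\<Oplus>e\<in>E. c e [^] p \<otimes> xm e)"
  using basis unfolding frob_basis_def module_basis_def finsum_pushforward
  by (simp add: frob_pushforward_def restrict_scalars_def)

lemma u_eq_crd: "u a = crd a (\<lambda>j\<in>{..<N}. p - 1)"
  unfolding u_map_def dual_basis_def crd_def finsum_pushforward
  by (simp add: frob_pushforward_def restrict_scalars_def)

lemma crd_expand: "a \<in> carrier R \<Longrightarrow> a = (\<Oplus>e\<in>E. crd a e [^] p \<otimes> xm e)"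
  and crd_PiE: "a \<in> carrier R \<Longrightarrow> crd a \<in> E \<rightarrow>\<^sub>E carrier R"
  using theI'[OF ex1_crd] unfolding crd_def by blast+

lemma crd_closed: "a \<in> carrier R \<Longrightarrow> e \<in> E \<Longrightarrow> crd a e \<in> carrier R"
  using crd_PiE by blast

lemma crd_unique:
  assumes "\<And>e. e \<in> E \<Longrightarrow> c e \<in> carrier R" "a = (\<Oplus>e\<in>E. c e [^] p \<otimes> xm e)" "e \<in> E"
  shows "crd a e = c e"
proof -
  have a: "a \<in> carrier R" unfolding assms(2) using assms(1) by (intro finsum_closed) auto
  have "a = (\<Oplus>e\<in>E. restrict c E e [^] p \<otimes> xm e)"
    unfolding assms(2) using assms(1) by (intro add.finprod_cong') auto
  then have "restrict c E \<in> E \<rightarrow>\<^sub>E carrier R \<and> a = (\<Oplus>e\<in>E. restrict c E e [^] p \<otimes> xm e)" using assms(1) by auto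
  then have "crd a = restrict c E"
    unfolding crd_def by (rule the1_equality[OF ex1_crd[OF a]])
  then show ?thesis using assms(3) by simp
qed

lemma crd_add:
  assumes "a \<in> carrier R" "b \<in> carrier R" "e \<in> E"
  shows "crd (a \<oplus> b) e = crd a e \<oplus> crd b e"
proof (rule crd_unique[OF _ _ assms(3)])
  note c = crd_closed[OF assms(1)] crd_closed[OF assms(2)]
  show "crd a e \<oplus> crd b e \<in> carrier R" if "e \<in> E" for e using c that by auto
  have "a \<oplus> b = (\<Oplus>e\<in>E. crd a e [^] p \<otimes> xm e) \<oplus> (\<Oplus>e\<in>E. crd b e [^] p \<otimes> xm e)"
    using crd_expand[OF assms(1)] crd_expand[OF assms(2)] by simp
  also have "\<dots> = (\<Oplus>e\<in>E. crd a e [^] p \<otimes> xm e \<oplus> crd b e [^] p \<otimes> xm e)"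
    by (subst finsum_addf) (use c in auto)
  also have "\<dots> = (\<Oplus>e\<in>E. (crd a e \<oplus> crd b e) [^] p \<otimes> xm e)"
    by (intro add.finprod_cong') (use c in \<open>auto simp: freshman[OF prime_p char_p] l_distr\<close>)
  finally show "a \<oplus> b = \<dots>" .
qed

lemma crd_mult:
  assumes "a \<in> carrier R" "r \<in> carrier R" "e \<in> E"
  shows "crd (r [^] p \<otimes> a) e = r \<otimes> crd a e"
proof (rule crd_unique[OF _ _ assms(3)])
  note c = crd_closed[OF assms(1)]
  show "r \<otimes> crd a e \<in> carrier R" if "e \<in> E" for e using c that assms(2) by auto
  have "r [^] p \<otimes> a = r [^] p \<otimes> (\<Oplus>e\<in>E. crd a e [^] p \<otimes> xm e)" using crd_expand[OF assms(1)] by simp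
  also have "\<dots> = (\<Oplus>e\<in>E. r [^] p \<otimes> (crd a e [^] p \<otimes> xm e))"
    by (subst finsum_rdistr) (use c assms finite_E in auto)
  also have "\<dots> = (\<Oplus>e\<in>E. (r \<otimes> crd a e) [^] p \<otimes> xm e)"
    by (intro add.finprod_cong') (use c assms in \<open>auto simp: nat_pow_distrib m_assoc\<close>)
  finally show "r [^] p \<otimes> a = \<dots>" .
qed

lemma crd_xm:
  assumes "e' \<in> E" "e \<in> E" "b \<in> carrier R"
  shows "crd (b [^] p \<otimes> xm e') e = (if e = e' then b else \<zero>)"
proof (rule crd_unique[OF _ _ assms(2)])
  show "(if e = e' then b else \<zero>) \<in> carrier R" for e using assms by simp
  have z: "\<zero> [^] p = \<zero>" using p_pos by (simp add: nat_pow_zero)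
  have "(\<Oplus>e\<in>E. (if e = e' then b else \<zero>) [^] p \<otimes> xm e) = (\<Oplus>e\<in>E. if e' = e then b [^] p \<otimes> xm e else \<zero>)"
    by (intro add.finprod_cong') (use assms z in auto)
  also have "\<dots> = b [^] p \<otimes> xm e'"
    by (rule add.finprod_singleton) (use assms finite_E in auto)
  finally show "b [^] p \<otimes> xm e' = (\<Oplus>e\<in>E. (if e = e' then b else \<zero>) [^] p \<otimes> xm e)" ..
qed

section \<open>Monomials and the duality given by \<open>u\<close>\<close>

lemma xm_add: "xm (\<lambda>j. d j + d' j) = xm d \<otimes> xm d'"
proof -
  have "xm (\<lambda>j. d j + d' j) = (\<Otimes>j\<in>{..<N}. x j [^] d j \<otimes> x j [^] d' j)"
    unfolding x_monom_def using x_closed by (intro finprod_cong') (auto simp: nat_pow_mult)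
  also have "\<dots> = xm d \<otimes> xm d'"
    unfolding x_monom_def using x_closed by (intro finprod_multf) auto
  finally show ?thesis .
qed

lemma xm_cong: "(\<And>j. j < N \<Longrightarrow> d j = d' j) \<Longrightarrow> xm d = xm d'"
  unfolding x_monom_def using x_closed by (intro finprod_cong') auto

lemma xm_power: "xm (\<lambda>j. k * d j) = xm d [^] (k::nat)"
proof (induction k)
  case 0 then show ?case using x_closed by (simp add: x_monom_def finprod_one_eqI)
next
  case (Suc k)
  then show ?case using xm_add[of d "\<lambda>j. k * d j"] by (simp add: m_comm)
qed

definition red :: "(nat \<Rightarrow> nat) \<Rightarrow> nat \<Rightarrow> nat" where "red d = (\<lambda>j\<in>{..<N}. d j mod p)"

lemma red_E: "red d \<in> E"
  using p_pos by (auto simp: red_def exponents_def Suc_le_eq simp flip: less_Suc_eq_le)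

lemma xm_red: "xm d = xm (\<lambda>j. d j div p) [^] p \<otimes> xm (red d)"
proof -
  have "xm d = xm (\<lambda>j. p * (d j div p) + red d j)"
    by (rule xm_cong) (simp add: red_def)
  then show ?thesis using xm_power by (simp add: xm_add)
qed

lemma crd_xm_red:
  assumes "e \<in> E" "b \<in> carrier R"
  shows "crd (b [^] p \<otimes> xm d) e = (if e = red d then b \<otimes> xm (\<lambda>j. d j div p) else \<zero>)"
proof -
  have "b [^] p \<otimes> xm d = (b \<otimes> xm (\<lambda>j. d j div p)) [^] p \<otimes> xm (red d)"
    using assms by (subst xm_red) (simp add: nat_pow_distrib m_assoc)
  then show ?thesis using crd_xm[OF red_E assms(1)] assms by simp
qed

definition top_e :: "nat \<Rightarrow> nat" where "top_e = (\<lambda>j\<in>{..<N}. p - 1)"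

lemma top_E: "top_e \<in> E" by (auto simp: top_e_def exponents_def)

lemma u_crd: "u a = crd a top_e" by (simp add: u_eq_crd top_e_def)

lemma u_closed [simp, intro]: "a \<in> carrier R \<Longrightarrow> u a \<in> carrier R"
  using crd_closed top_E by (simp add: u_crd)

lemma u_add: "a \<in> carrier R \<Longrightarrow> b \<in> carrier R \<Longrightarrow> u (a \<oplus> b) = u a \<oplus> u b"
  using crd_add top_E by (simp add: u_crd)

lemma u_mult: "a \<in> carrier R \<Longrightarrow> r \<in> carrier R \<Longrightarrow> u (r [^] p \<otimes> a) = r \<otimes> u a"
  using crd_mult top_E by (simp add: u_crd)

lemma u_zero: "u \<zero> = \<zero>"
  using u_mult[of \<zero> \<zero>] p_pos by (simp add: nat_pow_zero)

lemma u_minus: "a \<in> carrier R \<Longrightarrow> u (\<ominus> a) = \<ominus> u a"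
  using u_add[of a "\<ominus> a"] u_zero by (simp add: r_neg minus_equality[symmetric] a_comm)

lemma u_finsum: "(\<And>i. i \<in> S \<Longrightarrow> g i \<in> carrier R) \<Longrightarrow> u (\<Oplus>i\<in>S. g i) = (\<Oplus>i\<in>S. u (g i))"
proof (induction S rule: infinite_finite_induct)
  case (insert i S)
  then show ?case by (simp add: u_add Pi_def)
qed (simp_all add: u_zero)

text \<open>The complementary exponent: multiplying a basis monomial by the complement of e' reaches
  the top exponent modulo \<open>p\<close> exactly when the monomial has exponent e'. So
  \<open>u\<close> after this multiplication is the coordinate at e'.\<close>

definition dual_e :: "(nat \<Rightarrow> nat) \<Rightarrow> nat \<Rightarrow> nat" where "dual_e e j = p - 1 - e j"

lemma red_dual:
  assumes "e \<in> E" "e' \<in> E"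
  shows "red (\<lambda>j. e j + dual_e e' j) = top_e \<longleftrightarrow> e = e'"
proof
  assume r: "red (\<lambda>j. e j + dual_e e' j) = top_e"
  show "e = e'"
  proof (rule PiE_ext[where k = "{..<N}" and s = "\<lambda>_. {0..p - 1}"])
    fix j assume j: "j \<in> {..<N}"
    have b: "e j \<le> p - 1" "e' j \<le> p - 1" using assms j by (auto simp: exponents_def PiE_iff)
    have "(e j + (p - 1 - e' j)) mod p = p - 1" using fun_cong[OF r, of j] j by (simp add: red_def top_e_def dual_e_def)
    \<comment> \<open>If e j > e' j, the sum exceeds p-1 and wraps around to at most p-2; otherwise
      it is p-1 only for e j = e' j.\<close>
    moreover have "(e j + (p - 1 - e' j)) mod p = (if e j \<le> e' j then e j + (p - 1 - e' j) else e j - e' j - 1)"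
    proof (cases "e j \<le> e' j")
      case True then show ?thesis using b p_pos by simp
    next
      case False
      then have eq: "e j + (p - 1 - e' j) = p + (e j - e' j - 1)" using b p_pos by simp
      have "e j - e' j - 1 < p" using b p_pos by simp
      then have "(e j + (p - 1 - e' j)) mod p = e j - e' j - 1" unfolding eq mod_add_self1 by (rule mod_less)
      then show ?thesis using False by simp
    qed
    ultimately show "e j = e' j" using b p_gt_1 by (auto split: if_splits)
  qed (use assms in \<open>simp_all add: exponents_def\<close>)
next
  assume "e = e'"
  have "j < N \<Longrightarrow> e j \<le> p - 1" for j using assms(1) by (auto simp: exponents_def PiE_iff)
  then have "j < N \<Longrightarrow> e j + dual_e e' j = p - 1" for j
    using \<open>e = e'\<close> by (force simp: dual_e_def)
  then show "red (\<lambda>j. e j + dual_e e' j) = top_e" using p_pos by (auto simp: red_def top_e_def fun_eq_iff)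
qed

lemma u_dual:
  assumes "e \<in> E" "e' \<in> E" "b \<in> carrier R"
  shows "u (b [^] p \<otimes> xm e \<otimes> xm (dual_e e')) = (if e = e' then b else \<zero>)"
proof -
  have "b [^] p \<otimes> xm e \<otimes> xm (dual_e e') = b [^] p \<otimes> xm (\<lambda>j. e j + dual_e e' j)"
    using assms by (simp add: xm_add m_assoc)
  then have *: "u (b [^] p \<otimes> xm e \<otimes> xm (dual_e e'))
      = (if e = e' then b \<otimes> xm (\<lambda>j. (e j + dual_e e' j) div p) else \<zero>)"
    using crd_xm_red[OF top_E assms(3)] red_dual[OF assms(1,2)] by (auto simp: u_crd)
  have "xm (\<lambda>j. (e j + dual_e e' j) div p) = \<one>" if "e = e'"
  proof -
    have "xm (\<lambda>j. (e j + dual_e e' j) div p) = xm (\<lambda>j. 0 * e j)"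
    proof (rule xm_cong)
      fix j assume "j < N"
      then have "e j \<le> p - 1" using assms(1) by (auto simp: exponents_def PiE_iff)
      then have "e j + dual_e e' j = p - 1" using that by (simp add: dual_e_def)
      then show "(e j + dual_e e' j) div p = 0 * e j" using p_pos by simp
    qed
    then show ?thesis unfolding xm_power by simp
  qed
  then show ?thesis using * assms(3) by simp
qed

text \<open>Expand \<open>a\<close> in the basis; by \<open>u_dual\<close> only the summand at
  \<open>e\<close> survives. This is the sense in which \<open>u\<close> generates the linear
  functionals on F_* R as a module over F_* R.\<close>

lemma crd_eq_u:
  assumes "a \<in> carrier R" "e \<in> E"
  shows "crd a e = u (a \<otimes> xm (dual_e e))"
proof -
  note c = crd_closed[OF assms(1)]
  have "a \<otimes> xm (dual_e e) = (\<Oplus>e'\<in>E. crd a e' [^] p \<otimes> xm e') \<otimes> xm (dual_e e)"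
    using crd_expand[OF assms(1)] by simp
  also have "\<dots> = (\<Oplus>e'\<in>E. crd a e' [^] p \<otimes> xm e' \<otimes> xm (dual_e e))"
    by (rule finsum_ldistr) (use c finite_E in auto)
  finally have "u (a \<otimes> xm (dual_e e)) = u (\<Oplus>e'\<in>E. crd a e' [^] p \<otimes> xm e' \<otimes> xm (dual_e e))" by simp
  also have "\<dots> = (\<Oplus>e'\<in>E. u (crd a e' [^] p \<otimes> xm e' \<otimes> xm (dual_e e)))"
    by (rule u_finsum) (use c in auto)
  also have "\<dots> = (\<Oplus>e'\<in>E. if e = e' then crd a e' else \<zero>)"
    by (intro add.finprod_cong') (use c assms u_dual in auto)
  also have "\<dots> = crd a e"
    by (rule add.finprod_singleton) (use c assms finite_E in auto)
  finally show ?thesis ..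
qed

lemma ex_u_one: "\<exists>v\<in>carrier R. u v = \<one>"
proof
  show "u (xm top_e) = \<one>" using crd_xm[OF top_E top_E one_closed] by (simp add: u_crd)
qed simp

section \<open>Frobenius powers of ideals\<close>

lemma frob_preimage_ideal:
  assumes "ideal J R"
  shows "ideal {a \<in> carrier R. a [^] p \<in> J} R"
proof -
  interpret J: ideal J R by fact
  show ?thesis
  proof (rule idealI)
    show "subgroup {a \<in> carrier R. a [^] p \<in> J} (add_monoid R)"
    proof
      fix a b assume "a \<in> {a \<in> carrier R. a [^] p \<in> J}" "b \<in> {a \<in> carrier R. a [^] p \<in> J}"
      then show "a \<otimes>\<^bsub>add_monoid R\<^esub> b \<in> {a \<in> carrier R. a [^] p \<in> J}"
        by (simp add: freshman[OF prime_p char_p])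
    next
      fix a assume a: "a \<in> {a \<in> carrier R. a [^] p \<in> J}"
      have "(\<ominus> a) [^] p = (\<ominus> \<one>) [^] p \<otimes> a [^] p"
        using a by (subst nat_pow_distrib[symmetric]) (auto simp: l_minus)
      then show "inv\<^bsub>add_monoid R\<^esub> a \<in> {a \<in> carrier R. a [^] p \<in> J}"
        using a by (simp add: a_inv_def[symmetric] J.I_l_closed)
    qed (use p_pos in \<open>auto simp: nat_pow_zero\<close>)
    fix a r assume "a \<in> {a \<in> carrier R. a [^] p \<in> J}" "r \<in> carrier R"
    then show "r \<otimes> a \<in> {a \<in> carrier R. a [^] p \<in> J}" "a \<otimes> r \<in> {a \<in> carrier R. a [^] p \<in> J}"
      by (auto simp: nat_pow_distrib J.I_l_closed J.I_r_closed)
  qed (rule ring_axioms)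
qed

lemma frob_power_ideal: "J \<subseteq> carrier R \<Longrightarrow> ideal (frob_power p R J) R"
  unfolding frob_power_def by (rule genideal_ideal) auto

lemma frob_power_gen: "J \<subseteq> carrier R \<Longrightarrow> a \<in> J \<Longrightarrow> a [^] p \<in> frob_power p R J"
  unfolding frob_power_def by (rule subsetD[OF genideal_self]) auto

text \<open>By additivity of Frobenius, the elements whose p-th power lies in a given ideal form an
  ideal; therefore p-th powers of generators suffice.\<close>

lemma frob_power_pow_ideal:
  assumes car: "\<And>i. i < m \<Longrightarrow> f i \<in> carrier R"
  shows "frob_power p R (pow_ideal R f (\<lambda>_. q) m) = pow_ideal R f (\<lambda>_. p * q) m"
proof
  let ?L = "pow_ideal R f (\<lambda>_. q) m" and ?L' = "pow_ideal R f (\<lambda>_. p * q) m"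
  have I: "ideal ?L R" "ideal ?L' R" by (rule pow_ideal_ideal; use car in auto)+
  have sub: "?L \<subseteq> carrier R" using pow_ideal_sub[of m f] car by auto
  have e: "(f i [^] q) [^] p = f i [^] (p * q)" if "i < m" for i
    using car[OF that] by (simp add: nat_pow_pow mult.commute)
  have "?L \<subseteq> {a \<in> carrier R. a [^] p \<in> ?L'}"
    by (rule pow_ideal_least[OF frob_preimage_ideal[OF I(2)]])
      (use car e pow_ideal_gen[of m f _ "\<lambda>_. p * q"] in auto)
  then show "frob_power p R ?L \<subseteq> ?L'"
    unfolding frob_power_def by (intro genideal_minimal[OF I(2)]) auto
  show "?L' \<subseteq> frob_power p R ?L"
  proof (rule pow_ideal_least[OF frob_power_ideal[OF sub]])
    fix i assume i: "i < m"
    show "f i [^] (p * q) \<in> frob_power p R ?L"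
      using frob_power_gen[OF sub pow_ideal_gen[of m f i "\<lambda>_. q"]] car i e[OF i] by simp
  qed (use car in auto)
qed

text \<open>The elements all of whose multiples are sent into \<open>J\<close> by \<open>u\<close>
  form an ideal, and it contains a^p for a in \<open>J\<close> because u(r a^p) = a u(r).\<close>

lemma u_frob_power:
  assumes "ideal J R" "a \<in> frob_power p R J"
  shows "u a \<in> J"
proof -
  interpret J: ideal J R by fact
  have J: "J \<subseteq> carrier R" using J.Icarr by blast
  have "ideal {a \<in> carrier R. \<forall>r\<in>carrier R. u (r \<otimes> a) \<in> J} R" (is "ideal ?K R")
  proof (rule idealI)
    show "subgroup ?K (add_monoid R)"
    proof
      fix a b assume "a \<in> ?K" "b \<in> ?K"
      then show "a \<otimes>\<^bsub>add_monoid R\<^esub> b \<in> ?K" by (auto simp: r_distr u_add)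
    next
      fix a assume "a \<in> ?K"
      then show "inv\<^bsub>add_monoid R\<^esub> a \<in> ?K" by (auto simp: a_inv_def[symmetric] r_minus u_minus)
    qed (auto simp: u_zero)
    fix a s assume as: "a \<in> ?K" "s \<in> carrier R"
    have "r \<otimes> (s \<otimes> a) = (r \<otimes> s) \<otimes> a" if "r \<in> carrier R" for r using as that by (simp add: m_assoc)
    then show "s \<otimes> a \<in> ?K" using as by auto
    then show "a \<otimes> s \<in> ?K" using as by (simp add: m_comm)
  qed (rule ring_axioms)
  then have "frob_power p R J \<subseteq> ?K"
    unfolding frob_power_def
  proof (rule genideal_minimal)
    show "(\<lambda>a. a [^] p) ` J \<subseteq> ?K"
    proof safe
      fix a r assume a: "a \<in> J" "r \<in> carrier R"
      then have ac: "a \<in> carrier R" using J by blast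
      have "u (r \<otimes> a [^] p) = a \<otimes> u r" using u_mult[of r a] a ac by (simp add: m_comm)
      then show "u (r \<otimes> a [^] p) \<in> J" using a by (simp add: J.I_r_closed)
    qed (use J in auto)
  qed
  then have "u (\<one> \<otimes> a) \<in> J" "a \<in> carrier R" using assms(2) by auto
  then show ?thesis by simp
qed

text \<open>For the converse, the coordinates of \<open>a\<close> are values of \<open>u\<close> at
  monomial multiples of \<open>a\<close>; if they lie in \<open>J\<close>, then \<open>a\<close> is
  a combination of p-th powers of elements of \<open>J\<close>.\<close>

lemma frob_power_iff:
  assumes "ideal J R" "a \<in> carrier R"
  shows "a \<in> frob_power p R J \<longleftrightarrow> (\<forall>r\<in>carrier R. u (r \<otimes> a) \<in> J)"
proof
  interpret J: ideal J R by fact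
  have J: "J \<subseteq> carrier R" using J.Icarr by blast
  interpret F: ideal "frob_power p R J" R by (rule frob_power_ideal[OF J])
  show "\<forall>r\<in>carrier R. u (r \<otimes> a) \<in> J" if "a \<in> frob_power p R J"
    using u_frob_power[OF assms(1)] F.I_l_closed[OF that] by blast
  assume *: "\<forall>r\<in>carrier R. u (r \<otimes> a) \<in> J"
  have "crd a e \<in> J" if "e \<in> E" for e
    using crd_eq_u[OF assms(2) that] bspec[OF *, of "xm (dual_e e)"] assms(2) by (simp add: m_comm)
  then have "crd a e [^] p \<otimes> xm e \<in> frob_power p R J" if "e \<in> E" for e
    using that frob_power_gen[OF J] by (auto intro!: F.I_r_closed)
  then have "(\<Oplus>e\<in>E. crd a e [^] p \<otimes> xm e) \<in> frob_power p R J"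
    by (intro finsum_ideal[OF F.ideal_axioms])
  then show "a \<in> frob_power p R J" using crd_expand[OF assms(2)] by simp
qed

lemma u_iter_closed: "a \<in> carrier R \<Longrightarrow> (u ^^ k) a \<in> carrier R"
  by (induction k) auto

lemma u_iter_add: "a \<in> carrier R \<Longrightarrow> b \<in> carrier R \<Longrightarrow> (u ^^ k) (a \<oplus> b) = (u ^^ k) a \<oplus> (u ^^ k) b"
  by (induction k) (auto simp: u_add u_iter_closed)

lemma u_iter_mult: "a \<in> carrier R \<Longrightarrow> r \<in> carrier R \<Longrightarrow> (u ^^ k) (r [^] (p ^ k) \<otimes> a) = r \<otimes> (u ^^ k) a"
proof (induction k arbitrary: a)
  case (Suc k)
  have "r [^] (p ^ Suc k) \<otimes> a = (r [^] (p ^ k)) [^] p \<otimes> a" using Suc by (simp add: nat_pow_pow mult.commute)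
  then show ?case using Suc by (simp add: funpow_Suc_right u_mult del: funpow.simps)
qed simp

text \<open>Iteration of \<open>frob_power_iff\<close>; the two multipliers of a step merge by s u(r
  a) = u(s^p r a).\<close>

lemma u_iter_pow_ideal:
  assumes car: "\<And>i. i < m \<Longrightarrow> f i \<in> carrier R" and "a \<in> carrier R"
  shows "a \<in> pow_ideal R f (\<lambda>_. p ^ k) m \<longleftrightarrow> (\<forall>r\<in>carrier R. (u ^^ k) (r \<otimes> a) \<in> pow_ideal R f (\<lambda>_. 1) m)"
  using assms(2)
proof (induction k arbitrary: a)
  case 0
  interpret J: ideal "pow_ideal R f (\<lambda>_. 1) m" R by (rule pow_ideal_ideal) (use car in auto)
  show ?case using 0 J.I_l_closed[of a] by (auto dest: bspec[of _ _ \<one>])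
next
  case (Suc k)
  have I: "ideal (pow_ideal R f (\<lambda>_. p ^ k) m) R" by (rule pow_ideal_ideal) (use car in auto)
  have "a \<in> pow_ideal R f (\<lambda>_. p ^ Suc k) m \<longleftrightarrow> (\<forall>r\<in>carrier R. u (r \<otimes> a) \<in> pow_ideal R f (\<lambda>_. p ^ k) m)"
    using frob_power_pow_ideal[of m f "p ^ k"] car frob_power_iff[OF I Suc.prems] by simp
  also have "\<dots> \<longleftrightarrow> (\<forall>r\<in>carrier R. \<forall>s\<in>carrier R. (u ^^ k) (s \<otimes> u (r \<otimes> a)) \<in> pow_ideal R f (\<lambda>_. 1) m)"
    using Suc by simp
  also have "\<dots> \<longleftrightarrow> (\<forall>r\<in>carrier R. (u ^^ Suc k) (r \<otimes> a) \<in> pow_ideal R f (\<lambda>_. 1) m)"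
  proof -
    have "(u ^^ k) (s \<otimes> u (r \<otimes> a)) = (u ^^ Suc k) ((s [^] p \<otimes> r) \<otimes> a)" if "r \<in> carrier R" "s \<in> carrier R" for r s
      using that Suc.prems by (simp add: funpow_Suc_right m_assoc u_mult del: funpow.simps)
    then show ?thesis using Suc.prems
      by (auto simp: ) (metis l_one nat_pow_one one_closed)
  qed
  finally show ?case .
qed

text \<open>In the induction step the maps sending b to g (b^p x^e) are represented by elements h_e.
  The sum H of the h_e^p x^(p-1-e) assembles them, since u(H a) is the sum of the h_e times the
  coordinates of a at e.\<close>

lemma dual_representation:
  assumes I: "ideal I R" 
    and g: "\<And>a. a \<in> carrier R \<Longrightarrow> g a \<in> carrier (R Quot I)"
      "\<And>a b. a \<in> carrier R \<Longrightarrow> b \<in> carrier R \<Longrightarrow> g (a \<oplus> b) = g a \<oplus>\<^bsub>R Quot I\<^esub> g b"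
      "\<And>a r. a \<in> carrier R \<Longrightarrow> r \<in> carrier R \<Longrightarrow> g (r [^] (p ^ k) \<otimes> a) = (I +> r) \<otimes>\<^bsub>R Quot I\<^esub> g a"
  shows "\<exists>h\<in>carrier R. \<forall>a\<in>carrier R. g a = I +> (u ^^ k) (h \<otimes> a)"
proof -
  interpret I: ideal I R by fact
  interpret Q: cring "R Quot I" by (rule I.quotient_is_cring) (rule is_cring)
  interpret q: ring_hom_cring R "R Quot I" "\<lambda>a. I +> a" by (rule I.rcos_ring_hom_cring) (rule is_cring)
  show ?thesis
    using g
  proof (induction k arbitrary: g)
    case 0
    have "g \<one> \<in> a_rcosets I"
      using 0(1)[OF one_closed] unfolding FactRing_def by (simp only: partial_object.select_convs)
    then obtain h where h: "h \<in> carrier R" "g \<one> = I +> h"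
      unfolding A_RCOSETS_def' by blast
    have "g a = I +> (h \<otimes> a)" if "a \<in> carrier R" for a
      using 0(3)[OF one_closed that] that h by (simp add: m_comm)
    then show ?case using h by auto
  next
    case (Suc k)
    have "\<exists>h\<in>carrier R. \<forall>b\<in>carrier R. g (b [^] p \<otimes> xm e) = I +> (u ^^ k) (h \<otimes> b)" for e
    proof (rule Suc.IH)
      show "g (a [^] p \<otimes> xm e) \<in> carrier (R Quot I)" if "a \<in> carrier R" for a using Suc.prems(1) that by simp
      show "g ((a \<oplus> b) [^] p \<otimes> xm e) = g (a [^] p \<otimes> xm e) \<oplus>\<^bsub>R Quot I\<^esub> g (b [^] p \<otimes> xm e)"
        if "a \<in> carrier R" "b \<in> carrier R" for a b
        using that Suc.prems(2) by (simp add: freshman[OF prime_p char_p] l_distr)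
      show "g ((r [^] (p ^ k) \<otimes> a) [^] p \<otimes> xm e) = (I +> r) \<otimes>\<^bsub>R Quot I\<^esub> g (a [^] p \<otimes> xm e)"
        if "a \<in> carrier R" "r \<in> carrier R" for a r
        using that Suc.prems(3)[of "a [^] p \<otimes> xm e" r]
        by (simp add: nat_pow_distrib nat_pow_pow m_assoc mult.commute)
    qed
    then obtain h where h: "\<And>e. h e \<in> carrier R" "\<And>e b. b \<in> carrier R \<Longrightarrow> g (b [^] p \<otimes> xm e) = I +> (u ^^ k) (h e \<otimes> b)"
      by (metis (no_types))
    define H where "H = (\<Oplus>e\<in>E. h e [^] p \<otimes> xm (dual_e e))"
    have H: "H \<in> carrier R" unfolding H_def using h by (intro finsum_closed) auto
    have gz: "g \<zero> = I +> \<zero>"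
      using Suc.prems(3)[of \<zero> \<zero>] Suc.prems(1)[of \<zero>] p_pos by (simp add: nat_pow_zero)
    have gs: "g (\<Oplus>e\<in>S. F e) = (\<Oplus>\<^bsub>R Quot I\<^esub>e\<in>S. g (F e))" if "finite S" "\<And>e. e \<in> S \<Longrightarrow> F e \<in> carrier R"
      for S and F :: "(nat \<Rightarrow> nat) \<Rightarrow> 'a"
      using that
    proof (induction S)
      case empty then show ?case using gz by simp
    next
      case (insert e S) then show ?case using Suc.prems(1,2) by (simp add: Pi_def)
    qed
    have us: "(u ^^ k) (\<Oplus>e\<in>S. F e) = (\<Oplus>e\<in>S. (u ^^ k) (F e))" if "finite S" "\<And>e. e \<in> S \<Longrightarrow> F e \<in> carrier R"
      for S and F :: "(nat \<Rightarrow> nat) \<Rightarrow> 'a"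
      using that
    proof (induction S)
      case empty
      have "(u ^^ k) \<zero> = \<zero>" by (induction k) (auto simp: u_zero)
      then show ?case by simp
    next
      case (insert e S) then show ?case by (simp add: Pi_def u_iter_add u_iter_closed)
    qed
    have "g a = I +> (u ^^ Suc k) (H \<otimes> a)" if a: "a \<in> carrier R" for a
    proof -
      note c = crd_closed[OF a]
      have "g a = g (\<Oplus>e\<in>E. crd a e [^] p \<otimes> xm e)" using crd_expand[OF a] by simp
      also have "\<dots> = (\<Oplus>\<^bsub>R Quot I\<^esub>e\<in>E. g (crd a e [^] p \<otimes> xm e))" by (rule gs[OF finite_E]) (use c in auto)
      also have "\<dots> = (\<Oplus>\<^bsub>R Quot I\<^esub>e\<in>E. I +> (u ^^ k) (h e \<otimes> crd a e))"
        by (intro Q.add.finprod_cong') (use c h u_iter_closed in auto)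
      also have "\<dots> = I +> (\<Oplus>e\<in>E. (u ^^ k) (h e \<otimes> crd a e))"
        by (subst q.hom_finsum) (use c h u_iter_closed in \<open>auto simp: comp_def\<close>)
      also have "(\<Oplus>e\<in>E. (u ^^ k) (h e \<otimes> crd a e)) = (u ^^ k) (\<Oplus>e\<in>E. h e \<otimes> crd a e)"
        by (rule us[symmetric, OF finite_E]) (use c h in auto)
      also have "(\<Oplus>e\<in>E. h e \<otimes> crd a e) = (\<Oplus>e\<in>E. u (h e [^] p \<otimes> xm (dual_e e) \<otimes> a))"
        by (intro add.finprod_cong') (use a h c in \<open>auto simp: crd_eq_u u_mult m_assoc m_comm[of a]\<close>)
      also have "\<dots> = u (\<Oplus>e\<in>E. h e [^] p \<otimes> xm (dual_e e) \<otimes> a)"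
        by (rule u_finsum[symmetric]) (use h a in auto)
      also have "(\<Oplus>e\<in>E. h e [^] p \<otimes> xm (dual_e e) \<otimes> a) = H \<otimes> a"
        unfolding H_def by (rule finsum_ldistr[symmetric]) (use h a finite_E in auto)
      finally show ?thesis by (simp add: funpow_swap1)
    qed
    then show ?case using H by blast
  qed
qed

end

section \<open>Witt vectors modulo p\<close>

locale p_basis_witt = p_basis R p N x + witt_hom p "zphi p" R \<epsilon>
  for R :: "('a, 'c) ring_scheme" (structure) and p N :: nat and x :: "nat \<Rightarrow> 'a" and \<epsilon> :: "'a zpoly \<Rightarrow> 'a" +
  assumes eps_zvar: "a \<in> carrier R \<Longrightarrow> \<epsilon> (zvar a) = a"
begin

abbreviation "WR n \<equiv> witt_ring p n R"

lemma cring_WR: "cring (WR n)" by (rule cring_witt_ring) (use prime_p is_cring in auto)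

lemma eps_p: "\<epsilon> (of_nat p * y) = \<zero>"
  using char_p hom_of_nat_mult[of p 1] by (simp add: hom_mult hom_one)

text \<open>The kernel of the presentation of W_n(R): congruence modulo it is equality of Witt
  vectors, see \<open>wproj_eq_iff\<close>.\<close>

definition wker :: "nat \<Rightarrow> (nat \<Rightarrow> 'a zpoly) set" where
  "wker n = {g. dwork g \<and> wproj n g = \<zero>\<^bsub>WR n\<^esub>}"

lemma wker_iff: "g \<in> wker n \<longleftrightarrow> dwork g \<and> (\<forall>i<n. \<epsilon> (coords g i) = \<zero>)"
  by (auto simp: wker_def wproj_def witt_ring_def restrict_def fun_eq_iff)

lemma wkerD [dest]: "g \<in> wker n \<Longrightarrow> dwork g" by (simp add: wker_def)

lemma wker_add: "g \<in> wker n \<Longrightarrow> h \<in> wker n \<Longrightarrow> g + h \<in> wker n"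
proof -
  interpret W: cring "WR n" by (rule cring_WR)
  show "g \<in> wker n \<Longrightarrow> h \<in> wker n \<Longrightarrow> g + h \<in> wker n" by (simp add: wker_def wproj_add)
qed

lemma wker_mult: "dwork g \<Longrightarrow> h \<in> wker n \<Longrightarrow> g * h \<in> wker n"
proof -
  interpret W: cring "WR n" by (rule cring_WR)
  show "dwork g \<Longrightarrow> h \<in> wker n \<Longrightarrow> g * h \<in> wker n" by (simp add: wker_def wproj_mult)
qed

lemma wker_minus: "h \<in> wker n \<Longrightarrow> - h \<in> wker n"
  using wker_mult[of "- 1" h n] by simp

lemma wker_diff: "g \<in> wker n \<Longrightarrow> h \<in> wker n \<Longrightarrow> g - h \<in> wker n"
  using wker_add[of g n "- h"] wker_minus by simp

lemma wker_zero: "0 \<in> wker n" by (simp add: wker_def wproj_zero)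

lemma wker_sum: "(\<And>s. s \<in> S \<Longrightarrow> g s \<in> wker n) \<Longrightarrow> sum g S \<in> wker n"
  by (induction S rule: infinite_finite_induct) (auto simp: wker_zero wker_add)

lemma wproj_eq_iff: "dwork g \<Longrightarrow> dwork h \<Longrightarrow> wproj n g = wproj n h \<longleftrightarrow> g - h \<in> wker n"
proof -
  interpret W: cring "WR n" by (rule cring_WR)
  assume g: "dwork g" and h: "dwork h"
  have "wproj n g = wproj n (g - h) \<oplus>\<^bsub>WR n\<^esub> wproj n h"
    using wproj_add[of "g - h" h n] g h by simp
  then have "wproj n g = wproj n h \<longleftrightarrow> wproj n (g - h) \<oplus>\<^bsub>WR n\<^esub> wproj n h = \<zero>\<^bsub>WR n\<^esub> \<oplus>\<^bsub>WR n\<^esub> wproj n h"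
    by simp
  also have "\<dots> \<longleftrightarrow> wproj n (g - h) = \<zero>\<^bsub>WR n\<^esub>"
    by (rule W.add.right_cancel) auto
  finally show ?thesis using g h by (simp add: wker_def)
qed

lemma wker_T: "\<epsilon> a = \<zero> \<Longrightarrow> T a \<in> wker n"
  by (auto simp: wker_iff coords_T hom_zero split: nat.split)

lemma wker_T_diff: "\<epsilon> a = \<epsilon> b \<Longrightarrow> T a - T b \<in> wker n"
  by (subst wproj_eq_iff[symmetric]) (auto simp: wproj_T)

lemma wker_V: "g \<in> wker n \<Longrightarrow> V g \<in> wker (Suc n)"
  by (auto simp: wker_iff coords_V hom_zero split: nat.split)

lemma wker_Suc: "g \<in> wker (Suc n) \<Longrightarrow> g \<in> wker n"
  by (auto simp: wker_iff)

lemma wker_V_D: "dwork g \<Longrightarrow> V g \<in> wker (Suc n) \<Longrightarrow> g \<in> wker n"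
  unfolding wker_iff by (simp add: coords_V) (metis (no_types, lifting) Suc_less_eq nat.case(2))

lemma wker_V': "g \<in> wker n \<Longrightarrow> V g \<in> wker n"
  using wker_V wker_Suc by blast

lemma dwork_V_iter [intro, simp]: "dwork g \<Longrightarrow> dwork ((V ^^ k) g)"
  by (induction k) auto

lemma wker_V_iter: "dwork g \<Longrightarrow> (V ^^ n) g \<in> wker n"
  by (induction n) (auto simp: wker_V, auto simp: wker_iff)

lemma wker_eps0: "g \<in> wker (Suc n) \<Longrightarrow> \<epsilon> (g 0) = \<zero>"
  using coords_0[of g] by (auto simp: wker_iff)

lemma eps_F0: "dwork g \<Longrightarrow> \<epsilon> (F g 0) = \<epsilon> (g 0) [^] p"
proof -
  assume g: "dwork g"
  obtain y where "coords (F g) 0 - coords g 0 ^ p = of_nat p * y" using coords_F[OF g, of 0] by blast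
  then have "F g 0 = g 0 ^ p + of_nat p * y" using g by (simp add: coords_0 algebra_simps)
  then show ?thesis by (simp add: hom_add eps_p hom_power)
qed

text \<open>F V = p holds for all ghost vectors, whereas V F = p is claimed only modulo the kernel:
  in characteristic \<open>p\<close> the Frobenius acts on each coordinate and therefore commutes
  with the shift V.\<close>

lemma wker_VF: "dwork g \<Longrightarrow> V (F g) - of_nat p * g \<in> wker n"
proof -
  assume g: "dwork g"
  have c: "\<epsilon> (coords (F h) i) = \<epsilon> (coords h i) [^] p" if "dwork h" for h i
    using fun_cong[OF wproj_F[OF char_p that, of "Suc i"], of i] by (simp add: wproj_def witt_frob_def)
  have "wproj n (V (F g)) = wproj n (F (V g))"
    using g p_pos by (auto simp: wproj_def coords_V c hom_zero nat_pow_zero fun_eq_iff restrict_def split: nat.split)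
  then show ?thesis using g by (simp add: F_V wproj_eq_iff)
qed

text \<open>As \<open>V (F g)\<close> lies in \<open>K n\<close>, coordinates of positive degree only count modulo \<open>p\<close>-th powers.\<close>

definition K :: "nat \<Rightarrow> (nat \<Rightarrow> 'a zpoly) set" where
  "K n = {of_nat p * g + k | g k. dwork g \<and> k \<in> wker n}"

lemma wker_K: "k \<in> wker n \<Longrightarrow> k \<in> K n"
  unfolding K_def by (rule CollectI, rule exI[of _ 0], rule exI[of _ k]) auto

lemma p_K: "dwork g \<Longrightarrow> of_nat p * g \<in> K n"
  unfolding K_def using wker_zero[of n] by (intro CollectI exI[of _ g] exI[of _ 0]) auto

lemma K_dwork [dest]: "g \<in> K n \<Longrightarrow> dwork g" by (auto simp: K_def)

lemma K_add: "g \<in> K n \<Longrightarrow> h \<in> K n \<Longrightarrow> g + h \<in> K n"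
proof -
  assume "g \<in> K n" "h \<in> K n"
  then obtain a k b l where "g = of_nat p * a + k" "h = of_nat p * b + l" "dwork a" "dwork b" "k \<in> wker n" "l \<in> wker n"
    unfolding K_def by blast
  then show ?thesis unfolding K_def
    by (intro CollectI exI[of _ "a + b"] exI[of _ "k + l"]) (auto simp: algebra_simps wker_add)
qed

lemma K_mult: "dwork g \<Longrightarrow> h \<in> K n \<Longrightarrow> g * h \<in> K n"
proof -
  assume g: "dwork g" and "h \<in> K n"
  then obtain b l where "h = of_nat p * b + l" "dwork b" "l \<in> wker n" unfolding K_def by blast
  then show ?thesis unfolding K_def using g
    by (intro CollectI exI[of _ "g * b"] exI[of _ "g * l"]) (auto simp: algebra_simps wker_mult)
qed

lemma K_minus: "h \<in> K n \<Longrightarrow> - h \<in> K n" using K_mult[of "- 1" h n] by simp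
lemma K_zero: "0 \<in> K n" using wker_K wker_zero by blast

lemma K_V: "h \<in> K n \<Longrightarrow> V h \<in> K n"
proof -
  assume "h \<in> K n"
  then obtain b l where "h = of_nat p * b + l" "dwork b" "l \<in> wker n" unfolding K_def by blast
  then show ?thesis unfolding K_def
    by (intro CollectI exI[of _ "V b"] exI[of _ "V l"]) (auto simp: V_add V_of_nat wker_V')
qed

lemma K_VF: "dwork g \<Longrightarrow> V (F g) \<in> K n"
  using K_add[OF wker_K[OF wker_VF] p_K] by fastforce

text \<open>Equality in W_n(R)/p. Membership in the ring of ghost vectors is built in, so that
  chains of congruences carry few side conditions.\<close>

definition eqv :: "nat \<Rightarrow> (nat \<Rightarrow> 'a zpoly) \<Rightarrow> (nat \<Rightarrow> 'a zpoly) \<Rightarrow> bool" where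
  "eqv n g h \<longleftrightarrow> dwork g \<and> dwork h \<and> g - h \<in> K n"

lemma eqv_refl: "dwork g \<Longrightarrow> eqv n g g" by (simp add: eqv_def K_zero)
lemma eqv_sym: "eqv n g h \<Longrightarrow> eqv n h g" using K_minus by (fastforce simp: eqv_def)
lemma eqv_trans [trans]: "eqv n g h \<Longrightarrow> eqv n h k \<Longrightarrow> eqv n g k"
  using K_add[of "g - h" n "h - k"] by (auto simp: eqv_def)
lemma eqv_add: "eqv n g h \<Longrightarrow> eqv n g' h' \<Longrightarrow> eqv n (g + g') (h + h')"
  using K_add[of "g - h" n "g' - h'"] by (auto simp: eqv_def algebra_simps)
lemma eqv_mult: "eqv n g h \<Longrightarrow> eqv n g' h' \<Longrightarrow> eqv n (g * g') (h * h')"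
  using K_add[OF K_mult[of g "g' - h'" n] K_mult[of h' "g - h" n]] by (auto simp: eqv_def algebra_simps)
lemma eqv_minus: "eqv n g h \<Longrightarrow> eqv n (- g) (- h)"
  using K_minus[of "g - h" n] by (auto simp: eqv_def)
lemma eqv_diff: "eqv n g h \<Longrightarrow> eqv n g' h' \<Longrightarrow> eqv n (g - g') (h - h')"
  using eqv_add[OF _ eqv_minus] by fastforce
lemma eqv_V: "eqv n g h \<Longrightarrow> eqv n (V g) (V h)"
  using K_V[of "g - h" n] by (auto simp: eqv_def V_diff)
lemma eqv_V_iter: "eqv n g h \<Longrightarrow> eqv n ((V ^^ k) g) ((V ^^ k) h)"
  by (induction k) (auto simp: eqv_V)
lemma eqv_power: "eqv n g h \<Longrightarrow> eqv n (g ^ k) (h ^ k)"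
  by (induction k) (auto simp: eqv_refl eqv_mult)
lemma eqv_sum: "(\<And>s. s \<in> S \<Longrightarrow> eqv n (g s) (h s)) \<Longrightarrow> eqv n (sum g S) (sum h S)"
  by (induction S rule: infinite_finite_induct) (auto simp: eqv_refl eqv_add)
lemma eqv_wker: "dwork g \<Longrightarrow> dwork h \<Longrightarrow> g - h \<in> wker n \<Longrightarrow> eqv n g h"
  by (auto simp: eqv_def wker_K)
lemma eqv_dwork: "eqv n g h \<Longrightarrow> dwork g" "eqv n g h \<Longrightarrow> dwork h" by (auto simp: eqv_def)
lemma eqv_K: "g \<in> K n \<Longrightarrow> dwork h \<Longrightarrow> eqv n (h + g) h" by (auto simp: eqv_def)
lemma eqv_K0: "g \<in> K n \<longleftrightarrow> eqv n g 0" by (auto simp: eqv_def)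

lemma V_iter_add: "(V ^^ k) (g + h) = (V ^^ k) g + (V ^^ k) h" by (induction k) (auto simp: V_add)
lemma V_iter_sum: "(V ^^ k) (sum f S) = (\<Sum>s\<in>S. (V ^^ k) (f s))" by (induction k) (auto simp: V_sum)
lemma V_iter_zero: "(V ^^ k) 0 = 0" by (induction k) (auto simp: V_zero)

text \<open>The projection formula \<open>V_F_mult\<close>, iterated; the k-fold Frobenius sends [a]
  to [a^(p^k)].\<close>

lemma V_iter_T_mult: "T a * (V ^^ k) g = (V ^^ k) (T (a ^ (p ^ k)) * g)"
proof (induction k arbitrary: a)
  case (Suc k)
  have "T a * (V ^^ Suc k) g = V (F (T a) * (V ^^ k) g)" by (simp add: V_F_mult)
  also have "\<dots> = V ((V ^^ k) (T ((a ^ p) ^ (p ^ k)) * g))" by (simp only: F_T Suc)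
  finally show ?case by (simp add: power_mult[symmetric])
qed simp

definition mon :: "(nat \<Rightarrow> nat) \<Rightarrow> 'a zpoly" where "mon d = (\<Prod>j<N. zvar (x j) ^ d j)"

lemma eps_mon: "\<epsilon> (mon d) = xm d"
  unfolding mon_def x_monom_def using x_closed
  by (simp add: hom_prod hom_power eps_zvar cong: finprod_cong)

text \<open>Additive modulo \<open>K\<close>, unlike the Teichmueller map.\<close>

definition sig :: "'a \<Rightarrow> nat \<Rightarrow> 'a zpoly" where
  "sig a = (\<Sum>e\<in>E. T (zvar (crd a e) ^ p * mon e))"

lemma dwork_sig [simp, intro]: "dwork (sig a)" by (simp add: sig_def)

lemma eps_sig: "a \<in> carrier R \<Longrightarrow> \<epsilon> (sig a 0) = a"
proof -
  assume a: "a \<in> carrier R"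
  have "\<epsilon> (sig a 0) = (\<Oplus>e\<in>E. crd a e [^] p \<otimes> xm e)"
    unfolding sig_def fun_apply hom_sum
    by (intro add.finprod_cong') (use crd_closed[OF a] in \<open>auto simp: hom_mult hom_power eps_zvar eps_mon\<close>)
  then show ?thesis using crd_expand[OF a] by simp
qed

text \<open>Up to a Teichmueller element whose Frobenius lies in the kernel, \<open>z\<close> is a
  Verschiebung, and F V = p. So modulo \<open>p\<close> the Frobenius depends only on the image of
  the first component.\<close>

lemma F_K:
  assumes "dwork z" "\<epsilon> (z 0) = \<zero>"
  shows "F z \<in> K n"
proof -
  obtain z' where z': "dwork z'" "z = T (z 0) + V z'" using dwork_tail[OF assms(1)] by blast
  have "F z = T (z 0 ^ p) + of_nat p * z'" by (subst z'(2)) (simp add: F_add F_T F_V)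
  moreover have "\<epsilon> (z 0 ^ p) = \<zero>" using assms(2) p_pos by (simp add: hom_power nat_pow_zero)
  ultimately show ?thesis using wker_T wker_K p_K[OF z'(1)] K_add by simp
qed

text \<open>The summands of \<open>sig\<close> are F[c_e] [x^e], and by \<open>F_K\<close> the
  Frobenius of [c_e] depends additively on c_e modulo \<open>K\<close>. This is why c_e enters as a
  p-th power.\<close>

lemma sig_add:
  assumes "a \<in> carrier R" "b \<in> carrier R"
  shows "eqv n (sig (a \<oplus> b)) (sig a + sig b)"
  unfolding sig_def sum.distrib[symmetric]
proof (rule eqv_sum)
  fix e assume e: "e \<in> E"
  let ?z = "T (zvar (crd (a \<oplus> b) e)) - (T (zvar (crd a e)) + T (zvar (crd b e)))"
  have "\<epsilon> (?z 0) = \<zero>"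
    using e assms crd_closed by (simp add: fun_apply hom_diff hom_add eps_zvar crd_add a_minus_def r_neg)
  then have "F ?z * T (mon e) \<in> K n" using K_mult[OF _ F_K, of "T (mon e)" ?z n] by (simp add: mult.commute)
  moreover have "F ?z * T (mon e) = T (zvar (crd (a \<oplus> b) e) ^ p * mon e)
      - (T (zvar (crd a e) ^ p * mon e) + T (zvar (crd b e) ^ p * mon e))"
    by (simp add: F_diff F_add F_T T_mult algebra_simps)
  ultimately show "eqv n (T (zvar (crd (a \<oplus> b) e) ^ p * mon e))
      (T (zvar (crd a e) ^ p * mon e) + T (zvar (crd b e) ^ p * mon e))"
    by (simp add: eqv_def)
qed

text \<open>Only the coordinate at \<open>red d\<close> is nonzero, and its summand is the
  Teichmueller element of the same element of \<open>R\<close>. The difference lies in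
  \<open>wker\<close> and not just in \<open>K\<close>: uniqueness of \<sigma>-coordinates needs an
  equality of Witt vectors.\<close>

lemma sig_p_monomial_wker:
  assumes "\<epsilon> y = b [^] p \<otimes> xm d" "b \<in> carrier R"
  shows "sig (b [^] p \<otimes> xm d) - T y \<in> wker n"
proof -
  let ?c = "b \<otimes> xm (\<lambda>j. d j div p)"
  note c = crd_xm_red[OF _ assms(2), of _ d]
  have s1: "sig (b [^] p \<otimes> xm d) = T (zvar ?c ^ p * mon (red d)) + (\<Sum>e\<in>E - {red d}. T (zvar \<zero> ^ p * mon e))"
    unfolding sig_def by (subst sum.remove[OF finite_E red_E[of d]]) (use c red_E in simp)
  have s2: "(\<Sum>e\<in>E - {red d}. T (zvar \<zero> ^ p * mon e)) \<in> wker n"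
  proof -
    have "T (zvar \<zero> ^ p * mon e) \<in> wker n" for e
      using p_pos by (intro wker_T) (simp add: hom_mult hom_power eps_zvar eps_mon nat_pow_zero)
    then show ?thesis by (intro wker_sum)
  qed
  have s3: "T (zvar ?c ^ p * mon (red d)) - T y \<in> wker n"
  proof (rule wker_T_diff)
    have "b [^] p \<otimes> xm d = ?c [^] p \<otimes> xm (red d)"
      using assms by (subst xm_red) (simp add: nat_pow_distrib m_assoc)
    then show "\<epsilon> (zvar ?c ^ p * mon (red d)) = \<epsilon> y"
      using assms by (simp add: hom_mult hom_power eps_zvar eps_mon)
  qed
  show ?thesis unfolding s1 using wker_add[OF s3 s2] by (simp add: algebra_simps)
qed

end

section \<open>Multinomial expansion of p-th powers\<close>

definition weak_comps :: "nat \<Rightarrow> nat \<Rightarrow> (nat \<Rightarrow> nat) set" where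
  "weak_comps r n = {\<alpha> \<in> {..<r} \<rightarrow>\<^sub>E {0..n}. (\<Sum>i<r. \<alpha> i) = n}"

lemma finite_weak_comps: "finite (weak_comps r n)"
  unfolding weak_comps_def by (rule finite_subset[OF _ finite_PiE[of "{..<r}" "\<lambda>_. {0..n}"]]) auto

lemma prod_fact_dvd: "(\<Prod>i<(r::nat). fact (\<alpha> i) :: nat) dvd fact (\<Sum>i<r. \<alpha> i)"
proof (induction r)
  case (Suc r)
  have "fact (\<Sum>i<r. \<alpha> i) * fact (\<alpha> r) dvd (fact ((\<Sum>i<r. \<alpha> i) + \<alpha> r) :: nat)"
    by (rule fact_fact_dvd_fact)
  then have "(\<Prod>i<r. fact (\<alpha> i)) * fact (\<alpha> r) dvd (fact ((\<Sum>i<r. \<alpha> i) + \<alpha> r) :: nat)"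
    by (rule dvd_trans[OF mult_dvd_mono[OF Suc dvd_refl]])
  then show ?case by simp
qed simp

lemma multinomial_step:
  fixes r k n :: nat
  assumes "k \<le> n" "(\<Sum>i<r. \<alpha> i) = n - k"
  shows "fact n div ((\<Prod>i<r. fact (\<alpha> i)) * fact k) = (n choose k) * (fact (n - k) div (\<Prod>i<r. fact (\<alpha> i)) :: nat)"
proof -
  have d: "(\<Prod>i<r. fact (\<alpha> i)) dvd (fact (n - k) :: nat)" using prod_fact_dvd[of \<alpha> r] assms by simp
  have "fact n = fact k * ((n choose k) * fact (n - k))" using binomial_fact_lemma[OF assms(1)] by (simp add: algebra_simps)
  then have "fact n div ((\<Prod>i<r. fact (\<alpha> i)) * fact k) = (n choose k) * fact (n - k) div (\<Prod>i<r. fact (\<alpha> i) :: nat)"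
    by (simp add: mult.commute[of _ "fact k"])
  also have "\<dots> = (n choose k) * (fact (n - k) div (\<Prod>i<r. fact (\<alpha> i)))" using d by (rule div_mult_swap[symmetric])
  finally show ?thesis .
qed

lemma multinomial:
  fixes y :: "nat \<Rightarrow> 'u::comm_ring_1"
  shows "(\<Sum>i<r. y i) ^ n = (\<Sum>\<alpha>\<in>weak_comps r n. of_nat (fact n div (\<Prod>i<r. fact (\<alpha> i))) * (\<Prod>i<r. y i ^ \<alpha> i))"
proof (induction r arbitrary: n)
  case 0
  show ?case by (cases "n = 0") (auto simp: weak_comps_def power_0_left)
next
  case (Suc r)
  let ?c = "\<lambda>r n \<alpha>. of_nat (fact n div (\<Prod>i<r. fact (\<alpha> i))) * (\<Prod>i<r. y i ^ \<alpha> i) :: 'u"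
  have "(\<Sum>i<Suc r. y i) ^ n = (\<Sum>k\<le>n. of_nat (n choose k) * y r ^ k * (\<Sum>i<r. y i) ^ (n - k))"
    by (simp add: binomial_ring[symmetric] add.commute)
  also have "\<dots> = (\<Sum>k\<le>n. \<Sum>\<alpha>\<in>weak_comps r (n - k). of_nat (n choose k) * y r ^ k * ?c r (n - k) \<alpha>)"
    by (simp add: Suc sum_distrib_left)
  also have "\<dots> = (\<Sum>(k, \<alpha>)\<in>Sigma {..n} (\<lambda>k. weak_comps r (n - k)). of_nat (n choose k) * y r ^ k * ?c r (n - k) \<alpha>)"
    by (rule sum.Sigma) (auto simp: finite_weak_comps)
  also have "\<dots> = (\<Sum>\<beta>\<in>weak_comps (Suc r) n. ?c (Suc r) n \<beta>)"
  \<comment> \<open>A composition of n with r+1 parts is its last part k together with a composition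
    of n-k with r parts; the value \<open>undefined\<close> at r restores extensionality.\<close>
  proof (rule sum.reindex_bij_witness[where i = "\<lambda>\<beta>. (\<beta> r, \<beta>(r := undefined))" and j = "\<lambda>(k, \<alpha>). \<alpha>(r := k)"], goal_cases)
    case (1 z) then show ?case by (auto simp: weak_comps_def PiE_def extensional_def fun_eq_iff)
  next
    case (2 z)
    then obtain k \<alpha> where z: "z = (k, \<alpha>)" "k \<le> n" "\<alpha> \<in> {..<r} \<rightarrow>\<^sub>E {0..n - k}" "(\<Sum>i<r. \<alpha> i) = n - k"
      by (auto simp: weak_comps_def)
    have "\<alpha>(r := k) \<in> {..<Suc r} \<rightarrow>\<^sub>E {0..n}"     proof (rule PiE_I)
      fix i assume i: "i \<in> {..<Suc r}"
      show "(\<alpha>(r := k)) i \<in> {0..n}"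
      proof (cases "i = r")
        case False
        then have "\<alpha> i \<in> {0..n - k}" using i by (intro PiE_mem[OF z(3)]) auto
        then show ?thesis using False by auto
      qed (use z in auto)
    next
      fix i assume "i \<notin> {..<Suc r}"
      then show "(\<alpha>(r := k)) i = undefined" using PiE_arb[OF z(3), of i] by simp
    qed
    moreover have "(\<Sum>i<Suc r. (\<alpha>(r := k)) i) = n" using z by simp
    ultimately show ?case unfolding z(1) prod.case weak_comps_def by blast
  next
    case (3 \<beta>) then show ?case by simp
  next
    case (4 \<beta>)
    then have b: "\<beta> \<in> {..<Suc r} \<rightarrow>\<^sub>E {0..n}" "(\<Sum>i<r. \<beta> i) + \<beta> r = n" by (simp_all add: weak_comps_def)
    have le: "\<beta> i \<le> n - \<beta> r" if "i < r" for i
      using member_le_sum[of i "{..<r}" \<beta>] that b(2) by simp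
    have "\<beta>(r := undefined) \<in> {..<r} \<rightarrow>\<^sub>E {0..n - \<beta> r}"
    proof (rule PiE_I)
      fix i assume "i \<in> {..<r}" then show "(\<beta>(r := undefined)) i \<in> {0..n - \<beta> r}" using le by simp
    next
      fix i assume "i \<notin> {..<r}" then show "(\<beta>(r := undefined)) i = undefined" using PiE_arb[OF b(1), of i] by simp
    qed
    moreover have "(\<Sum>i<r. (\<beta>(r := undefined)) i) = n - \<beta> r" "\<beta> r \<le> n" using b(2) by simp_all
    ultimately show ?case by (simp add: weak_comps_def)
  next
    case (5 z)
    then obtain k \<alpha> where z: "z = (k, \<alpha>)" "k \<le> n" "(\<Sum>i<r. \<alpha> i) = n - k" by (auto simp: weak_comps_def)
    have 1: "(\<Prod>i<Suc r. fact ((\<alpha>(r := k)) i) :: nat) = (\<Prod>i<r. fact (\<alpha> i)) * fact k" by simp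
    have 2: "(\<Prod>i<Suc r. y i ^ (\<alpha>(r := k)) i) = (\<Prod>i<r. y i ^ \<alpha> i) * y r ^ k" by simp
    show ?case unfolding z prod.case 1 2 multinomial_step[OF z(2,3)] by (simp add: algebra_simps)
  qed
  finally show ?case .
qed

text \<open>The polynomial behind \<open>delta_sum\<close>, over any commutative type-class ring, so
  that it can be evaluated at Teichmueller elements.\<close>

definition delta_poly :: "nat \<Rightarrow> nat \<Rightarrow> (nat \<Rightarrow> 'u::comm_ring_1) \<Rightarrow> 'u" where
  "delta_poly p r y = (\<Sum>\<alpha>\<in>{\<alpha> \<in> {..<r} \<rightarrow>\<^sub>E {0..p - 1}. (\<Sum>i<r. \<alpha> i) = p}.
     of_nat ((fact p div (\<Prod>i<r. fact (\<alpha> i))) div p) * (\<Prod>i<r. y i ^ \<alpha> i))"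

text \<open>Compositions of \<open>p\<close> with a part equal to \<open>p\<close> give the pure
  powers. All others have parts below \<open>p\<close>, so the factorials in the denominator are
  prime to \<open>p\<close> and the multinomial coefficient keeps its factor
  \<open>p\<close>.\<close>

lemma sum_power_prime:
  fixes y :: "nat \<Rightarrow> 'u::comm_ring_1"
  assumes p: "Factorial_Ring.prime p"
  shows "(\<Sum>i<r. y i) ^ p = (\<Sum>i<r. y i ^ p) + of_nat p * delta_poly p r y"
proof -
  define A where "A = {\<alpha> \<in> {..<r} \<rightarrow>\<^sub>E {0..p - 1}. (\<Sum>i<r. \<alpha> i) = p}"
  define s where "s i = (\<lambda>j\<in>{..<r}. if j = i then p else 0)" for i
  let ?c = "\<lambda>\<alpha>. of_nat (fact p div (\<Prod>i<r. fact (\<alpha> i))) * (\<Prod>i<r. y i ^ \<alpha> i) :: 'u"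
  have p0: "p > 0" using p prime_gt_0_nat by blast
  have ssum: "(\<Sum>j<r. s i j) = p" if "i < r" for i
    using that by (subst sum.remove[of _ i]) (auto simp: s_def)
  have comps: "weak_comps r p = A \<union> s ` {..<r}"
  proof (intro equalityI subsetI)
    fix \<alpha> assume a: "\<alpha> \<in> weak_comps r p"
    show "\<alpha> \<in> A \<union> s ` {..<r}"
    proof (cases "\<exists>i<r. \<alpha> i = p")
      case True
      then obtain i where i: "i < r" "\<alpha> i = p" by blast
      have "(\<Sum>j<r. \<alpha> j) = \<alpha> i + (\<Sum>j\<in>{..<r} - {i}. \<alpha> j)" using i by (intro sum.remove) auto
      then have "(\<Sum>j\<in>{..<r} - {i}. \<alpha> j) = 0" using a i by (simp add: weak_comps_def)
      then have "\<forall>j\<in>{..<r} - {i}. \<alpha> j = 0" by simp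
      then have "\<alpha> = s i" using a i by (auto simp: s_def fun_eq_iff weak_comps_def PiE_def extensional_def)
      then show ?thesis using i by blast
    next
      case False
      have "\<alpha> i \<le> p - 1" if "i < r" for i
      proof -
        have "\<alpha> i \<le> p" "\<alpha> i \<noteq> p" using a that False by (auto simp: weak_comps_def PiE_iff)
        then show ?thesis by simp
      qed
      then show ?thesis using a by (auto simp: A_def weak_comps_def PiE_iff)
    qed
  next
    fix \<alpha> assume "\<alpha> \<in> A \<union> s ` {..<r}"
    then show "\<alpha> \<in> weak_comps r p"
    proof
      assume a: "\<alpha> \<in> A"
      have "\<alpha> i \<le> p" if "i < r" for i
      proof -
        have "\<alpha> i \<le> p - 1" using a that by (auto simp: A_def PiE_iff)
        then show ?thesis by simp
      qed
      then show ?thesis using a by (auto simp: A_def weak_comps_def PiE_iff)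
    next
      assume "\<alpha> \<in> s ` {..<r}"
      then obtain i where i: "i < r" "\<alpha> = s i" by auto
      have "s i \<in> {..<r} \<rightarrow>\<^sub>E {0..p}" unfolding s_def by simp
      then show ?thesis using ssum[OF i(1)] unfolding i(2) weak_comps_def by simp
    qed
  qed
  have fA: "finite A" unfolding A_def by (rule finite_subset[OF _ finite_PiE[of "{..<r}" "\<lambda>_. {0..p - 1}"]]) auto
  have disj: "A \<inter> s ` {..<r} = {}"
  proof -
    have "s i \<notin> A" if i: "i < r" for i
    proof
      assume "s i \<in> A"
      then have "s i i \<le> p - 1" using i by (auto simp: A_def PiE_iff)
      then show False using i p0 by (simp add: s_def)
    qed
    then show ?thesis by blast
  qed
  have inj: "inj_on s {..<r}"
  proof (rule inj_onI)
    fix i j assume ij: "i \<in> {..<r}" "j \<in> {..<r}" "s i = s j"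
    have "s i i = p" "s j i = (if i = j then p else 0)" using ij(1) by (simp_all add: s_def)
    then show "i = j" using ij(3) p0 by (auto split: if_splits)
  qed
  have "(\<Sum>i<r. y i) ^ p = (\<Sum>\<alpha>\<in>weak_comps r p. ?c \<alpha>)" by (rule multinomial)
  also have "\<dots> = (\<Sum>\<alpha>\<in>A. ?c \<alpha>) + (\<Sum>\<alpha>\<in>s ` {..<r}. ?c \<alpha>)"
    unfolding comps by (rule sum.union_disjoint) (use fA disj in auto)
  also have "(\<Sum>\<alpha>\<in>s ` {..<r}. ?c \<alpha>) = (\<Sum>i<r. ?c (s i))" by (rule sum.reindex_cong[OF inj]) auto
  also have "\<dots> = (\<Sum>i<r. y i ^ p)"
  proof (rule sum.cong[OF refl])
    fix i assume "i \<in> {..<r}"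
    then have i: "i < r" by simp
    have "(\<Prod>j<r. fact (s i j) :: nat) = fact p" using i by (subst prod.remove[of _ i]) (auto simp: s_def)
    moreover have "(\<Prod>j<r. y j ^ s i j) = y i ^ p" using i by (subst prod.remove[of _ i]) (auto simp: s_def)
    ultimately show "?c (s i) = y i ^ p" by simp
  qed
  also have "(\<Sum>\<alpha>\<in>A. ?c \<alpha>) = of_nat p * delta_poly p r y"
    unfolding delta_poly_def A_def[symmetric] sum_distrib_left
  proof (rule sum.cong[OF refl])
    fix \<alpha> assume a: "\<alpha> \<in> A"
    let ?P = "\<Prod>i<r. fact (\<alpha> i) :: nat"
    have "?P dvd fact p" using prod_fact_dvd[of \<alpha> r] a by (simp add: A_def)
    then have e: "fact p = ?P * (fact p div ?P)" by simp
    have "\<not> p dvd ?P"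
    proof
      assume "p dvd ?P"
      then obtain i where i: "i < r" "p dvd fact (\<alpha> i)" using p by (auto simp: prime_dvd_prod_iff)
      then have "p \<le> \<alpha> i" using p prime_dvd_fact_iff by blast
      moreover have "\<alpha> i \<le> p - 1" using a i by (auto simp: A_def PiE_iff)
      ultimately show False using p0 by linarith
    qed
    moreover have "p dvd ?P * (fact p div ?P)" using e p0 by (metis dvd_fact order_refl One_nat_def Suc_leI)
    ultimately have "p dvd fact p div ?P" using p prime_dvd_mult_iff by blast
    then have "fact p div ?P = p * ((fact p div ?P) div p)" by simp
    then have "of_nat (fact p div ?P) = of_nat p * (of_nat ((fact p div ?P) div p) :: 'u)" by (metis of_nat_mult)
    then show "?c \<alpha> = of_nat p * (of_nat ((fact p div ?P) div p) * (\<Prod>i<r. y i ^ \<alpha> i))" by (simp add: mult.assoc)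
  qed
  finally show ?thesis by (simp add: add.commute)
qed

definition (in frob_lift) pow_rest :: "(nat \<Rightarrow> 'u) \<Rightarrow> (nat \<Rightarrow> 'u) \<Rightarrow> nat \<Rightarrow> 'u" where
  "pow_rest x y = (\<Sum>j\<in>{1..<p}. of_nat ((p choose j) div p) * x ^ (p - j) * y ^ j)"

context frob_lift
begin

lemma dwork_pow_rest [simp, intro]: "dwork x \<Longrightarrow> dwork y \<Longrightarrow> dwork (pow_rest x y)"
  by (simp add: pow_rest_def)

lemma power_p_add: "(x + y) ^ p = x ^ p + y ^ p + of_nat p * pow_rest x y"
proof -
  have "(y + x) ^ p = (\<Sum>j\<le>p. of_nat (p choose j) * y ^ j * x ^ (p - j))" by (rule binomial_ring)
  also have "{..p} = insert 0 (insert p {1..<p})" using p_gt_1 by auto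
  finally have "(y + x) ^ p = x ^ p + y ^ p + (\<Sum>j\<in>{1..<p}. of_nat (p choose j) * y ^ j * x ^ (p - j))"
    using p_gt_1 by simp
  also have "(\<Sum>j\<in>{1..<p}. of_nat (p choose j) * y ^ j * x ^ (p - j)) = of_nat p * pow_rest x y"
    unfolding pow_rest_def sum_distrib_left
  proof (rule sum.cong[OF refl])
    fix j assume "j \<in> {1..<p}"
    then have "p dvd (p choose j)" using prime_p by (intro dvd_choose_prime) auto
    then have "p choose j = p * ((p choose j) div p)" by simp
    then have "(of_nat (p choose j) :: nat \<Rightarrow> 'u) = of_nat p * of_nat ((p choose j) div p)" by (metis of_nat_mult)
    then show "of_nat (p choose j) * y ^ j * x ^ (p - j) = of_nat p * (of_nat ((p choose j) div p) * x ^ (p - j) * y ^ j)"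
      by (simp add: algebra_simps)
  qed
  finally show ?thesis by (simp add: add.commute)
qed

lemma pow_rest_first: "pow_rest x y = x ^ (p - 1) * y + (\<Sum>j\<in>{2..<p}. of_nat ((p choose j) div p) * x ^ (p - j) * y ^ j)"
proof -
  have "{1..<p} = insert 1 {2..<p}" using p_gt_1 by auto
  then show ?thesis using p_gt_1 by (simp add: pow_rest_def)
qed

text \<open>Each further factor V w contributes one \<open>p\<close>, because V g V h = p V(g
  h).\<close>

lemma V_power: "V w ^ Suc k = of_nat (p ^ k) * V (w ^ Suc k)"
proof (induction k)
  case (Suc k)
  have "V w ^ Suc (Suc k) = of_nat (p ^ k) * (V w * V (w ^ Suc k))"
    using Suc by (simp add: algebra_simps)
  then show ?case by (simp add: V_V_mult algebra_simps)
qed simp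

lemma P_fun_cancel: "of_nat p * (x :: nat \<Rightarrow> 'u) = of_nat p * y \<Longrightarrow> x = y"
proof
  fix i assume "of_nat p * x = of_nat p * y"
  from fun_cong[OF this, of i] show "x i = y i" using P_cancel by (simp add: fun_apply)
qed

end

context p_basis_witt
begin

section \<open>Arithmetic of \<open>sig\<close> modulo \<open>p\<close>\<close>

lemma sig_p_monomial:
  assumes "\<epsilon> y = b [^] p \<otimes> xm d" "b \<in> carrier R"
  shows "eqv n (sig (\<epsilon> y)) (T y)"
  using sig_p_monomial_wker[OF assms] assms(1) by (simp add: eqv_wker)

lemma sig_frob: "b \<in> carrier R \<Longrightarrow> sig (b [^] p) - F (T (zvar b)) \<in> wker n"
proof -
  assume b: "b \<in> carrier R"
  have "xm (\<lambda>j. 0 * (0 :: nat)) = \<one>" unfolding xm_power[of 0 "\<lambda>_. 0"] by simp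
  then have x0: "xm (\<lambda>_. 0) = \<one>" by simp
  have "sig (b [^] p \<otimes> xm (\<lambda>_. 0)) - T (zvar b ^ p) \<in> wker n"
    by (rule sig_p_monomial_wker) (use b x0 in \<open>auto simp: hom_power eps_zvar\<close>)
  then show ?thesis using b x0 by (simp add: F_T)
qed

lemma sig_zero_wker: "sig \<zero> \<in> wker n"
proof -
  have "sig (\<zero> [^] p) - F (T (zvar \<zero>)) \<in> wker n" by (rule sig_frob) simp
  moreover have "F (T (zvar \<zero>)) \<in> wker n"
    unfolding F_T by (rule wker_T) (use p_pos in \<open>simp add: hom_power eps_zvar nat_pow_zero\<close>)
  ultimately show ?thesis using wker_add p_pos by (fastforce simp: nat_pow_zero)
qed

lemma sig_zero: "eqv n (sig \<zero>) 0"
  by (rule eqv_wker) (auto simp: sig_zero_wker)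

lemma sig_sum:
  "(\<And>s. s \<in> S \<Longrightarrow> g s \<in> carrier R) \<Longrightarrow> eqv n (sig (\<Oplus>s\<in>S. g s)) (\<Sum>s\<in>S. sig (g s))"
proof (induction S rule: infinite_finite_induct)
  case (insert s S)
  have "eqv n (sig (g s \<oplus> (\<Oplus>s\<in>S. g s))) (sig (g s) + sig (\<Oplus>s\<in>S. g s))"
    by (rule sig_add) (use insert in auto)
  also have "eqv n \<dots> (sig (g s) + (\<Sum>s\<in>S. sig (g s)))"
    by (intro eqv_add eqv_refl) (use insert in auto)
  finally show ?case using insert by (simp add: Pi_def)
qed (auto simp: sig_zero)

lemma sig_minus: "a \<in> carrier R \<Longrightarrow> eqv n (sig (\<ominus> a)) (- sig a)"
proof -
  assume a: "a \<in> carrier R"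
  have "eqv n (sig a + sig (\<ominus> a)) (sig (a \<oplus> \<ominus> a))" by (rule eqv_sym, rule sig_add) (use a in auto)
  also have "eqv n (sig (a \<oplus> \<ominus> a)) 0" using a sig_zero by (simp add: r_neg)
  finally have "eqv n (sig a + sig (\<ominus> a) - sig a) (0 - sig a)" by (intro eqv_diff eqv_refl) auto
  then show ?thesis by simp
qed

lemma sig_add_pow: "a \<in> carrier R \<Longrightarrow> eqv n (sig (add_pow R (k :: nat) a)) (of_nat k * sig a)"
proof (induction k)
  case 0 then show ?case by (simp add: sig_zero)
next
  case (Suc k)
  have "eqv n (sig (add_pow R k a \<oplus> a)) (sig (add_pow R k a) + sig a)" by (rule sig_add) (use Suc in auto)
  also have "eqv n \<dots> (of_nat k * sig a + sig a)" by (intro eqv_add eqv_refl) (use Suc in auto)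
  finally show ?case by (simp add: algebra_simps)
qed

lemma T_cong: "\<epsilon> a = \<epsilon> b \<Longrightarrow> eqv n (T a) (T b)"
  by (rule eqv_wker) (auto simp: wker_T_diff)

text \<open>Multiplication by a p-th power t^p multiplies each coordinate by t and keeps the
  monomials, so the summands match one by one.\<close>

lemma sig_T_mult:
  assumes "a \<in> carrier R"
  shows "eqv n (T (t ^ p) * sig a) (sig (\<epsilon> t [^] p \<otimes> a))"
  unfolding sig_def sum_distrib_left
proof (rule eqv_sum)
  fix e assume e: "e \<in> E"
  have "\<epsilon> (t ^ p * (zvar (crd a e) ^ p * mon e)) = \<epsilon> (zvar (crd (\<epsilon> t [^] p \<otimes> a) e) ^ p * mon e)"
    using e assms crd_closed[OF assms e] by (simp add: hom_mult hom_power eps_zvar crd_mult nat_pow_distrib m_assoc)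
  then have "eqv n (T (t ^ p * (zvar (crd a e) ^ p * mon e))) (T (zvar (crd (\<epsilon> t [^] p \<otimes> a) e) ^ p * mon e))"
    by (rule T_cong)
  then show "eqv n (T (t ^ p) * T (zvar (crd a e) ^ p * mon e)) (T (zvar (crd (\<epsilon> t [^] p \<otimes> a) e) ^ p * mon e))"
    by (simp add: T_mult)
qed

lemma eps_term: "a \<in> carrier R \<Longrightarrow> e \<in> E \<Longrightarrow> \<epsilon> (zvar (crd a e) ^ p * mon e) = crd a e [^] p \<otimes> xm e"
  using crd_closed by (simp add: hom_mult hom_power eps_zvar eps_mon)

text \<open>A product of two p-monomials is again a p-monomial, and there \<open>sig\<close> agrees
  with the Teichmueller map. After expanding both factors, additivity of \<open>sig\<close> collects
  the products.\<close>

lemma sig_mult: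
  assumes a: "a \<in> carrier R" and b: "b \<in> carrier R"
  shows "eqv n (sig a * sig b) (sig (a \<otimes> b))"
proof -
  let ?t = "\<lambda>a e. zvar (crd a e) ^ p * mon e"
  note ca = crd_closed[OF a] and cb = crd_closed[OF b]
  define y where "y e e' = ?t a e * ?t b e'" for e e'
  define c where "c e e' = \<epsilon> (y e e')" for e e'
  have c [simp]: "c e e' \<in> carrier R" for e e' by (simp add: c_def)
  have e1: "sig a * sig b = (\<Sum>e\<in>E. \<Sum>e'\<in>E. T (y e e'))"
    unfolding sig_def sum_product T_mult[symmetric] y_def ..
  have e2: "eqv n (\<Sum>e\<in>E. \<Sum>e'\<in>E. T (y e e')) (\<Sum>e\<in>E. \<Sum>e'\<in>E. sig (c e e'))"
  proof (intro eqv_sum)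
    fix e e' assume e: "e \<in> E" "e' \<in> E"
    have 1: "\<epsilon> (y e e') = (crd a e \<otimes> crd b e') [^] p \<otimes> xm (\<lambda>j. e j + e' j)"
      unfolding y_def hom_mult[of "?t a e"] eps_term[OF a e(1)] eps_term[OF b e(2)]
      using ca[OF e(1)] cb[OF e(2)] by (simp add: xm_add nat_pow_distrib m_ac)
    have 2: "crd a e \<otimes> crd b e' \<in> carrier R" using ca[OF e(1)] cb[OF e(2)] by simp
    show "eqv n (T (y e e')) (sig (c e e'))"
      unfolding c_def by (rule eqv_sym[OF sig_p_monomial[OF 1 2]])
  qed
  have e3: "eqv n (sig (\<Oplus>e\<in>E. \<Oplus>e'\<in>E. c e e')) (\<Sum>e\<in>E. sig (\<Oplus>e'\<in>E. c e e'))"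
    by (rule sig_sum) auto
  have e4: "eqv n (\<Sum>e\<in>E. sig (\<Oplus>e'\<in>E. c e e')) (\<Sum>e\<in>E. \<Sum>e'\<in>E. sig (c e e'))"
    by (intro eqv_sum sig_sum) auto
  have e5: "(\<Oplus>e\<in>E. \<Oplus>e'\<in>E. c e e') = a \<otimes> b"
  proof -
    have "(\<Oplus>e\<in>E. \<Oplus>e'\<in>E. c e e') = \<epsilon> (\<Sum>e\<in>E. \<Sum>e'\<in>E. y e e')"
      by (simp add: hom_sum c_def)
    also have "\<dots> = \<epsilon> (\<Sum>e\<in>E. ?t a e) \<otimes> \<epsilon> (\<Sum>e\<in>E. ?t b e)" by (simp add: y_def sum_product hom_mult[symmetric])
    also have "\<dots> = a \<otimes> b"
      using eps_sig[OF a] eps_sig[OF b] by (simp add: sig_def fun_apply)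
    finally show ?thesis .
  qed
  show ?thesis
    unfolding e1 using eqv_trans[OF e2 eqv_sym[OF eqv_trans[OF e3 e4]]] unfolding e5 .
qed

lemma V_sig_frob:
  assumes "b \<in> carrier R"
  shows "eqv n ((V ^^ Suc k) (sig (b [^] p))) 0"
proof -
  have "eqv n (sig (b [^] p)) (F (T (zvar b)))" by (rule eqv_wker) (use sig_frob[OF assms] in auto)
  then have "eqv n (V (sig (b [^] p))) (V (F (T (zvar b))))" by (rule eqv_V)
  also have "eqv n \<dots> 0" using K_VF[of "T (zvar b)" n] by (simp add: eqv_K0[symmetric])
  finally have "eqv n ((V ^^ k) (V (sig (b [^] p)))) ((V ^^ k) 0)" by (rule eqv_V_iter)
  then show ?thesis by (simp add: V_iter_zero funpow_swap1)
qed

text \<open>Exponents are arbitrary here, unlike in \<open>p_monomials\<close>, which makes closure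
  under products immediate.\<close>

definition is_pmon :: "'a \<Rightarrow> bool" where
  "is_pmon c \<longleftrightarrow> (\<exists>b\<in>carrier R. \<exists>d. c = b [^] p \<otimes> xm d)"

lemma is_pmon_closed: "is_pmon c \<Longrightarrow> c \<in> carrier R"
  by (auto simp: is_pmon_def)

lemma is_pmon_mult:
  assumes "is_pmon c" "is_pmon c'" shows "is_pmon (c \<otimes> c')"
proof -
  obtain b d b' d' where bd: "b \<in> carrier R" "b' \<in> carrier R" "c = b [^] p \<otimes> xm d" "c' = b' [^] p \<otimes> xm d'"
    using assms by (auto simp: is_pmon_def)
  then have "c \<otimes> c' = (b \<otimes> b') [^] p \<otimes> xm (\<lambda>j. d j + d' j)"
    by (simp add: xm_add nat_pow_distrib m_ac)
  then show ?thesis using bd unfolding is_pmon_def by blast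
qed

lemma xm_zero: "xm (\<lambda>_. 0) = \<one>"
  using xm_power[of 0 "\<lambda>_. 0"] by simp

lemma is_pmon_one: "is_pmon \<one>"
  unfolding is_pmon_def using xm_zero by (intro bexI[of _ \<one>] exI[of _ "\<lambda>_. 0"]) auto

lemma is_pmon_pow: "is_pmon c \<Longrightarrow> is_pmon (c [^] (k :: nat))"
  by (induction k) (auto simp: is_pmon_one is_pmon_mult)

lemma is_pmon_prod: "(\<And>i. i \<in> S \<Longrightarrow> is_pmon (g i)) \<Longrightarrow> is_pmon (\<Otimes>i\<in>S. g i)"
proof (induction S rule: infinite_finite_induct)
  case (insert i S)
  then show ?case by (simp add: is_pmon_mult is_pmon_closed Pi_def)
qed (auto simp: is_pmon_one)

lemma sig_is_pmon: "is_pmon (\<epsilon> y) \<Longrightarrow> eqv n (T y) (sig (\<epsilon> y))"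
  using sig_p_monomial by (auto simp: is_pmon_def intro: eqv_sym)

lemma p_monomials_is_pmon: "c \<in> p_monomials R p N x \<Longrightarrow> is_pmon c"
  by (auto simp: p_monomials_def is_pmon_def)

lemma eps_delta_poly:
  assumes "\<And>i. i < length as \<Longrightarrow> as ! i \<in> carrier R"
  shows "delta_poly p (length as) (\<lambda>i. T (zvar (as ! i))) =
    (\<Sum>\<alpha>\<in>{\<alpha> \<in> {..<length as} \<rightarrow>\<^sub>E {0..p - 1}. (\<Sum>i<length as. \<alpha> i) = p}.
     of_nat ((fact p div (\<Prod>i<length as. fact (\<alpha> i))) div p) * T (\<Prod>i<length as. zvar (as ! i) ^ \<alpha> i))"
  unfolding delta_poly_def T_prod T_power ..

text \<open>At Teichmueller elements of p-monomials, each term of \<open>delta_poly\<close> is an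
  integer multiple of the Teichmueller element of a p-monomial, where T and \<open>sig\<close>
  agree. This is where decompositions into p-monomials enter.\<close>

lemma sig_delta:
  assumes "set as \<subseteq> p_monomials R p N x"
  shows "eqv n (delta_poly p (length as) (\<lambda>i. T (zvar (as ! i)))) (sig (delta_sum R p as))"
    and "delta_sum R p as \<in> carrier R"
proof -
  have pm: "is_pmon (as ! i)" if "i < length as" for i
    using assms that p_monomials_is_pmon by (metis nth_mem subset_iff)
  note car = is_pmon_closed[OF pm]
  let ?c = "\<lambda>\<alpha>. (fact p div (\<Prod>i<length as. fact (\<alpha> i))) div p :: nat"
  let ?q = "\<lambda>\<alpha>. \<Otimes>i\<in>{..<length as}. (as ! i) [^] (\<alpha> i :: nat)"
  have q: "\<epsilon> (\<Prod>i<length as. zvar (as ! i) ^ \<alpha> i) = ?q \<alpha>" for \<alpha> :: "nat \<Rightarrow> nat"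
    unfolding hom_prod hom_power using car by (intro finprod_cong') (auto simp: eps_zvar)
  have pq: "is_pmon (?q \<alpha>)" for \<alpha> using pm by (intro is_pmon_prod is_pmon_pow) auto
  have tm: "eqv n (of_nat (?c \<alpha>) * T (\<Prod>i<length as. zvar (as ! i) ^ \<alpha> i)) (sig (add_pow R (?c \<alpha>) (?q \<alpha>)))" for \<alpha>
  proof -
    have "eqv n (T (\<Prod>i<length as. zvar (as ! i) ^ \<alpha> i)) (sig (?q \<alpha>))"
      using sig_is_pmon[of "\<Prod>i<length as. zvar (as ! i) ^ \<alpha> i" n] pq[of \<alpha>] unfolding q by simp
    then have "eqv n (of_nat (?c \<alpha>) * T (\<Prod>i<length as. zvar (as ! i) ^ \<alpha> i)) (of_nat (?c \<alpha>) * sig (?q \<alpha>))"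
      by (intro eqv_mult eqv_refl) auto
    then show ?thesis using eqv_trans eqv_sym[OF sig_add_pow[OF is_pmon_closed[OF pq]]] by blast
  qed
  show "delta_sum R p as \<in> carrier R"
    unfolding delta_sum_def using is_pmon_closed[OF pq] by (intro finsum_closed) auto
  have st: "eqv n (sig (delta_sum R p as))
    (\<Sum>\<alpha>\<in>{\<alpha> \<in> {..<length as} \<rightarrow>\<^sub>E {0..p - 1}. (\<Sum>i<length as. \<alpha> i) = p}. sig (add_pow R (?c \<alpha>) (?q \<alpha>)))"
    unfolding delta_sum_def by (rule sig_sum) (use is_pmon_closed[OF pq] in auto)
  show "eqv n (delta_poly p (length as) (\<lambda>i. T (zvar (as ! i)))) (sig (delta_sum R p as))"
  proof (rule eqv_trans[OF _ eqv_sym[OF st]])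
    show "eqv n (delta_poly p (length as) (\<lambda>i. T (zvar (as ! i))))
      (\<Sum>\<alpha>\<in>{\<alpha> \<in> {..<length as} \<rightarrow>\<^sub>E {0..p - 1}. (\<Sum>i<length as. \<alpha> i) = p}. sig (add_pow R (?c \<alpha>) (?q \<alpha>)))"
      by (subst eps_delta_poly[OF car], assumption, rule eqv_sum, rule tm)
  qed
qed

section \<open>Expansion of Teichmueller elements\<close>

lemma dwork_delta_poly: "dwork (delta_poly p r (\<lambda>i. T (y i)))"
  unfolding delta_poly_def T_power[symmetric] by (intro dwork_sum dwork_mult dwork_of_nat dwork_prod dwork_T)

text \<open>Write w = [w_0] + V y. Both sides contain [w_0]^p; the rest of w^p consists of mixed
  terms and of a power of V y, all divisible by \<open>p\<close>, and the rest of F w is F V y = p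
  y.\<close>

lemma power_p_eqv_F: "dwork w \<Longrightarrow> eqv n (w ^ p) (F w)"
proof -
  assume w: "dwork w"
  obtain y where y: "dwork y" "w = T (w 0) + V y" using dwork_tail[OF w] by blast
  obtain k where k: "p = Suc k" "k > 0" using p_gt_1 by (cases p) auto
  obtain j where j: "k = Suc j" using k by (cases k) auto
  have Fw: "F w = T (w 0) ^ p + of_nat p * y" by (subst y(2)) (simp add: F_add F_T F_V T_power)
  have "V y ^ p = of_nat p * (of_nat (p ^ j) * V (y ^ p))"
    using V_power[of y k] unfolding k(1)[symmetric] by (simp add: j mult.assoc)
  then have "w ^ p = T (w 0) ^ p + of_nat p * (of_nat (p ^ j) * V (y ^ p)) + of_nat p * pow_rest (T (w 0)) (V y)"
    by (subst y(2)) (simp add: power_p_add)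
  then have "w ^ p - F w = of_nat p * (of_nat (p ^ j) * V (y ^ p) + pow_rest (T (w 0)) (V y) - y)"
    unfolding Fw by (simp add: algebra_simps)
  moreover have "dwork (of_nat (p ^ j) * V (y ^ p) + pow_rest (T (w 0)) (V y) - y)" using y by auto
  ultimately show ?thesis using w p_K by (simp add: eqv_def)
qed

text \<open>The defect of additivity is V w. Comparing F[a] = [a]^p with the p-th power of S + V w,
  where S is the sum of the [y_i], and dividing by \<open>p\<close> expresses w through itself: w is
  D plus mixed terms plus p^(p-2) V(w^p). Modulo \<open>p\<close> only the mixed term S^(p-1) V w
  survives; it equals V(F(S)^(p-1) w), and F S is [a]^p.\<close>

lemma teich_sum_recursion:
  fixes r :: nat and y :: "nat \<Rightarrow> 'a zpoly"
  defines "D \<equiv> delta_poly p r (\<lambda>i. T (y i))" and "a \<equiv> (\<Sum>i<r. y i)"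
  shows "\<exists>w. dwork w \<and> T a = (\<Sum>i<r. T (y i)) + V w \<and> (\<forall>n. eqv n w (D + V (T (a ^ (p * (p - 1))) * w)))"
proof -
  define S where "S = (\<Sum>i<r. T (y i))"
  have dS: "dwork S" and dD: "dwork D" unfolding S_def D_def by (auto simp: dwork_delta_poly)
  have "(T a - S) 0 = 0" by (simp add: fun_apply S_def a_def)
  then obtain w where w: "dwork w" "T a - S = V w" using V_surj[of "T a - S"] dS by auto
  then have Ta: "T a = S + V w" by (simp add: algebra_simps)
  obtain k where k: "p = Suc (Suc k)" using p_gt_1 by (metis One_nat_def Suc_lessE less_imp_Suc_add add_Suc_right plus_nat.add_0)
  have FS: "S ^ p = F S + of_nat p * D"
    using sum_power_prime[OF prime_p, of "\<lambda>i. T (y i)" r] by (simp add: S_def D_def F_sum F_T T_power)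
  have FTa: "F (T a) = T a ^ p" by (simp add: F_T T_power)
  have Vp: "V w ^ p = of_nat p * (of_nat (p ^ k) * V (w ^ p))"
    using V_power[of w "Suc k"] unfolding k[symmetric] by (simp add: mult.assoc)
  have "of_nat p * w = F (T a) - F S" unfolding Ta by (simp add: F_add F_V)
  also have "\<dots> = of_nat p * (D + pow_rest S (V w) + of_nat (p ^ k) * V (w ^ p))"
    unfolding FTa unfolding Ta power_p_add Vp FS by (simp add: algebra_simps)
  finally have w_eq: "w = D + pow_rest S (V w) + of_nat (p ^ k) * V (w ^ p)" by (rule P_fun_cancel)
  have "eqv n w (D + V (T (a ^ (p * (p - 1))) * w))" for n
  proof -
    have rest: "eqv n (pow_rest S (V w)) (S ^ (p - 1) * V w)"
    proof -
      have "(\<Sum>j\<in>{2..<p}. of_nat ((p choose j) div p) * S ^ (p - j) * V w ^ j)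
        = of_nat p * (\<Sum>j\<in>{2..<p}. of_nat ((p choose j) div p) * S ^ (p - j) * (of_nat (p ^ (j - 2)) * V (w ^ j)))"
        unfolding sum_distrib_left
      proof (rule sum.cong[OF refl])
        fix j assume "j \<in> {2..<p}"
        then obtain i where i: "j = Suc (Suc i)" by (metis One_nat_def Suc_1 add_2_eq_Suc atLeastLessThan_iff le_Suc_ex)
        have "V w ^ j = of_nat p * (of_nat (p ^ (j - 2)) * V (w ^ j))"
          unfolding i using V_power[of w "Suc i"] by (simp add: mult.assoc)
        then show "of_nat ((p choose j) div p) * S ^ (p - j) * V w ^ j
          = of_nat p * (of_nat ((p choose j) div p) * S ^ (p - j) * (of_nat (p ^ (j - 2)) * V (w ^ j)))"
          by (simp add: mult.left_commute)
      qed
      moreover have "dwork (\<Sum>j\<in>{2..<p}. of_nat ((p choose j) div p) * S ^ (p - j) * (of_nat (p ^ (j - 2)) * V (w ^ j)))"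
        using dS w by auto
      ultimately have "(\<Sum>j\<in>{2..<p}. of_nat ((p choose j) div p) * S ^ (p - j) * V w ^ j) \<in> K n"
        using p_K by simp
      then show ?thesis unfolding pow_rest_first using dS w by (intro eqv_K) auto
    qed
    \<comment> \<open>The factor p^k with k = p-2 is 1 for p = 2, so this term has to vanish for
      another reason: w^p is F w modulo \<open>p\<close>, and V F is multiplication by
      \<open>p\<close>.\<close>
    have "eqv n (V (w ^ p)) (V (F w))" by (rule eqv_V[OF power_p_eqv_F[OF w(1)]])
    then have "eqv n (V (w ^ p)) 0" using K_VF[OF w(1), of n] eqv_K0 eqv_trans by blast
    then have last: "eqv n (of_nat (p ^ k) * V (w ^ p)) (of_nat (p ^ k) * 0)" by (intro eqv_mult eqv_refl) auto
    have "F S = T a ^ p - of_nat p * w" using \<open>of_nat p * w = F (T a) - F S\<close> FTa by (simp add: algebra_simps)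
    then have "eqv n (F S) (T a ^ p)" using p_K[OF w(1), of n] K_minus dS by (fastforce simp: eqv_def)
    then have "eqv n (F S ^ (p - 1) * w) ((T a ^ p) ^ (p - 1) * w)" by (intro eqv_mult eqv_power eqv_refl w)
    then have "eqv n (V (F (S ^ (p - 1)) * w)) (V (T (a ^ (p * (p - 1))) * w))"
      by (intro eqv_V) (simp add: F_power T_power power_mult)
    then have "eqv n (S ^ (p - 1) * V w) (V (T (a ^ (p * (p - 1))) * w))" by (simp add: V_F_mult)
    then have "eqv n (D + pow_rest S (V w) + of_nat (p ^ k) * V (w ^ p)) (D + V (T (a ^ (p * (p - 1))) * w) + of_nat (p ^ k) * 0)"
      by (intro eqv_add eqv_refl dD last eqv_trans[OF rest])
    then show ?thesis using w_eq by simp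
  qed
  then show ?thesis using w(1) Ta unfolding S_def by blast
qed

text \<open>Unrolls the recursion m times. A factor [a^e] passes under V as [a^(p e)], so the
  exponents satisfy e_(m+1) = p (p-1) + p e_m with e_0 = 0, hence e_m = p (p^m - 1).\<close>

lemma teich_sum_iterate:
  assumes w: "dwork w" and D: "dwork D" and rec: "eqv n w (D + V (T (a ^ (p * (p - 1))) * w))"
  shows "eqv n w ((\<Sum>k<m. (V ^^ k) (T (a ^ (p * (p ^ k - 1))) * D)) + (V ^^ m) (T (a ^ (p * (p ^ m - 1))) * w))"
proof (induction m)
  case 0 then show ?case using w by (simp add: T_one eqv_refl)
next
  case (Suc m)
  let ?e = "p * (p ^ m - 1)"
  have ex: "p * (p - 1) + ?e * p = p * (p ^ Suc m - 1)"
    using p_pos by (simp add: algebra_simps diff_mult_distrib2)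
  have "T (a ^ ?e) * V (T (a ^ (p * (p - 1))) * w) = V (F (T (a ^ ?e)) * (T (a ^ (p * (p - 1))) * w))"
    by (simp add: V_F_mult)
  also have "F (T (a ^ ?e)) * (T (a ^ (p * (p - 1))) * w) = T (a ^ (p * (p ^ Suc m - 1))) * w"
    unfolding F_T mult.assoc[symmetric] T_mult[symmetric] power_mult[symmetric] power_add[symmetric] ex[symmetric]
    by (simp only: add.commute)
  finally have e1: "T (a ^ ?e) * V (T (a ^ (p * (p - 1))) * w) = V (T (a ^ (p * (p ^ Suc m - 1))) * w)" .
  have "eqv n (T (a ^ ?e) * w) (T (a ^ ?e) * D + V (T (a ^ (p * (p ^ Suc m - 1))) * w))"
    using eqv_mult[OF eqv_refl[OF dwork_T[of "a ^ ?e"]] rec] by (simp only: distrib_left e1)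
  then have "eqv n ((V ^^ m) (T (a ^ ?e) * w)) ((V ^^ m) (T (a ^ ?e) * D + V (T (a ^ (p * (p ^ Suc m - 1))) * w)))"
    by (rule eqv_V_iter)
  then have "eqv n ((V ^^ m) (T (a ^ ?e) * w))
     ((V ^^ m) (T (a ^ ?e) * D) + (V ^^ Suc m) (T (a ^ (p * (p ^ Suc m - 1))) * w))"
    by (simp add: V_iter_add funpow_swap1)
  then have "eqv n ((\<Sum>k<m. (V ^^ k) (T (a ^ (p * (p ^ k - 1))) * D)) + (V ^^ m) (T (a ^ ?e) * w))
     ((\<Sum>k<m. (V ^^ k) (T (a ^ (p * (p ^ k - 1))) * D)) +
       ((V ^^ m) (T (a ^ ?e) * D) + (V ^^ Suc m) (T (a ^ (p * (p ^ Suc m - 1))) * w)))"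
    by (intro eqv_add eqv_refl) (auto simp: D)
  from eqv_trans[OF Suc this] show ?case by (simp only: sum.lessThan_Suc add.assoc)
qed

text \<open>\<open>d\<close> represents the class \<open>\<Delta>\<^sub>1(a)\<close>.\<close>

definition is_delta :: "'a \<Rightarrow> 'a \<Rightarrow> bool" where
  "is_delta a d \<longleftrightarrow> (\<exists>as b. p_decomposition R p N x a as \<and> b \<in> carrier R \<and> d = b [^] p \<oplus> delta_sum R p as)"

lemma is_delta_closed: "is_delta a d \<Longrightarrow> a \<in> carrier R \<and> d \<in> carrier R"
proof -
  assume "is_delta a d"
  then obtain as b where as: "set as \<subseteq> p_monomials R p N x" "a = (\<Oplus>i\<in>{..<length as}. as ! i)" "b \<in> carrier R"
    "d = b [^] p \<oplus> delta_sum R p as" by (auto simp: is_delta_def p_decomposition_def)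
  have "as ! i \<in> carrier R" if "i < length as" for i
    using as(1) that p_monomials_is_pmon is_pmon_closed by (metis nth_mem subset_iff)
  then show ?thesis using as sig_delta(2)[OF as(1)] by auto
qed

text \<open>The exponent p (p^k - 1) is a multiple of \<open>p\<close>, so the coefficient of
  \<Delta>_1 is a p-th power and passes into \<open>sig\<close> by \<open>sig_T_mult\<close>. After
  n steps the remainder of the recursion is an n-fold Verschiebung, which is zero in W_n.\<close>

theorem teich_expansion:
  assumes "is_delta a d" "\<epsilon> a' = a"
  shows "eqv n (T a') (sig a + (\<Sum>k<n. (V ^^ Suc k) (sig (a [^] (p * (p ^ k - 1)) \<otimes> d))))"
proof -
  obtain as b where as: "set as \<subseteq> p_monomials R p N x" "a = (\<Oplus>i\<in>{..<length as}. as ! i)" and b: "b \<in> carrier R"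
    and d: "d = b [^] p \<oplus> delta_sum R p as" using assms(1) by (auto simp: is_delta_def p_decomposition_def)
  have pm: "is_pmon (as ! i)" if "i < length as" for i
    using as(1) that p_monomials_is_pmon by (metis nth_mem subset_iff)
  note car = is_pmon_closed[OF pm]
  define y where "y i = zvar (as ! i)" for i
  define D where "D = delta_poly p (length as) (\<lambda>i. T (y i))"
  define aa where "aa = (\<Sum>i<length as. y i)"
  have ey: "\<epsilon> (y i) = as ! i" if "i < length as" for i using car[OF that] by (simp add: y_def eps_zvar)
  have ea: "\<epsilon> aa = a" unfolding aa_def hom_sum as(2) by (rule add.finprod_cong') (use ey car in auto)
  have ac: "a \<in> carrier R" and dc: "d \<in> carrier R" using is_delta_closed[OF assms(1)] by auto
  have sc: "delta_sum R p as \<in> carrier R" by (rule sig_delta(2)[OF as(1)])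
  have dD: "dwork D" by (simp add: D_def dwork_delta_poly)
  obtain w where w: "dwork w" "T aa = (\<Sum>i<length as. T (y i)) + V w"
    "eqv n w (D + V (T (aa ^ (p * (p - 1))) * w))"
    using teich_sum_recursion[of y "length as"] unfolding D_def aa_def by blast
  have S: "eqv n (\<Sum>i<length as. T (y i)) (sig a)"
  proof -
    have "eqv n (\<Sum>i<length as. T (y i)) (\<Sum>i<length as. sig (as ! i))"
    proof (rule eqv_sum)
      fix i assume "i \<in> {..<length as}"
      then show "eqv n (T (y i)) (sig (as ! i))" using sig_is_pmon[of "y i" n] pm[of i] ey[of i] by simp
    qed
    also have "eqv n \<dots> (sig a)" unfolding as(2) by (rule eqv_sym, rule sig_sum) (use car in auto)
    finally show ?thesis .
  qed
  have Dd: "eqv n D (sig (delta_sum R p as))" unfolding D_def y_def by (rule sig_delta(1)[OF as(1)])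
  have "eqv n ((V ^^ k) (T (aa ^ (p * (p ^ k - 1))) * D)) ((V ^^ k) (sig (a [^] (p * (p ^ k - 1)) \<otimes> delta_sum R p as)))" for k
  proof (rule eqv_V_iter)
    have "eqv n (T ((aa ^ (p ^ k - 1)) ^ p) * D) (T ((aa ^ (p ^ k - 1)) ^ p) * sig (delta_sum R p as))"
      by (intro eqv_mult eqv_refl Dd) auto
    also have "eqv n \<dots> (sig (\<epsilon> (aa ^ (p ^ k - 1)) [^] p \<otimes> delta_sum R p as))" by (rule sig_T_mult[OF sc])
    finally show "eqv n (T (aa ^ (p * (p ^ k - 1))) * D) (sig (a [^] (p * (p ^ k - 1)) \<otimes> delta_sum R p as))"
      using ac by (simp add: hom_power ea nat_pow_pow mult.commute[of p] flip: power_mult)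
  qed
  then have "eqv n (\<Sum>k<n. (V ^^ k) (T (aa ^ (p * (p ^ k - 1))) * D)) (\<Sum>k<n. (V ^^ k) (sig (a [^] (p * (p ^ k - 1)) \<otimes> delta_sum R p as)))"
    by (intro eqv_sum)
  moreover have "eqv n ((V ^^ n) (T (aa ^ (p * (p ^ n - 1))) * w)) 0"
    using wker_V_iter[of "T (aa ^ (p * (p ^ n - 1))) * w" n] w(1) by (simp add: eqv_K0[symmetric] wker_K)
  ultimately have "eqv n w ((\<Sum>k<n. (V ^^ k) (sig (a [^] (p * (p ^ k - 1)) \<otimes> delta_sum R p as))) + 0)"
    by (intro eqv_trans[OF teich_sum_iterate[OF w(1) dD w(3), of n]] eqv_add)
  then have Vw: "eqv n (V w) (\<Sum>k<n. (V ^^ Suc k) (sig (a [^] (p * (p ^ k - 1)) \<otimes> delta_sum R p as)))"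
    using eqv_V by (fastforce simp: V_sum)
  \<comment> \<open>Representatives of \<Delta>_1(a) differ by p-th powers, and so do their
    multiples by p-th powers; in positive degrees these do not count.\<close>
  have change: "eqv n ((V ^^ Suc k) (sig (a [^] (p * (p ^ k - 1)) \<otimes> delta_sum R p as)))
      ((V ^^ Suc k) (sig (a [^] (p * (p ^ k - 1)) \<otimes> d)))" for k
  proof -
    let ?q = "a [^] (p * (p ^ k - 1))" and ?c = "(a [^] (p ^ k - 1) \<otimes> b) [^] p"
    have "?q \<otimes> d = ?c \<oplus> ?q \<otimes> delta_sum R p as"
      unfolding d using ac b sc by (simp add: r_distr nat_pow_distrib nat_pow_pow mult.commute[of p])
    then have "eqv n (sig (?q \<otimes> d)) (sig ?c + sig (?q \<otimes> delta_sum R p as))"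
      using sig_add[of ?c "?q \<otimes> delta_sum R p as" n] ac b sc by simp
    then have "eqv n ((V ^^ Suc k) (sig (?q \<otimes> d))) ((V ^^ Suc k) (sig ?c) + (V ^^ Suc k) (sig (?q \<otimes> delta_sum R p as)))"
      using eqv_V_iter V_iter_add by metis
    also have "eqv n \<dots> (0 + (V ^^ Suc k) (sig (?q \<otimes> delta_sum R p as)))"
      by (intro eqv_add V_sig_frob eqv_refl) (use ac b in auto)
    finally show ?thesis using eqv_sym by simp
  qed
  have "eqv n (T aa) (sig a + (\<Sum>k<n. (V ^^ Suc k) (sig (a [^] (p * (p ^ k - 1)) \<otimes> d))))"
    unfolding w(2) by (intro eqv_add S eqv_trans[OF Vw] eqv_sum change)
  moreover have "eqv n (T a') (T aa)" by (rule T_cong) (simp add: assms(2) ea)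
  ultimately show ?thesis by (rule eqv_trans[rotated])
qed

section \<open>Existence and uniqueness of \<sigma>-coordinates\<close>

definition vsum :: "nat \<Rightarrow> (nat \<Rightarrow> 'a) \<Rightarrow> nat \<Rightarrow> 'a zpoly" where
  "vsum n a = (\<Sum>k<n. (V ^^ k) (sig (a k)))"

lemma dwork_vsum [simp, intro]: "dwork (vsum n a)" by (simp add: vsum_def)

lemma vsum_Suc: "vsum (Suc n) a = sig (a 0) + V (vsum n (\<lambda>k. a (Suc k)))"
  unfolding vsum_def by (simp add: sum.lessThan_Suc_shift V_sum del: sum.lessThan_Suc)

lemma eps_F_diff:
  assumes "g - F h \<in> wker (Suc n)" "dwork h"
  shows "\<epsilon> (g 0) = \<epsilon> (h 0) [^] p"
proof -
  have "\<epsilon> ((g - F h) 0) = \<zero>" by (rule wker_eps0) fact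
  then have "\<epsilon> (g 0) \<ominus> \<epsilon> (h 0) [^] p = \<zero>" using eps_F0[OF assms(2)] by (simp add: fun_apply hom_diff)
  then show ?thesis by (simp add: r_right_minus_eq)
qed

text \<open>The first component of F g is b^p, so a_0 = b^p. Removing F[b] from both sides leaves F
  of a vector with vanishing first component, which is p h' = V F h'. Cancelling one V gives the
  same statement for the tail, with h' in place of g.\<close>

lemma sig_uniq_F:
  assumes "\<And>k. a k \<in> carrier R" "dwork g" "vsum n a - F g \<in> wker n" "k < n"
  shows "a k \<in> frob_image R p"
  using assms
proof (induction n arbitrary: a g k)
  case (Suc n)
  define b where "b = \<epsilon> (g 0)"
  have b: "b \<in> carrier R" by (simp add: b_def)
  have "\<epsilon> (vsum (Suc n) a 0) = a 0" using Suc.prems(1) by (simp add: vsum_Suc fun_apply hom_add eps_sig hom_zero)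
  then have a0: "a 0 = b [^] p" using eps_F_diff[OF Suc.prems(3,2)] b_def by simp
  define h where "h = g - T (zvar b)"
  have h: "dwork h" "\<epsilon> (h 0) = \<zero>" using Suc.prems(2) by (auto simp: h_def fun_apply hom_diff eps_zvar b b_def[symmetric] a_minus_def r_neg)
  obtain h' where h': "dwork h'" "h = T (h 0) + V h'" using dwork_tail[OF h(1)] by blast
  have Fh: "F h = T (h 0 ^ p) + of_nat p * h'" by (subst h'(2)) (simp add: F_add F_T F_V)
  have k1: "T (h 0 ^ p) \<in> wker (Suc n)" using h(2) p_pos by (intro wker_T) (simp add: hom_power nat_pow_zero)
  have k2: "sig (b [^] p) - F (T (zvar b)) \<in> wker (Suc n)" by (rule sig_frob[OF b])
  have k3: "V (F h') - of_nat p * h' \<in> wker (Suc n)" by (rule wker_VF[OF h'(1)])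
  have Fg: "F g = F (T (zvar b)) + F h" by (simp add: h_def F_diff)
  let ?v = "vsum n (\<lambda>k. a (Suc k))"
  have "V (?v - F h') = (vsum (Suc n) a - F g) - (sig (b [^] p) - F (T (zvar b))) + T (h 0 ^ p) - (V (F h') - of_nat p * h')"
    unfolding vsum_Suc a0 Fg Fh V_diff by (simp add: algebra_simps)
  also have "\<dots> \<in> wker (Suc n)"
    by (rule wker_diff[OF wker_add[OF wker_diff[OF Suc.prems(3) k2] k1] k3])
  finally have "?v - F h' \<in> wker n" by (rule wker_V_D[rotated]) (use h' in auto)
  then have IH: "a (Suc j) \<in> frob_image R p" if "j < n" for j
    using Suc.IH[of "\<lambda>k. a (Suc k)" h' j] Suc.prems(1) h'(1) that by blast
  show ?case
  proof (cases k)
    case 0 then show ?thesis using a0 b by (auto simp: frob_image_def)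
  next
    case (Suc j) then show ?thesis using IH Suc.prems(4) by simp
  qed
qed simp

text \<open>Multiples of \<open>p\<close> have vanishing first component, so a_0 = 0. Since p g = V
  F g, cancelling V leaves a tail equal to F g, to which \<open>sig_uniq_F\<close> applies.\<close>

lemma sig_uniq:
  assumes a: "\<And>k. a k \<in> carrier R" and K: "vsum n a \<in> K n" and n: "n > 0"
  shows "a 0 = \<zero>" "0 < k \<Longrightarrow> k < n \<Longrightarrow> a k \<in> frob_image R p"
proof -
  obtain m where m: "n = Suc m" using n by (cases n) auto
  obtain g z where g: "vsum n a = of_nat p * g + z" "dwork g" "z \<in> wker n" using K unfolding K_def by blast
  have "\<epsilon> (vsum n a 0) = a 0" using a by (simp add: m vsum_Suc fun_apply hom_add eps_sig hom_zero)
  moreover have "\<epsilon> ((of_nat p * g + z) 0) = \<zero>"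
    using g(3) wker_eps0 m by (simp add: fun_apply hom_add eps_p)
  ultimately show a0: "a 0 = \<zero>" using g by simp
  have k: "sig \<zero> \<in> wker n" "V (F g) - of_nat p * g \<in> wker n" using sig_zero_wker wker_VF g by auto
  let ?v = "vsum m (\<lambda>k. a (Suc k))"
  have "V (?v - F g) = z - sig \<zero> - (V (F g) - of_nat p * g)"
    using g(1) unfolding m vsum_Suc a0 V_diff by (simp add: algebra_simps)
  also have "\<dots> \<in> wker (Suc m)" using k g(3) m wker_diff by simp
  finally have "?v - F g \<in> wker m" by (rule wker_V_D[rotated]) (use g in auto)
  then have "a (Suc j) \<in> frob_image R p" if "j < m" for j
    using sig_uniq_F[of "\<lambda>k. a (Suc k)" g m j] a g(2) that by blast
  then show "a k \<in> frob_image R p" if "0 < k" "k < n" using that m by (cases k) auto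
qed

text \<open>Successive approximation: subtracting \<open>sig\<close> of the first component leaves a
  Verschiebung modulo the kernel, and the procedure continues with its argument.\<close>

lemma sig_exist_aux:
  "dwork g \<Longrightarrow> \<exists>a g'. (\<forall>k. a k \<in> carrier R) \<and> dwork g' \<and> eqv n g (vsum m a + (V ^^ m) g')"
proof (induction m arbitrary: g)
  case 0
  then show ?case by (intro exI[of _ "\<lambda>_. \<zero>"] exI[of _ g]) (auto simp: vsum_def eqv_refl)
next
  case (Suc m)
  define b where "b = \<epsilon> (g 0)"
  have b: "b \<in> carrier R" by (simp add: b_def)
  define h where "h = g - sig b"
  have h: "dwork h" "\<epsilon> (h 0) = \<zero>"
    using Suc.prems b by (auto simp: h_def fun_apply hom_diff eps_sig b_def[symmetric] a_minus_def r_neg)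
  obtain h' where h': "dwork h'" "h = T (h 0) + V h'" using dwork_tail[OF h(1)] by blast
  obtain a g' where a: "\<forall>k. a k \<in> carrier R" "dwork g'" "eqv n h' (vsum m a + (V ^^ m) g')"
    using Suc.IH[OF h'(1)] by blast
  let ?a = "case_nat b a"
  have "eqv n (T (h 0)) 0" using wker_T[OF h(2), of n] by (simp add: eqv_K0[symmetric] wker_K)
  then have "eqv n (sig b + (T (h 0) + V h')) (sig b + (0 + V (vsum m a + (V ^^ m) g')))"
    by (intro eqv_add eqv_refl eqv_V a) auto
  moreover have "g = sig b + h" by (simp add: h_def)
  ultimately have "eqv n g (vsum (Suc m) ?a + (V ^^ Suc m) g')"
    unfolding h'(2)[symmetric] by (simp add: vsum_Suc V_add algebra_simps)
  moreover have "\<forall>k. ?a k \<in> carrier R" using a b by (auto split: nat.split)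
  ultimately show ?case using a(2) by blast
qed

lemma sig_exist:
  assumes "dwork g" obtains a where "\<And>k. a k \<in> carrier R" "eqv n g (vsum n a)"
proof -
  obtain a g' where a: "\<forall>k. a k \<in> carrier R" "dwork g'" "eqv n g (vsum n a + (V ^^ n) g')"
    using sig_exist_aux[OF assms] by blast
  have "eqv n (vsum n a + (V ^^ n) g') (vsum n a)" by (intro eqv_K wker_K wker_V_iter a) auto
  from eqv_trans[OF a(3) this] show ?thesis using that a(1) by blast
qed

lemma teich_expansion_V:
  assumes "is_delta a d" "\<epsilon> a' = a"
  shows "eqv n (T a') (sig a + V (\<Sum>k<n. (V ^^ k) (sig (a [^] (p * (p ^ k - 1)) \<otimes> d))))"
  using teich_expansion[OF assms] by (simp add: V_sum)

lemma T_mult_V_sum: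
  assumes "r \<in> carrier R" "\<And>k. y k \<in> carrier R"
  shows "eqv n (T (zvar r) * V (\<Sum>k<n. (V ^^ k) (sig (y k)))) (\<Sum>k<n. (V ^^ Suc k) (sig (r [^] (p ^ Suc k) \<otimes> y k)))"
proof -
  have "T (zvar r) * V (\<Sum>k<n. (V ^^ k) (sig (y k))) = (\<Sum>k<n. T (zvar r) * (V ^^ Suc k) (sig (y k)))"
    by (simp add: V_sum sum_distrib_left)
  moreover have "eqv n \<dots> (\<Sum>k<n. (V ^^ Suc k) (sig (r [^] (p ^ Suc k) \<otimes> y k)))"
  proof (rule eqv_sum)
    fix k
    have "eqv n (T ((zvar r ^ (p ^ k)) ^ p) * sig (y k)) (sig (\<epsilon> (zvar r ^ (p ^ k)) [^] p \<otimes> y k))"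
      by (rule sig_T_mult) (rule assms)
    then have "eqv n (T (zvar r ^ (p ^ Suc k)) * sig (y k)) (sig (r [^] (p ^ Suc k) \<otimes> y k))"
      using assms(1) by (simp add: hom_power eps_zvar nat_pow_pow mult.commute[of p] flip: power_mult)
    then show "eqv n (T (zvar r) * (V ^^ Suc k) (sig (y k))) ((V ^^ Suc k) (sig (r [^] (p ^ Suc k) \<otimes> y k)))"
      unfolding V_iter_T_mult by (rule eqv_V_iter)
  qed
  ultimately show ?thesis by simp
qed

text \<open>Expand both factors. The product of the two Verschiebung parts is divisible by
  \<open>p\<close>, so in the cross terms the other factor may be taken to be a Teichmueller
  element, which passes under V^(k+1) as its p^(k+1)-st power. Compared with the expansion of [f r]
  as one element, this separates the contributions of f and r.\<close>

theorem teich_mult_expansion: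
  assumes f: "is_delta f d" and r: "is_delta r e"
  shows "eqv n (T (zvar f * zvar r)) (sig (f \<otimes> r) + (\<Sum>k<n. (V ^^ Suc k) (sig
     (r [^] (p ^ Suc k) \<otimes> (f [^] (p * (p ^ k - 1)) \<otimes> d) \<oplus> f [^] (p ^ Suc k) \<otimes> (r [^] (p * (p ^ k - 1)) \<otimes> e)))))"
proof -
  have car: "f \<in> carrier R" "d \<in> carrier R" "r \<in> carrier R" "e \<in> carrier R"
    using is_delta_closed[OF f] is_delta_closed[OF r] by auto
  define yf yr where "yf k = f [^] (p * (p ^ k - 1)) \<otimes> d" and "yr k = r [^] (p * (p ^ k - 1)) \<otimes> e" for k
  have y: "yf k \<in> carrier R" "yr k \<in> carrier R" for k using car by (simp_all add: yf_def yr_def)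
  define Ef Er where "Ef = (\<Sum>k<n. (V ^^ k) (sig (yf k)))" and "Er = (\<Sum>k<n. (V ^^ k) (sig (yr k)))"
  have dE: "dwork Ef" "dwork Er" by (auto simp: Ef_def Er_def)
  let ?f = "T (zvar f)" and ?r = "T (zvar r)"
  have ef: "eqv n ?f (sig f + V Ef)" and er: "eqv n ?r (sig r + V Er)"
    using teich_expansion_V[OF f, of "zvar f" n] teich_expansion_V[OF r, of "zvar r" n] car
    by (simp_all add: Ef_def Er_def yf_def yr_def eps_zvar)
  have VV: "eqv n (V Ef * V Er) 0"
    unfolding V_V_mult eqv_K0[symmetric] by (rule p_K) (use dE in auto)
  have sr: "eqv n (sig r) (?r - V Er)"
    using eqv_diff[OF eqv_sym[OF er] eqv_refl[of "V Er" n]] dE by simp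
  have 1: "eqv n (V Ef * sig r) (V Ef * ?r)"
  proof -
    have a: "eqv n (V Ef * sig r) (V Ef * (?r - V Er))" by (intro eqv_mult eqv_refl sr) (use dE in auto)
    have b: "eqv n (V Ef * ?r - V Ef * V Er) (V Ef * ?r - 0)" by (intro eqv_diff eqv_refl VV) (use dE in auto)
    show ?thesis using eqv_trans[OF a[unfolded right_diff_distrib] b] by simp
  qed
  have 2: "eqv n (?f * sig r) (sig (f \<otimes> r) + V Ef * ?r)"
  proof -
    have a: "eqv n (?f * sig r) ((sig f + V Ef) * sig r)" by (intro eqv_mult eqv_refl ef) auto
    have b: "eqv n (sig f * sig r + V Ef * sig r) (sig (f \<otimes> r) + V Ef * ?r)"
      by (intro eqv_add sig_mult car 1)
    show ?thesis by (rule eqv_trans[OF a[unfolded distrib_right] b])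
  qed
  have 3: "eqv n (?f * ?r) ((sig (f \<otimes> r) + V Ef * ?r) + ?f * V Er)"
  proof -
    have a: "eqv n (?f * ?r) (?f * (sig r + V Er))" by (intro eqv_mult eqv_refl er) auto
    have b: "eqv n (?f * sig r + ?f * V Er) ((sig (f \<otimes> r) + V Ef * ?r) + ?f * V Er)"
      by (intro eqv_add 2 eqv_refl) (use dE in auto)
    show ?thesis by (rule eqv_trans[OF a[unfolded distrib_left] b])
  qed
  have 4: "eqv n (?r * V Ef) (\<Sum>k<n. (V ^^ Suc k) (sig (r [^] (p ^ Suc k) \<otimes> yf k)))"
    "eqv n (?f * V Er) (\<Sum>k<n. (V ^^ Suc k) (sig (f [^] (p ^ Suc k) \<otimes> yr k)))"
    unfolding Ef_def Er_def by (rule T_mult_V_sum; use car y in auto)+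
  have 5: "eqv n ((\<Sum>k<n. (V ^^ Suc k) (sig (r [^] (p ^ Suc k) \<otimes> yf k))) + (\<Sum>k<n. (V ^^ Suc k) (sig (f [^] (p ^ Suc k) \<otimes> yr k))))
    (\<Sum>k<n. (V ^^ Suc k) (sig (r [^] (p ^ Suc k) \<otimes> yf k \<oplus> f [^] (p ^ Suc k) \<otimes> yr k)))"
    unfolding sum.distrib[symmetric] V_iter_add[symmetric]
    by (intro eqv_sum eqv_V_iter eqv_sym[OF sig_add]) (use car y in auto)
  have "eqv n ((sig (f \<otimes> r) + V Ef * ?r) + ?f * V Er) (sig (f \<otimes> r) +
    ((\<Sum>k<n. (V ^^ Suc k) (sig (r [^] (p ^ Suc k) \<otimes> yf k))) + (\<Sum>k<n. (V ^^ Suc k) (sig (f [^] (p ^ Suc k) \<otimes> yr k)))))"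
    using eqv_add[OF eqv_refl[OF dwork_sig[of "f \<otimes> r"]] eqv_add[OF 4]]
    by (simp only: add.assoc mult.commute[of "?r" "V Ef"])
  then have "eqv n ((sig (f \<otimes> r) + V Ef * ?r) + ?f * V Er) (sig (f \<otimes> r) +
    (\<Sum>k<n. (V ^^ Suc k) (sig (r [^] (p ^ Suc k) \<otimes> yf k \<oplus> f [^] (p ^ Suc k) \<otimes> yr k))))"
    by (rule eqv_trans) (intro eqv_add eqv_refl 5 dwork_sig)
  from eqv_trans[OF 3 this] show ?thesis by (simp only: T_mult yf_def yr_def)
qed

section \<open>The product rule for \<Delta>_1\<close>

lemma vsum_2: "eqv 2 (sig a + V (sig c)) (vsum 2 (case_nat a (\<lambda>_. c)))"
proof -
  have "vsum 2 (case_nat a (\<lambda>_. c)) = sig a + V (sig c)"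
    by (simp add: vsum_def numeral_2_eq_2)
  then show ?thesis by (simp add: eqv_refl)
qed

text \<open>Length 2 is enough to see \<Delta>_1: there V (sig c) determines c up to p-th powers, by
  \<open>sig_uniq\<close>.\<close>

lemma delta_congruence:
  assumes c: "c \<in> carrier R" "c' \<in> carrier R" and e: "eqv 2 (V (sig c)) (V (sig c'))"
  shows "c \<ominus> c' \<in> frob_image R p"
proof -
  have "eqv 2 (sig (c \<oplus> \<ominus> c')) (sig c + sig (\<ominus> c'))" by (rule sig_add) (use c in auto)
  also have "eqv 2 \<dots> (sig c + - sig c')" by (intro eqv_add eqv_refl sig_minus c dwork_sig)
  finally have a: "eqv 2 (V (sig (c \<ominus> c'))) (V (sig c - sig c'))" unfolding a_minus_def by (simp add: eqv_V)
  have b: "eqv 2 (V (sig c) - V (sig c')) (V (sig c') - V (sig c'))" by (intro eqv_diff e eqv_refl) auto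
  have 0: "eqv 2 (V (sig (c \<ominus> c'))) 0" using eqv_trans[OF a[unfolded V_diff] b] by simp
  have "eqv 2 (sig \<zero> + V (sig (c \<ominus> c'))) (0 + 0)" by (intro eqv_add 0 sig_zero)
  from eqv_trans[OF eqv_sym[OF vsum_2] this] have "vsum 2 (case_nat \<zero> (\<lambda>_. c \<ominus> c')) \<in> K 2"
    unfolding eqv_K0 by simp
  then have "case_nat \<zero> (\<lambda>_. c \<ominus> c') 1 \<in> frob_image R p"
    by (intro sig_uniq(2)) (use c in \<open>auto split: nat.split\<close>)
  then show ?thesis by simp
qed

lemma sum_2_V: "(\<And>k. dwork (z k)) \<Longrightarrow> eqv 2 (\<Sum>k<2. (V ^^ Suc k) (z k)) (V (z 0))"
proof -
  assume z: "\<And>k. dwork (z k)"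
  have "(\<Sum>k<2. (V ^^ Suc k) (z k)) = V (z 0) + (V ^^ 2) (z 1)" by (simp add: numeral_2_eq_2)
  then show ?thesis using wker_V_iter[of "z 1" 2] z by (simp add: eqv_K wker_K)
qed

lemma teich_expansion_2:
  assumes "is_delta a d" "\<epsilon> a' = a"
  shows "eqv 2 (T a') (sig a + V (sig d))"
proof -
  have d: "d \<in> carrier R" using is_delta_closed[OF assms(1)] by auto
  have "eqv 2 (\<Sum>k<2. (V ^^ Suc k) (sig (a [^] (p * (p ^ k - 1)) \<otimes> d))) (V (sig (a [^] (p * (p ^ 0 - 1)) \<otimes> d)))"
    by (rule sum_2_V) auto
  then have "eqv 2 (\<Sum>k<2. (V ^^ Suc k) (sig (a [^] (p * (p ^ k - 1)) \<otimes> d))) (V (sig d))" using d by simp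
  then show ?thesis by (intro eqv_trans[OF teich_expansion[OF assms]] eqv_add eqv_refl) auto
qed

text \<open>Compare the degree 1 coordinate of [f r] in length 2, computed by
  \<open>teich_expansion_2\<close> and, as a product, by
  \<open>teich_mult_expansion\<close>.\<close>

lemma delta_mult:
  assumes f: "is_delta f d" and r: "is_delta r e" and c: "is_delta (f \<otimes> r) c"
  shows "c \<ominus> (r [^] p \<otimes> d \<oplus> f [^] p \<otimes> e) \<in> frob_image R p"
proof (rule delta_congruence)
  have car: "f \<in> carrier R" "d \<in> carrier R" "r \<in> carrier R" "e \<in> carrier R"
    using is_delta_closed[OF f] is_delta_closed[OF r] by auto
  show "c \<in> carrier R" using is_delta_closed[OF c] by auto
  show "r [^] p \<otimes> d \<oplus> f [^] p \<otimes> e \<in> carrier R" using car by simp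
  let ?z = "\<lambda>k. sig (r [^] (p ^ Suc k) \<otimes> (f [^] (p * (p ^ k - 1)) \<otimes> d) \<oplus> f [^] (p ^ Suc k) \<otimes> (r [^] (p * (p ^ k - 1)) \<otimes> e))"
  have "eqv 2 (\<Sum>k<2. (V ^^ Suc k) (?z k)) (V (?z 0))" by (rule sum_2_V) auto
  then have "eqv 2 (\<Sum>k<2. (V ^^ Suc k) (?z k)) (V (sig (r [^] p \<otimes> d \<oplus> f [^] p \<otimes> e)))" using car by simp
  then have 1: "eqv 2 (T (zvar f * zvar r)) (sig (f \<otimes> r) + V (sig (r [^] p \<otimes> d \<oplus> f [^] p \<otimes> e)))"
    by (intro eqv_trans[OF teich_mult_expansion[OF f r]] eqv_add eqv_refl) auto
  have 2: "eqv 2 (T (zvar f * zvar r)) (sig (f \<otimes> r) + V (sig c))"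
    by (rule teich_expansion_2[OF c]) (use car in \<open>simp add: hom_mult eps_zvar\<close>)
  have "eqv 2 (sig (f \<otimes> r) + V (sig c) - sig (f \<otimes> r)) (sig (f \<otimes> r) + V (sig (r [^] p \<otimes> d \<oplus> f [^] p \<otimes> e)) - sig (f \<otimes> r))"
    by (intro eqv_diff eqv_trans[OF eqv_sym[OF 2] 1] eqv_refl) auto
  then show "eqv 2 (V (sig c)) (V (sig (r [^] p \<otimes> d \<oplus> f [^] p \<otimes> e)))" by simp
qed

lemma exists_p_decomposition:
  assumes "a \<in> carrier R" shows "\<exists>as. p_decomposition R p N x a as"
proof -
  obtain es where es: "set es = E" "distinct es" using finite_distinct_list[OF finite_E] by blast
  let ?g = "\<lambda>e. crd a e [^] p \<otimes> xm e"
  have g: "?g e \<in> p_monomials R p N x" if "e \<in> E" for e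
    using that crd_closed[OF assms] by (auto simp: p_monomials_def)
  have gc: "?g e \<in> carrier R" if "e \<in> E" for e using that crd_closed[OF assms] by auto
  have bij: "bij_betw ((!) es) {..<length es} E" using bij_betw_nth[OF es(2)] es(1) by blast
  have "a = (\<Oplus>e\<in>E. ?g e)" by (rule crd_expand[OF assms])
  also have "\<dots> = (\<Oplus>i\<in>{..<length es}. ?g (es ! i))"
    using add.finprod_reindex[of ?g "(!) es" "{..<length es}"] bij gc
    by (auto simp: bij_betw_def Pi_def)
  also have "\<dots> = (\<Oplus>i\<in>{..<length (map ?g es)}. map ?g es ! i)"
    by (rule add.finprod_cong') (use es(1) gc nth_mem[of _ es] in auto)
  finally have "p_decomposition R p N x a (map ?g es)"
    unfolding p_decomposition_def using g es by auto
  then show ?thesis by blast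
qed

lemma exists_delta:
  assumes "a \<in> carrier R" obtains d where "is_delta a d"
proof -
  obtain as where "p_decomposition R p N x a as" using exists_p_decomposition[OF assms] by blast
  then have "is_delta a (\<zero> [^] p \<oplus> delta_sum R p as)" unfolding is_delta_def by blast
  then show ?thesis using that by blast
qed

lemma frob_image_add: "z \<in> frob_image R p \<Longrightarrow> z' \<in> frob_image R p \<Longrightarrow> z \<oplus> z' \<in> frob_image R p"
proof -
  assume "z \<in> frob_image R p" "z' \<in> frob_image R p"
  then obtain b b' where "z = b [^] p" "z' = b' [^] p" "b \<in> carrier R" "b' \<in> carrier R" by (auto simp: frob_image_def)
  then have "z \<oplus> z' = (b \<oplus> b') [^] p" by (simp add: freshman[OF prime_p char_p])
  then show ?thesis using \<open>b \<in> carrier R\<close> \<open>b' \<in> carrier R\<close> unfolding frob_image_def by blast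
qed

lemma frob_image_mult: "z \<in> frob_image R p \<Longrightarrow> r \<in> carrier R \<Longrightarrow> r [^] p \<otimes> z \<in> frob_image R p"
proof -
  assume "z \<in> frob_image R p" and r: "r \<in> carrier R"
  then obtain b where "z = b [^] p" "b \<in> carrier R" by (auto simp: frob_image_def)
  then have "r [^] p \<otimes> z = (r \<otimes> b) [^] p" using r by (simp add: nat_pow_distrib)
  then show ?thesis using \<open>b \<in> carrier R\<close> r unfolding frob_image_def by blast
qed

lemma u_frob_image:
  assumes "z \<in> frob_image R p" "a \<in> carrier R" "u a = \<zero>"
  shows "u (z \<otimes> a) = \<zero>"
  using assms u_mult by (auto simp: frob_image_def)

text \<open>Induction with the product rule, as for the derivative of a power.\<close>

lemma delta_power:
  assumes f: "is_delta f d"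
  shows "is_delta (f [^] Suc k) c \<Longrightarrow> c \<ominus> add_pow R (Suc k) (f [^] (p * k) \<otimes> d) \<in> frob_image R p"
proof (induction k arbitrary: c)
  have car: "f \<in> carrier R" "d \<in> carrier R" using is_delta_closed[OF f] by auto
  {
    case 0
    have "eqv 2 (V (sig c)) (V (sig d))"
    proof -
      have "eqv 2 (sig f + V (sig c) - sig f) (sig f + V (sig d) - sig f)"
      proof (intro eqv_diff eqv_refl dwork_sig)
        have "eqv 2 (T (zvar f)) (sig f + V (sig d))" "eqv 2 (T (zvar f)) (sig f + V (sig c))"
          using teich_expansion_2[OF f, of "zvar f"] teich_expansion_2[of f c "zvar f"] 0 car by (simp_all add: eps_zvar)
        then show "eqv 2 (sig f + V (sig c)) (sig f + V (sig d))" by (rule eqv_trans[OF eqv_sym, rotated])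
      qed
      then show ?thesis by simp
    qed
    moreover have "c \<in> carrier R" using is_delta_closed[OF 0] by auto
    ultimately show ?case using delta_congruence[of c d] car by simp
  next
    case (Suc k)
    obtain e where e: "is_delta (f [^] Suc k) e" using exists_delta[of "f [^] Suc k"] car by auto
    have ec: "e \<in> carrier R" "c \<in> carrier R" using is_delta_closed[OF e] is_delta_closed[OF Suc.prems] by auto
    let ?s = "add_pow R (Suc k) (f [^] (p * k) \<otimes> d)"
    have sc: "?s \<in> carrier R" using car by auto
    have "is_delta (f \<otimes> f [^] Suc k) c" using Suc.prems car by (simp add: m_comm)
    then have 1: "c \<ominus> ((f [^] Suc k) [^] p \<otimes> d \<oplus> f [^] p \<otimes> e) \<in> frob_image R p"
      using delta_mult[OF f e] by simp
    have 2: "f [^] p \<otimes> (e \<ominus> ?s) \<in> frob_image R p" by (rule frob_image_mult[OF Suc.IH[OF e] car(1)])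
    have pe: "(f [^] Suc k) [^] p = f [^] (p * Suc k)" using car by (simp only: nat_pow_pow mult.commute)
    have fs: "f [^] p \<otimes> ?s = add_pow R (Suc k) (f [^] (p * Suc k) \<otimes> d)"
    proof -
      have "f [^] p \<otimes> ?s = add_pow R (Suc k) (f [^] p \<otimes> (f [^] (p * k) \<otimes> d))"
        by (rule add_pow_rdistr) (use car in auto)
      also have "f [^] p \<otimes> (f [^] (p * k) \<otimes> d) = f [^] (p * Suc k) \<otimes> d"
        using car by (simp add: m_assoc[symmetric] nat_pow_mult)
      finally show ?thesis .
    qed
    let ?A = "f [^] (p * Suc k) \<otimes> d"
    have Ac: "?A \<in> carrier R" using car by simp
    have "(c \<ominus> (?A \<oplus> f [^] p \<otimes> e)) \<oplus> f [^] p \<otimes> (e \<ominus> ?s) = c \<ominus> (?A \<oplus> f [^] p \<otimes> ?s)"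
      using ec sc car Ac by (simp add: a_minus_def r_distr r_minus minus_add a_ac r_neg2)
    moreover have "?A \<oplus> f [^] p \<otimes> ?s = add_pow R (Suc (Suc k)) ?A"
      unfolding fs using Ac by (simp add: a_comm)
    ultimately show ?case using frob_image_add[OF 1[unfolded pe] 2] by simp
  }
qed

lemma add_pow_p: "z \<in> carrier R \<Longrightarrow> add_pow R p z = \<zero>"
  using add_pow_ldistr[of \<one> z p] char_p by simp

text \<open>By \<open>delta_power\<close>, \<Delta>_1(f^(p-1)) is (p-1) f^(p(p-2)) \<Delta>_1(f),
  and p-1 is -1 in \<open>R\<close>. The power of f leaves \<open>u\<close> as f^(p-2); the
  ambiguity by p-th powers disappears because u a = 0.\<close>

lemma theta_eq:
  assumes f: "is_delta f d" and a: "a \<in> carrier R" "u a = \<zero>"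
  shows "theta R p N x f a = \<ominus> (f [^] (p - 2) \<otimes> u (d \<otimes> a))"
proof -
  have car: "f \<in> carrier R" "d \<in> carrier R" using is_delta_closed[OF f] by auto
  let ?c = "SOME c. c \<in> Delta1 R p N x (f [^] (p - 1))"
  have mem: "c \<in> Delta1 R p N x b \<longleftrightarrow> (\<exists>r\<in>carrier R. c = r [^] p \<oplus> delta_sum R p (SOME as. p_decomposition R p N x b as))" for c b
    unfolding Delta1_def a_r_coset_def' frob_image_def by auto
  have some: "p_decomposition R p N x b (SOME as. p_decomposition R p N x b as)" if "b \<in> carrier R" for b
    using exists_p_decomposition[OF that] by (rule someI_ex)
  have "?c \<in> Delta1 R p N x (f [^] (p - 1))"
    by (rule someI[of _ "\<zero> [^] p \<oplus> delta_sum R p (SOME as. p_decomposition R p N x (f [^] (p - 1)) as)"]) (use mem in blast)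
  then have c: "is_delta (f [^] (p - 1)) ?c"
    unfolding mem is_delta_def using some[of "f [^] (p - 1)"] car by auto
  have k: "p = Suc (Suc (p - 2))" using p_gt_1 by simp
  define k where "k = p - 2"
  note k = k[folded k_def]
  let ?A = "f [^] (p * k) \<otimes> d"
  have Ac: "?A \<in> carrier R" using car by simp
  have cc: "?c \<in> carrier R" using is_delta_closed[OF c] by auto
  have "?c \<ominus> add_pow R (Suc k) ?A \<in> frob_image R p"
    using delta_power[OF f, of k ?c] c unfolding k by simp
  moreover have neg: "add_pow R (Suc k) ?A = \<ominus> ?A"
  proof -
    have "add_pow R (Suc k) ?A \<oplus> ?A = add_pow R p ?A" using k by (metis add.nat_pow_Suc)
    then have "add_pow R (Suc k) ?A \<oplus> ?A = \<zero>" using add_pow_p[OF Ac] by simp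
    then show ?thesis using minus_equality[of "add_pow R (Suc k) ?A" ?A] Ac by simp
  qed
  ultimately have fi: "?c \<oplus> ?A \<in> frob_image R p" using cc Ac by (simp add: a_minus_def)
  have "u (?c \<otimes> a) \<oplus> u (?A \<otimes> a) = u ((?c \<oplus> ?A) \<otimes> a)" using cc Ac a by (simp add: l_distr u_add)
  also have "\<dots> = \<zero>" by (rule u_frob_image[OF fi a])
  finally have "u (?c \<otimes> a) = \<ominus> u (?A \<otimes> a)" using minus_equality[of "u (?c \<otimes> a)" "u (?A \<otimes> a)"] cc Ac a by simp
  also have "?A \<otimes> a = (f [^] k) [^] p \<otimes> (d \<otimes> a)" using car a by (simp add: nat_pow_pow mult.commute m_assoc)
  also have "u \<dots> = f [^] k \<otimes> u (d \<otimes> a)" by (rule u_mult) (use car a in auto)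
  finally show ?thesis unfolding theta_def using k by simp
qed

text \<open>With f = h g, the product rule splits \<Delta>_1(f) into g^p d and h^p e. The first part
  contributes exactly -f^(p-1) u(a d) to \<theta>(a) h, and the second carries the factor f^(p-2) h
  h = h^p g^(p-2). This relates the one map \<theta> of the product to each f_i separately.\<close>

lemma theta_factor:
  assumes fi: "is_delta h d" and g: "g \<in> carrier R" and f: "f = h \<otimes> g" and a: "a \<in> carrier R" "u a = \<zero>"
  shows "\<exists>s\<in>carrier R. theta R p N x f a \<otimes> h \<oplus> f [^] (p - 1) \<otimes> u (a \<otimes> d) = h [^] p \<otimes> s"
proof -
  have car: "h \<in> carrier R" "d \<in> carrier R" using is_delta_closed[OF fi] by auto
  obtain e where e: "is_delta g e" using exists_delta[OF g] by blast
  have fc: "f \<in> carrier R" using f car g by simp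
  obtain c where c: "is_delta f c" using exists_delta[OF fc] by blast
  have ec: "e \<in> carrier R" "c \<in> carrier R" using is_delta_closed[OF e] is_delta_closed[OF c] by auto
  have k: "p = Suc (Suc (p - 2))" using p_gt_1 by simp
  define k where "k = p - 2"
  note k = k[folded k_def]
  let ?D = "g [^] p \<otimes> d \<oplus> h [^] p \<otimes> e"
  have Dc: "?D \<in> carrier R" using car g ec by simp
  have "c \<ominus> ?D \<in> frob_image R p" using delta_mult[OF fi e] c f by simp
  then have "u ((c \<ominus> ?D) \<otimes> a) = \<zero>" using a by (rule u_frob_image)
  moreover have "c \<otimes> a = (c \<ominus> ?D) \<otimes> a \<oplus> ?D \<otimes> a" using ec Dc a by (simp add: a_minus_def l_distr[symmetric] a_assoc l_neg)
  ultimately have "u (c \<otimes> a) = u (?D \<otimes> a)" using ec Dc a by (simp add: u_add)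
  also have "?D \<otimes> a = g [^] p \<otimes> (d \<otimes> a) \<oplus> h [^] p \<otimes> (e \<otimes> a)" using car g ec a by (simp add: l_distr m_assoc)
  also have "u \<dots> = g \<otimes> u (d \<otimes> a) \<oplus> h \<otimes> u (e \<otimes> a)" using car g ec a by (simp add: u_add u_mult)
  finally have uc: "u (c \<otimes> a) = g \<otimes> u (d \<otimes> a) \<oplus> h \<otimes> u (e \<otimes> a)" .
  let ?U = "u (d \<otimes> a)" and ?W = "u (e \<otimes> a)"
  have UW: "?U \<in> carrier R" "?W \<in> carrier R" using car ec a by auto
  have th: "theta R p N x f a = \<ominus> (f [^] k \<otimes> (g \<otimes> ?U \<oplus> h \<otimes> ?W))"
    using theta_eq[OF c a] uc k by simp
  have fk: "f [^] Suc k = f [^] k \<otimes> (h \<otimes> g)" using f by simp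
  have fk': "f [^] k = h [^] k \<otimes> g [^] k" using f car g by (simp add: nat_pow_distrib)
  have fkc: "f [^] k \<in> carrier R" using fc by simp
  have "theta R p N x f a \<otimes> h \<oplus> f [^] (p - 1) \<otimes> u (a \<otimes> d) = \<ominus> (f [^] k \<otimes> (h \<otimes> (h \<otimes> ?W)))"
  proof -
    have "theta R p N x f a \<otimes> h = \<ominus> (f [^] k \<otimes> (h \<otimes> g) \<otimes> ?U) \<oplus> \<ominus> (f [^] k \<otimes> (h \<otimes> (h \<otimes> ?W)))"
      unfolding th using car g UW fkc by (simp add: l_minus r_minus r_distr minus_add m_ac)
    moreover have "f [^] (p - 1) \<otimes> u (a \<otimes> d) = f [^] k \<otimes> (h \<otimes> g) \<otimes> ?U"
      using k fk a car by (simp add: m_comm[of a])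
    moreover have "(\<ominus> X \<oplus> \<ominus> Y) \<oplus> X = \<ominus> Y" if "X \<in> carrier R" "Y \<in> carrier R" for X Y
    proof -
      have "(\<ominus> X \<oplus> \<ominus> Y) \<oplus> X = \<ominus> Y \<oplus> (\<ominus> X \<oplus> X)" using that by (simp only: a_comm[of "\<ominus> X"] a_assoc a_inv_closed)
      then show ?thesis using that by (simp add: l_neg)
    qed
    ultimately show ?thesis using car g UW fkc by simp
  qed
  also have "\<dots> = h [^] p \<otimes> (\<ominus> (g [^] k \<otimes> ?W))"
    unfolding fk' using k car g UW by (simp add: r_minus m_ac)
  finally show ?thesis using g UW by (intro bexI[of _ "\<ominus> (g [^] k \<otimes> ?W)"]) auto
qed

end

section \<open>The criterion\<close>

locale fedder = p_basis_witt R p N x \<epsilon>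
  for R :: "('a, 'c) ring_scheme" (structure) and p N :: nat and x :: "nat \<Rightarrow> 'a" and \<epsilon> :: "'a zpoly \<Rightarrow> 'a" +
  fixes f :: "nat \<Rightarrow> 'a" and m :: nat and df :: "nat \<Rightarrow> 'a"
  assumes wr: "weak_regular f m" and df: "i < m \<Longrightarrow> is_delta (f i) (df i)"
begin

abbreviation "L q \<equiv> pow_ideal R f (\<lambda>_. q) m"
abbreviation "ff \<equiv> fprod f m"
definition FI :: "nat \<Rightarrow> 'a set" where "FI = fedder_ideal R p N x ff (L 1)"
abbreviation "\<theta> \<equiv> theta R p N x ff"

lemma car: "i < m \<Longrightarrow> f i \<in> carrier R" using weak_regular_car[OF wr] .

lemma L_ideal: "ideal (L q) R" by (rule pow_ideal_ideal) (use car in auto)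

lemma L_closed: "a \<in> L q \<Longrightarrow> a \<in> carrier R" using pow_ideal_sub[of m f a] car by blast

lemma ff_closed [simp, intro]: "ff \<in> carrier R" by (rule fprod_closed) (use car in auto)

lemma f_pow_L: "i < m \<Longrightarrow> q \<le> k \<Longrightarrow> f i [^] k \<in> L q"
proof -
  assume i: "i < m" and k: "q \<le> k"
  interpret J: ideal "L q" R by (rule L_ideal)
  have "f i [^] k = f i [^] q \<otimes> f i [^] (k - q)" using car[OF i] k by (simp add: nat_pow_mult)
  then show ?thesis using pow_ideal_gen[of m f i "\<lambda>_. q"] car i J.I_r_closed by simp
qed

lemma ff_mult_L: "a \<in> L q \<Longrightarrow> ff [^] c \<otimes> a \<in> L (q + c)"
proof -
  assume a: "a \<in> L q"
  have "ff [^] c \<otimes> a \<in> pow_ideal R f (\<lambda>i. if i < m then q + c else q) m"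
    by (rule fprod_mult_pow_ideal) (use car a in auto)
  also have "pow_ideal R f (\<lambda>i. if i < m then q + c else q) m = L (q + c)" by (rule pow_ideal_cong) auto
  finally show ?thesis .
qed

lemma frob_power_L: "frob_power p R (L q) = L (p * q)"
  by (rule frob_power_pow_ideal) (use car in auto)

lemma u_L: "a \<in> L (p * q) \<Longrightarrow> u a \<in> L q"
  using u_frob_power[OF L_ideal] by (simp add: frob_power_L[symmetric])

lemma u_iter_L: "a \<in> L (p ^ k) \<Longrightarrow> (u ^^ k) a \<in> L 1"
  using u_iter_pow_ideal[of m f a k] car L_closed by (auto dest: bspec[of _ _ \<one>])

section \<open>The ideals I_s and their chains\<close>

lemma FI_1: "FI (Suc 0) = {a \<in> carrier R. \<forall>b\<in>L 1. a \<otimes> b \<in> L p}"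
  by (simp add: FI_def fedder_ideal_def ideal_colon_def frob_power_L)

lemma FI_1_iff: "a \<in> FI (Suc 0) \<longleftrightarrow> a \<in> carrier R \<and> (\<forall>i<m. f i \<otimes> a \<in> L p)"
proof
  assume a: "a \<in> FI (Suc 0)"
  have "f i \<in> L 1" if "i < m" for i using f_pow_L[OF that, of 1 1] car[OF that] by simp
  then show "a \<in> carrier R \<and> (\<forall>i<m. f i \<otimes> a \<in> L p)" using a car by (auto simp: FI_1 m_comm)
next
  assume a: "a \<in> carrier R \<and> (\<forall>i<m. f i \<otimes> a \<in> L p)"
  have "L 1 \<subseteq> {b \<in> carrier R. a \<otimes> b \<in> L p}"
    by (rule pow_ideal_least[OF ideal_mult_preimage[OF L_ideal]]) (use a car in \<open>auto simp: m_comm\<close>)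
  then show "a \<in> FI (Suc 0)" using a by (auto simp: FI_1)
qed

lemma FI_Suc: "FI (Suc (Suc k)) = \<theta> ` (FI (Suc k) \<inter> v_perp R p N x) <+> FI (Suc 0)"
  by (simp add: FI_def fedder_ideal_def Let_def)

lemma v_perp_iff: "a \<in> v_perp R p N x \<longleftrightarrow> a \<in> carrier R \<and> u a = \<zero>"
  by (simp add: v_perp_def frob_pushforward_def restrict_scalars_def)

lemma theta_props:
  assumes "a \<in> carrier R" "u a = \<zero>"
  shows theta_closed: "\<theta> a \<in> carrier R"
    and theta_add: "b \<in> carrier R \<Longrightarrow> u b = \<zero> \<Longrightarrow> \<theta> (a \<oplus> b) = \<theta> a \<oplus> \<theta> b"
    and theta_mult: "r \<in> carrier R \<Longrightarrow> \<theta> (r [^] p \<otimes> a) = r \<otimes> \<theta> a"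
proof -
  obtain d where d: "is_delta ff d" by (rule exists_delta[OF ff_closed])
  have dc: "d \<in> carrier R" using is_delta_closed[OF d] by auto
  note t = theta_eq[OF d]
  show "\<theta> a \<in> carrier R" unfolding t[OF assms] using dc assms by simp
  show "\<theta> (a \<oplus> b) = \<theta> a \<oplus> \<theta> b" if b: "b \<in> carrier R" "u b = \<zero>"
  proof -
    have "u (a \<oplus> b) = \<zero>" using assms b by (simp add: u_add)
    then show ?thesis using t[OF assms] t[OF b] t[of "a \<oplus> b"] assms b dc
      by (simp add: r_distr u_add minus_add)
  qed
  show "\<theta> (r [^] p \<otimes> a) = r \<otimes> \<theta> a" if r: "r \<in> carrier R"
  proof -
    have "u (r [^] p \<otimes> a) = \<zero>" using assms r by (simp add: u_mult)
    moreover have "u (d \<otimes> (r [^] p \<otimes> a)) = r \<otimes> u (d \<otimes> a)"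
      using assms r dc u_mult[of "d \<otimes> a" r] by (simp add: m_lcomm)
    ultimately show ?thesis using t[OF assms] t[of "r [^] p \<otimes> a"] assms r dc
      by (simp add: r_minus m_lcomm)
  qed
qed

lemma theta_zero: "\<theta> \<zero> = \<zero>"
  using theta_mult[of \<zero> \<zero>] theta_closed[of \<zero>] u_zero p_pos by (simp add: nat_pow_zero)

lemma FI_1_ideal: "ideal (FI (Suc 0)) R"
proof -
  have "ideal {a \<in> carrier R. \<forall>b\<in>L 1. a \<otimes> b \<in> L p} R"
  proof -
    interpret J: ideal "L p" R by (rule L_ideal)
    show ?thesis
    proof (rule idealI)
      show "subgroup {a \<in> carrier R. \<forall>b\<in>L 1. a \<otimes> b \<in> L p} (add_monoid R)"
      proof
        fix a assume "a \<in> {a \<in> carrier R. \<forall>b\<in>L 1. a \<otimes> b \<in> L p}"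
        then show "inv\<^bsub>add_monoid R\<^esub> a \<in> {a \<in> carrier R. \<forall>b\<in>L 1. a \<otimes> b \<in> L p}"
          using L_closed by (auto simp: a_inv_def[symmetric] l_minus)
      qed (use L_closed in \<open>auto simp: l_distr\<close>)
      fix a r assume a: "a \<in> {a \<in> carrier R. \<forall>b\<in>L 1. a \<otimes> b \<in> L p}" and r: "r \<in> carrier R"
      have "(r \<otimes> a) \<otimes> b = r \<otimes> (a \<otimes> b)" if "b \<in> L 1" for b using a r L_closed[OF that] by (simp add: m_assoc)
      then show "r \<otimes> a \<in> {a \<in> carrier R. \<forall>b\<in>L 1. a \<otimes> b \<in> L p}" using a r J.I_l_closed by simp
      then show "a \<otimes> r \<in> {a \<in> carrier R. \<forall>b\<in>L 1. a \<otimes> b \<in> L p}" using a r by (simp add: m_comm)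
    qed (rule ring_axioms)
  qed
  then show ?thesis by (simp add: FI_1)
qed

text \<open>The image of \<theta> is closed under multiplication because r \<theta>(a) =
  \<theta>(r^p a), and r^p a stays in the ideal I_s and in the kernel of \<open>u\<close>.\<close>

lemma FI_ideal: "ideal (FI (Suc k)) R"
proof (induction k)
  case 0
  show ?case by (rule FI_1_ideal)
next
  case (Suc k)
  interpret J: ideal "FI (Suc k)" R by (rule Suc)
  let ?T = "\<theta> ` (FI (Suc k) \<inter> v_perp R p N x)"
  have "ideal ?T R"
  proof (rule idealI)
    have add: "a \<oplus> b \<in> ?T" if abT: "a \<in> ?T" "b \<in> ?T" for a b
    proof -
      obtain a' b' where ab: "a = \<theta> a'" "b = \<theta> b'" "a' \<in> FI (Suc k)" "b' \<in> FI (Suc k)"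
        "a' \<in> carrier R" "u a' = \<zero>" "b' \<in> carrier R" "u b' = \<zero>" using abT v_perp_iff unfolding image_iff by blast
      have "a \<oplus> b = \<theta> (a' \<oplus> b')" using ab theta_add by simp
      moreover have "a' \<oplus> b' \<in> FI (Suc k) \<inter> v_perp R p N x" using ab J.a_closed by (simp add: v_perp_iff u_add)
      ultimately show ?thesis by blast
    qed
    have mult: "r \<otimes> a \<in> ?T" if aT: "a \<in> ?T" and that: "r \<in> carrier R" for a r
    proof -
      obtain a' where a: "a = \<theta> a'" "a' \<in> FI (Suc k)" "a' \<in> carrier R" "u a' = \<zero>" using aT v_perp_iff unfolding image_iff by blast
      have "r \<otimes> a = \<theta> (r [^] p \<otimes> a')" using a that theta_mult by simp
      moreover have "r [^] p \<otimes> a' \<in> FI (Suc k) \<inter> v_perp R p N x" using a that J.I_l_closed by (simp add: v_perp_iff u_mult)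
      ultimately show ?thesis by blast
    qed
    have sub: "?T \<subseteq> carrier R" using theta_closed by (auto simp: v_perp_iff)
    show "subgroup ?T (add_monoid R)"
    proof
      fix a assume a: "a \<in> ?T"
      have "\<ominus> a = (\<ominus> \<one>) \<otimes> a" using a sub by (auto simp: l_minus)
      then show "inv\<^bsub>add_monoid R\<^esub> a \<in> ?T" using mult[OF a, of "\<ominus> \<one>"] by (simp add: a_inv_def[symmetric])
    next
      have "\<zero> \<in> FI (Suc k) \<inter> v_perp R p N x" by (simp add: v_perp_iff u_zero)
      then show "\<one>\<^bsub>add_monoid R\<^esub> \<in> ?T" using theta_zero by (auto intro!: image_eqI[of _ _ \<zero>])
    qed (use add sub in auto)
    fix a r assume "a \<in> ?T" "r \<in> carrier R"
    then show "r \<otimes> a \<in> ?T" "a \<otimes> r \<in> ?T" using mult[of a r] sub m_comm[of a r] by auto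
  qed (rule ring_axioms)
  then show ?case unfolding FI_Suc by (intro add_ideals FI_1_ideal)
qed

lemma FI_closed: "a \<in> FI (Suc k) \<Longrightarrow> a \<in> carrier R"
  using ideal.Icarr[OF FI_ideal] .

lemma FI_1_sub: "FI (Suc 0) \<subseteq> FI (Suc k)"
proof (cases k)
  case (Suc j)
  have z: "\<zero> \<in> FI (Suc j)" using FI_ideal[of j] additive_subgroup.zero_closed ideal.axioms(1) by blast
  have "a \<in> FI (Suc (Suc j))" if a: "a \<in> FI (Suc 0)" for a
  proof -
    have "\<theta> \<zero> \<in> \<theta> ` (FI (Suc j) \<inter> v_perp R p N x)" using z by (auto simp: v_perp_iff u_zero)
    moreover have "a = \<theta> \<zero> \<oplus> a" using FI_closed[OF a] theta_zero by simp
    ultimately show ?thesis unfolding FI_Suc set_add_def' using a by blast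
  qed
  then show ?thesis using Suc by auto
qed simp

text \<open>Used for corrections: changing an element by p-th powers of the ideal does not move it
  out of any I_s.\<close>

lemma L_p_FI: "a \<in> L p \<Longrightarrow> a \<in> FI (Suc k)"
proof -
  assume a: "a \<in> L p"
  interpret J: ideal "L p" R by (rule L_ideal)
  have "a \<in> FI (Suc 0)" unfolding FI_1_iff using a L_closed[OF a] car J.I_l_closed by simp
  then show ?thesis using FI_1_sub by blast
qed

lemma FI_Suc_mem:
  "a \<in> FI (Suc (Suc k)) \<longleftrightarrow> (\<exists>a'\<in>FI (Suc k). \<exists>b\<in>FI (Suc 0). u a' = \<zero> \<and> a = \<theta> a' \<oplus> b)"
proof
  assume "a \<in> FI (Suc (Suc k))"
  then obtain t b where "t \<in> \<theta> ` (FI (Suc k) \<inter> v_perp R p N x)" "b \<in> FI (Suc 0)" "a = t \<oplus> b"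
    unfolding FI_Suc set_add_def' by blast
  then show "\<exists>a'\<in>FI (Suc k). \<exists>b\<in>FI (Suc 0). u a' = \<zero> \<and> a = \<theta> a' \<oplus> b" using v_perp_iff by blast
next
  assume "\<exists>a'\<in>FI (Suc k). \<exists>b\<in>FI (Suc 0). u a' = \<zero> \<and> a = \<theta> a' \<oplus> b"
  then show "a \<in> FI (Suc (Suc k))" unfolding FI_Suc set_add_def' using v_perp_iff FI_closed by blast
qed

text \<open>An element of I_(n+1) is unwound into the elements that produce it; the relevant part of
  the sequence has n+1 entries and ends in I_1.\<close>

lemma FI_chain:
  assumes "c \<in> FI (Suc n)"
  shows "\<exists>a. a 0 = c \<and> (\<forall>j\<le>n. a j \<in> carrier R) \<and> (\<forall>j. 0 < j \<and> j \<le> n \<longrightarrow> u (a j) = \<zero>) \<and>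
     (\<forall>j<n. \<exists>b\<in>FI (Suc 0). a j = \<theta> (a (Suc j)) \<oplus> b) \<and> a n \<in> FI (Suc 0)"
  using assms
proof (induction n arbitrary: c)
  case 0 then show ?case using FI_closed by (intro exI[of _ "\<lambda>_. c"]) auto
next
  case (Suc n)
  then obtain c' b where c': "c' \<in> FI (Suc n)" "b \<in> FI (Suc 0)" "u c' = \<zero>" "c = \<theta> c' \<oplus> b"
    unfolding FI_Suc_mem by blast
  obtain a where a: "a 0 = c'" "\<forall>j\<le>n. a j \<in> carrier R" "\<forall>j. 0 < j \<and> j \<le> n \<longrightarrow> u (a j) = \<zero>"
     "\<forall>j<n. \<exists>b\<in>FI (Suc 0). a j = \<theta> (a (Suc j)) \<oplus> b" "a n \<in> FI (Suc 0)" using Suc.IH[OF c'(1)] by blast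
  let ?a = "case_nat c a"
  have "\<forall>j\<le>Suc n. ?a j \<in> carrier R" using a(2) FI_closed[OF Suc.prems] by (auto split: nat.split)
  moreover have "\<forall>j. 0 < j \<and> j \<le> Suc n \<longrightarrow> u (?a j) = \<zero>"
  proof (intro allI impI)
    fix j assume j: "0 < j \<and> j \<le> Suc n"
    then obtain i where i: "j = Suc i" "i \<le> n" by (cases j) auto
    have "u (a i) = \<zero>" using a(1,3) c'(3) i(2) by (cases i) auto
    then show "u (?a j) = \<zero>" by (simp add: i)
  qed
  moreover have "\<forall>j<Suc n. \<exists>b\<in>FI (Suc 0). ?a j = \<theta> (?a (Suc j)) \<oplus> b"
    using a(1,4) c' by (auto split: nat.split)
  ultimately show ?case using a(5) by (intro exI[of _ ?a]) auto
qed

text \<open>\<open>Y i r e l\<close> is the coordinate of the Teichmueller element of \<open>f\<^sub>i r\<close> in degree \<open>l\<close>, for \<open>e\<close> in \<open>\<Delta>\<^sub>1(r)\<close>.\<close>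

definition Y :: "nat \<Rightarrow> 'a \<Rightarrow> 'a \<Rightarrow> nat \<Rightarrow> 'a" where
  "Y i r e l = (case l of 0 \<Rightarrow> f i \<otimes> r | Suc k \<Rightarrow>
     r [^] (p ^ Suc k) \<otimes> (f i [^] (p * (p ^ k - 1)) \<otimes> df i) \<oplus> f i [^] (p ^ Suc k) \<otimes> (r [^] (p * (p ^ k - 1)) \<otimes> e))"

lemma df_closed: "i < m \<Longrightarrow> df i \<in> carrier R" using is_delta_closed[OF df] by blast

lemma Y_closed: "i < m \<Longrightarrow> r \<in> carrier R \<Longrightarrow> e \<in> carrier R \<Longrightarrow> Y i r e l \<in> carrier R"
  using car df_closed by (auto simp: Y_def split: nat.split)

text \<open>The functional with coefficients \<open>h\<close> maps \<open>V\<^sup>k [f\<^sub>i r]\<close> into the ideal.\<close>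

definition coeff_cond :: "nat \<Rightarrow> (nat \<Rightarrow> 'a) \<Rightarrow> nat \<Rightarrow> bool" where
  "coeff_cond n h k \<longleftrightarrow> (\<forall>i<m. \<forall>r e. is_delta r e \<longrightarrow>
     (\<Oplus>l\<in>{..<n - k}. (u ^^ Suc (k + l)) (h (k + l) \<otimes> Y i r e l)) \<in> L 1)"

lemma L_add_iff: "a \<in> carrier R \<Longrightarrow> b \<in> L q \<Longrightarrow> a \<oplus> b \<in> L q \<longleftrightarrow> a \<in> L q"
proof -
  assume a: "a \<in> carrier R" and b: "b \<in> L q"
  interpret J: ideal "L q" R by (rule L_ideal)
  show ?thesis using sub_mem_ideal[OF L_ideal _ b a] b J.a_closed by blast
qed

lemma L_mult_right: "a \<in> L q \<Longrightarrow> b \<in> carrier R \<Longrightarrow> a \<otimes> b \<in> L q"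
  using ideal.I_r_closed[OF L_ideal] by blast

text \<open>u^k sends the p^k-th Frobenius power of the ideal into the ideal, so a coefficient
  counts only modulo that power.\<close>

lemma u_iter_diff_L:
  assumes "h \<in> carrier R" "h' \<in> carrier R" "h \<ominus> h' \<in> L (p ^ k)" "y \<in> carrier R"
  shows "\<exists>z\<in>L 1. (u ^^ k) (h \<otimes> y) = (u ^^ k) (h' \<otimes> y) \<oplus> z"
proof -
  have "h \<otimes> y = h' \<otimes> y \<oplus> (h \<ominus> h') \<otimes> y"
  proof -
    have "h = h' \<oplus> (h \<ominus> h')" using assms by (simp add: a_minus_def a_lcomm r_neg)
    then show ?thesis using assms l_distr[of h' "h \<ominus> h'" y] by simp
  qed
  moreover have "(h \<ominus> h') \<otimes> y \<in> L (p ^ k)" by (rule L_mult_right) fact+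
  ultimately show ?thesis using assms u_iter_add u_iter_L L_closed
    by (intro bexI[of _ "(u ^^ k) ((h \<ominus> h') \<otimes> y)"]) auto
qed

text \<open>Hence the terms with \<open>l \<ge> 2\<close> in the coefficient condition vanish modulo the ideal.\<close>

lemma high_terms:
  assumes i: "i < m" and r: "r \<in> carrier R" and e: "e \<in> carrier R" and a: "a \<in> carrier R" and j: "l \<le> j"
  shows "2 \<le> l \<Longrightarrow> ff [^] (p ^ Suc j - p) \<otimes> a \<otimes> Y i r e l \<in> L (p ^ Suc j)"
    and "ff [^] (p ^ Suc j - p) \<otimes> a \<otimes> (f i [^] p \<otimes> r) \<in> L (p ^ Suc j)"
proof -
  have pj: "p \<le> p ^ Suc j" using p_pos by simp
  have key: "ff [^] (p ^ Suc j - p) \<otimes> a \<otimes> (f i [^] k \<otimes> y) \<in> L (p ^ Suc j)" if "p \<le> k" "y \<in> carrier R" for k y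
  proof -
    have "ff [^] (p ^ Suc j - p) \<otimes> f i [^] k \<in> L (p + (p ^ Suc j - p))" by (rule ff_mult_L[OF f_pow_L[OF i that(1)]])
    then have "ff [^] (p ^ Suc j - p) \<otimes> f i [^] k \<otimes> (a \<otimes> y) \<in> L (p + (p ^ Suc j - p))" by (rule L_mult_right) (use a that in auto)
    moreover have "ff [^] (p ^ Suc j - p) \<otimes> f i [^] k \<otimes> (a \<otimes> y) = ff [^] (p ^ Suc j - p) \<otimes> a \<otimes> (f i [^] k \<otimes> y)"
      using a that car[OF i] by (simp add: m_ac)
    ultimately show ?thesis using pj by simp
  qed
  then show "ff [^] (p ^ Suc j - p) \<otimes> a \<otimes> (f i [^] p \<otimes> r) \<in> L (p ^ Suc j)" using r by simp
  assume l: "2 \<le> l"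
  define k where "k = l - 2"
  have k: "l = Suc (Suc k)" using l by (simp add: k_def)
  have p1: "p ^ Suc k - 1 \<ge> 1" using one_less_power[OF p_gt_1, of "Suc k"] by (simp add: Suc_le_eq)
  have e1: "p \<le> p * (p ^ Suc k - 1)" using p1 by simp
  have e2: "p \<le> p ^ Suc (Suc k)" using p_pos by simp
  have Y: "Y i r e l = f i [^] (p * (p ^ Suc k - 1)) \<otimes> (r [^] (p ^ Suc (Suc k)) \<otimes> df i) \<oplus> f i [^] (p ^ Suc (Suc k)) \<otimes> (r [^] (p * (p ^ Suc k - 1)) \<otimes> e)"
    unfolding k Y_def using r car[OF i] df_closed[OF i] by (simp add: m_lcomm)
  interpret J: ideal "L (p ^ Suc j)" R by (rule L_ideal)
  have y: "r [^] (p ^ Suc (Suc k)) \<otimes> df i \<in> carrier R" "r [^] (p * (p ^ Suc k - 1)) \<otimes> e \<in> carrier R" using r e df_closed[OF i] by auto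
  show "ff [^] (p ^ Suc j - p) \<otimes> a \<otimes> Y i r e l \<in> L (p ^ Suc j)"
    unfolding Y using J.a_closed[OF key[OF e1 y(1)] key[OF e2 y(2)]] a y car[OF i] by (simp only: r_distr m_closed nat_pow_closed ff_closed)
qed

lemma Y_0: "Y i r e 0 = f i \<otimes> r" by (simp add: Y_def)

lemma Y_1: "i < m \<Longrightarrow> r \<in> carrier R \<Longrightarrow> e \<in> carrier R \<Longrightarrow> Y i r e (Suc 0) = r [^] p \<otimes> df i \<oplus> f i [^] p \<otimes> e"
  using df_closed by (simp add: Y_def)

lemma approx_Y:
  assumes i: "i < m" and r: "r \<in> carrier R" "e \<in> carrier R" and a: "a \<in> carrier R" and h: "h \<in> carrier R"
    and ha: "h \<ominus> ff [^] (p ^ Suc j - p) \<otimes> a \<in> L (p ^ Suc j)"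
  shows "\<exists>z\<in>L 1. (u ^^ Suc j) (h \<otimes> Y i r e l) = (u ^^ Suc j) (ff [^] (p ^ Suc j - p) \<otimes> a \<otimes> Y i r e l) \<oplus> z"
  by (rule u_iter_diff_L[OF h _ ha]) (use a Y_closed i r in auto)

lemma high_term_L:
  assumes i: "i < m" and r: "r \<in> carrier R" "e \<in> carrier R" and a: "a \<in> carrier R" and h: "h \<in> carrier R"
    and ha: "h \<ominus> ff [^] (p ^ Suc j - p) \<otimes> a \<in> L (p ^ Suc j)" and l: "2 \<le> l" "l \<le> j"
  shows "(u ^^ Suc j) (h \<otimes> Y i r e l) \<in> L 1"
proof -
  interpret J: ideal "L 1" R by (rule L_ideal)
  have "(u ^^ Suc j) (ff [^] (p ^ Suc j - p) \<otimes> a \<otimes> Y i r e l) \<in> L 1"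
    by (rule u_iter_L, rule high_terms(1)) (use i r a l in auto)
  then show ?thesis using approx_Y[OF i r a h ha, of l] J.a_closed by auto
qed

text \<open>In degree 1 the coordinate of [f_i r] is r^p \<Delta>_1(f_i) plus a multiple of f_i^p,
  and the multiple vanishes by \<open>high_terms\<close>. With q = p^(k+1), one application of
  \<open>u\<close> turns the rest into ff^(q-1) r u(a df_i). By \<open>theta_factor\<close>,
  multiplied with ff^(q-p), this cancels r f_i ff^(q-p) \<theta>(a) up to a multiple of ff^(q-p)
  f_i^p, which lies in the ideal of q-th powers.\<close>

lemma linear_term:
  assumes i: "i < m" and r: "r \<in> carrier R" "e \<in> carrier R" and a: "a \<in> carrier R" "u a = \<zero>" and h: "h \<in> carrier R"
    and ha: "h \<ominus> ff [^] (p ^ Suc (Suc k) - p) \<otimes> a \<in> L (p ^ Suc (Suc k))"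
  shows "(u ^^ Suc k) (r \<otimes> (f i \<otimes> (ff [^] (p ^ Suc k - p) \<otimes> \<theta> a))) \<oplus> (u ^^ Suc (Suc k)) (h \<otimes> Y i r e (Suc 0)) \<in> L 1"
proof -
  let ?q = "p ^ Suc k"
  interpret J: ideal "L 1" R by (rule L_ideal)
  interpret Jq: ideal "L ?q" R by (rule L_ideal)
  have fi: "f i \<in> carrier R" and di: "df i \<in> carrier R" using car[OF i] df_closed[OF i] by auto
  have tc: "\<theta> a \<in> carrier R" by (rule theta_closed[OF a])
  let ?w = "u (a \<otimes> df i)"
  have wc: "?w \<in> carrier R" using a di by simp
  have pq: "p \<le> ?q" using p_pos by simp
  obtain z where z: "z \<in> L 1" "(u ^^ Suc (Suc k)) (h \<otimes> Y i r e (Suc 0)) =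
     (u ^^ Suc (Suc k)) (ff [^] (p ^ Suc (Suc k) - p) \<otimes> a \<otimes> Y i r e (Suc 0)) \<oplus> z"
    using approx_Y[OF i r a(1) h ha] by blast
  have exp: "p ^ Suc (Suc k) - p = (?q - 1) * p" by (simp add: diff_mult_distrib2 mult.commute[of _ p])
  have Y: "ff [^] (p ^ Suc (Suc k) - p) \<otimes> a \<otimes> Y i r e (Suc 0) =
     (ff [^] (?q - 1) \<otimes> r) [^] p \<otimes> (a \<otimes> df i) \<oplus> ff [^] (p ^ Suc (Suc k) - p) \<otimes> a \<otimes> (f i [^] p \<otimes> e)"
  proof -
    have "ff [^] (p ^ Suc (Suc k) - p) \<otimes> a \<otimes> (r [^] p \<otimes> df i) = (ff [^] (?q - 1) \<otimes> r) [^] p \<otimes> (a \<otimes> df i)"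
      unfolding exp using a r fi di by (simp only: nat_pow_distrib nat_pow_pow[symmetric] m_closed nat_pow_closed ff_closed m_ac)
    then show ?thesis using a r fi di by (simp only: Y_1[OF i r] r_distr m_closed nat_pow_closed ff_closed)
  qed
  let ?c = "ff [^] (?q - 1) \<otimes> r \<otimes> ?w"
  have e1: "(u ^^ Suc (Suc k)) ((ff [^] (?q - 1) \<otimes> r) [^] p \<otimes> (a \<otimes> df i)) = (u ^^ Suc k) ?c"
    unfolding funpow_Suc_right[of "Suc k"] comp_def using a r di by (simp only: u_mult m_closed nat_pow_closed ff_closed)
  have e2: "(u ^^ Suc (Suc k)) (ff [^] (p ^ Suc (Suc k) - p) \<otimes> a \<otimes> (f i [^] p \<otimes> e)) \<in> L 1"
    by (rule u_iter_L, rule high_terms(2)[OF i _ _ _ le_refl]) (use i r a in auto)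
  have c1: "(ff [^] (?q - 1) \<otimes> r) [^] p \<otimes> (a \<otimes> df i) \<in> carrier R" "ff [^] (p ^ Suc (Suc k) - p) \<otimes> a \<otimes> (f i [^] p \<otimes> e) \<in> carrier R"
    using a r di fi by auto
  obtain y where y: "y \<in> L 1" "(u ^^ Suc (Suc k)) (h \<otimes> Y i r e (Suc 0)) = (u ^^ Suc k) ?c \<oplus> y"
  proof
    let ?y = "(u ^^ Suc (Suc k)) (ff [^] (p ^ Suc (Suc k) - p) \<otimes> a \<otimes> (f i [^] p \<otimes> e)) \<oplus> z"
    show "?y \<in> L 1" using e2 z(1) by (rule J.a_closed)
    have cc: "(u ^^ Suc k) ?c \<in> carrier R" using wc r by (intro u_iter_closed) simp
    show "(u ^^ Suc (Suc k)) (h \<otimes> Y i r e (Suc 0)) = (u ^^ Suc k) ?c \<oplus> ?y"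
      unfolding z(2) Y u_iter_add[OF c1] e1 by (rule a_assoc[OF cc J.Icarr[OF e2] J.Icarr[OF z(1)]])
  qed
  obtain g where g: "g \<in> carrier R" "ff = f i \<otimes> g" using fprod_split[of m f i] car i by blast
  obtain s where s: "s \<in> carrier R" "\<theta> a \<otimes> f i \<oplus> ff [^] (p - 1) \<otimes> ?w = f i [^] p \<otimes> s"
    using theta_factor[OF df[OF i] g a] by blast
  let ?b = "r \<otimes> (f i \<otimes> (ff [^] (?q - p) \<otimes> \<theta> a))"
  have ff: "ff [^] (?q - 1) = ff [^] (?q - p) \<otimes> ff [^] (p - 1)" using pq p_pos by (simp add: nat_pow_mult)
  have "?b \<oplus> ?c = ff [^] (?q - p) \<otimes> r \<otimes> (\<theta> a \<otimes> f i \<oplus> ff [^] (p - 1) \<otimes> ?w)"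
    unfolding ff using r fi tc wc by (simp only: r_distr m_closed nat_pow_closed ff_closed m_ac)
  also have "\<dots> = (ff [^] (?q - p) \<otimes> f i [^] p) \<otimes> (r \<otimes> s)" unfolding s(2) using r fi s(1) by (simp only: m_closed nat_pow_closed ff_closed m_ac)
  also have "\<dots> \<in> L ?q"
  proof (rule L_mult_right)
    show "ff [^] (?q - p) \<otimes> f i [^] p \<in> L ?q" using ff_mult_L[OF f_pow_L[OF i le_refl], of "?q - p" p] by (simp only: le_add_diff_inverse[OF pq])
  qed (use r s in simp)
  finally have "(u ^^ Suc k) (?b \<oplus> ?c) \<in> L 1" by (rule u_iter_L)
  moreover have bc: "?b \<in> carrier R" "?c \<in> carrier R" using r fi tc wc by auto
  ultimately have "(u ^^ Suc k) ?b \<oplus> (u ^^ Suc k) ?c \<in> L 1" by (simp only: u_iter_add)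
  then have "(u ^^ Suc k) ?b \<oplus> (u ^^ Suc k) ?c \<oplus> y \<in> L 1" using y(1) by (rule J.a_closed)
  then show ?thesis unfolding y(2) using a_assoc[OF u_iter_closed[OF bc(1)] u_iter_closed[OF bc(2)] J.Icarr[OF y(1)], of "Suc k" "Suc k"] by simp
qed

text \<open>The value 0 in the top degree n-1, where no next element exists, lets that degree be
  treated like the others.\<close>

definition theta_next :: "nat \<Rightarrow> (nat \<Rightarrow> 'a) \<Rightarrow> nat \<Rightarrow> 'a" where
  "theta_next n a k = (if Suc k < n then \<theta> (a (Suc k)) else \<zero>)"

text \<open>Modulo the ideal only the terms l = 0 and l = 1 of the condition remain. The first comes
  from h_k f_i r, and the second is expressed by \<theta>(a_(k+1)) through
  \<open>linear_term\<close>. As r varies, having all values of u^(k+1) in the ideal means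
  membership in the ideal of p^(k+1)-st powers.\<close>

lemma coeff_cond_iff:
  assumes k: "k < n" and hc: "\<And>j. k \<le> j \<Longrightarrow> j < n \<Longrightarrow> h j \<in> carrier R"
    and ac: "\<And>j. k < j \<Longrightarrow> j < n \<Longrightarrow> a j \<in> carrier R" and ua: "\<And>j. k < j \<Longrightarrow> j < n \<Longrightarrow> u (a j) = \<zero>"
    and ha: "\<And>j. k < j \<Longrightarrow> j < n \<Longrightarrow> h j \<ominus> ff [^] (p ^ Suc j - p) \<otimes> a j \<in> L (p ^ Suc j)"
  shows "coeff_cond n h k \<longleftrightarrow> (\<forall>i<m. f i \<otimes> (h k \<ominus> ff [^] (p ^ Suc k - p) \<otimes> theta_next n a k) \<in> L (p ^ Suc k))"
proof -
  let ?X = "ff [^] (p ^ Suc k - p) \<otimes> theta_next n a k"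
  interpret J: ideal "L 1" R by (rule L_ideal)
  have tc: "theta_next n a k \<in> carrier R" using theta_closed[OF ac ua] by (simp add: theta_next_def)
  have Xc: "?X \<in> carrier R" using tc by simp
  have hk: "h k \<in> carrier R" using hc[OF le_refl k] .
  have key: "(\<Oplus>l\<in>{..<n - k}. (u ^^ Suc (k + l)) (h (k + l) \<otimes> Y i r e l)) \<in> L 1 \<longleftrightarrow>
      (u ^^ Suc k) (r \<otimes> (f i \<otimes> (h k \<ominus> ?X))) \<in> L 1" if i: "i < m" and r: "r \<in> carrier R" "e \<in> carrier R" for i r e
  proof -
    let ?t = "\<lambda>l. (u ^^ Suc (k + l)) (h (k + l) \<otimes> Y i r e l)"
    have fi: "f i \<in> carrier R" by (rule car[OF i])
    have tcl: "?t l \<in> carrier R" if "l < n - k" for l using that hc[of "k + l"] Y_closed[OF i r] by (intro u_iter_closed) simp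
    let ?A = "(u ^^ Suc k) (r \<otimes> (f i \<otimes> (h k \<ominus> ?X)))" and ?B = "(u ^^ Suc k) (r \<otimes> (f i \<otimes> ?X))"
    have cA: "?A \<in> carrier R" "?B \<in> carrier R" using r fi hk Xc by (intro u_iter_closed; simp)+
    have "h k = (h k \<ominus> ?X) \<oplus> ?X" using hk Xc by (simp add: a_minus_def a_assoc l_neg)
    then have "h k \<otimes> (f i \<otimes> r) = ((h k \<ominus> ?X) \<oplus> ?X) \<otimes> (f i \<otimes> r)" by simp
    also have "\<dots> = r \<otimes> (f i \<otimes> (h k \<ominus> ?X)) \<oplus> r \<otimes> (f i \<otimes> ?X)" using r(1) fi hk Xc
      by (simp only: l_distr m_closed minus_closed m_ac)
    finally have t0: "?t 0 = ?A \<oplus> ?B" using u_iter_add[of "r \<otimes> (f i \<otimes> (h k \<ominus> ?X))" "r \<otimes> (f i \<otimes> ?X)" "Suc k"] r fi hk Xc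
      by (simp only: Y_0 add_0_right m_closed minus_closed)
    have high: "?t l \<in> L 1" if "2 \<le> l" "l < n - k" for l
      by (rule high_term_L[OF i r, of "a (k + l)"]) (use that hc ac ha in auto)
    show ?thesis
    proof (cases "Suc k < n")
      case False
      then have "{..<n - k} = {0}" using k by auto
      then have "(\<Oplus>l\<in>{..<n - k}. ?t l) = ?t 0" using tcl[of 0] k by (simp del: funpow.simps)
      moreover have "?B = \<zero>"
      proof -
        have "?X = \<zero>" using False by (simp add: theta_next_def)
        then have "r \<otimes> (f i \<otimes> ?X) = \<zero>" using r fi by simp
        moreover have "(u ^^ j) \<zero> = \<zero>" for j by (induction j) (auto simp: u_zero)
        ultimately show ?thesis by (simp only:)
      qed
      ultimately show ?thesis unfolding t0 using cA by simp
    next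
      case True
      have "{..<n - k} = {0, Suc 0} \<union> {2..<n - k}" using True by auto
      moreover have "(\<Oplus>l\<in>{0, Suc 0} \<union> {2..<n - k}. ?t l) = (\<Oplus>l\<in>{0, Suc 0}. ?t l) \<oplus> (\<Oplus>l\<in>{2..<n - k}. ?t l)"
        by (rule finsum_Un_disjoint)
          (use tcl tcl[of 0] tcl[of "Suc 0"] True k in \<open>auto simp del: funpow.simps\<close>)
      moreover have "(\<Oplus>l\<in>{0, Suc 0}. ?t l) = ?t 0 \<oplus> ?t (Suc 0)"
        using tcl[of 0] tcl[of "Suc 0"] True by (simp del: funpow.simps)
      ultimately have "(\<Oplus>l\<in>{..<n - k}. ?t l) = ?A \<oplus> ?B \<oplus> ?t (Suc 0) \<oplus> (\<Oplus>l\<in>{2..<n - k}. ?t l)" unfolding t0 by simp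
      also have "\<dots> = ?A \<oplus> ((?B \<oplus> ?t (Suc 0)) \<oplus> (\<Oplus>l\<in>{2..<n - k}. ?t l))"
        using cA tcl[of "Suc 0"] True finsum_closed[of ?t "{2..<n - k}"] tcl by (simp add: a_assoc del: funpow.simps)
      finally have sum: "(\<Oplus>l\<in>{..<n - k}. ?t l) = \<dots>" .
      have "?B \<oplus> ?t (Suc 0) \<in> L 1"
        using linear_term[OF i r ac[OF lessI True] ua[OF lessI True] hc[OF _ True] ha[OF lessI True]] True by (simp add: theta_next_def del: funpow.simps)
      moreover have "(\<Oplus>l\<in>{2..<n - k}. ?t l) \<in> L 1" by (rule finsum_ideal[OF L_ideal]) (use high in auto)
      ultimately have "(?B \<oplus> ?t (Suc 0)) \<oplus> (\<Oplus>l\<in>{2..<n - k}. ?t l) \<in> L 1" by (rule J.a_closed)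
      then show ?thesis unfolding sum by (rule L_add_iff[OF cA(1)])
    qed
  qed
  have "coeff_cond n h k \<longleftrightarrow> (\<forall>i<m. \<forall>r\<in>carrier R. (u ^^ Suc k) (r \<otimes> (f i \<otimes> (h k \<ominus> ?X))) \<in> L 1)"
  proof
    assume c: "coeff_cond n h k"
    show "\<forall>i<m. \<forall>r\<in>carrier R. (u ^^ Suc k) (r \<otimes> (f i \<otimes> (h k \<ominus> ?X))) \<in> L 1"
    proof (intro allI impI ballI)
      fix i r assume i: "i < m" and r: "r \<in> carrier R"
      obtain e where e: "is_delta r e" by (rule exists_delta[OF r])
      have ec: "e \<in> carrier R" using is_delta_closed[OF e] by blast
      show "(u ^^ Suc k) (r \<otimes> (f i \<otimes> (h k \<ominus> ?X))) \<in> L 1"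
        using c i e key[OF i r ec] unfolding coeff_cond_def by blast
    qed
  next
    assume c: "\<forall>i<m. \<forall>r\<in>carrier R. (u ^^ Suc k) (r \<otimes> (f i \<otimes> (h k \<ominus> ?X))) \<in> L 1"
    show "coeff_cond n h k" unfolding coeff_cond_def
    proof (intro allI impI)
      fix i r e assume i: "i < m" and e: "is_delta r e"
      have "r \<in> carrier R" "e \<in> carrier R" using is_delta_closed[OF e] by blast+
      then show "(\<Oplus>l\<in>{..<n - k}. (u ^^ Suc (k + l)) (h (k + l) \<otimes> Y i r e l)) \<in> L 1"
        using c i key by blast
    qed
  qed
  also have "\<dots> \<longleftrightarrow> (\<forall>i<m. f i \<otimes> (h k \<ominus> ?X) \<in> L (p ^ Suc k))"
  proof -
    have "f i \<otimes> (h k \<ominus> ?X) \<in> L (p ^ Suc k) \<longleftrightarrow> (\<forall>r\<in>carrier R. (u ^^ Suc k) (r \<otimes> (f i \<otimes> (h k \<ominus> ?X))) \<in> L 1)" if "i < m" for i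
      by (rule u_iter_pow_ideal) (use car that hk Xc in simp_all)
    then show ?thesis by simp
  qed
  finally show ?thesis .
qed

text \<open>Take h_j = ff^(p^(j+1)-p) a_j exactly; the exponent is a multiple of \<open>p\<close>,
  so u(h_j) vanishes with u(a_j). With q = p^(k+1), the condition in degree k asks that f_i ff^(q-p)
  b lie in the q-th powers, where b in I_1 is the difference of a_k and \<theta>(a_(k+1)). This
  holds because f_i b lies in the p-th powers.\<close>

lemma chain_coeff_cond:
  assumes c: "c \<in> FI (Suc n)"
  shows "\<exists>h. h 0 = c \<and> (\<forall>k\<le>n. h k \<in> carrier R \<and> coeff_cond (Suc n) h k) \<and> (\<forall>k. 0 < k \<and> k \<le> n \<longrightarrow> u (h k) = \<zero>)"
proof -
  obtain a where a: "a 0 = c" "\<And>j. j \<le> n \<Longrightarrow> a j \<in> carrier R" "\<And>j. 0 < j \<Longrightarrow> j \<le> n \<Longrightarrow> u (a j) = \<zero>"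
     "\<And>j. j < n \<Longrightarrow> \<exists>b\<in>FI (Suc 0). a j = \<theta> (a (Suc j)) \<oplus> b" "a n \<in> FI (Suc 0)" using FI_chain[OF c] by blast
  define h where "h j = ff [^] (p ^ Suc j - p) \<otimes> a j" for j
  have hc: "h k \<in> carrier R" if "k \<le> n" for k using a(2)[OF that] by (simp add: h_def)
  have uh: "u (h k) = \<zero>" if "0 < k" "k \<le> n" for k
  proof -
    have "p ^ Suc k - p = (p ^ k - 1) * p" by (simp add: diff_mult_distrib2 mult.commute[of _ p])
    then have "h k = (ff [^] (p ^ k - 1)) [^] p \<otimes> a k" by (simp only: h_def nat_pow_pow ff_closed)
    then show ?thesis using a(2,3) that by (simp add: u_mult)
  qed
  have "coeff_cond (Suc n) h k" if k: "k \<le> n" for k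
  proof -
    have "f i \<otimes> (h k \<ominus> ff [^] (p ^ Suc k - p) \<otimes> theta_next (Suc n) a k) \<in> L (p ^ Suc k)" if i: "i < m" for i
    proof -
      have tc: "theta_next (Suc n) a k \<in> carrier R" using theta_closed a(2,3) by (simp add: theta_next_def)
      obtain b where b: "b \<in> FI (Suc 0)" "a k = theta_next (Suc n) a k \<oplus> b"
      proof (cases "k < n")
        case True
        then show ?thesis using a(4)[OF True] that by (auto simp: theta_next_def)
      next
        case False
        then show ?thesis using a(5) that[of "a n"] k FI_closed[OF a(5)] by (auto simp: theta_next_def)
      qed
      have bc: "b \<in> carrier R" by (rule FI_closed[OF b(1)])
      have "h k \<ominus> ff [^] (p ^ Suc k - p) \<otimes> theta_next (Suc n) a k = ff [^] (p ^ Suc k - p) \<otimes> b"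
      proof -
        have "h k = ff [^] (p ^ Suc k - p) \<otimes> b \<oplus> ff [^] (p ^ Suc k - p) \<otimes> theta_next (Suc n) a k"
          unfolding h_def by (subst b(2)) (use tc bc in \<open>simp add: r_distr a_comm\<close>)
        then show ?thesis using tc bc by (simp add: a_minus_def a_assoc r_neg)
      qed
      moreover have "ff [^] (p ^ Suc k - p) \<otimes> (f i \<otimes> b) \<in> L (p + (p ^ Suc k - p))"
        by (rule ff_mult_L) (use b(1) i in \<open>simp add: FI_1_iff\<close>)
      moreover have "p + (p ^ Suc k - p) = p ^ Suc k" by (rule le_add_diff_inverse) (use p_pos in simp)
      ultimately show ?thesis using car[OF i] bc by (simp add: m_lcomm)
    qed
    moreover have "h j \<ominus> ff [^] (p ^ Suc j - p) \<otimes> a j \<in> L (p ^ Suc j)" if "j < Suc n" for j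
    proof -
      interpret J: ideal "L (p ^ Suc j)" R by (rule L_ideal)
      show ?thesis using hc[of j] that by (simp add: h_def[symmetric] a_minus_def r_neg del: power_Suc)
    qed
    ultimately show ?thesis using coeff_cond_iff[of k "Suc n" h a] k hc a(2,3) by (auto simp del: power_Suc)
  qed
  then show ?thesis using hc uh a(1,2) FI_closed[OF c] by (intro exI[of _ h]) (simp add: h_def)
qed

lemma frob_L: "a \<in> L 1 \<Longrightarrow> a [^] p \<in> L p"
  using frob_power_gen[of "L 1" a] L_closed by (auto simp: frob_power_L)

text \<open>Descending induction on the degree, with q = p^(k+1). The entries above k being chosen,
  \<open>coeff_cond_iff\<close> puts h_k - ff^(q-p) \<theta>(a_(k+1)) into the colon ideal, so it is
  ff^(q-1) z modulo q-th powers. Splitting off ff^(q-p) gives the new entry \<theta>(a_(k+1)) +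
  ff^(p-1) z, whose second summand lies in I_1.\<close>

lemma coeff_cond_chain:
  assumes hc: "\<And>k. k < n \<Longrightarrow> h k \<in> carrier R" and cc: "\<And>k. k < n \<Longrightarrow> coeff_cond n h k"
    and uh: "\<And>k. 0 < k \<Longrightarrow> k < n \<Longrightarrow> u (h k) \<in> L (p ^ k)" and n: "0 < n"
  shows "h 0 \<in> FI n"
proof -
  define Q where "Q j c \<longleftrightarrow> c \<in> FI (n - j) \<and> (0 < j \<longrightarrow> u c = \<zero>) \<and> h j \<ominus> ff [^] (p ^ Suc j - p) \<otimes> c \<in> L (p ^ Suc j)" for j c
  \<comment> \<open>\<open>Q j\<close> describes an acceptable entry in degree j. Choosing all
    entries by one global \<open>SOME\<close> makes those above k available as a single function in
    the induction.\<close>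
  define a where "a j = (SOME c. Q j c)" for j
  have nj: "\<exists>i. n - j = Suc i" if "j < n" for j using that by (intro exI[of _ "n - Suc j"]) simp
  have aQ: "k < n \<Longrightarrow> Q k (a k)" for k
  proof (induction "n - k" arbitrary: k rule: less_induct)
    case less
    have k: "k < n" by fact
    have later: "Q j (a j)" if "k < j" "j < n" for j using less(1)[of j] that k by simp
    have ac: "a j \<in> carrier R" if "k < j" "j < n" for j
      using later[OF that] nj[OF that(2)] FI_closed unfolding Q_def by metis
    let ?q = "p ^ Suc k" and ?t = "theta_next n a k"
    interpret Jq: ideal "L ?q" R by (rule L_ideal)
    have ua: "u (a j) = \<zero>" if "k < j" "j < n" for j using later[OF that] that by (simp add: Q_def)
    have tc: "?t \<in> carrier R" using theta_closed[OF ac ua] by (simp add: theta_next_def)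
    have hk: "h k \<in> carrier R" by (rule hc[OF k])
    have pq: "p \<le> ?q" "2 \<le> ?q" using p_gt_1 one_less_power[OF p_gt_1, of "Suc k"] by simp_all
    have "f i \<otimes> (h k \<ominus> ff [^] (?q - p) \<otimes> ?t) \<in> L ?q" if "i < m" for i
      using cc[OF k] coeff_cond_iff[OF k, of h a] hc ac ua later that unfolding Q_def by blast
    then obtain z l where z: "z \<in> carrier R" "l \<in> L ?q" "h k \<ominus> ff [^] (?q - p) \<otimes> ?t = ff [^] (?q - 1) \<otimes> z \<oplus> l"
      using colon_pow_ideal[OF wr pq(2), of "h k \<ominus> ff [^] (?q - p) \<otimes> ?t"] hk tc by auto
    have lc: "l \<in> carrier R" by (rule L_closed[OF z(2)])
    let ?b = "ff [^] (p - 1) \<otimes> z"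
    have b1: "?b \<in> FI (Suc 0)" unfolding FI_1_iff
    proof (intro conjI allI impI)
      fix i assume i: "i < m"
      have "ff [^] (p - 1) \<otimes> f i \<in> L (1 + (p - 1))" by (rule ff_mult_L) (use f_pow_L[OF i, of 1 1] car[OF i] in simp)
      then have "ff [^] (p - 1) \<otimes> f i \<otimes> z \<in> L p" using L_mult_right[OF _ z(1)] p_pos by simp
      then show "f i \<otimes> ?b \<in> L p" using car[OF i] z(1) by (simp add: m_ac)
    qed (use z in simp)
    define c' where "c' = ?t \<oplus> ?b"
    have c'c: "c' \<in> carrier R" using tc z(1) by (simp add: c'_def)
    have c'F: "c' \<in> FI (n - k)"
    proof (cases "Suc k < n")
      case True
      obtain i where i: "n - Suc k = Suc i" using nj[OF True] by blast
      then have "n - k = Suc (Suc i)" by simp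
      moreover have "a (Suc k) \<in> FI (Suc i)" using later[of "Suc k"] True i by (simp add: Q_def)
      ultimately show ?thesis using b1 ua[of "Suc k"] True unfolding c'_def FI_Suc_mem theta_next_def
        by (auto simp: FI_Suc_mem)
    next
      case False
      then have "n - k = Suc 0" using k by simp
      then show ?thesis using b1 False z(1) by (simp add: c'_def theta_next_def)
    qed
    have hk_eq: "h k = ff [^] (?q - p) \<otimes> c' \<oplus> l"
    proof -
      have "ff [^] (?q - 1) = ff [^] (?q - p) \<otimes> ff [^] (p - 1)" using pq p_pos by (simp add: nat_pow_mult)
      moreover have "h k = (h k \<ominus> ff [^] (?q - p) \<otimes> ?t) \<oplus> ff [^] (?q - p) \<otimes> ?t"
        using hk tc by (simp add: a_minus_def a_assoc l_neg)
      ultimately have "h k = ff [^] (?q - p) \<otimes> ?t \<oplus> (ff [^] (?q - p) \<otimes> ?b \<oplus> l)"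
        unfolding z(3) using z(1) tc lc by (simp only: m_assoc a_ac m_closed ff_closed nat_pow_closed a_closed)
      then show ?thesis using tc z(1) lc by (simp add: c'_def r_distr a_assoc)
    qed
    have "\<exists>c. Q k c"
    proof (cases "k = 0")
      case True
      have "h k \<ominus> ff [^] (?q - p) \<otimes> c' = l" using hk_eq c'c lc by (simp add: a_minus_def a_ac r_neg)
      then have "Q k c'" using c'F z(2) True by (simp add: Q_def)
      then show ?thesis by blast
    next
      case False
      have exp: "?q - p = (p ^ k - 1) * p" by (simp add: diff_mult_distrib2 mult.commute[of _ p])
      have "u (h k) = ff [^] (p ^ k - 1) \<otimes> u c' \<oplus> u l"
        unfolding hk_eq exp nat_pow_pow[OF ff_closed, symmetric] using c'c lc by (simp add: u_add u_mult)
      moreover have "u l \<in> L (p ^ k)" by (rule u_L) (use z(2) in simp)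
      \<comment> \<open>The hypothesis \<open>uh\<close> controls u (h k) only modulo p^k-th powers;
        dividing by ff^(p^k-1) leaves u c' in the ideal itself.\<close>
      ultimately have "ff [^] (p ^ k - 1) \<otimes> u c' \<in> L (p ^ k)"
        using uh[of k] k False L_add_iff[of "ff [^] (p ^ k - 1) \<otimes> u c'" "u l" "p ^ k"] c'c by simp
      then have "u c' \<in> pow_ideal R f (\<lambda>i. if i < m then p ^ k - (p ^ k - 1) else p ^ k) m"
        by (intro colon_fprod[OF wr le_refl]) (use p_pos c'c in \<open>auto simp: Suc_le_eq\<close>)
      also have "\<dots> = L 1" by (rule pow_ideal_cong) (use p_pos in \<open>auto simp: Suc_le_eq\<close>)
      finally have uc: "u c' \<in> L 1" .
      obtain v where v: "v \<in> carrier R" "u v = \<one>" using ex_u_one by blast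
      \<comment> \<open>The chain requires u c = 0 exactly. Since u(y^p v) = y when u v = 1,
        subtracting \<open>?w\<close> corrects c'. As \<open>?w\<close> lies in the p-th powers,
        neither membership in the ideal of the chain nor the congruence for h k is lost.\<close>
      let ?w = "(u c') [^] p \<otimes> v"
      have w: "?w \<in> L p" by (rule L_mult_right[OF frob_L[OF uc] v(1)])
      have wc: "?w \<in> carrier R" using c'c v by simp
      define c where "c = c' \<ominus> ?w"
      obtain i where i: "n - k = Suc i" using nj[OF k] by blast
      interpret FF: ideal "FI (n - k)" R unfolding i by (rule FI_ideal)
      have "?w \<in> FI (n - k)" unfolding i by (rule L_p_FI[OF w])
      then have cF: "c \<in> FI (n - k)" using c'F unfolding c_def a_minus_def by (intro FF.a_closed FF.a_inv_closed)
      have "u c = \<zero>" using c'c v wc by (simp add: c_def a_minus_def u_add u_minus u_mult r_neg)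
      moreover have "h k \<ominus> ff [^] (?q - p) \<otimes> c = l \<oplus> ff [^] (?q - p) \<otimes> ?w"
      proof -
        have "c' = c \<oplus> ?w" using c'c wc by (simp add: c_def a_minus_def a_assoc l_neg)
        moreover have cc: "c \<in> carrier R" using c'c wc by (simp add: c_def)
        moreover have "ff [^] (?q - p) \<otimes> (c \<oplus> w) \<oplus> l = ff [^] (?q - p) \<otimes> c \<oplus> (l \<oplus> ff [^] (?q - p) \<otimes> w)"
          if "w \<in> carrier R" for w
          using that cc lc by (simp only: r_distr ff_closed nat_pow_closed m_closed a_closed a_ac)
        ultimately have "h k = ff [^] (?q - p) \<otimes> c \<oplus> (l \<oplus> ff [^] (?q - p) \<otimes> ?w)"
          using hk_eq wc by metis
        then show ?thesis using cc wc lc by (simp add: a_minus_def a_ac r_neg r_neg2)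
      qed
      moreover have "ff [^] (?q - p) \<otimes> ?w \<in> L ?q" using ff_mult_L[OF w, of "?q - p"] pq by simp
      ultimately have "Q k c" using cF Jq.a_closed[OF z(2)] by (simp add: Q_def)
      then show ?thesis by blast
    qed
    then show ?case unfolding a_def by (rule someI_ex)
  qed
  obtain i where i: "n = Suc i" using n by (cases n) auto
  interpret FF: ideal "FI n" R unfolding i by (rule FI_ideal)
  have a0: "a 0 \<in> FI n" "h 0 \<ominus> a 0 \<in> L p" using aQ[OF n] FF.Icarr by (auto simp: Q_def)
  have "h 0 \<ominus> a 0 \<in> FI n" unfolding i by (rule L_p_FI[OF a0(2)])
  then have "(h 0 \<ominus> a 0) \<oplus> a 0 \<in> FI n" using a0(1) by (rule FF.a_closed)
  then show ?thesis using hc[OF n] FF.Icarr[OF a0(1)] by (simp add: a_minus_def a_assoc l_neg)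
qed

section \<open>The quotient ring and its Witt vectors\<close>

abbreviation "I \<equiv> L (Suc 0)"
abbreviation "B \<equiv> R Quot I"
abbreviation "cls y \<equiv> I +> y"

lemma I_ideal: "ideal I R" by (rule L_ideal)

lemma cring_B: "cring B" by (rule ideal.quotient_is_cring[OF I_ideal is_cring])

sublocale Q: cring B by (rule cring_B)
sublocale cls: ring_hom_cring R B "(+>) I" by (rule ideal.rcos_ring_hom_cring[OF I_ideal is_cring])

lemma cls_eq_zero_iff: "y \<in> carrier R \<Longrightarrow> cls y = \<zero>\<^bsub>B\<^esub> \<longleftrightarrow> y \<in> I"
  using quotient_eq_iff_same_a_r_cos[OF I_ideal, of y \<zero>] by (simp add: a_minus_def)

lemma cls_surj: "z \<in> carrier B \<Longrightarrow> \<exists>y\<in>carrier R. z = cls y"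
  unfolding FactRing_def A_RCOSETS_def' by (simp only: partial_object.select_convs) blast

text \<open>A second presentation by the same ghost vectors, now of W_n(R/I): \<epsilon> followed by
  the residue class map.\<close>

sublocale wB: witt_hom p "zphi p" B "\<lambda>y. cls (\<epsilon> y)"
  by unfold_locales (simp_all add: hom_add hom_mult hom_one)

abbreviation "WB n \<equiv> witt_ring p n B"

lemma cring_WB: "cring (WB n)" by (rule cring_witt_ring[OF prime_p cring_B])

lemma char_B: "add_pow B p \<one>\<^bsub>B\<^esub> = \<zero>\<^bsub>B\<^esub>"
  using wB.hom_of_nat_mult[of p 1] eps_p[of 1] by (simp add: hom_one)

lemma eps_surj: "(\<lambda>y. cls (\<epsilon> y)) ` UNIV = carrier B"
proof -
  have "z \<in> (\<lambda>y. cls (\<epsilon> y)) ` UNIV" if z: "z \<in> carrier B" for z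
  proof -
    obtain y where y: "y \<in> carrier R" "z = cls y" using cls_surj[OF z] by blast
    then have "z = cls (\<epsilon> (zvar y))" by (simp add: eps_zvar)
    then show ?thesis by (rule image_eqI) simp
  qed
  then show ?thesis by auto
qed

lemma coords_V_iter: "dwork g \<Longrightarrow> coords ((V ^^ k) g) i = (if i < k then 0 else coords g (i - k))"
proof (induction k arbitrary: i)
  case (Suc k)
  then show ?case by (auto simp: coords_V split: nat.split)
qed simp

lemma wB_zero_iff: "wB.wproj n g = \<zero>\<^bsub>WB n\<^esub> \<longleftrightarrow> (\<forall>i<n. \<epsilon> (coords g i) \<in> I)"
  by (auto simp: wB.wproj_def witt_ring_def fun_eq_iff restrict_def cls_eq_zero_iff)

lemma wB_V_iter:
  assumes "dwork g" "wB.wproj n g = \<zero>\<^bsub>WB n\<^esub>" shows "wB.wproj n ((V ^^ k) g) = \<zero>\<^bsub>WB n\<^esub>"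
proof -
  interpret J: ideal I R by (rule I_ideal)
  show ?thesis using assms by (auto simp: wB_zero_iff coords_V_iter hom_zero)
qed

lemma wB_T: "\<epsilon> a \<in> I \<Longrightarrow> wB.wproj n (T a) = \<zero>\<^bsub>WB n\<^esub>"
proof -
  assume a: "\<epsilon> a \<in> I"
  interpret J: ideal I R by (rule I_ideal)
  show ?thesis using a by (auto simp: wB_zero_iff coords_T hom_zero split: nat.split)
qed

lemma wB_wker: "g \<in> wker n \<Longrightarrow> wB.wproj n g = \<zero>\<^bsub>WB n\<^esub>"
proof -
  assume g: "g \<in> wker n"
  interpret J: ideal I R by (rule I_ideal)
  show ?thesis using g by (auto simp: wB_zero_iff wker_iff)
qed

text \<open>V^k moves the expansion of [f_i r] to start in degree k, and degrees from n on vanish in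
  W_n.\<close>

lemma teich_V_iter:
  assumes i: "i < m" and r: "is_delta r e" and k: "k < n"
  shows "eqv n ((V ^^ k) (T (zvar (f i) * zvar r))) (\<Sum>l<n - k. (V ^^ (k + l)) (sig (Y i r e l)))"
proof -
  have car': "f i \<in> carrier R" "df i \<in> carrier R" "r \<in> carrier R" "e \<in> carrier R"
    using car[OF i] df_closed[OF i] is_delta_closed[OF r] by auto
  have "eqv n (T (zvar (f i) * zvar r)) (sig (Y i r e 0) + (\<Sum>l<n. (V ^^ Suc l) (sig (Y i r e (Suc l)))))"
    using teich_mult_expansion[OF df[OF i] r, of n] by (simp add: Y_def)
  also have "(sig (Y i r e 0) + (\<Sum>l<n. (V ^^ Suc l) (sig (Y i r e (Suc l))))) = (\<Sum>l<Suc n. (V ^^ l) (sig (Y i r e l)))"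
    by (simp add: sum.lessThan_Suc_shift del: sum.lessThan_Suc)
  finally have 1: "eqv n ((V ^^ k) (T (zvar (f i) * zvar r))) ((V ^^ k) (\<Sum>l<Suc n. (V ^^ l) (sig (Y i r e l))))"
    by (rule eqv_V_iter)
  have "(V ^^ k) (\<Sum>l<Suc n. (V ^^ l) (sig (Y i r e l))) = (\<Sum>l<Suc n. (V ^^ (k + l)) (sig (Y i r e l)))"
    by (simp only: V_iter_sum funpow_add comp_def)
  also have "\<dots> = (\<Sum>l<n - k. (V ^^ (k + l)) (sig (Y i r e l))) + (\<Sum>l\<in>{n - k..<Suc n}. (V ^^ (k + l)) (sig (Y i r e l)))"
    using sum.atLeastLessThan_concat[of 0 "n - k" "Suc n" "\<lambda>l. (V ^^ (k + l)) (sig (Y i r e l))"] by (simp add: atLeast0LessThan)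
  finally have 2: "(V ^^ k) (\<Sum>l<Suc n. (V ^^ l) (sig (Y i r e l))) = \<dots>" .
  have "(V ^^ (k + l)) (sig (Y i r e l)) \<in> wker n" if "n - k \<le> l" for l
  proof -
    have "k + l = n + (k + l - n)" using that k by simp
    then have "(V ^^ (k + l)) (sig (Y i r e l)) = (V ^^ n) ((V ^^ (k + l - n)) (sig (Y i r e l)))"
      by (metis funpow_add comp_apply)
    then show ?thesis using wker_V_iter by simp
  qed
  then have "(\<Sum>l\<in>{n - k..<Suc n}. (V ^^ (k + l)) (sig (Y i r e l))) \<in> K n"
    by (intro wker_K wker_sum) simp
  from eqv_K[OF this, of "\<Sum>l<n - k. (V ^^ (k + l)) (sig (Y i r e l))"]
  show ?thesis by (intro eqv_trans[OF 1[unfolded 2]]) simp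
qed

text \<open>Each datum of the chain comes from one property of \<psi>: linearity gives h_k by
  \<open>dual_representation\<close>, vanishing on V^k [f_i r] gives the coefficient conditions,
  vanishing on V^k (sig (r^p)) for k > 0 bounds u(h_k), and the value 1 at 1 gives u(h_0).\<close>

lemma qfs_map_imp:
  assumes \<psi>: "qfs_map p n B \<psi>" and n: "0 < n"
  shows "\<exists>c\<in>FI n. cls (u c) = \<one>\<^bsub>B\<^esub>"
proof -
  interpret W: cring "WB n" by (rule cring_WB)
  interpret J: ideal I R by (rule I_ideal)
  define \<Psi> where "\<Psi> g = \<psi> (wB.wproj n g)" for g
  from \<psi> have q: "\<psi> \<in> carrier (WB n) \<rightarrow> carrier B"
    "\<forall>x\<in>carrier (WB n). \<forall>y\<in>carrier (WB n). \<psi> (x \<oplus>\<^bsub>WB n\<^esub> y) = \<psi> x \<oplus>\<^bsub>B\<^esub> \<psi> y"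
    "\<forall>a\<in>carrier (WB n). \<forall>x\<in>carrier (WB n). \<psi> (witt_frob p n B a \<otimes>\<^bsub>WB n\<^esub> x) = a 0 \<otimes>\<^bsub>B\<^esub> \<psi> x"
    "\<forall>w\<in>carrier (WB n). \<psi> (witt_frob p n B w) = w 0"
    unfolding qfs_map_def by - (elim conjE; assumption)+
  have closed: "\<Psi> g \<in> carrier B" for g unfolding \<Psi>_def by (rule funcset_mem[OF q(1)]) simp
  have add: "\<Psi> (g + h) = \<Psi> g \<oplus>\<^bsub>B\<^esub> \<Psi> h" if "dwork g" "dwork h" for g h
    unfolding \<Psi>_def wB.wproj_add[OF that] by (rule q(2)[rule_format]) simp_all
  have w0: "wB.wproj n g 0 = cls (\<epsilon> (g 0))" if "dwork g" for g
    using that n by (simp add: wB.wproj_def coords_0)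
  have mult: "\<Psi> (F g * h) = cls (\<epsilon> (g 0)) \<otimes>\<^bsub>B\<^esub> \<Psi> h" if "dwork g" "dwork h" for g h
    unfolding \<Psi>_def wB.wproj_mult[OF dwork_F[OF that(1)] that(2)] wB.wproj_F[OF char_B that(1)] w0[OF that(1), symmetric]
    by (rule q(3)[rule_format]) simp_all
  have frob: "\<Psi> (F g) = cls (\<epsilon> (g 0))" if "dwork g" for g
    unfolding \<Psi>_def wB.wproj_F[OF char_B that] w0[OF that, symmetric] by (rule q(4)[rule_format]) simp
  have "\<Psi> 0 = \<Psi> 0 \<oplus>\<^bsub>B\<^esub> \<Psi> 0" using add[of 0 0] by simp
  then have zero: "\<Psi> 0 = \<zero>\<^bsub>B\<^esub>" using Q.add.r_cancel_one'[OF closed closed] by metis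
  have ker: "\<Psi> g = \<zero>\<^bsub>B\<^esub>" if "wB.wproj n g = \<zero>\<^bsub>WB n\<^esub>" for g
    using zero that by (simp add: \<Psi>_def wB.wproj_zero)
  have K0: "\<Psi> g = \<zero>\<^bsub>B\<^esub>" if gK: "g \<in> K n" for g
  proof -
    obtain d k where g: "g = of_nat p * d + k" "dwork d" "k \<in> wker n" using gK unfolding K_def by blast
    have "of_nat p * d = F (V 1) * d" by (simp add: F_V)
    then have "\<Psi> (of_nat p * d) = \<zero>\<^bsub>B\<^esub>" using mult[of "V 1" d] g closed by (simp add: hom_zero)
    moreover have "\<Psi> k = \<zero>\<^bsub>B\<^esub>" by (rule ker[OF wB_wker]) fact
    ultimately show ?thesis using g add[of "of_nat p * d" k] by (simp add: wkerD)
  qed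
  have eqv: "\<Psi> g = \<Psi> h" if "eqv n g h" for g h
  proof -
    have "\<Psi> ((g - h) + h) = \<Psi> (g - h) \<oplus>\<^bsub>B\<^esub> \<Psi> h" using that by (intro add) (auto simp: eqv_def)
    then show ?thesis using K0[of "g - h"] that closed by (simp add: eqv_def)
  qed
  have sum: "\<Psi> (\<Sum>l<j. g l) = (\<Oplus>\<^bsub>B\<^esub>l\<in>{..<j}. \<Psi> (g l))" if "\<And>l. dwork (g l)" for g and j :: nat
    by (induction j) (auto simp: zero add that closed lessThan_Suc Q.a_comm)
  define G where "G k a = \<Psi> ((V ^^ k) (sig a))" for k a
  have "\<exists>h\<in>carrier R. \<forall>a\<in>carrier R. G k a = cls ((u ^^ Suc k) (h \<otimes> a))" for k
  proof (rule dual_representation[OF I_ideal])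
    show "G k a \<in> carrier B" for a by (simp add: G_def closed)
    show "G k (a \<oplus> b) = G k a \<oplus>\<^bsub>B\<^esub> G k b" if "a \<in> carrier R" "b \<in> carrier R" for a b
      using eqv[OF eqv_V_iter[OF sig_add[OF that]], of k] add unfolding G_def by (simp add: V_iter_add)
    show "G k (r [^] (p ^ Suc k) \<otimes> a) = cls r \<otimes>\<^bsub>B\<^esub> G k a" if "a \<in> carrier R" "r \<in> carrier R" for a r
    proof -
      have "F (T (zvar r)) * (V ^^ k) (sig a) = (V ^^ k) (T ((zvar r ^ (p ^ k)) ^ p) * sig a)"
        unfolding F_T V_iter_T_mult by (simp add: power_mult[symmetric] mult.commute)
      moreover have "eqv n (T ((zvar r ^ (p ^ k)) ^ p) * sig a) (sig (\<epsilon> (zvar r ^ (p ^ k)) [^] p \<otimes> a))"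
        by (rule sig_T_mult) fact
      moreover have "\<epsilon> (zvar r ^ (p ^ k)) [^] p = r [^] (p ^ Suc k)"
        using that by (simp add: hom_power eps_zvar nat_pow_pow mult.commute)
      ultimately have "\<Psi> (F (T (zvar r)) * (V ^^ k) (sig a)) = G k (r [^] (p ^ Suc k) \<otimes> a)"
        unfolding G_def using eqv[OF eqv_V_iter] by metis
      then show ?thesis using mult[of "T (zvar r)" "(V ^^ k) (sig a)"] that by (simp add: G_def eps_zvar)
    qed
  qed
  then obtain h where h: "\<And>k. h k \<in> carrier R" "\<And>k a. a \<in> carrier R \<Longrightarrow> G k a = cls ((u ^^ Suc k) (h k \<otimes> a))"
    by (metis (no_types))
  have uL: "u (h k) \<in> L (p ^ k)" if k: "0 < k" for k
  proof -
    have "(u ^^ k) (r \<otimes> u (h k)) \<in> L 1" if r: "r \<in> carrier R" for r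
    proof -
      obtain j where j: "k = Suc j" using k by (cases k) auto
      have "G k (r [^] p) = \<zero>\<^bsub>B\<^esub>" unfolding G_def j using eqv[OF V_sig_frob[OF r]] zero by simp
      moreover have "(u ^^ Suc k) (h k \<otimes> r [^] p) = (u ^^ k) (r \<otimes> u (h k))"
        unfolding funpow_Suc_right comp_def using r h(1)[of k] u_mult[of "h k" r] m_comm[of "h k" "r [^] p"] by simp
      ultimately have "cls ((u ^^ k) (r \<otimes> u (h k))) = \<zero>\<^bsub>B\<^esub>" using h(2)[of "r [^] p" k] r by (simp del: funpow.simps)
      then show ?thesis using cls_eq_zero_iff[OF u_iter_closed, of "r \<otimes> u (h k)" k] r h(1)[of k] by simp
    qed
    then show ?thesis using u_iter_pow_ideal[of m f "u (h k)" k] car h(1)[of k] by blast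
  qed
  have cc: "coeff_cond n h k" if k: "k < n" for k
    unfolding coeff_cond_def
  proof (intro allI impI)
    fix i r e assume i: "i < m" and e: "is_delta r e"
    have rc: "r \<in> carrier R" "e \<in> carrier R" using is_delta_closed[OF e] by auto
    have Yc: "Y i r e l \<in> carrier R" for l using Y_closed[OF i rc] .
    have "\<epsilon> (zvar (f i) * zvar r) \<in> I"
    proof -
      have "f i \<in> I" using f_pow_L[OF i, of 1 1] car[OF i] by simp
      then show ?thesis using car[OF i] rc J.I_r_closed by (simp add: hom_mult eps_zvar)
    qed
    then have "\<Psi> ((V ^^ k) (T (zvar (f i) * zvar r))) = \<zero>\<^bsub>B\<^esub>" by (intro ker wB_V_iter wB_T) simp_all
    then have "\<zero>\<^bsub>B\<^esub> = (\<Oplus>\<^bsub>B\<^esub>l\<in>{..<n - k}. \<Psi> ((V ^^ (k + l)) (sig (Y i r e l))))"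
      using eqv[OF teich_V_iter[OF i e k]] sum by simp
    also have "\<dots> = (\<Oplus>\<^bsub>B\<^esub>l\<in>{..<n - k}. cls ((u ^^ Suc (k + l)) (h (k + l) \<otimes> Y i r e l)))"
      by (simp only: G_def[symmetric] h(2)[OF Yc])
    also have "\<dots> = cls (\<Oplus>l\<in>{..<n - k}. (u ^^ Suc (k + l)) (h (k + l) \<otimes> Y i r e l))"
      by (subst cls.hom_finsum) (use h(1) Yc u_iter_closed in \<open>auto simp: comp_def simp del: funpow.simps\<close>)
    finally show "(\<Oplus>l\<in>{..<n - k}. (u ^^ Suc (k + l)) (h (k + l) \<otimes> Y i r e l)) \<in> L 1"
      using cls_eq_zero_iff[of "\<Oplus>l\<in>{..<n - k}. (u ^^ Suc (k + l)) (h (k + l) \<otimes> Y i r e l)"] h(1) Yc u_iter_closed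
      by (simp del: funpow.simps)
  qed
  have "h 0 \<in> FI n" by (rule coeff_cond_chain) (use h cc uL n in auto)
  moreover have "cls (u (h 0)) = \<one>\<^bsub>B\<^esub>"
  proof -
    have "eqv n 1 (sig \<one>)" using sig_is_pmon[of 1 n] is_pmon_one by (simp add: hom_one T_one)
    then have "\<Psi> 1 = G 0 \<one>" using eqv by (simp add: G_def)
    moreover have "\<Psi> 1 = \<one>\<^bsub>B\<^esub>" using frob[of 1] by (simp add: F_one hom_one fun_apply)
    ultimately show ?thesis using h(2)[of \<one> 0] h(1)[of 0] by simp
  qed
  ultimately show ?thesis by blast
qed

end

section \<open>From a coefficient system to a splitting\<close>

locale fedder_split = fedder R p N x \<epsilon> f m df
  for R :: "('a, 'c) ring_scheme" (structure) and p N :: nat and x :: "nat \<Rightarrow> 'a" and \<epsilon> :: "'a zpoly \<Rightarrow> 'a"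
    and f :: "nat \<Rightarrow> 'a" and m :: nat and df :: "nat \<Rightarrow> 'a" +
  fixes n :: nat and h :: "nat \<Rightarrow> 'a"
  assumes n_pos: "0 < n" and h_closed: "k < n \<Longrightarrow> h k \<in> carrier R" and h_coeff: "k < n \<Longrightarrow> coeff_cond n h k"
    and u_h: "0 < k \<Longrightarrow> k < n \<Longrightarrow> u (h k) = \<zero>" and u_h_0: "u (h 0) = \<one>"
begin

definition S :: "(nat \<Rightarrow> 'a) \<Rightarrow> 'a" where "S a = (\<Oplus>k\<in>{..<n}. (u ^^ Suc k) (h k \<otimes> a k))"

lemma term_closed: "k < n \<Longrightarrow> a \<in> carrier R \<Longrightarrow> (u ^^ Suc k) (h k \<otimes> a) \<in> carrier R"
  using h_closed by (intro u_iter_closed) simp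

lemma S_closed: "(\<And>k. a k \<in> carrier R) \<Longrightarrow> S a \<in> carrier R"
  unfolding S_def by (intro finsum_closed) (use term_closed in \<open>auto simp del: funpow.simps\<close>)

lemma S_add: "(\<And>k. a k \<in> carrier R) \<Longrightarrow> (\<And>k. b k \<in> carrier R) \<Longrightarrow> S (\<lambda>k. a k \<oplus> b k) = S a \<oplus> S b"
proof -
  assume a: "\<And>k. a k \<in> carrier R" and b: "\<And>k. b k \<in> carrier R"
  have "S (\<lambda>k. a k \<oplus> b k) = (\<Oplus>k\<in>{..<n}. (u ^^ Suc k) (h k \<otimes> a k) \<oplus> (u ^^ Suc k) (h k \<otimes> b k))"
    unfolding S_def
    by (rule finsum_cong') (use a b h_closed term_closed in \<open>auto simp: r_distr u_iter_add simp del: funpow.simps\<close>)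
  also have "\<dots> = S a \<oplus> S b" unfolding S_def
    by (rule finsum_addf) (use a b term_closed in \<open>auto simp del: funpow.simps\<close>)
  finally show ?thesis .
qed

lemma vsum_add:
  assumes "\<And>k. a k \<in> carrier R" "\<And>k. b k \<in> carrier R"
  shows "eqv n (vsum n (\<lambda>k. a k \<oplus> b k)) (vsum n a + vsum n b)"
  unfolding vsum_def sum.distrib[symmetric] V_iter_add[symmetric]
  by (intro eqv_sum eqv_V_iter sig_add assms)

text \<open>Two \<sigma>-expansions of one vector have the same entry in degree 0 and differ by a
  p-th power c^p in each degree k > 0, where u(h_k c^p) = c u(h_k) = 0.\<close>

lemma S_cong:
  assumes a: "\<And>k. a k \<in> carrier R" and b: "\<And>k. b k \<in> carrier R" and e: "eqv n (vsum n a) (vsum n b)"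
  shows "S a = S b"
proof -
  define d where "d k = a k \<ominus> b k" for k
  have d: "d k \<in> carrier R" for k using a b by (simp add: d_def)
  have abd: "a = (\<lambda>k. b k \<oplus> d k)" using a b by (auto simp: d_def a_minus_def a_lcomm r_neg)
  have "eqv n (vsum n b + vsum n d) (vsum n b)"
    using eqv_trans[OF eqv_sym[OF vsum_add[of b d, OF b d]]] e by (simp add: abd[symmetric])
  then have "vsum n d \<in> K n" by (simp add: eqv_def)
  note z = sig_uniq[of d, OF d this n_pos]
  have "(u ^^ Suc k) (h k \<otimes> d k) = \<zero>" if k: "k < n" for k
  proof (cases "k = 0")
    case True
    then show ?thesis using z(1) h_closed[OF k] by (simp add: u_zero)
  next
    case False
    then obtain c where c: "c \<in> carrier R" "d k = c [^] p" using z(2)[of k] k by (auto simp: frob_image_def)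
    have "u (h k \<otimes> d k) = \<zero>"
      using u_mult[of "h k" c] c u_h[of k] h_closed[OF k] False k by (simp add: m_comm)
    moreover have "(u ^^ k) \<zero> = \<zero>" for k by (induction k) (auto simp: u_zero)
    ultimately show ?thesis by (simp only: funpow_Suc_right comp_apply)
  qed
  then have "S d = \<zero>" unfolding S_def by (intro add.finprod_one_eqI) auto
  moreover have "S a = S b \<oplus> S d" by (subst abd) (rule S_add[of b d, OF b d])
  ultimately show ?thesis using S_closed[of b] b by simp
qed

text \<open>\<sigma>-coordinates exist but are not unique; \<open>S_cong\<close> makes the value
  independent of the chosen expansion.\<close>

definition Psi :: "(nat \<Rightarrow> 'a zpoly) \<Rightarrow> 'a" where
  "Psi g = S (SOME a. (\<forall>k. a k \<in> carrier R) \<and> eqv n g (vsum n a))"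

lemma Psi_eq:
  assumes a: "\<And>k. a k \<in> carrier R" and g: "eqv n g (vsum n a)"
  shows "Psi g = S a"
proof -
  let ?b = "SOME a. (\<forall>k. a k \<in> carrier R) \<and> eqv n g (vsum n a)"
  have "(\<forall>k. ?b k \<in> carrier R) \<and> eqv n g (vsum n ?b)" by (rule someI[of _ a]) (use a g in simp)
  then have b: "\<And>k. ?b k \<in> carrier R" "eqv n g (vsum n ?b)" by simp_all
  show ?thesis unfolding Psi_def by (rule S_cong[OF b(1) a eqv_trans[OF eqv_sym[OF b(2)] g]])
qed

lemma Psi_closed: "dwork g \<Longrightarrow> Psi g \<in> carrier R"
proof -
  assume g: "dwork g"
  obtain a where a: "\<And>k. a k \<in> carrier R" "eqv n g (vsum n a)" using sig_exist[OF g, of n] by metis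
  show ?thesis unfolding Psi_eq[OF a] by (rule S_closed[OF a(1)])
qed

lemma Psi_cong: "eqv n g g' \<Longrightarrow> Psi g = Psi g'"
proof -
  assume e: "eqv n g g'"
  obtain a where a: "\<And>k. a k \<in> carrier R" "eqv n g' (vsum n a)" using sig_exist[OF eqv_dwork(2)[OF e], of n] by metis
  show ?thesis unfolding Psi_eq[OF a] by (rule Psi_eq[OF a(1) eqv_trans[OF e a(2)]])
qed

lemma Psi_add: "dwork g \<Longrightarrow> dwork g' \<Longrightarrow> Psi (g + g') = Psi g \<oplus> Psi g'"
proof -
  assume g: "dwork g" and g': "dwork g'"
  obtain a where a: "\<And>k. a k \<in> carrier R" "eqv n g (vsum n a)" using sig_exist[OF g, of n] by metis
  obtain b where b: "\<And>k. b k \<in> carrier R" "eqv n g' (vsum n b)" using sig_exist[OF g', of n] by metis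
  have "eqv n (g + g') (vsum n (\<lambda>k. a k \<oplus> b k))"
    by (rule eqv_trans[OF eqv_add[OF a(2) b(2)] eqv_sym[OF vsum_add[of a b, OF a(1) b(1)]]])
  then have "Psi (g + g') = S (\<lambda>k. a k \<oplus> b k)" by (intro Psi_eq) (use a b in auto)
  then show ?thesis unfolding Psi_eq[OF a] Psi_eq[OF b] by (simp only: S_add[of a b, OF a(1) b(1)])
qed

lemma Psi_zero: "Psi 0 = \<zero>"
proof -
  have "Psi 0 = Psi 0 \<oplus> Psi 0" using Psi_add[of 0 0] by simp
  then show ?thesis using Psi_closed[of 0] by (metis add.r_cancel_one' dwork_zero)
qed

lemma Psi_wker: "g \<in> wker n \<Longrightarrow> Psi g = \<zero>"
  using Psi_cong[of g 0] Psi_zero eqv_K0 wker_K by metis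

lemma Psi_sum: "(\<And>l. dwork (g l)) \<Longrightarrow> Psi (\<Sum>l<j. g l) = (\<Oplus>l\<in>{..<j}. Psi (g l))" for j :: nat
  by (induction j) (auto simp: Psi_zero Psi_add Psi_closed lessThan_Suc a_comm)

lemma Psi_T_mult: "dwork g \<Longrightarrow> Psi (T (t ^ p) * g) = \<epsilon> t \<otimes> Psi g"
proof -
  assume g: "dwork g"
  obtain a where a: "\<And>k. a k \<in> carrier R" "eqv n g (vsum n a)" using sig_exist[OF g, of n] by metis
  let ?b = "\<lambda>k. \<epsilon> t [^] (p ^ Suc k) \<otimes> a k"
  have b: "?b k \<in> carrier R" for k using a(1) by simp
  have "eqv n (T (t ^ p) * vsum n a) (vsum n ?b)"
    unfolding vsum_def sum_distrib_left V_iter_T_mult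
  proof (intro eqv_sum eqv_V_iter)
    fix k
    have "(t ^ p) ^ p ^ k = (t ^ p ^ k) ^ p" by (simp add: power_mult[symmetric] mult.commute)
    moreover have "\<epsilon> (t ^ p ^ k) [^] p = \<epsilon> t [^] (p ^ Suc k)" by (simp add: hom_power nat_pow_pow mult.commute)
    ultimately show "eqv n (T ((t ^ p) ^ p ^ k) * sig (a k)) (sig (?b k))"
      using sig_T_mult[OF a(1), of n "t ^ p ^ k" k] by simp
  qed
  then have "eqv n (T (t ^ p) * g) (vsum n ?b)"
    by (rule eqv_trans[OF eqv_mult[OF eqv_refl a(2)], rotated]) simp
  then have "Psi (T (t ^ p) * g) = S ?b" by (rule Psi_eq[OF b])
  also have "\<dots> = (\<Oplus>k\<in>{..<n}. \<epsilon> t \<otimes> (u ^^ Suc k) (h k \<otimes> a k))"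
    unfolding S_def
  proof (rule finsum_cong')
    fix k assume k: "k \<in> {..<n}"
    then have "h k \<otimes> ?b k = \<epsilon> t [^] (p ^ Suc k) \<otimes> (h k \<otimes> a k)" using a(1)[of k] h_closed[of k] by (simp add: m_lcomm)
    then show "(u ^^ Suc k) (h k \<otimes> ?b k) = \<epsilon> t \<otimes> (u ^^ Suc k) (h k \<otimes> a k)"
      using u_iter_mult[of "h k \<otimes> a k" "\<epsilon> t" "Suc k"] k a(1)[of k] h_closed[of k] by (simp only:) simp
  qed (use a term_closed in \<open>auto simp del: funpow.simps\<close>)
  also have "\<dots> = \<epsilon> t \<otimes> S a" unfolding S_def
    by (rule finsum_rdistr[symmetric]) (use a term_closed in \<open>auto simp del: funpow.simps\<close>)
  finally show ?thesis unfolding Psi_eq[OF a] .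
qed

lemma Psi_V_sig: "k < n \<Longrightarrow> a \<in> carrier R \<Longrightarrow> Psi ((V ^^ k) (sig a)) = (u ^^ Suc k) (h k \<otimes> a)"
proof -
  assume k: "k < n" and a: "a \<in> carrier R"
  let ?b = "\<lambda>j. if j = k then a else \<zero>"
  have "eqv n (\<Sum>j<n. if j = k then (V ^^ k) (sig a) else 0) (vsum n ?b)"
    unfolding vsum_def
  proof (rule eqv_sum)
    fix j
    have "eqv n 0 ((V ^^ j) (sig \<zero>))" using eqv_V_iter[OF eqv_sym[OF sig_zero[of n]], of j] by (simp add: V_iter_zero)
    then show "eqv n (if j = k then (V ^^ k) (sig a) else 0) ((V ^^ j) (sig (?b j)))" by (auto intro: eqv_refl)
  qed
  then have "eqv n ((V ^^ k) (sig a)) (vsum n ?b)" using k by simp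
  then have "Psi ((V ^^ k) (sig a)) = S ?b" by (intro Psi_eq) (use a in auto)
  also have "\<dots> = (\<Oplus>j\<in>{..<n}. if k = j then (u ^^ Suc k) (h k \<otimes> a) else \<zero>)"
    unfolding S_def
  proof (rule finsum_cong')
    fix j assume j: "j \<in> {..<n}"
    have "(u ^^ i) \<zero> = \<zero>" for i by (induction i) (auto simp: u_zero)
    then show "(u ^^ Suc j) (h j \<otimes> ?b j) = (if k = j then (u ^^ Suc k) (h k \<otimes> a) else \<zero>)"
      using h_closed[of j] j by (auto simp del: funpow.simps)
  qed (use term_closed[OF k a] in \<open>auto simp del: funpow.simps\<close>)
  also have "\<dots> = (u ^^ Suc k) (h k \<otimes> a)"
    using finsum_singleton[of k "{..<n}" "\<lambda>_. (u ^^ Suc k) (h k \<otimes> a)"] term_closed[OF k a] k by (simp del: funpow.simps)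
  finally show ?thesis .
qed

text \<open>Expanding V^k [f_i r] by \<open>teich_V_iter\<close> turns the value into the sum that
  occurs in \<open>coeff_cond\<close>.\<close>

lemma Psi_generator:
  assumes i: "i < m" and r: "r \<in> carrier R" and k: "k < n"
  shows "Psi ((V ^^ k) (T (zvar (f i) * zvar r))) \<in> I"
proof -
  obtain e where e: "is_delta r e" by (rule exists_delta[OF r])
  have ec: "e \<in> carrier R" using is_delta_closed[OF e] by blast
  have "Psi ((V ^^ k) (T (zvar (f i) * zvar r))) = (\<Oplus>l\<in>{..<n - k}. Psi ((V ^^ (k + l)) (sig (Y i r e l))))"
    unfolding Psi_cong[OF teich_V_iter[OF i e k]] by (rule Psi_sum) simp
  also have "\<dots> = (\<Oplus>l\<in>{..<n - k}. (u ^^ Suc (k + l)) (h (k + l) \<otimes> Y i r e l))"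
  proof (rule finsum_cong')
    fix l assume "l \<in> {..<n - k}"
    then show "Psi ((V ^^ (k + l)) (sig (Y i r e l))) = (u ^^ Suc (k + l)) (h (k + l) \<otimes> Y i r e l)"
      by (intro Psi_V_sig Y_closed[OF i r ec]) simp
  qed (use term_closed Y_closed[OF i r ec] in \<open>auto simp del: funpow.simps\<close>)
  also have "\<dots> \<in> L 1" using h_coeff[OF k] i e unfolding coeff_cond_def by blast
  finally show ?thesis by simp
qed

lemma wB_zero_diff:
  assumes "dwork g" "dwork g'" "wB.wproj n g = wB.wproj n g'"
  shows "wB.wproj n (g - g') = \<zero>\<^bsub>WB n\<^esub>"
proof -
  interpret W: cring "WB n" by (rule cring_WB)
  have "wB.wproj n (g - g') \<oplus>\<^bsub>WB n\<^esub> wB.wproj n g' = wB.wproj n g'"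
    using wB.wproj_add[of "g - g'" g' n] assms by simp
  then show ?thesis by simp
qed

text \<open>Descending induction on k, splitting g into [g_0] and V g'. For [t] with t in the ideal,
  an inner induction along \<open>pow_ideal\<close> writes t = y + f_i r. Then [t] differs from [y]
  + [f_i r] by some V w; since the three Teichmueller elements vanish over R/I, the coordinates of w
  lie in the ideal, and the outer hypothesis covers V w.\<close>

lemma Psi_V_iter_I:
  assumes "dwork g" "\<And>j. \<epsilon> (coords g j) \<in> I"
  shows "Psi ((V ^^ k) g) \<in> I"
  using assms
proof (induction "n - k" arbitrary: k g)
  case 0
  interpret J: ideal I R by (rule I_ideal)
  have "(V ^^ k) g = (V ^^ n) ((V ^^ (k - n)) g)" using 0 funpow_add[of n "k - n" V] by simp
  then show ?case using Psi_wker wker_V_iter[of "(V ^^ (k - n)) g" n] 0 by simp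
next
  case (Suc d)
  interpret J: ideal I R by (rule I_ideal)
  have k: "k < n" "d = n - Suc k" using Suc by auto
  have next_k: "Psi ((V ^^ k) (V w)) \<in> I" if w: "dwork w" "\<And>j. \<epsilon> (coords w j) \<in> I" for w
    using Suc.hyps(1)[OF k(2), of w] w by (simp add: funpow_swap1)
  have "Psi ((V ^^ k) (T t)) \<in> I" if "\<epsilon> t \<in> pow_ideal R f (\<lambda>_. Suc 0) i" "i \<le> m" for i t
    using that
  proof (induction i arbitrary: t)
    case 0
    then have "T t \<in> wker n" by (intro wker_T) simp
    then have "eqv n ((V ^^ k) (T t)) ((V ^^ k) 0)" by (intro eqv_V_iter) (simp add: eqv_K0[symmetric] wker_K)
    then show ?case using Psi_cong[of "(V ^^ k) (T t)" 0] Psi_zero by (simp add: V_iter_zero)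
  next
    case (Suc i)
    then obtain y r where y: "\<epsilon> t = y \<oplus> f i \<otimes> r" "y \<in> pow_ideal R f (\<lambda>_. Suc 0) i" "r \<in> carrier R"
      using car by auto
    have i: "i < m" using Suc.prems by simp
    have yc: "y \<in> carrier R" using pow_ideal_sub[of i f y] y(2) car i by auto
    have yI: "y \<in> I"
    proof -
      have "pow_ideal R f (\<lambda>_. Suc 0) i \<subseteq> I"
        by (rule pow_ideal_least[OF I_ideal]) (use f_pow_L[of _ "Suc 0" "Suc 0"] i car in auto)
      then show ?thesis using y(2) by blast
    qed
    have fiI: "f i \<otimes> r \<in> I" using f_pow_L[OF i, of "Suc 0" "Suc 0"] car[OF i] J.I_r_closed[OF _ y(3)] by simp
    let ?a = "zvar y" and ?b = "zvar (f i) * zvar r"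
    have et: "\<epsilon> (?a + ?b) = \<epsilon> t" using y car[OF i] yc by (simp add: hom_add hom_mult eps_zvar)
    have "(T (?a + ?b) - (T ?a + T ?b)) 0 = 0" by (simp add: fun_apply minus_fun_apply)
    then obtain w where w: "dwork w" "T (?a + ?b) - (T ?a + T ?b) = V w"
      using V_surj[of "T (?a + ?b) - (T ?a + T ?b)"] by auto
    have "\<epsilon> (coords w j) \<in> I" for j
    proof -
      interpret W: cring "WB (Suc (Suc j))" by (rule cring_WB)
      \<comment> \<open>Coordinate j of w is coordinate j+1 of V w, which is visible from length j+2
        on.\<close>
      have z: "wB.wproj (Suc (Suc j)) (T ?a) = \<zero>\<^bsub>WB (Suc (Suc j))\<^esub>" "wB.wproj (Suc (Suc j)) (T ?b) = \<zero>\<^bsub>WB (Suc (Suc j))\<^esub>"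
        "wB.wproj (Suc (Suc j)) (T (?a + ?b)) = \<zero>\<^bsub>WB (Suc (Suc j))\<^esub>"
        by (rule wB_T; use yI fiI y(3) yc car[OF i] in \<open>simp add: eps_zvar hom_add hom_mult J.a_closed\<close>)+
      have "T (?a + ?b) = V w + (T ?a + T ?b)" using w(2) by (simp add: algebra_simps)
      then have "wB.wproj (Suc (Suc j)) (V w) = \<zero>\<^bsub>WB (Suc (Suc j))\<^esub>"
        using z w(1) by (simp add: wB.wproj_add)
      then show ?thesis using w(1) unfolding wB_zero_iff by (auto simp: coords_V dest!: spec[of _ "Suc j"])
    qed
    then have 1: "Psi ((V ^^ k) (V w)) \<in> I" by (rule next_k[OF w(1)])
    have "eqv n (T t) (T (?a + ?b))" by (rule T_cong) (simp add: et)
    then have "Psi ((V ^^ k) (T t)) = Psi ((V ^^ k) (T (?a + ?b)))" by (intro Psi_cong eqv_V_iter)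
    also have "T (?a + ?b) = (T ?a + T ?b) + V w" using w(2) by (simp add: algebra_simps)
    also have "Psi ((V ^^ k) ((T ?a + T ?b) + V w)) = Psi ((V ^^ k) (T ?a)) \<oplus> Psi ((V ^^ k) (T ?b)) \<oplus> Psi ((V ^^ k) (V w))"
      using w(1) by (simp add: V_iter_add Psi_add)
    also have "\<dots> \<in> I"
      using 1 Suc.IH[of ?a] y(2) yc i Psi_generator[OF i y(3) k(1)] by (intro J.a_closed) (auto simp: eps_zvar)
    finally show ?case .
  qed
  then have T_I: "Psi ((V ^^ k) (T (g 0))) \<in> I" using Suc.prems(2)[of 0] Suc.prems(1) by (simp add: coords_0)
  obtain g' where g': "dwork g'" "g = T (g 0) + V g'" by (rule dwork_tail[OF Suc.prems(1)])
  have "coords g' j = coords g (Suc j)" for j using coords_T_V[OF g'(1), of "g 0"] g'(2) by (metis nat.case(2))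
  then have "Psi ((V ^^ k) (V g')) \<in> I" using Suc.prems(2) by (intro next_k[OF g'(1)]) simp
  then have "Psi ((V ^^ k) (T (g 0))) \<oplus> Psi ((V ^^ k) (V g')) \<in> I" using T_I by (intro J.a_closed)
  moreover have "Psi ((V ^^ k) g) = Psi ((V ^^ k) (T (g 0))) \<oplus> Psi ((V ^^ k) (V g'))"
    by (subst g'(2)) (use g'(1) in \<open>simp add: V_iter_add Psi_add\<close>)
  ultimately show ?case by simp
qed

lemma Psi_I:
  assumes g: "dwork g" "wB.wproj n g = \<zero>\<^bsub>WB n\<^esub>"
  shows "Psi g \<in> I"
proof -
  interpret J: ideal I R by (rule I_ideal)
  \<comment> \<open>Vanishing in W_n(R/I) controls only the first n coordinates, while
    \<open>Psi_V_iter_I\<close> asks for all of them; setting the others to 0 changes nothing in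
    W_n(R).\<close>
  let ?g = "ghost p (\<lambda>i. if i < n then coords g i else 0)"
  have "wproj n g = wproj n ?g" by (auto simp: wproj_def fun_eq_iff restrict_def)
  then have "eqv n g ?g" using g(1) by (intro eqv_wker) (simp_all add: wproj_eq_iff)
  moreover have "Psi ((V ^^ 0) ?g) \<in> I"
    by (rule Psi_V_iter_I) (use g(2) in \<open>auto simp: wB_zero_iff hom_zero\<close>)
  ultimately show ?thesis using Psi_cong[of g ?g] by simp
qed

text \<open>F g is [g_0^p] plus a multiple of \<open>p\<close>, and \<open>Psi\<close> ignores
  multiples of \<open>p\<close>.\<close>

lemma Psi_F_mult: "dwork g \<Longrightarrow> dwork g' \<Longrightarrow> Psi (F g * g') = \<epsilon> (g 0) \<otimes> Psi g'"
proof -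
  assume g: "dwork g" and g': "dwork g'"
  obtain w where w: "dwork w" "g = T (g 0) + V w" by (rule dwork_tail[OF g])
  have "F g = T (g 0 ^ p) + of_nat p * w" by (subst w(2)) (simp add: F_add F_T F_V)
  then have "F g * g' = T (g 0 ^ p) * g' + of_nat p * (w * g')" by (simp add: algebra_simps)
  moreover have "eqv n (T (g 0 ^ p) * g' + of_nat p * (w * g')) (T (g 0 ^ p) * g')"
    by (rule eqv_K[OF p_K]) (use w g' in auto)
  ultimately show ?thesis using Psi_cong[of "F g * g'" "T (g 0 ^ p) * g'"] Psi_T_mult[OF g', of "g 0"] by simp
qed

lemma Psi_one: "Psi 1 = \<one>"
proof -
  have "eqv n 1 ((V ^^ 0) (sig \<one>))" using sig_is_pmon[of 1 n] is_pmon_one by (simp add: hom_one T_one)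
  from Psi_cong[OF this] show ?thesis using Psi_V_sig[OF n_pos one_closed] h_closed[OF n_pos] u_h_0 by simp
qed

text \<open>\<open>Psi\<close> sends the kernel of the projection to W_n(R/I) into the ideal by
  \<open>Psi_I\<close>, so its class does not depend on the lift.\<close>

lemma ex_qfs_map: "\<exists>\<psi>. qfs_map p n B \<psi>"
proof -
  interpret J: ideal I R by (rule I_ideal)
  define lift where "lift w = (SOME g. dwork g \<and> wB.wproj n g = w)" for w
  define \<psi> where "\<psi> w = cls (Psi (lift w))" for w
  have lift: "dwork (lift w) \<and> wB.wproj n (lift w) = w" if w: "w \<in> carrier (WB n)" for w
  proof -
    obtain g where "dwork g" "wB.wproj n g = w" by (rule wB.wproj_surj[OF eps_surj w])
    then show ?thesis unfolding lift_def by - (rule someI[of "\<lambda>g. dwork g \<and> wB.wproj n g = w"], rule conjI)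
  qed
  have \<psi>: "\<psi> (wB.wproj n g) = cls (Psi g)" if g: "dwork g" for g
  proof -
    let ?g = "lift (wB.wproj n g)"
    have l: "dwork ?g" "wB.wproj n ?g = wB.wproj n g" using lift[OF wB.wproj_closed] by auto
    have "Psi ?g = Psi (?g - g) \<oplus> Psi g" using Psi_add[of "?g - g" g] l g by simp
    moreover have z: "Psi (?g - g) \<in> I" by (rule Psi_I) (use l g wB_zero_diff in auto)
    moreover have "cls (Psi (?g - g)) = \<zero>\<^bsub>B\<^esub>" using cls_eq_zero_iff[OF J.Icarr[OF z]] z by simp
    ultimately show ?thesis unfolding \<psi>_def using J.Icarr[OF z] Psi_closed[OF g] by simp
  qed
  have w0: "wB.wproj n g 0 = cls (\<epsilon> (g 0))" if "dwork g" for g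
    using that n_pos by (simp add: wB.wproj_def coords_0)
  have frob: "\<psi> (witt_frob p n B a \<otimes>\<^bsub>WB n\<^esub> y) = a 0 \<otimes>\<^bsub>B\<^esub> \<psi> y" if a: "a \<in> carrier (WB n)" and y: "y \<in> carrier (WB n)" for a y
  proof -
    obtain g where g: "dwork g" "wB.wproj n g = a" by (rule wB.wproj_surj[OF eps_surj a])
    obtain g' where g': "dwork g'" "wB.wproj n g' = y" by (rule wB.wproj_surj[OF eps_surj y])
    have "witt_frob p n B a \<otimes>\<^bsub>WB n\<^esub> y = wB.wproj n (F g * g')"
      unfolding g(2)[symmetric] g'(2)[symmetric] using g(1) g'(1) by (simp add: wB.wproj_mult wB.wproj_F[OF char_B])
    then have "\<psi> (witt_frob p n B a \<otimes>\<^bsub>WB n\<^esub> y) = cls (\<epsilon> (g 0)) \<otimes>\<^bsub>B\<^esub> cls (Psi g')"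
      using g(1) g'(1) Psi_closed by (simp add: \<psi> Psi_F_mult)
    then show ?thesis unfolding g(2)[symmetric] g'(2)[symmetric] w0[OF g(1)] \<psi>[OF g'(1)] .
  qed
  have "qfs_map p n B \<psi>" unfolding qfs_map_def
  proof (intro conjI ballI)
    show "\<psi> \<in> carrier (WB n) \<rightarrow> carrier B" using lift Psi_closed by (auto simp: \<psi>_def)
    fix a y assume a: "a \<in> carrier (WB n)" and y: "y \<in> carrier (WB n)"
    obtain g where g: "dwork g" "wB.wproj n g = a" by (rule wB.wproj_surj[OF eps_surj a])
    obtain g' where g': "dwork g'" "wB.wproj n g' = y" by (rule wB.wproj_surj[OF eps_surj y])
    show "\<psi> (a \<oplus>\<^bsub>WB n\<^esub> y) = \<psi> a \<oplus>\<^bsub>B\<^esub> \<psi> y"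
      unfolding g(2)[symmetric] g'(2)[symmetric] using g(1) g'(1) Psi_closed
      by (simp add: wB.wproj_add[symmetric] \<psi> Psi_add)
    show "\<psi> (witt_frob p n B a \<otimes>\<^bsub>WB n\<^esub> y) = a 0 \<otimes>\<^bsub>B\<^esub> \<psi> y" by (rule frob[OF a y])
  next
    fix a assume a: "a \<in> carrier (WB n)"
    obtain g where g: "dwork g" "wB.wproj n g = a" by (rule wB.wproj_surj[OF eps_surj a])
    have "witt_frob p n B a = wB.wproj n (F g * 1)" using g wB.wproj_F[OF char_B g(1), of n] by simp
    then have "\<psi> (witt_frob p n B a) = cls (\<epsilon> (g 0))" using g(1) Psi_F_mult[of g 1] by (simp add: \<psi> Psi_one)
    then show "\<psi> (witt_frob p n B a) = a 0" using w0[OF g(1)] g(2) by simp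
  qed
  then show ?thesis by blast
qed

end

context fedder
begin

lemma qfs_map_if:
  assumes n: "0 < n" and c: "c \<in> FI n" and uc: "u c = \<one>"
  shows "\<exists>\<psi>. qfs_map p n B \<psi>"
proof -
  obtain j where j: "n = Suc j" using n by (cases n) auto
  obtain h where h: "h 0 = c" "\<forall>k\<le>j. h k \<in> carrier R \<and> coeff_cond (Suc j) h k" "\<forall>k. 0 < k \<and> k \<le> j \<longrightarrow> u (h k) = \<zero>"
    using chain_coeff_cond[of c j] c unfolding j by blast
  interpret fedder_split R p N x \<epsilon> f m df n h
    by unfold_locales (use h j uc in auto)
  show ?thesis by (rule ex_qfs_map)
qed

text \<open>By \<open>frob_power_iff\<close>, an element a of I_n outside the Frobenius power of
  \<mm> has a multiple with u(r a) outside \<mm>, hence a unit. Multiplying by the p-th power of the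
  inverse normalises the value to 1 and stays in the ideal I_n. Conversely, a value of
  \<open>u\<close> that is 1 modulo \<open>I\<close> cannot lie in \<mm>.\<close>

theorem qfs_map_iff:
  assumes "ring_local": "\<And>a. a \<in> carrier R \<Longrightarrow> a \<notin> \<mm> \<Longrightarrow> a \<in> Units R" and \<mm>: "ideal \<mm> R" "\<one> \<notin> \<mm>" "I \<subseteq> \<mm>" and n: "0 < n"
  shows "(\<exists>\<psi>. qfs_map p n B \<psi>) \<longleftrightarrow> \<not> FI n \<subseteq> frob_power p R \<mm>"
proof
  obtain j where j: "n = Suc j" using n by (cases n) auto
  interpret M: ideal \<mm> R by (rule \<mm>)
  {
    assume "\<exists>\<psi>. qfs_map p n B \<psi>"
    then obtain c where c: "c \<in> FI n" "cls (u c) = \<one>\<^bsub>B\<^esub>" using qfs_map_imp n by blast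
    have cc: "c \<in> carrier R" using c(1) FI_closed unfolding j by blast
    have "u c \<ominus> \<one> \<in> I" using quotient_eq_iff_same_a_r_cos[OF I_ideal, of "u c" \<one>] c(2) cc by simp
    then have 1: "u c \<ominus> \<one> \<in> \<mm>" using \<mm> by blast
    have "u c \<notin> \<mm>"
    proof
      assume "u c \<in> \<mm>"
      moreover have "u c = \<one> \<oplus> (u c \<ominus> \<one>)" using cc a_lcomm[of "u c" \<one> "\<ominus> \<one>"] by (simp add: a_minus_def r_neg)
      ultimately show False using sub_mem_ideal[OF \<mm>(1) _ 1 one_closed] \<mm>(2) by argo
    qed
    then have "c \<notin> frob_power p R \<mm>" using u_frob_power[OF \<mm>(1)] by blast
    then show "\<not> FI n \<subseteq> frob_power p R \<mm>" using c(1) by blast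
  }
  assume "\<not> FI n \<subseteq> frob_power p R \<mm>"
  then obtain a where a: "a \<in> FI n" "a \<notin> frob_power p R \<mm>" by blast
  interpret FF: ideal "FI n" R unfolding j by (rule FI_ideal)
  have ac: "a \<in> carrier R" by (rule FF.Icarr[OF a(1)])
  obtain r where r: "r \<in> carrier R" "u (r \<otimes> a) \<notin> \<mm>" using a(2) frob_power_iff[OF \<mm>(1) ac] by blast
  have U: "u (r \<otimes> a) \<in> Units R" by (rule ring_local) (use r ac in auto)
  let ?s = "inv (u (r \<otimes> a))"
  have s: "?s \<in> carrier R" "?s \<otimes> u (r \<otimes> a) = \<one>" using U by auto
  have "?s [^] p \<otimes> (r \<otimes> a) \<in> FI n" using a(1) r s by (intro FF.I_l_closed) auto
  moreover have "u (?s [^] p \<otimes> (r \<otimes> a)) = \<one>" using u_mult[of "r \<otimes> a" ?s] r ac s by simp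
  ultimately show "\<exists>\<psi>. qfs_map p n B \<psi>" by (rule qfs_map_if[OF n])
qed

end

section \<open>Local rings and their quotients\<close>

lemma (in cring) exists_maximalideal:
  assumes nr: "noetherian_ring R" and I: "ideal I R" "\<one> \<notin> I"
  shows "\<exists>J. maximalideal J R \<and> I \<subseteq> J"
proof -
  let ?A = "{J. ideal J R \<and> I \<subseteq> J \<and> \<one> \<notin> J}"
  have "\<exists>M\<in>?A. \<forall>X\<in>?A. M \<subseteq> X \<longrightarrow> X = M"
  proof (rule subset_Zorn)
    fix C assume C: "subset.chain ?A C"
    show "\<exists>U\<in>?A. \<forall>X\<in>C. X \<subseteq> U"
    proof (cases "C = {}")
      case True then show ?thesis using I by blast
    next
      case False
      have "subset.chain {J. ideal J R} C" using C unfolding pred_on.chain_def by blast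
      \<comment> \<open>In a noetherian ring a nonempty chain of ideals contains its union, which is
        therefore an upper bound inside \<open>?A\<close>.\<close>
      then have "\<Union>C \<in> C" by (rule noetherian_ring.ideal_chain_is_trivial[OF nr False])
      moreover have "C \<subseteq> ?A" using C unfolding pred_on.chain_def by blast
      ultimately show ?thesis by (intro bexI[of _ "\<Union>C"]) blast+
    qed
  qed
  then obtain M where MA: "M \<in> ?A" and max: "\<forall>X\<in>?A. M \<subseteq> X \<longrightarrow> X = M" by (rule bexE)
  then have M: "ideal M R" "I \<subseteq> M" "\<one> \<notin> M" by simp_all
  have "maximalideal M R"
  proof (rule maximalidealI)
    fix J assume J: "ideal J R" "M \<subseteq> J" "J \<subseteq> carrier R"
    show "J = M \<or> J = carrier R"
    proof (cases "\<one> \<in> J")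
      case True then show ?thesis using ideal.one_imp_carrier[OF J(1)] by blast
    next
      case False
      then have "J \<in> ?A" using J M(2) by simp
      then show ?thesis using max J(2) by simp
    qed
  qed (use M in auto)
  then show ?thesis using M(2) by blast
qed

text \<open>A nonunit generates a proper ideal, which lies in some maximal ideal, and the only
  maximal ideal is \<mm>.\<close>

lemma local_ring_Units:
  assumes lr: "local_ring R \<mm>" and nr: "noetherian_ring R" and a: "a \<in> carrier R" "a \<notin> \<mm>"
  shows "a \<in> Units R"
proof (rule ccontr)
  interpret cring R using lr by (simp add: local_ring_def)
  assume U: "a \<notin> Units R"
  have "\<one>\<^bsub>R\<^esub> \<notin> PIdl\<^bsub>R\<^esub> a"
  proof
    assume "\<one>\<^bsub>R\<^esub> \<in> PIdl\<^bsub>R\<^esub> a"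
    then obtain r where "r \<in> carrier R" "\<one>\<^bsub>R\<^esub> = r \<otimes>\<^bsub>R\<^esub> a" by (auto simp: cgenideal_def)
    then show False using U a(1) m_comm[of r a] unfolding Units_def by auto
  qed
  then obtain J where J: "maximalideal J R" "PIdl\<^bsub>R\<^esub> a \<subseteq> J"
    using exists_maximalideal[OF nr cgenideal_ideal[OF a(1)]] by blast
  then have "J = \<mm>" using lr by (simp add: local_ring_def)
  then show False using cgenideal_self[OF a(1)] J(2) a(2) by blast
qed

lemma (in cring) quotient_local:
  assumes M: "ideal M R" "\<one> \<notin> M" "\<And>a. a \<in> carrier R \<Longrightarrow> a \<notin> M \<Longrightarrow> a \<in> Units R" and I: "ideal I R" "I \<subseteq> M"
  shows "primeideal ((+>) I ` M) (R Quot I)" "carrier (R Quot I) - (+>) I ` M \<subseteq> Units (R Quot I)"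
proof -
  interpret M: ideal M R by (rule M)
  interpret I: ideal I R by (rule I)
  interpret Q: cring "R Quot I" by (rule I.quotient_is_cring[OF is_cring])
  interpret q: ring_hom_cring R "R Quot I" "(+>) I" by (rule I.rcos_ring_hom_cring[OF is_cring])
  have surj: "\<exists>y\<in>carrier R. z = I +> y" if "z \<in> carrier (R Quot I)" for z
    using that unfolding FactRing_def A_RCOSETS_def' by (simp only: partial_object.select_convs) blast
  have mem: "I +> y \<in> (+>) I ` M \<longleftrightarrow> y \<in> M" if y: "y \<in> carrier R" for y
  proof
    assume "I +> y \<in> (+>) I ` M"
    then obtain y' where y': "y' \<in> M" "I +> y = I +> y'" by blast
    have "y \<ominus> y' \<in> I" using quotient_eq_iff_same_a_r_cos[OF I(1) y] y' by simp
    then have "(y \<ominus> y') \<oplus> y' \<in> M" using y' I(2) by (intro M.a_closed) auto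
    then show "y \<in> M" using y M.Icarr[OF y'(1)] by (simp add: a_minus_def a_assoc l_neg)
  qed blast
  have unit: "I +> y \<in> Units (R Quot I)" if y: "y \<in> carrier R" "y \<notin> M" for y
  proof -
    have "inv y \<in> carrier R" "inv y \<otimes> y = \<one>" "y \<otimes> inv y = \<one>" using M(3)[OF y] by auto
    then show ?thesis using y q.hom_mult[of y "inv y"] q.hom_mult[of "inv y" y]
      unfolding Units_def by (auto intro!: bexI[of _ "I +> inv y"])
  qed
  show "carrier (R Quot I) - (+>) I ` M \<subseteq> Units (R Quot I)" using surj unit by blast
  show "primeideal ((+>) I ` M) (R Quot I)"
  proof (rule primeidealI)
    show "ideal ((+>) I ` M) (R Quot I)"
    proof (rule idealI)
      show "subgroup ((+>) I ` M) (add_monoid (R Quot I))"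
      proof
        fix a b assume "a \<in> (+>) I ` M" "b \<in> (+>) I ` M"
        then obtain a' b' where ab: "a' \<in> M" "b' \<in> M" "a = I +> a'" "b = I +> b'" by blast
        then have "a \<otimes>\<^bsub>add_monoid (R Quot I)\<^esub> b = I +> (a' \<oplus> b')" by (simp add: M.Icarr)
        then show "a \<otimes>\<^bsub>add_monoid (R Quot I)\<^esub> b \<in> (+>) I ` M" by (rule image_eqI) (rule M.a_closed[OF ab(1,2)])
      next
        fix a assume "a \<in> (+>) I ` M"
        then obtain a' where a: "a' \<in> M" "a = I +> a'" by blast
        then have "inv\<^bsub>add_monoid (R Quot I)\<^esub> a = I +> (\<ominus> a')"
          using q.hom_a_inv[OF M.Icarr[OF a(1)]] by (simp only: a_inv_def)
        then show "inv\<^bsub>add_monoid (R Quot I)\<^esub> a \<in> (+>) I ` M" by (rule image_eqI) (rule M.a_inv_closed[OF a(1)])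
      next
        show "\<one>\<^bsub>add_monoid (R Quot I)\<^esub> \<in> (+>) I ` M" 
          by (rule image_eqI[of _ _ \<zero>]) simp_all
      qed (auto simp: M.Icarr)
      fix a z assume "a \<in> (+>) I ` M" and z: "z \<in> carrier (R Quot I)"
      then obtain a' y where a: "a' \<in> M" "a = I +> a'" "y \<in> carrier R" "z = I +> y" using surj[OF z] by blast
      then have "z \<otimes>\<^bsub>R Quot I\<^esub> a = I +> (y \<otimes> a')" by (simp add: M.Icarr)
      then show "z \<otimes>\<^bsub>R Quot I\<^esub> a \<in> (+>) I ` M" by (rule image_eqI) (rule M.I_l_closed[OF a(1,3)])
      then show "a \<otimes>\<^bsub>R Quot I\<^esub> z \<in> (+>) I ` M" using Q.m_comm[of z a] z a q.hom_closed[OF M.Icarr[OF a(1)]] by simp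
    qed (rule Q.ring_axioms)
    show "carrier (R Quot I) \<noteq> (+>) I ` M" using mem[OF one_closed] M(2) q.hom_closed[OF one_closed] by blast
    fix a b assume ab: "a \<in> carrier (R Quot I)" "b \<in> carrier (R Quot I)" "a \<otimes>\<^bsub>R Quot I\<^esub> b \<in> (+>) I ` M"
    obtain y z where yz: "y \<in> carrier R" "a = I +> y" "z \<in> carrier R" "b = I +> z" using surj[OF ab(1)] surj[OF ab(2)] by blast
    have yzM: "y \<otimes> z \<in> M" using ab(3) yz mem[of "y \<otimes> z"] by simp
    have "y \<in> M \<or> z \<in> M"
    proof (rule ccontr)
      assume "\<not> (y \<in> M \<or> z \<in> M)"
      then have u: "y \<in> Units R" "z \<in> Units R" using M(3) yz by auto
      then have yz_unit: "y \<otimes> z \<in> Units R" by (rule Units_m_closed)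
      have "inv (y \<otimes> z) \<otimes> (y \<otimes> z) \<in> M" by (rule M.I_l_closed[OF yzM]) (use yz_unit in simp)
      then show False using M(2) Units_l_inv[OF yz_unit] by simp
    qed
    then show "a \<in> (+>) I ` M \<or> b \<in> (+>) I ` M" using yz by blast
  qed (rule Q.is_cring)
qed

theorem theorem4p11:
  fixes R :: "('a, 'c) ring_scheme" (structure)
    and \<mm> :: "'a set" and p N m :: nat and x f :: "nat \<Rightarrow> 'a"
  assumes "regular_local_ring R \<mm>"
    and "Factorial_Ring.prime p" and "add_pow R p \<one> = \<zero>"
    and "F_finite p R"
    and "frob_basis R p N x"
    and "regular_sequence R m f" and "\<forall>i<m. f i \<in> \<mm>"
  shows "ring_height p (R Quot (Idl (f ` {..<m}))) =
         Inf {enat n | n. 1 \<le> n \<and>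
                \<not> fedder_ideal R p N x (\<Otimes>i\<in>{..<m}. f i) (Idl (f ` {..<m})) n
                    \<subseteq> frob_power p R \<mm>}"
proof -
  have lr: "local_ring R \<mm>" and nr: "noetherian_ring R" using assms(1) by (simp_all add: regular_local_ring_def)
  interpret cring R using lr by (simp add: local_ring_def)
  have M: "ideal \<mm> R" "\<one> \<notin> \<mm>"
  proof -
    interpret maximalideal \<mm> R using lr by (simp add: local_ring_def)
    show "ideal \<mm> R" by (rule is_ideal)
    show "\<one> \<notin> \<mm>" using one_imp_carrier I_notcarr by blast
  qed
  note units = local_ring_Units[OF lr nr]
  interpret M: ideal \<mm> R by (rule M)
  interpret p_basis R p N x by unfold_locales (use assms in auto)
  obtain \<epsilon> :: "'a zpoly \<Rightarrow> 'a" where e: "witt_hom p (zphi p) R \<epsilon>" "\<forall>a\<in>carrier R. \<epsilon> (zvar a) = a"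
    by (rule exists_witt_hom[OF prime_p is_cring])
  interpret w: witt_hom p "zphi p" R \<epsilon> by (rule e)
  interpret p_basis_witt R p N x \<epsilon> by unfold_locales (use e in auto)
  have car: "f i \<in> carrier R" if "i < m" for i using assms(6) that by (simp add: regular_sequence_def)
  \<comment> \<open>Regularity speaks of the ideals generated by initial segments, the colon lemmas
    of \<open>pow_ideal\<close>; \<open>weak_regular\<close> needs the translation for every initial
    segment.\<close>
  have Idl: "Idl (f ` {..<s}) = pow_ideal R f (\<lambda>_. 1) s" if "s \<le> m" for s
  proof -
    have "(\<lambda>i. f i [^] (1 :: nat)) ` {..<s} = f ` {..<s}" by (rule image_cong) (use car that in auto)
    then show ?thesis using pow_ideal_Idl[of s f "\<lambda>_. 1"] car that by simp
  qed
  have wr: "weak_regular f m"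
    using assms(6) Idl unfolding weak_regular_def regular_sequence_def by simp
  define df where "df i = (SOME d. is_delta (f i) d)" for i
  have df: "is_delta (f i) (df i)" if i: "i < m" for i
  proof -
    obtain d where "is_delta (f i) d" by (rule exists_delta[OF car[OF i]])
    then show ?thesis unfolding df_def by (rule someI)
  qed
  interpret fedder R p N x \<epsilon> f m df by unfold_locales (use wr df in auto)
  have IM: "I \<subseteq> \<mm>"
    using pow_ideal_least[OF M(1), of m f "\<lambda>_. Suc 0"] assms(7) car by simp
  have B: "R Quot (Idl (f ` {..<m})) = B" using Idl[of m] by simp
  have FI_eq: "fedder_ideal R p N x (\<Otimes>i\<in>{..<m}. f i) (Idl (f ` {..<m})) n = FI n" for n
    using Idl[of m] by (simp add: FI_def fprod_def)
  have "quasi_F_split p n (Spec B) \<longleftrightarrow> \<not> FI n \<subseteq> frob_power p R \<mm>" if n: "1 \<le> n" for n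
  proof -
    have n': "0 < n" using n by simp
    show ?thesis
      using quasi_F_split_Spec[OF prime_p n' cring_B quotient_local[OF M units I_ideal IM]]
        qfs_map_iff[OF units M IM n'] by simp
  qed
  then have "1 \<le> n \<and> quasi_F_split p n (Spec B) \<longleftrightarrow> 1 \<le> n \<and> \<not> FI n \<subseteq> frob_power p R \<mm>" for n
    by (rule conj_cong[OF refl])
  then show ?thesis unfolding ring_height_def scheme_height_def B FI_eq by (simp only:)
qed

end
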